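(* Let $N$ be a $4$-dimensional neutral space form with constant sectional curvature $L_0$. Let $M$ be a Lorentz surface and $F:M\rightarrow N$ a time-like and conformal immersion of $M$ into $N$ with zero mean curvature vector. Then the following are equivalent: (a) $F$ satisfies $X_+^2\neq Y_+^2$ and $X_-=Y_-\neq0$ (at every point); (b) around each point of $M$, the induced metric $g$ is represented as $g=e^{2\lambda}d\check{w}\,d\overline{\check{w}}$ in some local paracomplex coordinate $\check{w}=u+jv$, and $\lambda$ and the functions $\alpha_k,\beta_k,\mu_k$ $(k=1,2)$ of $F$ satisfy $(\ast)$: there exist signs $\varepsilon,\varepsilon',\varepsilon''\in\{+1,-1\}$, functions $f_1,f_2$ with $$(f_1)_{st}=L_0e^{-f_1-f_2},\qquad (f_2)_{st}=-\tfrac{\varepsilon}{2}e^{f_1+2f_2},$$ and functions $P_+,Q_+,\tilde{P}_-$ with $$f_1=P_+-Q_++2\tilde{P}_-,\qquad f_2=Q_+-\tilde{P}_-,$$ such that $\lambda=-\tfrac12(P_++\tilde{P}_-)$, $$\mu_1=-\tfrac12(P_+)_u+\tfrac{1}{\sqrt2}(Q_+)_s-\tfrac12(\tilde{P}_-)_v,\qquad \mu_2=-\tfrac12(P_+)_v+\tfrac{1}{\sqrt2}(Q_+)_s-\tfrac12(\tilde{P}_-)_u,$$ $$\alpha_1=\tfrac12(X_++X_-),\quad \alpha_2=\tfrac12(Y_++Y_-),\quad \beta_1=\tfrac12(Y_+-Y_-),\quad \beta_2=\tfrac12(X_+-X_-),$$ where $X_+=\tfrac{\varepsilon'}{2}(e^{P_+}+\varepsilon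 e^{Q_+})$, $Y_+=\tfrac{\varepsilon'}{2}(e^{P_+}-\varepsilon e^{Q_+})$, $X_-=Y_-=\tfrac{\varepsilon''}{2}e^{\tilde{P}_-}$. In addition, functions $\lambda,\alpha_k,\beta_k,\mu_k$ $(k=1,2)$ of $u,v$ as in $(\ast)$ locally define a time-like surface in $N$ with zero mean curvature vector, $X_+^2\neq Y_+^2$ and $X_-=Y_-\neq0$ (i.e. near each point there is such an immersion having these functions as its associated functions), which is unique up to an isometry of $N$.
   Context: All objects are smooth. Paracomplex numbers: $a+jb$ with $a,b\in\mathbb{R}$, $j^2=1$; conjugate $a-jb$. Space form: $N$ is oriented with neutral metric $h$ (signature $(2,2)$) and is taken to be $E^4_2$ if $L_0=0$, $\{x\in E^5_2 : \langle x,x\rangle =1/L_0\}$ if $L_0>0$, $\{x\in E^5_3 : \langle x,x\rangle =1/L_0\}$ if $L_0<0$, where $E^m_k$ is the $m$-dimensional pseudo-Euclidean space of index $k$ (i.e. $k$ minus signs). $\nabla$ is the Levi-Civita connection of $N$. Lorentz surface: a surface $M$ with an atlas of compatible local paracomplex coordinates $\check{w}=u+jv$, oriented by $(\partial_u,\partial_v)$. "$F$ time-like and conformal" means that the induced metric is $g=F^*h=e^{2\lambda}d\check{w}\,d\overline{\check{w}}=e^{2\lambda}(du^2-dv^2)$ for a real-valued function $\lambda$ in each such coordinate. We put $s=\frac{1}{\sqrt2}(u+v)$, $t=\frac{1}{\sqrt2}(u-v)$; subscripts $u,v,s,t$ denote partial derivatives. Associated functions: given a local paracomplex coordinate, put $T_1=dF(\partial_u)$,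 $T_2=dF(\partial_v)$ and choose local normal vector fields $N_1,N_2$ of $F$ with $h(N_1,N_1)=-h(N_2,N_2)=e^{2\lambda}$, $h(N_1,N_2)=0$, such that $(T_1,N_1,T_2,N_2)$ gives the orientation of $N$. Since the mean curvature vector is zero, there are real functions $\alpha_k,\beta_k,\mu_k$ $(k=1,2)$ with $$\nabla_{T_1}T_1=\lambda_uT_1+\lambda_vT_2+\alpha_1N_1+\beta_1N_2,\quad \nabla_{T_1}T_2=\nabla_{T_2}T_1=\lambda_vT_1+\lambda_uT_2+\alpha_2N_1+\beta_2N_2,$$ $$\nabla_{T_2}T_2=\lambda_uT_1+\lambda_vT_2+\alpha_1N_1+\beta_1N_2,$$ $$\nabla_{T_1}N_1=-\alpha_1T_1+\alpha_2T_2+\lambda_uN_1+\mu_1N_2,\quad \nabla_{T_1}N_2=\beta_1T_1-\beta_2T_2+\mu_1N_1+\lambda_uN_2,$$ $$\nabla_{T_2}N_1=-\alpha_2T_1+\alpha_1T_2+\lambda_vN_1+\mu_2N_2,\quad \nabla_{T_2}N_2=\beta_2T_1-\beta_1T_2+\mu_2N_1+\lambda_vN_2.$$ These are the functions $\alpha_k,\beta_k,\mu_k$ of $F$ (with respect to the coordinate and the frame $N_1,N_2$). For $F$ one sets $X_{\pm}:=\alpha_1\pm\beta_2$, $Y_{\pm}:=\alpha_2\pm\beta_1$; the conditions $X_+^2\neq Y_+^2$ and $X_-=Y_-\neq0$ do not depend on the choice of coordinate and frame. That given functions $\lambda,\alpha_k,\beta_k,\mu_k$ of $(u,v)$ locally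 define a surface means: every point of their domain has a connected neighborhood $U$ and a time-like conformal immersion $F:U\to N$ with zero mean curvature vector and induced metric $e^{2\lambda}(du^2-dv^2)$, admitting normal vector fields $N_1,N_2$ on $U$ with $h(N_1,N_1)=-h(N_2,N_2)=e^{2\lambda}$, $h(N_1,N_2)=0$ and with $(dF(\partial_u),N_1,dF(\partial_v),N_2)$ giving the orientation of $N$, for which these functions are the associated functions; uniqueness means any two such $F$ on $U$ differ by an isometry of $N$. *)

theory Defs
  imports "HOL-Analysis.Analysis"
begin

section \<open>Smooth functions and partial derivatives\<close>

text \<open>\<^term>\<open>Ck_on k S f\<close> is meant for open sets \<open>S\<close> of a finite-dimensional space: all iterated
  directional derivatives of order at most \<open>k\<close> exist, and are continuous.\<close>

primrec Ck_on :: "nat \<Rightarrow> 'a::real_normed_vector set \<Rightarrow> ('a \<Rightarrow> 'b::real_normed_vector) \<Rightarrow> bool" where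
  "Ck_on 0 S f \<longleftrightarrow> continuous_on S f"
| "Ck_on (Suc k) S f \<longleftrightarrow>
     (\<forall>x\<in>S. f differentiable (at x)) \<and> (\<forall>v. Ck_on k S (\<lambda>x. frechet_derivative f (at x) v))"

definition smooth_on :: "'a::real_normed_vector set \<Rightarrow> ('a \<Rightarrow> 'b::real_normed_vector) \<Rightarrow> bool" where
  "smooth_on S f \<longleftrightarrow> (\<forall>k. Ck_on k S f)"

text \<open>The paracomplex number \<open>u + jv\<close> is the pair \<open>(u, v)\<close>. As \<open>s = (u + v) / sqrt 2\<close> and
  \<open>t = (u - v) / sqrt 2\<close>, one has \<open>\<partial>\<^sub>s = (\<partial>\<^sub>u + \<partial>\<^sub>v) / sqrt 2\<close> and \<open>\<partial>\<^sub>t = (\<partial>\<^sub>u - \<partial>\<^sub>v) / sqrt 2\<close>.\<close>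

type_synonym plane = "real \<times> real"

definition D_u :: "(plane \<Rightarrow> 'b::real_normed_vector) \<Rightarrow> plane \<Rightarrow> 'b" where
  "D_u f p = frechet_derivative f (at p) (1, 0)"

definition D_v :: "(plane \<Rightarrow> 'b::real_normed_vector) \<Rightarrow> plane \<Rightarrow> 'b" where
  "D_v f p = frechet_derivative f (at p) (0, 1)"

definition D_s :: "(plane \<Rightarrow> 'b::real_normed_vector) \<Rightarrow> plane \<Rightarrow> 'b" where
  "D_s f p = frechet_derivative f (at p) (1 / sqrt 2, 1 / sqrt 2)"

definition D_t :: "(plane \<Rightarrow> 'b::real_normed_vector) \<Rightarrow> plane \<Rightarrow> 'b" where
  "D_t f p = frechet_derivative f (at p) (1 / sqrt 2, - 1 / sqrt 2)"


section \<open>Neutral space forms\<close>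

text \<open>The three models live in one ambient type. With the form \<^term>\<open>psc L0\<close>, \<^typ>\<open>real^5\<close> is
  \<open>E\<^sup>5\<^sub>2\<close> if \<open>L0 > 0\<close> and \<open>E\<^sup>5\<^sub>3\<close> if \<open>L0 < 0\<close>. If \<open>L0 = 0\<close>, then \<open>E\<^sup>4\<^sub>2\<close> is the hyperplane where
  the last coordinate vanishes, and \<^term>\<open>psc L0\<close> restricts to its metric.\<close>

definition psc :: "real \<Rightarrow> real^5 \<Rightarrow> real^5 \<Rightarrow> real" where
  "psc L0 x y = x$1 * y$1 + x$2 * y$2 - x$3 * y$3 - x$4 * y$4 + sgn L0 * (x$5 * y$5)"

definition space_form :: "real \<Rightarrow> (real^5) set" where
  "space_form L0 = (if L0 = 0 then {x. x$5 = 0} else {x. psc L0 x x = 1 / L0})"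

definition tangent_sp :: "real \<Rightarrow> real^5 \<Rightarrow> (real^5) set" where
  "tangent_sp L0 x = (if L0 = 0 then {w. w$5 = 0} else {w. psc L0 x w = 0})"

text \<open>The space form is connected, so it has exactly two orientations; they are distinguished by
  a sign \<open>\<sigma>\<close>. The basis \<open>a, b, c, d\<close> of the tangent space at \<open>x\<close> is completed by a transversal
  vector.\<close>

definition positively_oriented ::
  "real \<Rightarrow> real \<Rightarrow> real^5 \<Rightarrow> real^5 \<Rightarrow> real^5 \<Rightarrow> real^5 \<Rightarrow> real^5 \<Rightarrow> bool" where
  "positively_oriented L0 \<sigma> x a b c d \<longleftrightarrow>
     \<sigma> * det ((\<chi> i. if i = 1 then a else if i = 2 then b else if i = 3 then c else if i = 4 then d
                else if L0 = 0 then axis 5 1 else x) :: real^5^5) > 0"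

text \<open>The covariant derivative in the direction \<open>z\<close>, for the Levi-Civita connection of the space
  form, of a vector field \<open>Y\<close> along a map \<open>X\<close> from the plane to the space form with
  \<open>Y p \<in> tangent_sp L0 (X p)\<close>. It is the tangential part of the flat ambient derivative; for
  \<open>L0 \<noteq> 0\<close> the position vector is normal with square \<open>1 / L0\<close>, and for \<open>L0 = 0\<close> nothing is
  subtracted.\<close>

definition nabla ::
  "real \<Rightarrow> (plane \<Rightarrow> real^5) \<Rightarrow> plane \<Rightarrow> (plane \<Rightarrow> real^5) \<Rightarrow> plane \<Rightarrow> real^5" where
  "nabla L0 X z Y p =
     (let w = frechet_derivative Y (at p) z in w - (L0 * psc L0 w (X p)) *\<^sub>R X p)"

text \<open>Smoothness on the closed submanifold \<^term>\<open>space_form L0\<close> is expressed by a smooth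
  extension to an ambient neighbourhood; on tangent vectors the derivative of an extension is the
  differential.\<close>

definition space_form_isometry :: "real \<Rightarrow> (real^5 \<Rightarrow> real^5) \<Rightarrow> bool" where
  "space_form_isometry L0 \<Phi> \<longleftrightarrow>
     bij_betw \<Phi> (space_form L0) (space_form L0) \<and>
     (\<exists>W \<Psi>. open W \<and> space_form L0 \<subseteq> W \<and> smooth_on W \<Psi> \<and>
        (\<forall>x\<in>space_form L0. \<Psi> x = \<Phi> x \<and>
           (\<forall>v\<in>tangent_sp L0 x. \<forall>w\<in>tangent_sp L0 x.
              psc L0 (frechet_derivative \<Psi> (at x) v) (frechet_derivative \<Psi> (at x) w) = psc L0 v w))) \<and>
     (\<exists>W \<Psi>. open W \<and> space_form L0 \<subseteq> W \<and> smooth_on W \<Psi> \<and>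
        (\<forall>x\<in>space_form L0. \<Psi> x = inv_into (space_form L0) \<Phi> x))"


section \<open>Lorentz surfaces\<close>

type_synonym 'm chart = "'m set \<times> ('m \<Rightarrow> plane)"

definition local_chart :: "'m::topological_space chart \<Rightarrow> bool" where
  "local_chart c \<longleftrightarrow> (case c of (U, \<phi>) \<Rightarrow>
     open U \<and> open (\<phi> ` U) \<and> homeomorphism U (\<phi> ` U) \<phi> (inv_into U \<phi>))"

text \<open>The differential of a coordinate change is multiplication by a paracomplex number \<open>a + jb\<close>;
  its determinant \<open>a\<^sup>2 - b\<^sup>2\<close> is positive because \<open>(\<partial>\<^sub>u, \<partial>\<^sub>v)\<close> gives the orientation of the surface.\<close>

definition paracomplex_change :: "'m chart \<Rightarrow> 'm chart \<Rightarrow> bool" where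
  "paracomplex_change c c' \<longleftrightarrow> (case (c, c') of ((U, \<phi>), (U', \<phi>')) \<Rightarrow>
     smooth_on (\<phi> ` (U \<inter> U')) (\<phi>' \<circ> inv_into U \<phi>) \<and>
     (\<forall>p\<in>\<phi> ` (U \<inter> U'). \<exists>a b. a\<^sup>2 - b\<^sup>2 > 0 \<and>
        ((\<phi>' \<circ> inv_into U \<phi>) has_derivative (\<lambda>(x, y). (a * x + b * y, b * x + a * y))) (at p)))"

definition lorentz_surface ::
  "'m::{t2_space, second_countable_topology} set \<Rightarrow> 'm chart set \<Rightarrow> bool" where
  "lorentz_surface M A \<longleftrightarrow>
     M = (\<Union>c\<in>A. fst c) \<and> (\<forall>c\<in>A. local_chart c) \<and> (\<forall>c\<in>A. \<forall>c'\<in>A. paracomplex_change c c')"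

text \<open>The local paracomplex coordinates of the surface are the members of the maximal atlas.\<close>

definition paracomplex_coordinate ::
  "'m::{t2_space, second_countable_topology} set \<Rightarrow> 'm chart set \<Rightarrow> 'm chart \<Rightarrow> bool" where
  "paracomplex_coordinate M A c \<longleftrightarrow>
     fst c \<subseteq> M \<and> local_chart c \<and> (\<forall>c'\<in>A. paracomplex_change c c' \<and> paracomplex_change c' c)"

definition local_rep :: "'m chart \<Rightarrow> ('m \<Rightarrow> real^5) \<Rightarrow> plane \<Rightarrow> real^5" where
  "local_rep c F = (\<lambda>p. F (inv_into (fst c) (snd c) p))"

abbreviation chart_image :: "'m chart \<Rightarrow> plane set" where
  "chart_image c \<equiv> snd c ` fst c"


section \<open>Time-like surfaces in coordinates\<close>

definition immersion_on :: "real \<Rightarrow> plane set \<Rightarrow> (plane \<Rightarrow> real^5) \<Rightarrow> bool" where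
  "immersion_on L0 D X \<longleftrightarrow> smooth_on D X \<and>
     (\<forall>p\<in>D. X p \<in> space_form L0 \<and> inj (frechet_derivative X (at p)))"

text \<open>The induced metric is \<open>e\<^bsup>2\<lambda>\<^esup> (du\<^sup>2 - dv\<^sup>2)\<close>.\<close>

definition conformal_metric :: "real \<Rightarrow> plane set \<Rightarrow> (plane \<Rightarrow> real^5) \<Rightarrow> (plane \<Rightarrow> real) \<Rightarrow> bool" where
  "conformal_metric L0 D X lam \<longleftrightarrow> (\<forall>p\<in>D.
     psc L0 (D_u X p) (D_u X p) = exp (2 * lam p) \<and>
     psc L0 (D_u X p) (D_v X p) = 0 \<and>
     psc L0 (D_v X p) (D_v X p) = - exp (2 * lam p))"

text \<open>Part of \<open>w\<close> normal to the surface, obtained by inverting the Gram matrix of the coordinate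
  vector fields.\<close>

definition normal_part :: "real \<Rightarrow> (plane \<Rightarrow> real^5) \<Rightarrow> plane \<Rightarrow> real^5 \<Rightarrow> real^5" where
  "normal_part L0 X p w =
     (let T1 = D_u X p; T2 = D_v X p;
          g11 = psc L0 T1 T1; g12 = psc L0 T1 T2; g22 = psc L0 T2 T2; d = g11 * g22 - g12\<^sup>2;
          a = psc L0 w T1; b = psc L0 w T2
      in w - ((g22 * a - g12 * b) / d) *\<^sub>R T1 - ((g11 * b - g12 * a) / d) *\<^sub>R T2)"

text \<open>Half the trace, with respect to the induced metric, of the second fundamental form.\<close>

definition mean_curvature_vector :: "real \<Rightarrow> (plane \<Rightarrow> real^5) \<Rightarrow> plane \<Rightarrow> real^5" where
  "mean_curvature_vector L0 X p =
     (let T1 = D_u X p; T2 = D_v X p;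
          g11 = psc L0 T1 T1; g12 = psc L0 T1 T2; g22 = psc L0 T2 T2; d = g11 * g22 - g12\<^sup>2;
          s11 = normal_part L0 X p (nabla L0 X (1, 0) (D_u X) p);
          s12 = normal_part L0 X p (nabla L0 X (1, 0) (D_v X) p);
          s22 = normal_part L0 X p (nabla L0 X (0, 1) (D_v X) p)
      in (1 / (2 * d)) *\<^sub>R (g22 *\<^sub>R s11 - (2 * g12) *\<^sub>R s12 + g11 *\<^sub>R s22))"

definition timelike_conformal_immersion ::
  "real \<Rightarrow> 'm::{t2_space, second_countable_topology} set \<Rightarrow> 'm chart set \<Rightarrow> ('m \<Rightarrow> real^5) \<Rightarrow> bool" where
  "timelike_conformal_immersion L0 M A F \<longleftrightarrow> (\<forall>c. paracomplex_coordinate M A c \<longrightarrow>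
     immersion_on L0 (chart_image c) (local_rep c F) \<and>
     (\<exists>lam. conformal_metric L0 (chart_image c) (local_rep c F) lam))"

definition zero_mean_curvature ::
  "real \<Rightarrow> 'm::{t2_space, second_countable_topology} set \<Rightarrow> 'm chart set \<Rightarrow> ('m \<Rightarrow> real^5) \<Rightarrow> bool" where
  "zero_mean_curvature L0 M A F \<longleftrightarrow> (\<forall>c. paracomplex_coordinate M A c \<longrightarrow>
     (\<forall>p\<in>chart_image c. mean_curvature_vector L0 (local_rep c F) p = 0))"

definition normal_frame ::
  "real \<Rightarrow> real \<Rightarrow> plane set \<Rightarrow> (plane \<Rightarrow> real^5) \<Rightarrow> (plane \<Rightarrow> real) \<Rightarrow>
   (plane \<Rightarrow> real^5) \<Rightarrow> (plane \<Rightarrow> real^5) \<Rightarrow> bool" where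
  "normal_frame L0 \<sigma> D X lam N1 N2 \<longleftrightarrow> smooth_on D N1 \<and> smooth_on D N2 \<and>
     (\<forall>p\<in>D.
        N1 p \<in> tangent_sp L0 (X p) \<and> N2 p \<in> tangent_sp L0 (X p) \<and>
        psc L0 (N1 p) (D_u X p) = 0 \<and> psc L0 (N1 p) (D_v X p) = 0 \<and>
        psc L0 (N2 p) (D_u X p) = 0 \<and> psc L0 (N2 p) (D_v X p) = 0 \<and>
        psc L0 (N1 p) (N1 p) = exp (2 * lam p) \<and> psc L0 (N2 p) (N2 p) = - exp (2 * lam p) \<and>
        psc L0 (N1 p) (N2 p) = 0 \<and>
        positively_oriented L0 \<sigma> (X p) (D_u X p) (N1 p) (D_v X p) (N2 p))"

text \<open>\<open>al1\<close>, \<open>al2\<close>, \<open>be1\<close>, \<open>be2\<close>, \<open>mu1\<close>, \<open>mu2\<close> are the functions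
  \<open>\<alpha>\<^sub>k, \<beta>\<^sub>k, \<mu>\<^sub>k\<close>. They are determined on \<open>D\<close> by \<open>X\<close> and the frame.\<close>

definition associated_functions ::
  "real \<Rightarrow> plane set \<Rightarrow> (plane \<Rightarrow> real^5) \<Rightarrow> (plane \<Rightarrow> real^5) \<Rightarrow> (plane \<Rightarrow> real^5) \<Rightarrow> (plane \<Rightarrow> real) \<Rightarrow>
   (plane \<Rightarrow> real) \<Rightarrow> (plane \<Rightarrow> real) \<Rightarrow> (plane \<Rightarrow> real) \<Rightarrow> (plane \<Rightarrow> real) \<Rightarrow>
   (plane \<Rightarrow> real) \<Rightarrow> (plane \<Rightarrow> real) \<Rightarrow> bool" where
  "associated_functions L0 D X N1 N2 lam al1 al2 be1 be2 mu1 mu2 \<longleftrightarrow> (\<forall>p\<in>D.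
     let T1 = D_u X; T2 = D_v X; lu = D_u lam p; lv = D_v lam p in
       nabla L0 X (1, 0) T1 p
         = lu *\<^sub>R T1 p + lv *\<^sub>R T2 p + al1 p *\<^sub>R N1 p + be1 p *\<^sub>R N2 p \<and>
       nabla L0 X (1, 0) T2 p
         = lv *\<^sub>R T1 p + lu *\<^sub>R T2 p + al2 p *\<^sub>R N1 p + be2 p *\<^sub>R N2 p \<and>
       nabla L0 X (0, 1) T1 p
         = lv *\<^sub>R T1 p + lu *\<^sub>R T2 p + al2 p *\<^sub>R N1 p + be2 p *\<^sub>R N2 p \<and>
       nabla L0 X (0, 1) T2 p
         = lu *\<^sub>R T1 p + lv *\<^sub>R T2 p + al1 p *\<^sub>R N1 p + be1 p *\<^sub>R N2 p \<and>
       nabla L0 X (1, 0) N1 p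
         = - al1 p *\<^sub>R T1 p + al2 p *\<^sub>R T2 p + lu *\<^sub>R N1 p + mu1 p *\<^sub>R N2 p \<and>
       nabla L0 X (1, 0) N2 p
         = be1 p *\<^sub>R T1 p - be2 p *\<^sub>R T2 p + mu1 p *\<^sub>R N1 p + lu *\<^sub>R N2 p \<and>
       nabla L0 X (0, 1) N1 p
         = - al2 p *\<^sub>R T1 p + al1 p *\<^sub>R T2 p + lv *\<^sub>R N1 p + mu2 p *\<^sub>R N2 p \<and>
       nabla L0 X (0, 1) N2 p
         = be2 p *\<^sub>R T1 p - be1 p *\<^sub>R T2 p + mu2 p *\<^sub>R N1 p + lv *\<^sub>R N2 p)"


section \<open>The conditions\<close>

text \<open>\<open>X\<^sub>+\<^sup>2 \<noteq> Y\<^sub>+\<^sup>2\<close> and \<open>X\<^sub>- = Y\<^sub>- \<noteq> 0\<close> at \<open>p\<close>.\<close>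

definition XY_condition ::
  "(plane \<Rightarrow> real) \<Rightarrow> (plane \<Rightarrow> real) \<Rightarrow> (plane \<Rightarrow> real) \<Rightarrow> (plane \<Rightarrow> real) \<Rightarrow> plane \<Rightarrow> bool" where
  "XY_condition al1 al2 be1 be2 p \<longleftrightarrow>
     (let Xp = al1 p + be2 p; Xm = al1 p - be2 p; Yp = al2 p + be1 p; Ym = al2 p - be1 p
      in Xp\<^sup>2 \<noteq> Yp\<^sup>2 \<and> Xm = Ym \<and> Ym \<noteq> 0)"

text \<open>The condition at a point does not depend on the coordinate and the frame, so it suffices to
  ask for one choice of both around that point.\<close>

definition satisfies_XY ::
  "real \<Rightarrow> real \<Rightarrow> 'm::{t2_space, second_countable_topology} set \<Rightarrow> 'm chart set \<Rightarrow>
   ('m \<Rightarrow> real^5) \<Rightarrow> bool" where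
  "satisfies_XY L0 \<sigma> M A F \<longleftrightarrow> (\<forall>x\<in>M. \<exists>c lam N1 N2 al1 al2 be1 be2 mu1 mu2.
     paracomplex_coordinate M A c \<and> x \<in> fst c \<and>
     conformal_metric L0 (chart_image c) (local_rep c F) lam \<and>
     normal_frame L0 \<sigma> (chart_image c) (local_rep c F) lam N1 N2 \<and>
     associated_functions L0 (chart_image c) (local_rep c F) N1 N2 lam al1 al2 be1 be2 mu1 mu2 \<and>
     XY_condition al1 al2 be1 be2 (snd c x))"

text \<open>The functions \<open>P, Q, R\<close> stand for \<open>P\<^sub>+, Q\<^sub>+\<close> and the function with a tilde,
  and \<open>e, e', e''\<close> for the three signs.\<close>

definition star ::
  "real \<Rightarrow> plane set \<Rightarrow> (plane \<Rightarrow> real) \<Rightarrow> (plane \<Rightarrow> real) \<Rightarrow> (plane \<Rightarrow> real) \<Rightarrow>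
   (plane \<Rightarrow> real) \<Rightarrow> (plane \<Rightarrow> real) \<Rightarrow> (plane \<Rightarrow> real) \<Rightarrow> (plane \<Rightarrow> real) \<Rightarrow> bool" where
  "star L0 D lam al1 al2 be1 be2 mu1 mu2 \<longleftrightarrow>
     (\<exists>e\<in>{1, -1}. \<exists>e'\<in>{1, -1}. \<exists>e''\<in>{1, -1}. \<exists>f1 f2 P Q R.
        smooth_on D f1 \<and> smooth_on D f2 \<and> smooth_on D P \<and> smooth_on D Q \<and> smooth_on D R \<and>
        (\<forall>p\<in>D.
           D_t (D_s f1) p = L0 * exp (- f1 p - f2 p) \<and>
           D_t (D_s f2) p = - (e / 2) * exp (f1 p + 2 * f2 p) \<and>
           f1 p = P p - Q p + 2 * R p \<and>
           f2 p = Q p - R p \<and>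
           lam p = - (1 / 2) * (P p + R p) \<and>
           mu1 p = - (1 / 2) * D_u P p + (1 / sqrt 2) * D_s Q p - (1 / 2) * D_v R p \<and>
           mu2 p = - (1 / 2) * D_v P p + (1 / sqrt 2) * D_s Q p - (1 / 2) * D_u R p \<and>
           (let Xp = (e' / 2) * (exp (P p) + e * exp (Q p));
                Yp = (e' / 2) * (exp (P p) - e * exp (Q p));
                Xm = (e'' / 2) * exp (R p);
                Ym = (e'' / 2) * exp (R p)
            in al1 p = (1 / 2) * (Xp + Xm) \<and> al2 p = (1 / 2) * (Yp + Ym) \<and>
               be1 p = (1 / 2) * (Yp - Ym) \<and> be2 p = (1 / 2) * (Xp - Xm))))"

definition star_representable ::
  "real \<Rightarrow> real \<Rightarrow> 'm::{t2_space, second_countable_topology} set \<Rightarrow> 'm chart set \<Rightarrow>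
   ('m \<Rightarrow> real^5) \<Rightarrow> bool" where
  "star_representable L0 \<sigma> M A F \<longleftrightarrow> (\<forall>x\<in>M. \<exists>c lam N1 N2 al1 al2 be1 be2 mu1 mu2.
     paracomplex_coordinate M A c \<and> x \<in> fst c \<and>
     conformal_metric L0 (chart_image c) (local_rep c F) lam \<and>
     normal_frame L0 \<sigma> (chart_image c) (local_rep c F) lam N1 N2 \<and>
     associated_functions L0 (chart_image c) (local_rep c F) N1 N2 lam al1 al2 be1 be2 mu1 mu2 \<and>
     star L0 (chart_image c) lam al1 al2 be1 be2 mu1 mu2)"

text \<open>\<open>X\<close> is a time-like conformal immersion of the plane domain \<open>U\<close> with zero mean curvature
  vector for which the given functions are the associated functions.\<close>

definition realizes ::
  "real \<Rightarrow> real \<Rightarrow> plane set \<Rightarrow> (plane \<Rightarrow> real^5) \<Rightarrow> (plane \<Rightarrow> real) \<Rightarrow> (plane \<Rightarrow> real) \<Rightarrow> (plane \<Rightarrow> real) \<Rightarrow>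
   (plane \<Rightarrow> real) \<Rightarrow> (plane \<Rightarrow> real) \<Rightarrow> (plane \<Rightarrow> real) \<Rightarrow> (plane \<Rightarrow> real) \<Rightarrow> bool" where
  "realizes L0 \<sigma> U X lam al1 al2 be1 be2 mu1 mu2 \<longleftrightarrow>
     immersion_on L0 U X \<and> conformal_metric L0 U X lam \<and>
     (\<forall>p\<in>U. mean_curvature_vector L0 X p = 0) \<and>
     (\<exists>N1 N2. normal_frame L0 \<sigma> U X lam N1 N2 \<and>
        associated_functions L0 U X N1 N2 lam al1 al2 be1 be2 mu1 mu2)"

end

theory Submission imports Defs begin

text \<open>In null directions of the tangent and normal planes the second fundamental form has four components.
  The condition \<open>X\<^sub>- = Y\<^sub>-\<close> says that one of them vanishes, and the others are up to sign
  \<open>e\<^sup>P\<close>, \<open>e\<^sup>Q\<close>, \<open>e\<^sup>R\<close> (\<open>R\<close> is the function written \<open>P\<^sub>-\<close> with a tilde in the theorem). The equations of Codazzi become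
  linear equations for the first derivatives of \<open>P\<close>, \<open>Q\<close>, \<open>R\<close>, \<open>\<lambda>\<close>, which express \<open>\<mu>\<^sub>1\<close>, \<open>\<mu>\<^sub>2\<close> and
  imply \<open>(2\<lambda> + P + R)\<^sub>t = 0\<close>. A change of the coordinate \<open>s\<close> therefore achieves \<open>2\<lambda> + P + R = 0\<close>, and then the
  equations of Gauss and Ricci amount to the two equations for \<open>f\<^sub>1\<close> and \<open>f\<^sub>2\<close>.

  Conversely, these equations are the integrability condition of the linear system
  \<open>F\<^sub>u = A F\<close>, \<open>F\<^sub>v = B F\<close> for the matrix \<open>F\<close> whose rows are the normalized frame and position vector.
  The system is solved by a Goursat problem. As \<open>A\<close> and \<open>B\<close> are skew for the ambient form, \<open>F\<^sup>T \<eta> F'\<close> is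
  constant for any two solutions, so orthonormality propagates and any two surfaces are congruent.\<close>

section \<open>Calculus of smooth functions\<close>

text \<open>The four components are \<open>X_+ + Y_+\<close>, \<open>X_+ - Y_+\<close>,
  \<open>X_- + Y_-\<close> and \<open>X_- - Y_-\<close>. So (a) says that the first three have no
  zeros and the last vanishes; a sign and a logarithm turn the three into \<open>P\<close>,
  \<open>Q\<close>, \<open>R\<close>. A coordinate change with differential \<open>a + jb\<close>
  multiplies each component by \<open>(a + b)^2\<close> or \<open>(a - b)^2\<close>, by a factor
  from a boost of the normal plane and by a ratio of metrics. In the product of the first component,
  the third and \<open>e^(2 \<lambda>)\<close> the boost cancels and only \<open>(a + b)^4\<close>
  is left. This product is the coefficient of a quartic differential in ds, which is why a change of
  s alone normalizes it. Condition (a) is granted at each point only in some chart around it, while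
  signs and logarithms have to be chosen on a whole chart; hence its invariance under changes of
  chart and frame is proved as well. For \<open>L0 = 0\<close> the position vector is not normal to
  the space form, and a constant unit vector completes the frame. The surface is then recovered from
  its differential by one more integration, and a translation enters the congruence.\<close>

lemma frechet_derivativeI:
  "(f has_derivative f') (at x) \<Longrightarrow> frechet_derivative f (at x) = f'"
  using frechet_derivative_at by metis

lemma has_derivative_frechet:
  "f differentiable (at x) \<Longrightarrow> (f has_derivative frechet_derivative f (at x)) (at x)"
  using frechet_derivative_works by blast

text \<open>Functions are total, while formulas for them and their derivatives hold only on
  \<open>S\<close>. Derivatives are local and \<open>S\<close> is open, so agreement on
  \<open>S\<close> passes to derivatives of every order.\<close>

lemma Ck_on_cong_imp:
  assumes "open S" "\<And>x. x \<in> S \<Longrightarrow> f x = g x" "Ck_on k S f"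
  shows "Ck_on k S g"
  using assms(2,3)
proof (induction k arbitrary: f g)
  case 0
  then show ?case by (simp cong: continuous_on_cong_simp)
next
  case (Suc k)
  have eq: "g differentiable (at x)" "frechet_derivative f (at x) = frechet_derivative g (at x)"
    if "x \<in> S" for x
  proof -
    have d: "f differentiable (at x)" using Suc.prems(2) that by simp
    show "g differentiable (at x)"
      using d Suc.prems(1) assms(1) that
      by (metis differentiable_def has_derivative_transform_within_open)
    show "frechet_derivative f (at x) = frechet_derivative g (at x)"
      using frechet_derivative_transform_within_open[OF d assms(1) that] Suc.prems(1) by blast
  qed
  have "Ck_on k S (\<lambda>x. frechet_derivative g (at x) v)" for v
    by (rule Suc.IH[of "\<lambda>x. frechet_derivative f (at x) v"]) (use Suc.prems(2) eq in auto)
  with eq show ?case by simp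
qed

lemma Ck_on_SucI:
  assumes "open S" "\<And>x. x \<in> S \<Longrightarrow> (f has_derivative f' x) (at x)" "\<And>v. Ck_on k S (\<lambda>x. f' x v)"
  shows "Ck_on (Suc k) S f"
proof -
  have "Ck_on k S (\<lambda>x. frechet_derivative f (at x) v)" for v
    by (rule Ck_on_cong_imp[OF assms(1) _ assms(3)[of v]])
      (use frechet_derivativeI[OF assms(2)] in auto)
  then show ?thesis using assms(2) by (auto simp: differentiable_def)
qed

lemma Ck_on_Suc_has_derivative:
  "Ck_on (Suc k) S f \<Longrightarrow> x \<in> S \<Longrightarrow> (f has_derivative frechet_derivative f (at x)) (at x)"
  by (simp add: has_derivative_frechet)

lemma Ck_on_Suc_imp: "Ck_on (Suc k) S f \<Longrightarrow> Ck_on k S f"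
proof (induction k arbitrary: f)
  case 0
  then show ?case
    by (auto intro!: differentiable_imp_continuous_on simp: differentiable_on_def
        differentiable_at_withinI)
qed simp

lemma Ck_on_subset: "Ck_on k S f \<Longrightarrow> T \<subseteq> S \<Longrightarrow> Ck_on k T f"
  by (induction k arbitrary: f) (auto intro: continuous_on_subset)

lemma Ck_on_const: "Ck_on k S (\<lambda>x. c)"
  by (induction k arbitrary: c) auto

lemma Ck_on_bounded_linear_compose:
  assumes "bounded_linear L" "open S"
  shows "Ck_on k S f \<Longrightarrow> Ck_on k S (\<lambda>x. L (f x))"
proof (induction k arbitrary: f)
  case 0
  then show ?case using assms(1) by (auto intro: bounded_linear.continuous_on)
next
  case (Suc k)
  show ?case
    by (rule Ck_on_SucI[OF assms(2), where f'="\<lambda>x v. L (frechet_derivative f (at x) v)"])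
      (use Suc in \<open>auto intro!: bounded_linear.has_derivative[OF assms(1)] has_derivative_frechet\<close>)
qed

lemma Ck_on_add:
  assumes "open S"
  shows "Ck_on k S f \<Longrightarrow> Ck_on k S g \<Longrightarrow> Ck_on k S (\<lambda>x. f x + g x)"
proof (induction k arbitrary: f g)
  case 0
  then show ?case by (auto intro: continuous_intros)
next
  case (Suc k)
  show ?case
  proof (rule Ck_on_SucI[OF assms, where
        f'="\<lambda>x v. frechet_derivative f (at x) v + frechet_derivative g (at x) v"])
    show "((\<lambda>x. f x + g x) has_derivative
        (\<lambda>v. frechet_derivative f (at x) v + frechet_derivative g (at x) v)) (at x)" if "x \<in> S" for x
      using Suc.prems that by (simp add: has_derivative_add has_derivative_frechet)
    show "Ck_on k S (\<lambda>x. frechet_derivative f (at x) v + frechet_derivative g (at x) v)" for v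
      using Suc.prems by (intro Suc.IH) simp_all
  qed
qed

text \<open>The Leibniz rule writes the derivative as a sum of two terms of the same shape, which is
  why the induction runs over all pairs of factors.\<close>

lemma Ck_on_bilinear:
  assumes "bounded_bilinear B" "open S"
  shows "Ck_on k S f \<Longrightarrow> Ck_on k S g \<Longrightarrow> Ck_on k S (\<lambda>x. B (f x) (g x))"
proof (induction k arbitrary: f g)
  case 0
  then show ?case using assms(1) by (auto intro: bounded_bilinear.continuous_on)
next
  case (Suc k)
  have fg: "Ck_on k S f" "Ck_on k S g" using Suc.prems Ck_on_Suc_imp by blast+
  show ?case
  proof (rule Ck_on_SucI[OF assms(2), where
        f'="\<lambda>x v. B (f x) (frechet_derivative g (at x) v) + B (frechet_derivative f (at x) v) (g x)"])
    show "((\<lambda>x. B (f x) (g x)) has_derivative (\<lambda>v. B (f x) (frechet_derivative g (at x) v)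
        + B (frechet_derivative f (at x) v) (g x))) (at x)" if "x \<in> S" for x
      by (rule bounded_bilinear.FDERIV[OF assms(1)])
        (use that Suc.prems in \<open>simp_all add: has_derivative_frechet\<close>)
    show "Ck_on k S (\<lambda>x. B (f x) (frechet_derivative g (at x) v) + B (frechet_derivative f (at x) v) (g x))" for v
      by (rule Ck_on_add[OF assms(2)]; rule Suc.IH) (use Suc.prems fg in simp_all)
  qed
qed

lemma Ck_on_sum:
  assumes "open S" "\<And>i. i \<in> I \<Longrightarrow> Ck_on k S (f i)"
  shows "Ck_on k S (\<lambda>x. \<Sum>i\<in>I. f i x)"
  using assms(2)
  by (induction I rule: infinite_finite_induct) (auto intro: Ck_on_const Ck_on_add[OF assms(1)])

lemma Ck_on_exp:
  fixes f :: "'a::real_normed_vector \<Rightarrow> real"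
  assumes "open S"
  shows "Ck_on k S f \<Longrightarrow> Ck_on k S (\<lambda>x. exp (f x))"
proof (induction k arbitrary: f)
  case 0
  then show ?case by (auto intro: continuous_intros)
next
  case (Suc k)
  show ?case
  proof (rule Ck_on_SucI[OF assms, where f'="\<lambda>x v. exp (f x) * frechet_derivative f (at x) v"])
    show "((\<lambda>x. exp (f x)) has_derivative (\<lambda>v. exp (f x) * frechet_derivative f (at x) v)) (at x)"
      if "x \<in> S" for x
      using has_derivative_exp[OF Ck_on_Suc_has_derivative[OF Suc.prems that]] by (simp add: mult.commute)
    show "Ck_on k S (\<lambda>x. exp (f x) * frechet_derivative f (at x) v)" for v
      by (rule Ck_on_bilinear[OF bounded_bilinear_mult assms Suc.IH[OF Ck_on_Suc_imp[OF Suc.prems]]])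
        (use Suc.prems in simp)
  qed
qed

lemma Ck_on_inverse:
  fixes f :: "'a::real_normed_vector \<Rightarrow> real"
  assumes "open S" "\<And>x. x \<in> S \<Longrightarrow> f x \<noteq> 0"
  shows "Ck_on k S f \<Longrightarrow> Ck_on k S (\<lambda>x. inverse (f x))"
proof (induction k)
  case 0
  then show ?case using assms by (auto intro: continuous_intros)
next
  case (Suc k)
  have inv: "Ck_on k S (\<lambda>x. inverse (f x))" using Suc Ck_on_Suc_imp by blast
  note m = Ck_on_bilinear[OF bounded_bilinear_mult assms(1)]
  show ?case
  proof (rule Ck_on_SucI[OF assms(1), where
        f'="\<lambda>x v. - (inverse (f x) * frechet_derivative f (at x) v * inverse (f x))"])
    show "((\<lambda>x. inverse (f x)) has_derivative
        (\<lambda>v. - (inverse (f x) * frechet_derivative f (at x) v * inverse (f x)))) (at x)"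
      if "x \<in> S" for x
      using Deriv.has_derivative_inverse[OF assms(2)[OF that] Ck_on_Suc_has_derivative[OF Suc.prems that]]
      by simp
    show "Ck_on k S (\<lambda>x. - (inverse (f x) * frechet_derivative f (at x) v * inverse (f x)))" for v
      by (rule Ck_on_bounded_linear_compose[OF bounded_linear_minus[OF bounded_linear_ident] assms(1)],
          rule m[OF m[OF inv] inv]) (use Suc.prems in simp)
  qed
qed

text \<open>No induction is required: the derivative \<open>f' / f\<close> contains no logarithm, so
  one differentiation reduces the claim to reciprocals.\<close>

lemma Ck_on_ln:
  fixes f :: "'a::real_normed_vector \<Rightarrow> real"
  assumes "open S" "\<And>x. x \<in> S \<Longrightarrow> f x > 0"
  shows "Ck_on k S f \<Longrightarrow> Ck_on k S (\<lambda>x. ln (f x))"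
proof (cases k)
  case 0
  then show "Ck_on k S f \<Longrightarrow> Ck_on k S (\<lambda>x. ln (f x))"
    using assms by (auto intro!: continuous_on_ln) (metis less_irrefl)
next
  case (Suc k')
  assume f: "Ck_on k S f"
  have nz: "\<And>x. x \<in> S \<Longrightarrow> f x \<noteq> 0" using assms(2) by force
  show ?thesis unfolding Suc
  proof (rule Ck_on_SucI[OF assms(1), where
        f'="\<lambda>x v. frechet_derivative f (at x) v * inverse (f x)"])
    show "((\<lambda>x. ln (f x)) has_derivative
        (\<lambda>v. frechet_derivative f (at x) v * inverse (f x))) (at x)"
      if "x \<in> S" for x
      by (rule has_derivative_ln[OF assms(2)[OF that] Ck_on_Suc_has_derivative[OF f[unfolded Suc] that]])
    show "Ck_on k' S (\<lambda>x. frechet_derivative f (at x) v * inverse (f x))" for v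
      using f[unfolded Suc] nz
      by (intro Ck_on_bilinear[OF bounded_bilinear_mult assms(1)] Ck_on_inverse[OF assms(1)] Ck_on_Suc_imp[OF f[unfolded Suc]])
        simp_all
  qed
qed

text \<open>In the chain rule the direction \<open>g' x v\<close> moves with \<open>x\<close>,
  whereas \<open>Ck_on\<close> speaks of derivatives in a fixed direction. Expanding it in a basis
  leaves the functions \<open>f' (g x) b\<close> with \<open>b\<close> fixed, to which the induction
  hypothesis applies.\<close>

lemma Ck_on_compose:
  fixes f :: "'b::euclidean_space \<Rightarrow> 'c::real_normed_vector" and g :: "'a::real_normed_vector \<Rightarrow> 'b"
  assumes "open S" "g ` S \<subseteq> T"
  shows "Ck_on k T f \<Longrightarrow> Ck_on k S g \<Longrightarrow> Ck_on k S (\<lambda>x. f (g x))"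
proof (induction k arbitrary: f)
  case 0
  then show ?case using assms continuous_on_compose2[of T f S g] by auto
next
  case (Suc k)
  let ?f' = "\<lambda>x v. \<Sum>b\<in>Basis. (frechet_derivative g (at x) v \<bullet> b) *\<^sub>R frechet_derivative f (at (g x)) b"
  show ?case
  proof (rule Ck_on_SucI[OF assms(1), where f'="?f'"])
    fix x assume x: "x \<in> S"
    then have gx: "g x \<in> T" using assms by auto
    have d: "(f has_derivative frechet_derivative f (at (g x))) (at (g x))"
      using Ck_on_Suc_has_derivative[OF Suc.prems(1) gx] .
    have "frechet_derivative f (at (g x)) (frechet_derivative g (at x) v) = ?f' x v" for v
    proof -
      have "frechet_derivative f (at (g x)) (\<Sum>b\<in>Basis. (frechet_derivative g (at x) v \<bullet> b) *\<^sub>R b) = ?f' x v"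
        by (simp add: linear_sum[OF has_derivative_linear[OF d]] linear_cmul[OF has_derivative_linear[OF d]])
      then show ?thesis by (simp add: euclidean_representation)
    qed
    then show "((\<lambda>x. f (g x)) has_derivative ?f' x) (at x)"
      using has_derivative_compose[OF Ck_on_Suc_has_derivative[OF Suc.prems(2) x] d] by presburger
  next
    fix v
    have "Ck_on k S (\<lambda>x. frechet_derivative f (at (g x)) b)" for b
      by (rule Suc.IH[OF _ Ck_on_Suc_imp[OF Suc.prems(2)]]) (use Suc.prems(1) in simp)
    then show "Ck_on k S (\<lambda>x. ?f' x v)"
      using Suc.prems(2)
      by (intro Ck_on_sum[OF assms(1)] Ck_on_bilinear[OF bounded_bilinear_scaleR assms(1)]
          Ck_on_bounded_linear_compose[OF bounded_linear_inner_left assms(1)]) auto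
  qed
qed

lemma smooth_on_cong:
  "smooth_on S f \<Longrightarrow> open S \<Longrightarrow> (\<And>x. x \<in> S \<Longrightarrow> f x = g x) \<Longrightarrow> smooth_on S g"
  unfolding smooth_on_def using Ck_on_cong_imp by blast

lemma smooth_on_subset: "smooth_on S f \<Longrightarrow> T \<subseteq> S \<Longrightarrow> smooth_on T f"
  unfolding smooth_on_def using Ck_on_subset by blast

lemma smooth_onI:
  assumes "open S" "\<And>x. x \<in> S \<Longrightarrow> (f has_derivative f' x) (at x)" "\<And>v. smooth_on S (\<lambda>x. f' x v)"
  shows "smooth_on S f"
  unfolding smooth_on_def using Ck_on_SucI[OF assms(1,2)] assms(3) Ck_on_Suc_imp
  unfolding smooth_on_def by blast

lemma smooth_on_differentiable: "smooth_on S f \<Longrightarrow> x \<in> S \<Longrightarrow> f differentiable (at x)"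
  unfolding smooth_on_def by (metis Ck_on.simps(2))

lemma smooth_on_continuous: "smooth_on S f \<Longrightarrow> continuous_on S f"
  unfolding smooth_on_def by (metis Ck_on.simps(1))

lemma smooth_on_frechet: "smooth_on S f \<Longrightarrow> smooth_on S (\<lambda>x. frechet_derivative f (at x) v)"
  unfolding smooth_on_def by (metis Ck_on.simps(2))

lemma smooth_on_const: "smooth_on S (\<lambda>x. c)"
  unfolding smooth_on_def using Ck_on_const by blast

lemma smooth_on_bounded_linear_compose:
  "bounded_linear L \<Longrightarrow> open S \<Longrightarrow> smooth_on S f \<Longrightarrow> smooth_on S (\<lambda>x. L (f x))"
  unfolding smooth_on_def using Ck_on_bounded_linear_compose by blast

lemma smooth_on_bounded_linear:
  assumes "bounded_linear L" shows "smooth_on S L"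
proof -
  have "smooth_on UNIV L"
    by (rule smooth_onI[where f'="\<lambda>x. L"])
      (auto intro: smooth_on_const bounded_linear_imp_has_derivative[OF assms])
  then show ?thesis using smooth_on_subset by blast
qed

lemma smooth_on_bilinear:
  "bounded_bilinear B \<Longrightarrow> open S \<Longrightarrow> smooth_on S f \<Longrightarrow> smooth_on S g \<Longrightarrow>
    smooth_on S (\<lambda>x. B (f x) (g x))"
  unfolding smooth_on_def using Ck_on_bilinear by blast

lemma smooth_on_compose:
  fixes f :: "'b::euclidean_space \<Rightarrow> 'c::real_normed_vector"
  shows "smooth_on T f \<Longrightarrow> open S \<Longrightarrow> smooth_on S g \<Longrightarrow> g ` S \<subseteq> T \<Longrightarrow> smooth_on S (\<lambda>x. f (g x))"
  unfolding smooth_on_def using Ck_on_compose by blast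

lemma smooth_on_add:
  "open S \<Longrightarrow> smooth_on S f \<Longrightarrow> smooth_on S g \<Longrightarrow> smooth_on S (\<lambda>x. f x + g x)"
  unfolding smooth_on_def using Ck_on_add by blast

lemma smooth_on_scaleR:
  "open S \<Longrightarrow> smooth_on S f \<Longrightarrow> smooth_on S g \<Longrightarrow> smooth_on S (\<lambda>x. f x *\<^sub>R g x)"
  by (rule smooth_on_bilinear[OF bounded_bilinear_scaleR])

lemma smooth_on_mult:
  fixes f g :: "'a::real_normed_vector \<Rightarrow> real"
  shows "open S \<Longrightarrow> smooth_on S f \<Longrightarrow> smooth_on S g \<Longrightarrow> smooth_on S (\<lambda>x. f x * g x)"
  by (rule smooth_on_bilinear[OF bounded_bilinear_mult])

lemma smooth_on_minus: "open S \<Longrightarrow> smooth_on S f \<Longrightarrow> smooth_on S (\<lambda>x. - f x)"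
  by (rule smooth_on_bounded_linear_compose[OF bounded_linear_minus[OF bounded_linear_ident]])

lemma smooth_on_diff:
  "open S \<Longrightarrow> smooth_on S f \<Longrightarrow> smooth_on S g \<Longrightarrow> smooth_on S (\<lambda>x. f x - g x)"
  using smooth_on_add[of S f "\<lambda>x. - g x"] smooth_on_minus[of S g] by simp

lemma smooth_on_exp:
  fixes f :: "'a::real_normed_vector \<Rightarrow> real"
  shows "open S \<Longrightarrow> smooth_on S f \<Longrightarrow> smooth_on S (\<lambda>x. exp (f x))"
  unfolding smooth_on_def using Ck_on_exp by blast

lemma smooth_on_inverse:
  fixes f :: "'a::real_normed_vector \<Rightarrow> real"
  shows "open S \<Longrightarrow> smooth_on S f \<Longrightarrow> (\<And>x. x \<in> S \<Longrightarrow> f x \<noteq> 0) \<Longrightarrow> smooth_on S (\<lambda>x. inverse (f x))"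
  unfolding smooth_on_def using Ck_on_inverse by blast

lemma smooth_on_ln:
  fixes f :: "'a::real_normed_vector \<Rightarrow> real"
  shows "open S \<Longrightarrow> smooth_on S f \<Longrightarrow> (\<And>x. x \<in> S \<Longrightarrow> f x > 0) \<Longrightarrow> smooth_on S (\<lambda>x. ln (f x))"
  unfolding smooth_on_def using Ck_on_ln by blast

lemma smooth_on_divide:
  fixes f g :: "'a::real_normed_vector \<Rightarrow> real"
  shows "open S \<Longrightarrow> smooth_on S f \<Longrightarrow> smooth_on S g \<Longrightarrow> (\<And>x. x \<in> S \<Longrightarrow> g x \<noteq> 0) \<Longrightarrow>
    smooth_on S (\<lambda>x. f x / g x)"
  unfolding divide_inverse by (intro smooth_on_mult smooth_on_inverse)

lemma smooth_on_vec_nth: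
  fixes f :: "'a::real_normed_vector \<Rightarrow> real^'n"
  shows "open S \<Longrightarrow> smooth_on S f \<Longrightarrow> smooth_on S (\<lambda>x. f x $ i)"
  by (rule smooth_on_bounded_linear_compose[OF bounded_linear_vec_nth])

lemmas smooth_intros = smooth_on_const smooth_on_add smooth_on_diff smooth_on_minus smooth_on_scaleR
  smooth_on_mult smooth_on_exp smooth_on_vec_nth

lemma smooth_on_if: "(b \<Longrightarrow> smooth_on S f) \<Longrightarrow> (\<not> b \<Longrightarrow> smooth_on S g) \<Longrightarrow> smooth_on S (\<lambda>x. if b then f x else g x)"
  by (cases b) simp_all

section \<open>Directional derivatives in the plane\<close>

lemma fd_add:
  "f differentiable (at p) \<Longrightarrow> g differentiable (at p) \<Longrightarrow>
   frechet_derivative (\<lambda>x. f x + g x) (at p) v = frechet_derivative f (at p) v + frechet_derivative g (at p) v"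
  by (subst frechet_derivativeI[OF has_derivative_add[OF has_derivative_frechet has_derivative_frechet]]) auto

lemma fd_diff:
  "f differentiable (at p) \<Longrightarrow> g differentiable (at p) \<Longrightarrow>
   frechet_derivative (\<lambda>x. f x - g x) (at p) v = frechet_derivative f (at p) v - frechet_derivative g (at p) v"
  by (subst frechet_derivativeI[OF has_derivative_diff[OF has_derivative_frechet has_derivative_frechet]]) auto

lemma fd_bounded_linear:
  "bounded_linear L \<Longrightarrow> f differentiable (at p) \<Longrightarrow>
   frechet_derivative (\<lambda>x. L (f x)) (at p) v = L (frechet_derivative f (at p) v)"
  by (subst frechet_derivativeI[OF bounded_linear.has_derivative[OF _ has_derivative_frechet]]) auto

lemma fd_bilinear:
  "bounded_bilinear B \<Longrightarrow> f differentiable (at p) \<Longrightarrow> g differentiable (at p) \<Longrightarrow>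
   frechet_derivative (\<lambda>x. B (f x) (g x)) (at p) v =
     B (f p) (frechet_derivative g (at p) v) + B (frechet_derivative f (at p) v) (g p)"
  by (subst frechet_derivativeI[OF bounded_bilinear.FDERIV[OF _ has_derivative_frechet has_derivative_frechet]]) auto

lemmas fd_scaleR = fd_bilinear[OF bounded_bilinear_scaleR]

lemma fd_mult:
  fixes f g :: "'a::real_normed_vector \<Rightarrow> real"
  shows "f differentiable (at p) \<Longrightarrow> g differentiable (at p) \<Longrightarrow>
   frechet_derivative (\<lambda>x. f x * g x) (at p) v =
     f p * frechet_derivative g (at p) v + frechet_derivative f (at p) v * g p"
  by (rule fd_bilinear[OF bounded_bilinear_mult])

lemma fd_cmult:
  fixes f :: "'a::real_normed_vector \<Rightarrow> real"
  shows "f differentiable (at p) \<Longrightarrow>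
   frechet_derivative (\<lambda>x. c * f x) (at p) v = c * frechet_derivative f (at p) v"
  by (rule fd_bounded_linear[OF bounded_linear_mult_right])

lemma fd_exp:
  fixes f :: "'a::real_normed_vector \<Rightarrow> real"
  shows "f differentiable (at p) \<Longrightarrow>
   frechet_derivative (\<lambda>x. exp (f x)) (at p) v = exp (f p) * frechet_derivative f (at p) v"
  by (subst frechet_derivativeI[OF has_derivative_exp[OF has_derivative_frechet]]) auto

lemma fd_cong:
  assumes "f differentiable (at p)" "open S" "p \<in> S" "\<And>x. x \<in> S \<Longrightarrow> f x = g x"
  shows "frechet_derivative g (at p) v = frechet_derivative f (at p) v"
  using frechet_derivative_transform_within_open[OF assms] by simp

lemma fd_plane:
  fixes f :: "plane \<Rightarrow> 'b::real_normed_vector"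
  assumes "f differentiable (at p)"
  shows "frechet_derivative f (at p) (a, b) = a *\<^sub>R D_u f p + b *\<^sub>R D_v f p"
proof -
  have lin: "linear (frechet_derivative f (at p))" using assms by (rule linear_frechet_derivative)
  have "(a, b) = a *\<^sub>R (1, 0) + b *\<^sub>R (0, 1)" by simp
  then have "frechet_derivative f (at p) (a, b) = frechet_derivative f (at p) (a *\<^sub>R (1, 0) + b *\<^sub>R (0, 1))"
    by (rule arg_cong)
  also have "\<dots> = a *\<^sub>R D_u f p + b *\<^sub>R D_v f p"
    unfolding D_u_def D_v_def linear_add[OF lin] linear_cmul[OF lin] ..
  finally show ?thesis .
qed

lemma D_s_uv: "f differentiable (at p) \<Longrightarrow> D_s f p = (1 / sqrt 2) *\<^sub>R (D_u f p + D_v f p)"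
  unfolding D_s_def using fd_plane by (metis scaleR_add_right)

lemma D_t_uv: "f differentiable (at p) \<Longrightarrow> D_t f p = (1 / sqrt 2) *\<^sub>R (D_u f p - D_v f p)"
  unfolding D_t_def using fd_plane[of f p "1 / sqrt 2" "- 1 / sqrt 2"] by (simp add: algebra_simps)

lemma smooth_on_D:
  assumes "smooth_on S f"
  shows "smooth_on S (D_u f)" "smooth_on S (D_v f)" "smooth_on S (D_s f)" "smooth_on S (D_t f)"
  using smooth_on_frechet[OF assms] unfolding D_u_def[abs_def] D_v_def[abs_def] D_s_def[abs_def] D_t_def[abs_def]
  by auto

lemma D_uv_has_derivative:
  fixes f :: "plane \<Rightarrow> 'b::real_normed_vector"
  assumes "f differentiable (at p)"
  shows "(f has_derivative (\<lambda>z. fst z *\<^sub>R D_u f p + snd z *\<^sub>R D_v f p)) (at p)"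
  using has_derivative_frechet[OF assms] fd_plane[OF assms]
  by (metis (no_types, lifting) ext prod.collapse)

lemma D_uv_of_has_derivative:
  assumes "(f has_derivative (\<lambda>z. fst z *\<^sub>R a + snd z *\<^sub>R b)) (at p)"
  shows "D_u f p = a" "D_v f p = b"
  unfolding D_u_def D_v_def by (simp_all add: frechet_derivativeI[OF assms])

lemma smooth_on_planeI:
  fixes f :: "plane \<Rightarrow> 'b::real_normed_vector"
  assumes "open S" "\<And>p. p \<in> S \<Longrightarrow> (f has_derivative (\<lambda>z. fst z *\<^sub>R g p + snd z *\<^sub>R h p)) (at p)"
    "smooth_on S g" "smooth_on S h"
  shows "smooth_on S f"
  by (rule smooth_onI[OF assms(1,2)]) (auto intro!: smooth_intros assms)

section \<open>Symmetry of the mixed second derivatives\<close>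

lemma D_u_real_deriv:
  fixes f :: "plane \<Rightarrow> real"
  assumes "f differentiable (at (x, y))"
  shows "((\<lambda>x. f (x, y)) has_real_derivative D_u f (x, y)) (at x)"
    "((\<lambda>y. f (x, y)) has_real_derivative D_v f (x, y)) (at y)"
proof -
  have d1: "((\<lambda>x. (x, y)) has_derivative (\<lambda>t. (t, 0::real))) (at x)"
    and d2: "((\<lambda>y. (x, y)) has_derivative (\<lambda>t. (0::real, t))) (at y)"
    by (auto intro!: derivative_eq_intros)
  note d = D_uv_has_derivative[OF assms]
  show "((\<lambda>x. f (x, y)) has_real_derivative D_u f (x, y)) (at x)"
    using has_derivative_compose[OF d1 d]
    by (simp add: has_field_derivative_def mult.commute[of _ "D_u f (x, y)"])
  show "((\<lambda>y. f (x, y)) has_real_derivative D_v f (x, y)) (at y)"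
    using has_derivative_compose[OF d2 d]
    by (simp add: has_field_derivative_def mult.commute[of _ "D_v f (x, y)"])
qed

text \<open>The second difference of \<open>f\<close> over a small square with corner
  \<open>p\<close> is \<open>h^2\<close> times either mixed derivative at some point of the square:
  two mean value theorems, in both orders. If the values at \<open>p\<close> differed, continuity
  would keep these two numbers apart.\<close>

lemma mixed_partials_real:
  fixes f :: "plane \<Rightarrow> real"
  assumes S: "open S" "p \<in> S" and f: "smooth_on S f"
  shows "D_u (D_v f) p = D_v (D_u f) p"
proof (rule ccontr)
  assume ne: "D_u (D_v f) p \<noteq> D_v (D_u f) p"
  \<comment> \<open>Half the gap, so that the intervals of radius \<open>c\<close> about the two
    values are disjoint.\<close>
  define c where "c = \<bar>D_u (D_v f) p - D_v (D_u f) p\<bar> / 2"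
  have c: "c > 0" using ne by (simp add: c_def)
  have "continuous_on S (D_u (D_v f))" "continuous_on S (D_v (D_u f))"
    using f by (auto intro!: smooth_on_continuous smooth_on_D)
  then have "isCont (D_u (D_v f)) p" "isCont (D_v (D_u f)) p"
    using S continuous_on_eq_continuous_at by blast+
  then have "eventually (\<lambda>x. dist (D_u (D_v f) x) (D_u (D_v f) p) < c \<and>
      dist (D_v (D_u f) x) (D_v (D_u f) p) < c \<and> x \<in> S) (nhds p)"
    using c S by (auto intro!: eventually_conj eventually_nhds_in_open tendstoD
        simp: continuous_at tendsto_at_iff_tendsto_nhds)
  then obtain e where e: "e > 0" and ee: "\<And>x. dist x p < e \<Longrightarrow> dist (D_u (D_v f) x) (D_u (D_v f) p) < c \<and>
      dist (D_v (D_u f) x) (D_v (D_u f) p) < c \<and> x \<in> S"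
    by (auto simp: eventually_nhds_metric)
  obtain a b where p: "p = (a, b)" by (cases p)
  \<comment> \<open>Every point of the square of side \<open>h\<close> with lower left corner
    \<open>p\<close> is within \<open>2 * h < e\<close> of \<open>p\<close>.\<close>
  define h where "h = e / 4"
  have h: "h > 0" using e by (simp add: h_def)
  have box: "dist (x, y) p < e" if "x \<in> {a..a+h}" "y \<in> {b..b+h}" for x y
  proof -
    have "dist (x, y) p \<le> \<bar>x - a\<bar> + \<bar>y - b\<bar>"
      unfolding p dist_Pair_Pair dist_real_def using sqrt_sum_squares_le_sum_abs[of "x - a" "y - b"] by (simp add: power2_abs)
    also have "\<dots> < e" using that h e unfolding h_def by auto
    finally show ?thesis .
  qed
  have inS: "(x, y) \<in> S" if "x \<in> {a..a+h}" "y \<in> {b..b+h}" for x y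
    using box[OF that] ee by blast
  note df = smooth_on_differentiable[OF f inS]
  note du = smooth_on_differentiable[OF smooth_on_D(1)[OF f] inS]
  note dv = smooth_on_differentiable[OF smooth_on_D(2)[OF f] inS]
  let ?\<Delta> = "f (a+h, b+h) - f (a+h, b) - f (a, b+h) + f (a, b)"
  have "\<exists>z>a. z < a+h \<and> (f (a+h, b+h) - f (a+h, b)) - (f (a, b+h) - f (a, b)) = (a+h-a) * (D_u f (z, b+h) - D_u f (z, b))"
    by (rule MVT2) (use h in \<open>auto intro!: DERIV_diff D_u_real_deriv df\<close>)
  then obtain x1 where x1: "x1 > a" "x1 < a+h"
    "(f (a+h, b+h) - f (a+h, b)) - (f (a, b+h) - f (a, b)) = h * (D_u f (x1, b+h) - D_u f (x1, b))" by auto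
  have "\<exists>z>b. z < b+h \<and> D_u f (x1, b+h) - D_u f (x1, b) = (b+h-b) * (D_v (D_u f) (x1, z))"
    by (rule MVT2) (use h x1 in \<open>auto intro!: DERIV_diff D_u_real_deriv du\<close>)
  then obtain y1 where y1: "y1 > b" "y1 < b+h"
    "D_u f (x1, b+h) - D_u f (x1, b) = h * D_v (D_u f) (x1, y1)" by auto
  have "\<exists>z>b. z < b+h \<and> (f (a+h, b+h) - f (a, b+h)) - (f (a+h, b) - f (a, b)) = (b+h-b) * (D_v f (a+h, z) - D_v f (a, z))"
    by (rule MVT2) (use h in \<open>auto intro!: DERIV_diff D_u_real_deriv df\<close>)
  then obtain y2 where y2: "y2 > b" "y2 < b+h"
    "(f (a+h, b+h) - f (a, b+h)) - (f (a+h, b) - f (a, b)) = h * (D_v f (a+h, y2) - D_v f (a, y2))" by auto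
  have "\<exists>z>a. z < a+h \<and> D_v f (a+h, y2) - D_v f (a, y2) = (a+h-a) * (D_u (D_v f) (z, y2))"
    by (rule MVT2) (use h y2 in \<open>auto intro!: DERIV_diff D_u_real_deriv dv\<close>)
  then obtain x2 where x2: "x2 > a" "x2 < a+h"
    "D_v f (a+h, y2) - D_v f (a, y2) = h * D_u (D_v f) (x2, y2)" by auto
  have "h * (h * D_v (D_u f) (x1, y1)) = h * (h * D_u (D_v f) (x2, y2))"
    using x1(3) y1(3) y2(3) x2(3) by (simp add: algebra_simps)
  then have "D_v (D_u f) (x1, y1) = D_u (D_v f) (x2, y2)" using h by simp
  moreover have "dist (D_v (D_u f) (x1, y1)) (D_v (D_u f) p) < c"
    using ee box x1 y1 by (meson atLeastAtMost_iff less_imp_le)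
  moreover have "dist (D_u (D_v f) (x2, y2)) (D_u (D_v f) p) < c"
    using ee box x2 y2 by (meson atLeastAtMost_iff less_imp_le)
  ultimately have "dist (D_v (D_u f) (x1, y1)) (D_v (D_u f) p) + dist (D_v (D_u f) (x1, y1)) (D_u (D_v f) p) < 2 * c"
    by simp
  moreover have "2 * c = dist (D_u (D_v f) p) (D_v (D_u f) p)"
    by (simp add: c_def dist_real_def)
  ultimately show False
    by (metis dist_commute dist_triangle2 add.commute not_less)
qed

lemma mixed_partials:
  fixes f :: "plane \<Rightarrow> 'b::euclidean_space"
  assumes S: "open S" "p \<in> S" and f: "smooth_on S f"
  shows "D_u (D_v f) p = D_v (D_u f) p"
proof (rule euclidean_eqI)
  fix b :: 'b assume "b \<in> Basis"
  have lin: "bounded_linear (\<lambda>x::'b. x \<bullet> b)" by (rule bounded_linear_inner_left)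
  have s: "smooth_on S (\<lambda>x. f x \<bullet> b)" by (rule smooth_on_bounded_linear_compose[OF lin S(1) f])
  have 1: "D_u (\<lambda>x. g x \<bullet> b) q = D_u g q \<bullet> b" "D_v (\<lambda>x. g x \<bullet> b) q = D_v g q \<bullet> b"
    if "smooth_on S g" "q \<in> S" for g :: "plane \<Rightarrow> 'b" and q
    unfolding D_u_def D_v_def using fd_bounded_linear[OF lin smooth_on_differentiable[OF that]] by auto
  have "D_u (D_v (\<lambda>x. f x \<bullet> b)) p = D_u (\<lambda>x. D_v f x \<bullet> b) p"
    unfolding D_u_def[of "D_v (\<lambda>x. f x \<bullet> b)"] D_u_def[of "\<lambda>x. D_v f x \<bullet> b"]
    by (rule fd_cong[OF _ S]) (use S 1 f s in \<open>auto intro!: smooth_on_differentiable[OF _ S(2)]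
        smooth_on_bounded_linear_compose[OF lin] smooth_on_D\<close>)
  moreover have "D_v (D_u (\<lambda>x. f x \<bullet> b)) p = D_v (\<lambda>x. D_u f x \<bullet> b) p"
    unfolding D_v_def[of "D_u (\<lambda>x. f x \<bullet> b)"] D_v_def[of "\<lambda>x. D_u f x \<bullet> b"]
    by (rule fd_cong[OF _ S]) (use S 1 f s in \<open>auto intro!: smooth_on_differentiable[OF _ S(2)]
        smooth_on_bounded_linear_compose[OF lin] smooth_on_D\<close>)
  ultimately show "D_u (D_v f) p \<bullet> b = D_v (D_u f) p \<bullet> b"
    using mixed_partials_real[OF S s] 1[OF smooth_on_D(2)[OF f] S(2)] 1[OF smooth_on_D(1)[OF f] S(2)]
    by simp
qed

section \<open>Completely integrable linear systems in the plane\<close>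

text \<open>Moves the variable endpoint into the integrand: continuity of parameter integrals is
  available over a fixed interval.\<close>

lemma integral_rescale:
  fixes f :: "real \<Rightarrow> 'e::banach"
  assumes "a \<le> v" "continuous_on {a..v} f"
  shows "integral {a..v} f = (v - a) *\<^sub>R integral {0..1} (\<lambda>\<theta>. f ((v - a) * \<theta> + a))"
proof (cases "v = a")
  case False
  then have m: "v - a > 0" using assms by simp
  have "(f has_integral integral {a..v} f) (cbox a v)"
    using integrable_continuous_real[OF assms(2)] by auto
  from has_integral_affinity[OF this, of "v - a" a] m
  have "((\<lambda>x. f ((v - a) * x + a)) has_integral (1 / (v - a)) *\<^sub>R integral {a..v} f)
      ((\<lambda>x. (1 / (v - a)) * x + - ((1 / (v - a)) * a)) ` {a..v})"
    by simp
  moreover have "(\<lambda>x. (1 / (v - a)) * x + - ((1 / (v - a)) * a)) ` {a..v} = {0..1}"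
    using m diff_divide_distrib[of v a "v - a", symmetric]
    by (subst image_affinity_atLeastAtMost) auto
  ultimately have "integral {0..1} (\<lambda>x. f ((v - a) * x + a)) = (1 / (v - a)) *\<^sub>R integral {a..v} f"
    using integral_unique by metis
  then show ?thesis using m by simp
qed simp

lemma continuous_on_integral_snd:
  fixes c :: "plane \<Rightarrow> 'e::banach"
  assumes c: "continuous_on (cbox (a1, a2) (b1, b2)) c"
  shows "continuous_on (cbox (a1, a2) (b1, b2)) (\<lambda>p. integral {a2..snd p} (\<lambda>y. c (fst p, y)))"
proof -
  let ?B = "cbox (a1, a2) (b1, b2)"
  have eq: "integral {a2..snd p} (\<lambda>y. c (fst p, y)) =
      (snd p - a2) *\<^sub>R integral (cbox 0 1) (\<lambda>\<theta>. c (fst p, (snd p - a2) * \<theta> + a2))" if p: "p \<in> ?B" for p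
  proof -
    have "continuous_on {a2..snd p} (\<lambda>y. c (fst p, y))"
      by (rule continuous_on_compose2[OF c])
        (use p in \<open>auto intro!: continuous_intros simp: cbox_Pair_eq\<close>)
    then show ?thesis using integral_rescale[of a2 "snd p"] p by (auto simp: cbox_Pair_eq)
  qed
  have in_box: "(fst p, (snd p - a2) * \<theta> + a2) \<in> ?B" if "p \<in> ?B" "\<theta> \<in> {0..1}" for p and \<theta> :: real
  proof -
    have "0 \<le> (snd p - a2) * \<theta>" "(snd p - a2) * \<theta> \<le> (snd p - a2)"
      using that by (auto simp: cbox_Pair_eq mult_left_le)
    then show ?thesis using that by (auto simp: cbox_Pair_eq)
  qed
  have "continuous_on (?B \<times> cbox 0 1) (\<lambda>(p, \<theta>). c (fst p, (snd p - a2) * \<theta> + a2))"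
    unfolding case_prod_unfold
    by (rule continuous_on_compose2[OF c]) (use in_box in \<open>auto intro!: continuous_intros\<close>)
  then have "continuous_on ?B (\<lambda>p. (snd p - a2) *\<^sub>R integral (cbox 0 1) (\<lambda>\<theta>. c (fst p, (snd p - a2) * \<theta> + a2)))"
    by (intro continuous_intros integral_continuous_on_param)
  then show ?thesis using eq by (simp cong: continuous_on_cong_simp)
qed

lemma continuous_on_integral_fst:
  fixes c :: "plane \<Rightarrow> 'e::banach"
  assumes c: "continuous_on (cbox (a1, a2) (b1, b2)) c"
  shows "continuous_on (cbox (a1, a2) (b1, b2)) (\<lambda>p. integral {a1..fst p} (\<lambda>x. c (x, snd p)))"
proof -
  have sw: "continuous_on X (\<lambda>p::plane. (snd p, fst p))" for X by (intro continuous_intros)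
  have "continuous_on (cbox (a2, a1) (b2, b1)) (\<lambda>p. c (snd p, fst p))"
    by (rule continuous_on_compose2[OF c sw]) (auto simp: cbox_Pair_eq)
  from continuous_on_integral_snd[OF this]
  have "continuous_on (cbox (a2, a1) (b2, b1)) (\<lambda>p. integral {a1..snd p} (\<lambda>y. c (y, fst p)))" by simp
  from continuous_on_compose2[OF this sw, of "cbox (a1, a2) (b1, b2)"]
  have "(\<lambda>p. (snd p, fst p)) ` cbox (a1, a2) (b1, b2) \<subseteq> cbox (a2, a1) (b2, b1) \<Longrightarrow> ?thesis" by simp
  then show ?thesis by (simp add: cbox_Pair_eq image_subset_iff)
qed

text \<open>The derivative in \<open>u\<close> is the fundamental theorem for the outer integral;
  for the one in \<open>v\<close> the order of integration is exchanged first. Derivatives within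
  closed intervals include the edges of the square, where initial values are prescribed.\<close>

lemma goursat_integral:
  fixes c :: "plane \<Rightarrow> 'e::banach"
  assumes c: "continuous_on (cbox (a1, a2) (b1, b2)) c"
  defines "I \<equiv> \<lambda>p. integral {a1..fst p} (\<lambda>x. integral {a2..snd p} (\<lambda>y. c (x, y)))"
  shows "continuous_on (cbox (a1, a2) (b1, b2)) I"
    and "\<lbrakk>u \<in> {a1..b1}; v \<in> {a2..b2}\<rbrakk> \<Longrightarrow>
      ((\<lambda>u. I (u, v)) has_vector_derivative integral {a2..v} (\<lambda>y. c (u, y))) (at u within {a1..b1})"
    and "\<lbrakk>u \<in> {a1..b1}; v \<in> {a2..b2}\<rbrakk> \<Longrightarrow>
      ((\<lambda>v. I (u, v)) has_vector_derivative integral {a1..u} (\<lambda>x. c (x, v))) (at v within {a2..b2})"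
proof -
  let ?B = "cbox (a1, a2) (b1, b2)"
  let ?K = "\<lambda>p. integral {a2..snd p} (\<lambda>y. c (fst p, y))"
  have K: "continuous_on ?B ?K" by (rule continuous_on_integral_snd[OF c])
  show "continuous_on ?B I" unfolding I_def using continuous_on_integral_fst[OF K] by simp
  {
    assume uv: "u \<in> {a1..b1}" "v \<in> {a2..b2}"
    have "continuous_on {a1..b1} (\<lambda>x. ?K (x, v))"
      by (rule continuous_on_compose2[OF K]) (use uv in \<open>auto intro!: continuous_intros simp: cbox_Pair_eq\<close>)
    from integral_has_vector_derivative[OF this uv(1)]
    show "((\<lambda>u. I (u, v)) has_vector_derivative integral {a2..v} (\<lambda>y. c (u, y))) (at u within {a1..b1})"
      unfolding I_def by simp
  }
  {
    assume uv: "u \<in> {a1..b1}" "v \<in> {a2..b2}"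
    let ?L = "\<lambda>p. integral {a1..fst p} (\<lambda>x. c (x, snd p))"
    have L: "continuous_on ?B ?L" by (rule continuous_on_integral_fst[OF c])
    have "continuous_on {a2..b2} (\<lambda>y. ?L (u, y))"
      by (rule continuous_on_compose2[OF L]) (use uv in \<open>auto intro!: continuous_intros simp: cbox_Pair_eq\<close>)
    from integral_has_vector_derivative[OF this uv(2)]
    have d: "((\<lambda>v. integral {a2..v} (\<lambda>y. integral {a1..u} (\<lambda>x. c (x, y)))) has_vector_derivative
        integral {a1..u} (\<lambda>x. c (x, v))) (at v within {a2..b2})" by simp
    have eq: "I (u, w) = integral {a2..w} (\<lambda>y. integral {a1..u} (\<lambda>x. c (x, y)))" if "w \<in> {a2..b2}" for w
    proof -
      have "continuous_on (cbox (a1, a2) (u, w)) c"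
        by (rule continuous_on_subset[OF c]) (use uv that in \<open>auto simp: cbox_Pair_eq\<close>)
      then have "continuous_on (cbox (a1, a2) (u, w)) (\<lambda>(x, y). c (x, y))" by simp
      from integral_swap_continuous[OF this] show ?thesis unfolding I_def by simp
    qed
    show "((\<lambda>v. I (u, v)) has_vector_derivative integral {a1..u} (\<lambda>x. c (x, v))) (at v within {a2..b2})"
      by (rule has_vector_derivative_transform[OF uv(2) _ d]) (use eq in auto)
  }
qed

text \<open>Turns partial derivatives obtained from integrals on a closed rectangle, one-sided at
  the edges, into a full derivative at interior points.\<close>

lemma has_derivative_continuous_partials:
  fixes f g h :: "plane \<Rightarrow> 'e::real_normed_vector"
  assumes p: "p \<in> box (a1, a2) (b1, b2)"
    and u: "\<And>u v. \<lbrakk>u \<in> {a1..b1}; v \<in> {a2..b2}\<rbrakk> \<Longrightarrow>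
      ((\<lambda>u. f (u, v)) has_vector_derivative g (u, v)) (at u within {a1..b1})"
    and v: "\<And>u v. \<lbrakk>u \<in> {a1..b1}; v \<in> {a2..b2}\<rbrakk> \<Longrightarrow>
      ((\<lambda>v. f (u, v)) has_vector_derivative h (u, v)) (at v within {a2..b2})"
    and h: "continuous_on (cbox (a1, a2) (b1, b2)) h"
  shows "(f has_derivative (\<lambda>z. fst z *\<^sub>R g p + snd z *\<^sub>R h p)) (at p)"
proof -
  obtain x y where pxy: "p = (x, y)" by (cases p)
  have xy: "x \<in> {a1..b1}" "y \<in> {a2..b2}" using p by (auto simp: pxy mem_box Basis_prod_def)
  have cb: "cbox (a1, a2) (b1, b2) = {a1..b1} \<times> {a2..b2}" by (auto simp: cbox_Pair_eq)
  let ?H = "\<lambda>u v. blinfun_scaleR_left (h (u, v))"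
  have "((\<lambda>(u, v). f (u, v)) has_derivative (\<lambda>(tx, ty). tx *\<^sub>R g p + blinfun_apply (?H x y) ty))
      (at (x, y) within {a1..b1} \<times> {a2..b2})"
  proof (rule has_derivative_partialsI[where fy="?H"])
    show "((\<lambda>u. f (u, y)) has_derivative (\<lambda>tx. tx *\<^sub>R g p)) (at x within {a1..b1})"
      using u[OF xy] by (simp add: has_vector_derivative_def pxy)
    show "((\<lambda>v. f (u, v)) has_derivative blinfun_apply (?H u v)) (at v within {a2..b2})"
      if "u \<in> {a1..b1}" "v \<in> {a2..b2}" for u v
      using v[OF that] by (simp add: has_vector_derivative_def)
    have "continuous (at (x, y) within {a1..b1} \<times> {a2..b2}) h"
      using h xy unfolding cb by (auto simp: continuous_on_eq_continuous_within)
    then have "continuous (at (x, y) within {a1..b1} \<times> {a2..b2}) (\<lambda>p. blinfun_scaleR_left (h p))"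
      by (rule bounded_linear.continuous[OF bounded_linear_blinfun_scaleR_left])
    then show "continuous (at (x, y) within {a1..b1} \<times> {a2..b2}) (\<lambda>(u, v). ?H u v)"
      by (simp add: case_prod_unfold)
  qed (use xy in auto)
  then have "(f has_derivative (\<lambda>z. fst z *\<^sub>R g p + snd z *\<^sub>R h p)) (at p within cbox (a1, a2) (b1, b2))"
    by (simp add: cb pxy case_prod_unfold)
  moreover have "at p within cbox (a1, a2) (b1, b2) = at p"
    by (rule at_within_interior) (use p in \<open>simp add: interior_cbox\<close>)
  ultimately show ?thesis by simp
qed

text \<open>The unknown is prescribed at the lower left corner of the square, so that all integrals
  run upwards and need no orientation.\<close>

lemma goursat_fixpoint:
  fixes R1 R2 R3 :: "plane \<Rightarrow> 'e \<Rightarrow> 'e::euclidean_space"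
  assumes \<delta>: "0 < \<delta>" "\<delta> \<le> 1" "3 * K * \<delta> < 1" and K: "0 \<le> K"
    and cont: "\<And>R \<Phi>. \<lbrakk>R \<in> {R1, R2, R3}; continuous_on (cbox (a1, a2) (a1 + \<delta>, a2 + \<delta>)) \<Phi>\<rbrakk> \<Longrightarrow>
      continuous_on (cbox (a1, a2) (a1 + \<delta>, a2 + \<delta>)) (\<lambda>p. R p (\<Phi> p))"
    and lip: "\<And>R p x y. \<lbrakk>R \<in> {R1, R2, R3}; p \<in> cbox (a1, a2) (a1 + \<delta>, a2 + \<delta>)\<rbrakk> \<Longrightarrow>
      norm (R p x - R p y) \<le> K * norm (x - y)"
  obtains \<Phi> where "continuous_on (cbox (a1, a2) (a1 + \<delta>, a2 + \<delta>)) \<Phi>"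
    and "\<And>p. p \<in> cbox (a1, a2) (a1 + \<delta>, a2 + \<delta>) \<Longrightarrow> \<Phi> p = e0
      + integral {a1..fst p} (\<lambda>x. R1 (x, a2) (\<Phi> (x, a2)))
      + integral {a2..snd p} (\<lambda>y. R2 (a1, y) (\<Phi> (a1, y)))
      + integral {a1..fst p} (\<lambda>x. integral {a2..snd p} (\<lambda>y. R3 (x, y) (\<Phi> (x, y))))"
proof -
  define a b where "a = (a1, a2)" and "b = (a1 + \<delta>, a2 + \<delta>)"
  let ?B = "cbox a b"
  have B: "?B = {a1..a1+\<delta>} \<times> {a2..a2+\<delta>}" by (auto simp: a_def b_def cbox_Pair_eq)
  note ab = a_def[symmetric] b_def[symmetric]
  note cont = cont[unfolded ab] and lip = lip[unfolded ab]
  define N where "N = (\<lambda>\<Phi> p. e0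
      + integral {a1..fst p} (\<lambda>x. R1 (x, a2) (\<Phi> (x, a2)))
      + integral {a2..snd p} (\<lambda>y. R2 (a1, y) (\<Phi> (a1, y)))
      + integral {a1..fst p} (\<lambda>x. integral {a2..snd p} (\<lambda>y. R3 (x, y) (\<Phi> (x, y)))))"
  have cR: "continuous_on ?B (\<lambda>p. R p (\<Phi> p))" if "continuous_on ?B \<Phi>" "R \<in> {R1, R2, R3}" for R \<Phi>
    using cont that by blast
  have c1: "continuous_on {a1..u} (\<lambda>x. R (x, v) (\<Phi> (x, v)))" if "continuous_on ?B \<Phi>" "R \<in> {R1, R2, R3}"
    "u \<in> {a1..a1+\<delta>}" "v \<in> {a2..a2+\<delta>}" for R \<Phi> u v
    using that by (intro continuous_on_compose2[OF cR[OF that(1,2)]]) (auto intro!: continuous_intros simp: B)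
  have c2: "continuous_on {a2..v} (\<lambda>y. R (u, y) (\<Phi> (u, y)))" if "continuous_on ?B \<Phi>" "R \<in> {R1, R2, R3}"
    "u \<in> {a1..a1+\<delta>}" "v \<in> {a2..a2+\<delta>}" for R \<Phi> u v
    using that by (intro continuous_on_compose2[OF cR[OF that(1,2)]]) (auto intro!: continuous_intros simp: B)
  have c3: "continuous_on {a1..u} (\<lambda>x. integral {a2..v} (\<lambda>y. R (x, y) (\<Phi> (x, y))))"
    if "continuous_on ?B \<Phi>" "R \<in> {R1, R2, R3}" "u \<in> {a1..a1+\<delta>}" "v \<in> {a2..a2+\<delta>}" for R \<Phi> u v
  proof -
    note c = continuous_on_integral_snd[OF cR[OF that(1,2), unfolded a_def b_def]]
    have "continuous_on {a1..u} (\<lambda>x. integral {a2..snd (x, v)} (\<lambda>y. R (fst (x, v), y) (\<Phi> (fst (x, v), y))))"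
      by (rule continuous_on_compose2[OF c, of _ "\<lambda>x. (x, v)"])
        (use that(3,4) in \<open>auto intro!: continuous_intros simp: cbox_Pair_eq\<close>)
    then show ?thesis by simp
  qed
  have N_cont: "continuous_on ?B (N \<Phi>)" if \<Phi>: "continuous_on ?B \<Phi>" for \<Phi>
  proof -
    have 1: "continuous_on ?B (\<lambda>p. integral {a1..fst p} (\<lambda>x. R1 (x, a2) (\<Phi> (x, a2))))"
    proof -
      have "continuous_on {a1..a1+\<delta>} (\<lambda>u. integral {a1..u} (\<lambda>x. R1 (x, a2) (\<Phi> (x, a2))))"
        by (rule indefinite_integral_continuous_1[OF integrable_continuous_real])
          (use c1[OF \<Phi>] \<delta> in auto)
      then show ?thesis
        by (rule continuous_on_compose2[where f=fst]) (auto intro!: continuous_intros simp: B)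
    qed
    have 2: "continuous_on ?B (\<lambda>p. integral {a2..snd p} (\<lambda>y. R2 (a1, y) (\<Phi> (a1, y))))"
    proof -
      have "continuous_on {a2..a2+\<delta>} (\<lambda>u. integral {a2..u} (\<lambda>y. R2 (a1, y) (\<Phi> (a1, y))))"
        by (rule indefinite_integral_continuous_1[OF integrable_continuous_real])
          (use c2[OF \<Phi>] \<delta> in auto)
      then show ?thesis
        by (rule continuous_on_compose2[where f=snd]) (auto intro!: continuous_intros simp: B)
    qed
    have 3: "continuous_on ?B (\<lambda>p. integral {a1..fst p} (\<lambda>x. integral {a2..snd p} (\<lambda>y. R3 (x, y) (\<Phi> (x, y)))))"
      using goursat_integral(1)[OF cR[OF \<Phi>, unfolded a_def b_def], of R3] by (simp add: ab)
    show ?thesis unfolding N_def by (intro continuous_intros 1 2 3)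
  qed
  \<comment> \<open>Each of the three integrals changes by at most \<open>K * m * \<delta>\<close>.
    In the double integral the inner length is estimated by 1, which is where
    \<open>\<delta> \<le> 1\<close> enters.\<close>
  have N_lip: "norm (N \<Phi> p - N \<Psi> p) \<le> (3 * K * \<delta>) * m"
    if \<Phi>: "continuous_on ?B \<Phi>" and \<Psi>: "continuous_on ?B \<Psi>" and p: "p \<in> ?B"
      and m: "\<And>q. q \<in> ?B \<Longrightarrow> norm (\<Phi> q - \<Psi> q) \<le> m" for \<Phi> \<Psi> p m
  proof -
    obtain u v where uv: "p = (u, v)" "u \<in> {a1..a1+\<delta>}" "v \<in> {a2..a2+\<delta>}" using p B by (cases p) auto
    have a_in: "a1 \<in> {a1..a1+\<delta>}" "a2 \<in> {a2..a2+\<delta>}" using \<delta> by auto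
    have m0: "0 \<le> m" using m[OF p] norm_ge_zero order_trans by blast
    have pt: "norm (R q (\<Phi> q) - R q (\<Psi> q)) \<le> K * m" if "R \<in> {R1, R2, R3}" "q \<in> ?B" for R q
      using lip[OF that] m[OF that(2)] K by (meson mult_left_mono order_trans)
    have len: "K * m * (u - a1) \<le> K * m * \<delta>" "K * m * (v - a2) \<le> K * m * \<delta>"
      using uv K m0 by (auto intro!: mult_left_mono)
    have 1: "norm (integral {a1..u} (\<lambda>x. R1 (x, a2) (\<Phi> (x, a2))) - integral {a1..u} (\<lambda>x. R1 (x, a2) (\<Psi> (x, a2))))
        \<le> K * m * \<delta>"
    proof (subst integral_diff[symmetric])
      show "norm (integral {a1..u} (\<lambda>x. R1 (x, a2) (\<Phi> (x, a2)) - R1 (x, a2) (\<Psi> (x, a2)))) \<le> K * m * \<delta>"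
        by (rule order_trans[OF integral_bound len(1)])
          (use uv a_in in \<open>auto intro!: continuous_on_diff c1[OF \<Phi>, where R=R1] c1[OF \<Psi>, where R=R1] pt simp: B\<close>)
    qed (use c1[OF \<Phi>, where R=R1] c1[OF \<Psi>, where R=R1] uv a_in in \<open>auto intro!: integrable_continuous_real\<close>)
    have 2: "norm (integral {a2..v} (\<lambda>y. R2 (a1, y) (\<Phi> (a1, y))) - integral {a2..v} (\<lambda>y. R2 (a1, y) (\<Psi> (a1, y))))
        \<le> K * m * \<delta>"
    proof (subst integral_diff[symmetric])
      show "norm (integral {a2..v} (\<lambda>y. R2 (a1, y) (\<Phi> (a1, y)) - R2 (a1, y) (\<Psi> (a1, y)))) \<le> K * m * \<delta>"
        by (rule order_trans[OF integral_bound len(2)])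
          (use uv a_in in \<open>auto intro!: continuous_on_diff c2[OF \<Phi>, where R=R2] c2[OF \<Psi>, where R=R2] pt simp: B\<close>)
    qed (use c2[OF \<Phi>, where R=R2] c2[OF \<Psi>, where R=R2] uv a_in in \<open>auto intro!: integrable_continuous_real\<close>)
    have inner: "norm (integral {a2..v} (\<lambda>y. R3 (x, y) (\<Phi> (x, y))) - integral {a2..v} (\<lambda>y. R3 (x, y) (\<Psi> (x, y))))
        \<le> K * m" if x: "x \<in> {a1..u}" for x
    proof (subst integral_diff[symmetric])
      have "norm (integral {a2..v} (\<lambda>y. R3 (x, y) (\<Phi> (x, y)) - R3 (x, y) (\<Psi> (x, y)))) \<le> K * m * (v - a2)"
        by (rule integral_bound)
          (use uv a_in x in \<open>auto intro!: continuous_on_diff c2[OF \<Phi>, where R=R3] c2[OF \<Psi>, where R=R3] pt simp: B\<close>)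
      also have "\<dots> \<le> K * m" using uv \<delta> K m0 by (auto intro!: mult_left_le)
      finally show "norm (integral {a2..v} (\<lambda>y. R3 (x, y) (\<Phi> (x, y)) - R3 (x, y) (\<Psi> (x, y)))) \<le> K * m" .
    qed (use c2[OF \<Phi>, where R=R3] c2[OF \<Psi>, where R=R3] uv a_in x in \<open>auto intro!: integrable_continuous_real\<close>)
    have 3: "norm (integral {a1..u} (\<lambda>x. integral {a2..v} (\<lambda>y. R3 (x, y) (\<Phi> (x, y))))
        - integral {a1..u} (\<lambda>x. integral {a2..v} (\<lambda>y. R3 (x, y) (\<Psi> (x, y))))) \<le> K * m * \<delta>"
    proof (subst integral_diff[symmetric])
      show "norm (integral {a1..u} (\<lambda>x. integral {a2..v} (\<lambda>y. R3 (x, y) (\<Phi> (x, y)))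
          - integral {a2..v} (\<lambda>y. R3 (x, y) (\<Psi> (x, y))))) \<le> K * m * \<delta>"
        by (rule order_trans[OF integral_bound len(1)])
          (use uv a_in in \<open>auto intro!: continuous_on_diff c3[OF \<Phi>, where R=R3] c3[OF \<Psi>, where R=R3] inner\<close>)
    qed (use c3[OF \<Phi>, where R=R3] c3[OF \<Psi>, where R=R3] uv a_in in \<open>auto intro!: integrable_continuous_real\<close>)
    have tri: "norm ((e0 + x1 + x2 + x3) - (e0 + y1 + y2 + y3)) \<le> norm (x1 - y1) + norm (x2 - y2) + norm (x3 - y3)"
      for x1 x2 x3 y1 y2 y3 :: 'e
    proof -
      have eq: "(e0 + x1 + x2 + x3) - (e0 + y1 + y2 + y3) = (x1 - y1) + (x2 - y2) + (x3 - y3)" by simp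
      show ?thesis unfolding eq using norm_triangle_ineq[of "x1 - y1 + (x2 - y2)" "x3 - y3"]
        norm_triangle_ineq[of "x1 - y1" "x2 - y2"] by linarith
    qed
    show ?thesis unfolding N_def uv(1) fst_conv snd_conv
      by (rule order_trans[OF tri]) (use 1 2 3 in \<open>simp add: algebra_simps\<close>)
  qed
  \<comment> \<open>The fixed point theorem is applied in the complete type of bounded continuous
    functions on the whole plane. Composition with \<open>clamp\<close> extends a function from the
    square to the plane, and its values outside the square are values taken on it.\<close>
  define G where "G = (\<lambda>\<Phi> :: plane \<Rightarrow>\<^sub>C 'e. Bcontfun (\<lambda>p. N (apply_bcontfun \<Phi>) (clamp a b p)))"
  have G: "apply_bcontfun (G \<Phi>) = (\<lambda>p. N (apply_bcontfun \<Phi>) (clamp a b p))" for \<Phi>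
  proof -
    have c: "continuous_on ?B (N (apply_bcontfun \<Phi>))" by (intro N_cont) simp
    have "bounded (N (apply_bcontfun \<Phi>) ` ?B)"
      by (rule compact_imp_bounded[OF compact_continuous_image[OF c compact_cbox]])
    then show ?thesis unfolding G_def
      by (intro Bcontfun_inverse) (auto simp: bcontfun_def intro: clamp_continuous_on[OF c] clamp_bounded)
  qed
  have ne: "clamp a b p \<in> ?B" for p
    by (rule clamp_in_interval) (use \<delta> in \<open>auto simp: a_def b_def Basis_prod_def\<close>)
  have "dist (G \<Phi>) (G \<Psi>) \<le> 3 * K * \<delta> * dist \<Phi> \<Psi>" for \<Phi> \<Psi>
  proof (rule dist_bound)
    fix p
    have "norm (N \<Phi> (clamp a b p) - N \<Psi> (clamp a b p)) \<le> 3 * K * \<delta> * dist \<Phi> \<Psi>"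
      by (rule N_lip) (use ne dist_bounded[of \<Phi> _ \<Psi>] in \<open>auto simp: dist_norm[where 'a='e]\<close>)
    then show "dist (G \<Phi> p) (G \<Psi> p) \<le> 3 * K * \<delta> * dist \<Phi> \<Psi>"
      by (simp add: G dist_norm[where 'a='e])
  qed
  then have "\<exists>!\<Phi>. G \<Phi> = \<Phi>"
    using \<delta> K by (intro banach_fix_type[of "3 * K * \<delta>"]) auto
  then obtain \<Phi> where \<Phi>: "G \<Phi> = \<Phi>" by blast
  have fix_eq: "apply_bcontfun \<Phi> p = N (apply_bcontfun \<Phi>) p" if "p \<in> ?B" for p
  proof -
    have "clamp a b p = p" using that by simp
    then show ?thesis using G[of \<Phi>] unfolding \<Phi> by (metis)
  qed
  show thesis
  proof (rule that[of "apply_bcontfun \<Phi>"])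
    show "continuous_on (cbox (a1, a2) (a1 + \<delta>, a2 + \<delta>)) (apply_bcontfun \<Phi>)" by simp
  qed (use fix_eq in \<open>simp add: ab N_def\<close>)
qed

section \<open>The Frobenius theorem for linear systems in the plane\<close>

lemma has_vector_derivative_D_uv:
  fixes f :: "plane \<Rightarrow> 'e::real_normed_vector"
  assumes "f differentiable (at (x, y))"
  shows "((\<lambda>x. f (x, y)) has_vector_derivative D_u f (x, y)) (at x within T)"
    "((\<lambda>y. f (x, y)) has_vector_derivative D_v f (x, y)) (at y within T)"
proof -
  have d1: "((\<lambda>x. (x, y)) has_derivative (\<lambda>t. (t, 0::real))) (at x)"
    and d2: "((\<lambda>y. (x, y)) has_derivative (\<lambda>t. (0::real, t))) (at y)"
    by (intro has_derivative_Pair has_derivative_ident has_derivative_const)+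
  note d = D_uv_has_derivative[OF assms]
  show "((\<lambda>x. f (x, y)) has_vector_derivative D_u f (x, y)) (at x within T)"
    using has_derivative_compose[OF d1 d]
    by (auto intro: has_derivative_at_withinI simp: has_vector_derivative_def)
  show "((\<lambda>y. f (x, y)) has_vector_derivative D_v f (x, y)) (at y within T)"
    using has_derivative_compose[OF d2 d]
    by (auto intro: has_derivative_at_withinI simp: has_vector_derivative_def)
qed

lemma norm_le_of_vector_derivative:
  fixes f f' :: "real \<Rightarrow> 'e::banach"
  assumes "\<And>x. x \<in> {a..b} \<Longrightarrow> (f has_vector_derivative f' x) (at x within {a..b})"
    and "\<And>x. x \<in> {a..b} \<Longrightarrow> norm (f' x) \<le> M" "f a = 0" "0 \<le> M" "x \<in> {a..b}"
  shows "norm (f x) \<le> M * (b - a)"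
proof -
  have "(f' has_integral (f x - f a)) {a..x}"
  proof (rule fundamental_theorem_of_calculus)
    show "a \<le> x" using assms(5) by simp
    show "(f has_vector_derivative f' y) (at y within {a..x})" if "y \<in> {a..x}" for y
      by (rule has_vector_derivative_within_subset[OF assms(1)]) (use that assms(5) in auto)
  qed
  from has_integral_bound_real[OF assms(4) finite.emptyI this] have "norm (f x) \<le> M * (x - a)"
    using assms by auto
  also have "\<dots> \<le> M * (b - a)" using assms(4,5) by (auto intro: mult_left_mono)
  finally show ?thesis .
qed

text \<open>If a solution exists, its mixed derivative is \<open>R \<Phi>\<close> with \<open>R = A\<^sub>v + A B\<close>, which is
  a Goursat problem. Conversely the defects \<open>W = \<Phi>\<^sub>u - A \<Phi>\<close> and \<open>V = \<Phi>\<^sub>v - B \<Phi>\<close>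
  of its solution satisfy \<open>W\<^sub>v = - A V\<close> and \<open>V\<^sub>u = - B W\<close>, and vanish on the two sides
  through the corner.\<close>

lemma frobenius_linear:
  fixes prod :: "'a::euclidean_space \<Rightarrow> 'e::euclidean_space \<Rightarrow> 'e" and A B :: "plane \<Rightarrow> 'a"
  assumes bil: "bounded_bilinear prod" and S: "open S" "p \<in> S"
    and A: "smooth_on S A" and B: "smooth_on S B"
    and compat: "\<And>q e. q \<in> S \<Longrightarrow> prod (D_v A q) e + prod (A q) (prod (B q) e) =
      prod (D_u B q) e + prod (B q) (prod (A q) e)"
  obtains a b \<Phi> where "p \<in> box a b" "cbox a b \<subseteq> S" "continuous_on (cbox a b) \<Phi>" "\<Phi> a = e0"
    "\<And>q. q \<in> box a b \<Longrightarrow>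
      (\<Phi> has_derivative (\<lambda>z. fst z *\<^sub>R prod (A q) (\<Phi> q) + snd z *\<^sub>R prod (B q) (\<Phi> q))) (at q)"
proof -
  interpret bounded_bilinear prod by (rule bil)
  obtain x y where pxy: "p = (x, y)" by (cases p)
  obtain e where e: "e > 0" "ball p e \<subseteq> S" using S by (meson openE)
  define r where "r = e / 3"
  let ?C = "cbox (x - r, y - r) (x + r, y + r)"
  have r: "r > 0" using e by (simp add: r_def)
  have CS: "?C \<subseteq> S"
  proof
    fix q assume q: "q \<in> ?C"
    obtain u v where uv: "q = (u, v)" by (cases q)
    have "dist p q \<le> \<bar>x - u\<bar> + \<bar>y - v\<bar>"
      using sqrt_sum_squares_le_sum_abs[of "x - u" "y - v"]
      by (simp add: pxy uv dist_Pair_Pair dist_real_def)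
    also have "\<dots> < e" using q r by (auto simp: uv cbox_Pair_eq r_def)
    finally show "q \<in> S" using e by auto
  qed
  have "\<exists>m\<ge>0. \<forall>q\<in>?C. norm (f q) \<le> m" if "smooth_on S f" for f :: "plane \<Rightarrow> 'a"
  proof -
    have "bounded (f ` ?C)"
      by (intro compact_imp_bounded compact_continuous_image compact_cbox
          continuous_on_subset[OF smooth_on_continuous[OF that] CS])
    then show ?thesis unfolding bounded_iff by (metis abs_ge_zero abs_ge_self image_eqI order_trans)
  qed
  then obtain m1 m2 m3 where m: "m1 \<ge> 0" "m2 \<ge> 0" "m3 \<ge> 0"
    "\<And>q. q \<in> ?C \<Longrightarrow> norm (A q) \<le> m1" "\<And>q. q \<in> ?C \<Longrightarrow> norm (B q) \<le> m2"
    "\<And>q. q \<in> ?C \<Longrightarrow> norm (D_v A q) \<le> m3"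
    using A B smooth_on_D(2)[OF A] by metis
  obtain kp where kp: "kp \<ge> 0" "\<And>a e. norm (prod a e) \<le> norm a * norm e * kp"
    using nonneg_bounded by blast
  define k where "k = (m1 + m2 + m3) * kp"
  have k: "k \<ge> 0" using m kp by (simp add: k_def)
  have nb: "norm (prod a e) \<le> k * norm e" if "norm a \<le> m1 \<or> norm a \<le> m2 \<or> norm a \<le> m3" for a e
  proof -
    have "norm a * (norm e * kp) \<le> (m1 + m2 + m3) * (norm e * kp)"
      by (rule mult_right_mono) (use that m kp in auto)
    then show ?thesis using kp(2)[of a e] unfolding k_def by (simp add: algebra_simps)
  qed
  \<comment> \<open>A common Lipschitz constant: \<open>k\<close> bounds multiplication by
    \<open>A\<close>, \<open>B\<close> and \<open>A_v\<close>, and the product of \<open>A\<close>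
    and \<open>B\<close> in \<open>R\<close> contributes \<open>k * k\<close>.\<close>
  define K where "K = k + k * k"
  have K: "K \<ge> 0" "k \<le> K" using k by (auto simp: K_def)
  \<comment> \<open>The bound \<open>r\<close> keeps the square inside \<open>?C\<close>, where the
    constants are valid; the last bound gives \<open>3 * K * \<delta> < 1\<close>, its summand 1
    covering the case \<open>K = 0\<close>.\<close>
  define \<delta> where "\<delta> = min r (min 1 (1 / (3 * K + 1)))"
  have \<delta>: "0 < \<delta>" "\<delta> \<le> r" "\<delta> \<le> 1" "\<delta> \<le> 1 / (3 * K + 1)"
  proof -
    have "0 < 1 / (3 * K + 1)" using K by simp
    then show "0 < \<delta>" "\<delta> \<le> r" "\<delta> \<le> 1" "\<delta> \<le> 1 / (3 * K + 1)"
      unfolding \<delta>_def using r by linarith+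
  qed
  have "3 * K * \<delta> \<le> 3 * K * (1 / (3 * K + 1))" using \<delta>(4) K by (intro mult_left_mono) auto
  also have "\<dots> < 1" using K by (simp add: field_simps)
  finally have \<delta>K: "3 * K * \<delta> < 1" .
  have "k * \<delta> \<le> K * \<delta>" "0 \<le> K * \<delta>" using K \<delta> by (auto intro: mult_right_mono)
  then have k\<delta>: "k * \<delta> < 1" using \<delta>K by linarith
  \<comment> \<open>The data are prescribed at the corner, but \<open>p\<close> has to be an
    interior point, so it is made the centre.\<close>
  define a1 a2 where "a1 = x - \<delta> / 2" and "a2 = y - \<delta> / 2"
  let ?B = "cbox (a1, a2) (a1 + \<delta>, a2 + \<delta>)"
  have Bsq: "?B = {a1..a1+\<delta>} \<times> {a2..a2+\<delta>}" by (auto simp: cbox_Pair_eq)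
  have BC: "?B \<subseteq> ?C" using \<delta> by (auto simp: cbox_Pair_eq a1_def a2_def)
  then have BS: "?B \<subseteq> S" using CS by blast
  have cA: "continuous_on ?B A" and cB: "continuous_on ?B B" and cAv: "continuous_on ?B (D_v A)"
    using A B smooth_on_D(2)[OF A] smooth_on_continuous continuous_on_subset BS by blast+
  define R where "R = (\<lambda>q e. prod (D_v A q) e + prod (A q) (prod (B q) e))"
  have R_diff: "R q e - R q e' = R q (e - e')" for q e e'
    by (simp add: R_def diff_right)
  have R_norm: "norm (R q e) \<le> K * norm e" if "q \<in> ?C" for q e
  proof -
    have "norm (prod (A q) (prod (B q) e)) \<le> k * norm (prod (B q) e)" using nb m that by blast
    also have "\<dots> \<le> k * (k * norm e)" using nb m that k by (intro mult_left_mono) auto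
    finally have "norm (prod (A q) (prod (B q) e)) \<le> k * (k * norm e)" .
    moreover have "norm (prod (D_v A q) e) \<le> k * norm e" using nb m that by blast
    ultimately show ?thesis unfolding R_def K_def
      using norm_triangle_ineq[of "prod (D_v A q) e" "prod (A q) (prod (B q) e)"]
      by (simp add: algebra_simps)
  qed
  have cR: "continuous_on ?B (\<lambda>q. R q (\<Phi> q))" if "continuous_on ?B \<Phi>" for \<Phi>
    unfolding R_def by (intro continuous_on_add continuous_on cA cB cAv that)
  have kK: "norm (prod a e) \<le> K * norm e" if "norm a \<le> m1 \<or> norm a \<le> m2 \<or> norm a \<le> m3" for a e
    using nb[OF that, of e] mult_right_mono[OF K(2), of "norm e"] by simp
  obtain \<Phi> where \<Phi>: "continuous_on ?B \<Phi>" and \<Phi>_eq: "\<And>q. q \<in> ?B \<Longrightarrow> \<Phi> q = e0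
      + integral {a1..fst q} (\<lambda>x. prod (A (x, a2)) (\<Phi> (x, a2)))
      + integral {a2..snd q} (\<lambda>y. prod (B (a1, y)) (\<Phi> (a1, y)))
      + integral {a1..fst q} (\<lambda>x. integral {a2..snd q} (\<lambda>y. R (x, y) (\<Phi> (x, y))))"
  proof (rule goursat_fixpoint[of \<delta> K "\<lambda>q. prod (A q)" "\<lambda>q. prod (B q)" R a1 a2 e0])
    show "continuous_on ?B (\<lambda>p. R' p (\<Psi> p))"
      if "R' \<in> {\<lambda>q. prod (A q), \<lambda>q. prod (B q), R}" "continuous_on ?B \<Psi>" for R' \<Psi>
      using that cR by (auto intro!: continuous_on cA cB)
    show "norm (R' p x - R' p y) \<le> K * norm (x - y)"
      if "R' \<in> {\<lambda>q. prod (A q), \<lambda>q. prod (B q), R}" "p \<in> ?B" for R' p x y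
    proof -
      have pC: "p \<in> ?C" using BC that(2) by blast
      have "norm (prod (A p) (x - y)) \<le> K * norm (x - y)" using kK[of "A p"] m(4)[OF pC] by blast
      moreover have "norm (prod (B p) (x - y)) \<le> K * norm (x - y)" using kK[of "B p"] m(5)[OF pC] by blast
      ultimately show ?thesis
        using that(1) R_norm[OF pC, of "x - y"] by (auto simp: R_diff diff_right[symmetric])
    qed
    show "0 < \<delta>" "\<delta> \<le> 1" "3 * K * \<delta> < 1" "0 \<le> K" by fact+
  qed (rule that, assumption, blast)
  let ?RP = "\<lambda>q. R q (\<Phi> q)"
  have cRP: "continuous_on ?B ?RP" by (rule cR[OF \<Phi>])
  \<comment> \<open>\<open>PU\<close> and \<open>PV\<close> are the derivatives of
    \<open>\<Phi>\<close> as given by the integral equation; they are still to be identified with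
    \<open>A \<Phi>\<close> and \<open>B \<Phi>\<close>.\<close>
  define PU where "PU = (\<lambda>q. prod (A (fst q, a2)) (\<Phi> (fst q, a2)) + integral {a2..snd q} (\<lambda>y. ?RP (fst q, y)))"
  define PV where "PV = (\<lambda>q. prod (B (a1, snd q)) (\<Phi> (a1, snd q)) + integral {a1..fst q} (\<lambda>x. ?RP (x, snd q)))"
  have line_u: "continuous_on T (\<lambda>q::plane. (fst q, a2))" and line_v: "continuous_on T (\<lambda>q::plane. (a1, snd q))" for T
    by (intro continuous_intros)+
  have in_u: "(\<lambda>q. (fst q, a2)) ` ?B \<subseteq> ?B" and in_v: "(\<lambda>q. (a1, snd q)) ` ?B \<subseteq> ?B"
    using \<delta> by (auto simp: cbox_Pair_eq)
  have cPU: "continuous_on ?B PU" unfolding PU_def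
    by (intro continuous_on_add continuous_on continuous_on_integral_snd[OF cRP]
        continuous_on_compose2[OF cA line_u in_u] continuous_on_compose2[OF \<Phi> line_u in_u])
  have cPV: "continuous_on ?B PV" unfolding PV_def
    by (intro continuous_on_add continuous_on continuous_on_integral_fst[OF cRP]
        continuous_on_compose2[OF cB line_v in_v] continuous_on_compose2[OF \<Phi> line_v in_v])
  have cA\<Phi>: "continuous_on ?B (\<lambda>q. prod (A q) (\<Phi> q))" and cB\<Phi>: "continuous_on ?B (\<lambda>q. prod (B q) (\<Phi> q))"
    by (intro continuous_on cA cB \<Phi>)+
  have dU: "((\<lambda>u. \<Phi> (u, v)) has_vector_derivative PU (u, v)) (at u within {a1..a1+\<delta>})"
    and dV: "((\<lambda>v. \<Phi> (u, v)) has_vector_derivative PV (u, v)) (at v within {a2..a2+\<delta>})"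
    if u: "u \<in> {a1..a1+\<delta>}" and v: "v \<in> {a2..a2+\<delta>}" for u v
  proof -
    have c1: "continuous_on {a1..a1+\<delta>} (\<lambda>x. prod (A (x, a2)) (\<Phi> (x, a2)))"
      by (rule continuous_on_compose2[OF cA\<Phi>]) (use \<delta> in \<open>auto intro!: continuous_intros simp: cbox_Pair_eq\<close>)
    have c2: "continuous_on {a2..a2+\<delta>} (\<lambda>y. prod (B (a1, y)) (\<Phi> (a1, y)))"
      by (rule continuous_on_compose2[OF cB\<Phi>]) (use \<delta> in \<open>auto intro!: continuous_intros simp: cbox_Pair_eq\<close>)
    note d1 = integral_has_vector_derivative[OF c1 u] and d2 = integral_has_vector_derivative[OF c2 v]
    note g = goursat_integral(2,3)[OF cRP u v, simplified]
    let ?I1 = "\<lambda>u. integral {a1..u} (\<lambda>x. prod (A (x, a2)) (\<Phi> (x, a2)))"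
    let ?I2 = "\<lambda>v. integral {a2..v} (\<lambda>y. prod (B (a1, y)) (\<Phi> (a1, y)))"
    let ?I3 = "\<lambda>u v. integral {a1..u} (\<lambda>x. integral {a2..v} (\<lambda>y. ?RP (x, y)))"
    have "((\<lambda>u. e0 + ?I1 u + ?I2 v + ?I3 u v) has_vector_derivative
        (0 + prod (A (u, a2)) (\<Phi> (u, a2)) + 0 + integral {a2..v} (\<lambda>y. ?RP (u, y)))) (at u within {a1..a1+\<delta>})"
      by (rule has_vector_derivative_add[OF has_vector_derivative_add[OF has_vector_derivative_add[OF
            has_vector_derivative_const d1] has_vector_derivative_const] g(1)])
    then have d: "((\<lambda>u. e0 + ?I1 u + ?I2 v + ?I3 u v) has_vector_derivative PU (u, v)) (at u within {a1..a1+\<delta>})"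
      by (simp add: PU_def)
    show "((\<lambda>u. \<Phi> (u, v)) has_vector_derivative PU (u, v)) (at u within {a1..a1+\<delta>})"
      by (rule has_vector_derivative_transform[OF u _ d]) (use v \<Phi>_eq in \<open>simp add: Bsq\<close>)
    have "((\<lambda>v. e0 + ?I1 u + ?I2 v + ?I3 u v) has_vector_derivative
        (0 + 0 + prod (B (a1, v)) (\<Phi> (a1, v)) + integral {a1..u} (\<lambda>x. ?RP (x, v)))) (at v within {a2..a2+\<delta>})"
      by (rule has_vector_derivative_add[OF has_vector_derivative_add[OF has_vector_derivative_add[OF
            has_vector_derivative_const has_vector_derivative_const] d2] g(2)])
    then have d: "((\<lambda>v. e0 + ?I1 u + ?I2 v + ?I3 u v) has_vector_derivative PV (u, v)) (at v within {a2..a2+\<delta>})"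
      by (simp add: PV_def)
    show "((\<lambda>v. \<Phi> (u, v)) has_vector_derivative PV (u, v)) (at v within {a2..a2+\<delta>})"
      by (rule has_vector_derivative_transform[OF v _ d]) (use u \<Phi>_eq in \<open>simp add: Bsq\<close>)
  qed
  define W where "W = (\<lambda>q. PU q - prod (A q) (\<Phi> q))"
  define V where "V = (\<lambda>q. PV q - prod (B q) (\<Phi> q))"
  have dW: "((\<lambda>v. W (u, v)) has_vector_derivative - prod (A (u, v)) (V (u, v))) (at v within {a2..a2+\<delta>})"
    and dVu: "((\<lambda>u. V (u, v)) has_vector_derivative - prod (B (u, v)) (W (u, v))) (at u within {a1..a1+\<delta>})"
    if u: "u \<in> {a1..a1+\<delta>}" and v: "v \<in> {a2..a2+\<delta>}" for u v
  proof -
    have q: "(u, v) \<in> S" using BS u v Bsq by blast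
    note A' = has_vector_derivative_D_uv(2)[OF smooth_on_differentiable[OF A q]]
    note B' = has_vector_derivative_D_uv(1)[OF smooth_on_differentiable[OF B q]]
    have c1: "continuous_on {a2..a2+\<delta>} (\<lambda>y. ?RP (u, y))"
      by (rule continuous_on_compose2[OF cRP]) (use u in \<open>auto intro!: continuous_intros simp: cbox_Pair_eq\<close>)
    have c2: "continuous_on {a1..a1+\<delta>} (\<lambda>x. ?RP (x, v))"
      by (rule continuous_on_compose2[OF cRP]) (use v in \<open>auto intro!: continuous_intros simp: cbox_Pair_eq\<close>)
    have "((\<lambda>v. W (u, v)) has_vector_derivative (0 + ?RP (u, v)) -
        (prod (A (u, v)) (PV (u, v)) + prod (D_v A (u, v)) (\<Phi> (u, v)))) (at v within {a2..a2+\<delta>})"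
      unfolding W_def PU_def fst_conv snd_conv
      by (rule has_vector_derivative_diff[OF has_vector_derivative_add[OF has_vector_derivative_const
            integral_has_vector_derivative[OF c1 v]] has_vector_derivative[OF A' dV[OF u v]]])
    moreover have "(0 + ?RP (u, v)) - (prod (A (u, v)) (PV (u, v)) + prod (D_v A (u, v)) (\<Phi> (u, v)))
        = - prod (A (u, v)) (V (u, v))"
      by (simp add: R_def V_def diff_right)
    ultimately show "((\<lambda>v. W (u, v)) has_vector_derivative - prod (A (u, v)) (V (u, v))) (at v within {a2..a2+\<delta>})"
      by simp
    have "((\<lambda>u. V (u, v)) has_vector_derivative (0 + ?RP (u, v)) -
        (prod (B (u, v)) (PU (u, v)) + prod (D_u B (u, v)) (\<Phi> (u, v)))) (at u within {a1..a1+\<delta>})"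
      unfolding V_def PV_def fst_conv snd_conv
      by (rule has_vector_derivative_diff[OF has_vector_derivative_add[OF has_vector_derivative_const
            integral_has_vector_derivative[OF c2 u]] has_vector_derivative[OF B' dU[OF u v]]])
    \<comment> \<open>\<open>R\<close> was built from \<open>A_v\<close> and \<open>A B\<close>; the
      compatibility condition rewrites it by \<open>B_u\<close> and \<open>B A\<close>, and so makes
      the second defect satisfy an equation like that of the first.\<close>
    moreover have "(0 + ?RP (u, v)) - (prod (B (u, v)) (PU (u, v)) + prod (D_u B (u, v)) (\<Phi> (u, v)))
        = - prod (B (u, v)) (W (u, v))"
      using compat[OF q, of "\<Phi> (u, v)"] by (simp add: R_def W_def diff_right)
    ultimately show "((\<lambda>u. V (u, v)) has_vector_derivative - prod (B (u, v)) (W (u, v))) (at u within {a1..a1+\<delta>})"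
      by simp
  qed
  have "continuous_on ?B (\<lambda>q. max (norm (W q)) (norm (V q)))"
    unfolding W_def V_def by (intro continuous_intros cPU cPV cA\<Phi> cB\<Phi>)
  moreover have "(a1, a2) \<in> ?B" using \<delta> by (auto simp: cbox_Pair_eq)
  ultimately obtain q0 where q0: "q0 \<in> ?B"
    "\<And>q. q \<in> ?B \<Longrightarrow> max (norm (W q)) (norm (V q)) \<le> max (norm (W q0)) (norm (V q0))"
    using continuous_attains_sup[of ?B "\<lambda>q. max (norm (W q)) (norm (V q))"] compact_cbox by blast
  \<comment> \<open>The largest defect on the square, attained by compactness. Integrating the
    equations for \<open>W\<close> and \<open>V\<close> from the sides where these vanish gives
    \<open>mx \<le> k * \<delta> * mx\<close>, and \<open>k * \<delta> < 1\<close> forces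
    \<open>mx = 0\<close>.\<close>
  define mx where "mx = max (norm (W q0)) (norm (V q0))"
  have mx: "norm (W q) \<le> mx" "norm (V q) \<le> mx" if "q \<in> ?B" for q
    using q0(2)[OF that] by (auto simp: mx_def)
  have mx0: "mx \<ge> 0" by (simp add: mx_def le_max_iff_disj)
  have W_le: "norm (W (u, v)) \<le> k * mx * \<delta>" and V_le: "norm (V (u, v)) \<le> k * mx * \<delta>"
    if u: "u \<in> {a1..a1+\<delta>}" and v: "v \<in> {a2..a2+\<delta>}" for u v
  proof -
    have b: "norm (prod (A q) (V q)) \<le> k * mx" "norm (prod (B q) (W q)) \<le> k * mx" if "q \<in> ?B" for q
    proof -
      have qC: "q \<in> ?C" using BC that by blast
      show "norm (prod (A q) (V q)) \<le> k * mx"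
        using nb[of "A q" "V q"] m(4)[OF qC] mult_left_mono[OF mx(2)[OF that] k] by simp
      show "norm (prod (B q) (W q)) \<le> k * mx"
        using nb[of "B q" "W q"] m(5)[OF qC] mult_left_mono[OF mx(1)[OF that] k] by simp
    qed
    have "norm (W (u, v)) \<le> k * mx * (a2 + \<delta> - a2)"
      by (rule norm_le_of_vector_derivative[OF dW[OF u]])
        (use u v b k mx0 in \<open>auto simp: Bsq W_def PU_def\<close>)
    then show "norm (W (u, v)) \<le> k * mx * \<delta>" by simp
    have "norm (V (u, v)) \<le> k * mx * (a1 + \<delta> - a1)"
      by (rule norm_le_of_vector_derivative[OF dVu[OF _ v]])
        (use u v b k mx0 in \<open>auto simp: Bsq V_def PV_def\<close>)
    then show "norm (V (u, v)) \<le> k * mx * \<delta>" by simp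
  qed
  obtain u0 v0 where uv0: "q0 = (u0, v0)" "u0 \<in> {a1..a1+\<delta>}" "v0 \<in> {a2..a2+\<delta>}"
    using q0(1) Bsq by (cases q0) auto
  have "mx \<le> (k * \<delta>) * mx" using W_le[OF uv0(2,3)] V_le[OF uv0(2,3)] by (simp add: mx_def uv0(1) mult_ac)
  then have "mx = 0" using k\<delta> mx0 by (metis mult_le_cancel_right1 not_less order_antisym_conv)
  then have WV0: "PU q = prod (A q) (\<Phi> q)" "PV q = prod (B q) (\<Phi> q)" if "q \<in> ?B" for q
    using mx[OF that] by (auto simp: W_def V_def)
  show thesis
  proof (rule that[of "(a1, a2)" "(a1 + \<delta>, a2 + \<delta>)" \<Phi>])
    show "p \<in> box (a1, a2) (a1 + \<delta>, a2 + \<delta>)"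
      using \<delta> by (auto simp: pxy a1_def a2_def mem_box Basis_prod_def)
    show "\<Phi> (a1, a2) = e0" using \<Phi>_eq[of "(a1, a2)"] \<delta> by (simp add: cbox_Pair_eq)
    fix q assume q: "q \<in> box (a1, a2) (a1 + \<delta>, a2 + \<delta>)"
    show "(\<Phi> has_derivative (\<lambda>z. fst z *\<^sub>R prod (A q) (\<Phi> q) + snd z *\<^sub>R prod (B q) (\<Phi> q))) (at q)"
      by (rule has_derivative_continuous_partials[OF q _ _ cB\<Phi>])
        (use dU dV WV0 in \<open>auto simp: Bsq\<close>)
  qed (use BS \<Phi> in auto)
qed

text \<open>The derivative of \<open>\<Phi>\<close> is a smooth bilinear expression in
  \<open>\<Phi>\<close> itself, so every order of differentiability yields the next one.\<close>

lemma smooth_on_linear_system: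
  fixes prod :: "'a::real_normed_vector \<Rightarrow> 'e::real_normed_vector \<Rightarrow> 'e" and A B :: "plane \<Rightarrow> 'a"
  assumes bil: "bounded_bilinear prod" and S: "open S" and A: "smooth_on S A" and B: "smooth_on S B"
    and d: "\<And>q. q \<in> S \<Longrightarrow>
      (\<Phi> has_derivative (\<lambda>z. fst z *\<^sub>R prod (A q) (\<Phi> q) + snd z *\<^sub>R prod (B q) (\<Phi> q))) (at q)"
  shows "smooth_on S \<Phi>"
proof -
  have "Ck_on k S \<Phi>" for k
  proof (induction k)
    case 0
    have "\<forall>q\<in>S. isCont \<Phi> q" using d has_derivative_continuous by blast
    then show ?case by (simp add: continuous_at_imp_continuous_on)
  next
    case (Suc k)
    have AB: "Ck_on k S A" "Ck_on k S B" using A B by (auto simp: smooth_on_def)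
    show ?case
      by (rule Ck_on_SucI[OF S d])
        (auto intro!: Ck_on_add[OF S] Ck_on_bilinear[OF bounded_bilinear_scaleR S] Ck_on_const
          Ck_on_bilinear[OF bil S] AB Suc)
  qed
  then show ?thesis by (simp add: smooth_on_def)
qed

text \<open>A vanishing derivative gives constancy on the open box only; continuity extends it to
  the corner \<open>a\<close>, where the initial value is known.\<close>

lemma constant_on_cbox:
  fixes f :: "'a::euclidean_space \<Rightarrow> 'b::real_normed_vector"
  assumes ne: "box a b \<noteq> {}" and c: "continuous_on (cbox a b) f"
    and d: "\<And>q. q \<in> box a b \<Longrightarrow> (f has_derivative (\<lambda>z. 0)) (at q)" and q: "q \<in> cbox a b"
  shows "f q = f a"
proof -
  obtain k where k: "\<And>q. q \<in> box a b \<Longrightarrow> f q = k"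
    using has_derivative_zero_constant[OF convex_box(2), of a b f] d has_derivative_at_withinI by metis
  have cl: "closure (box a b) = cbox a b" using ne by (rule closure_box)
  have "a \<in> cbox a b" using ne by (force simp: mem_box box_ne_empty)
  then show ?thesis
    using continuous_constant_on_closure[of "box a b" f k a] continuous_constant_on_closure[of "box a b" f k q]
      k c cl q by auto
qed

text \<open>The inhomogeneous system \<open>f_u = g\<close>, \<open>f_v = h\<close> becomes linear
  and homogeneous once a component that stays equal to 1 is adjoined. Closedness then is the
  compatibility condition of \<open>frobenius_linear\<close>.\<close>

lemma poincare_plane:
  fixes g h :: "plane \<Rightarrow> 'e::euclidean_space"
  assumes S: "open S" "p \<in> S" and g: "smooth_on S g" and h: "smooth_on S h"
    and closed: "\<And>q. q \<in> S \<Longrightarrow> D_v g q = D_u h q"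
  obtains a b f where "p \<in> box a b" "box a b \<subseteq> S"
    "\<And>q. q \<in> box a b \<Longrightarrow> (f has_derivative (\<lambda>z. fst z *\<^sub>R g q + snd z *\<^sub>R h q)) (at q)"
proof -
  \<comment> \<open>the linear system \<open>f\<^sub>u = c g\<close>, \<open>f\<^sub>v = c h\<close>, \<open>c\<^sub>u = c\<^sub>v = 0\<close>\<close>
  let ?prod = "\<lambda>(a::'e) (e::'e \<times> real). (snd e *\<^sub>R a, 0::real)"
  have bil: "bounded_bilinear ?prod"
  proof
    show "\<exists>K. \<forall>(a::'e) (b::'e \<times> real). norm (snd b *\<^sub>R a, 0::real) \<le> norm a * norm b * K"
    proof (intro exI[of _ 1] allI)
      fix a :: 'e and b :: "'e \<times> real"
      show "norm (snd b *\<^sub>R a, 0::real) \<le> norm a * norm b * 1"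
        using mult_left_mono[OF norm_snd_le[of "snd b" "fst b"] norm_ge_zero[of a]] by (simp add: norm_Pair mult.commute)
    qed
  qed (auto simp: algebra_simps)
  obtain a b \<Phi> where ab: "p \<in> box a b" "cbox a b \<subseteq> S" and c: "continuous_on (cbox a b) \<Phi>" and \<Phi>a: "\<Phi> a = (0, 1)"
    and d: "\<And>q. q \<in> box a b \<Longrightarrow>
      (\<Phi> has_derivative (\<lambda>z. fst z *\<^sub>R ?prod (g q) (\<Phi> q) + snd z *\<^sub>R ?prod (h q) (\<Phi> q))) (at q)"
  proof (rule frobenius_linear[OF bil S g h, where ?e0.0="(0, 1)"])
    show "?prod (D_v g q) e + ?prod (g q) (?prod (h q) e) = ?prod (D_u h q) e + ?prod (h q) (?prod (g q) e)"
      if "q \<in> S" for q e using closed[OF that] by simp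
  qed (erule that, assumption, assumption, assumption, blast)
  have "snd (\<Phi> q) = snd (\<Phi> a)" if "q \<in> box a b" for q
  proof (rule constant_on_cbox[where f="\<lambda>q. snd (\<Phi> q)"])
    show "box a b \<noteq> {}" using ab(1) by blast
    show "continuous_on (cbox a b) (\<lambda>q. snd (\<Phi> q))" by (rule continuous_on_snd[OF c])
    show "((\<lambda>q. snd (\<Phi> q)) has_derivative (\<lambda>z. 0)) (at q)" if "q \<in> box a b" for q
      using has_derivative_snd[OF d[OF that]] by simp
    show "q \<in> cbox a b" using that box_subset_cbox by blast
  qed
  then have k1: "snd (\<Phi> q) = 1" if "q \<in> box a b" for q using that \<Phi>a by simp
  show thesis
  proof (rule that[of a b "\<lambda>q. fst (\<Phi> q)"])
    show "((\<lambda>q. fst (\<Phi> q)) has_derivative (\<lambda>z. fst z *\<^sub>R g q + snd z *\<^sub>R h q)) (at q)" if "q \<in> box a b" for q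
      using has_derivative_fst[OF d[OF that]] k1[OF that] by simp
  qed (use ab box_subset_cbox in auto)
qed

section \<open>Linear algebra of the ambient space\<close>

lemma exhaust_5: "x = 1 \<or> x = 2 \<or> x = 3 \<or> x = 4 \<or> x = (5::5)"
proof (induct x)
  case (of_int z)
  then have "z = 0 \<or> z = 1 \<or> z = 2 \<or> z = 3 \<or> z = 4" by fastforce
  then show ?case by auto
qed

lemma forall_5: "(\<forall>i::5. P i) \<longleftrightarrow> P 1 \<and> P 2 \<and> P 3 \<and> P 4 \<and> P 5"
  by (metis exhaust_5)

lemma UNIV_5: "UNIV = {1, 2, 3, 4, 5::5}"
  using exhaust_5 by auto

lemma sum_5: "sum f (UNIV::5 set) = f 1 + f 2 + f 3 + f 4 + f 5"
  unfolding UNIV_5 by (simp add: ac_simps)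

section \<open>The ambient form, and matrices given by their rows\<close>

lemma bounded_bilinear_psc: "bounded_bilinear (psc L0)"
  unfolding bilinear_conv_bounded_bilinear[symmetric] bilinear_def
  by (auto intro!: linearI simp: psc_def algebra_simps)

interpretation psc: bounded_bilinear "psc L0" for L0 by (rule bounded_bilinear_psc)

lemmas psc_linear = psc.add_left psc.add_right psc.diff_left psc.diff_right psc.minus_left psc.minus_right
  psc.scaleR_left psc.scaleR_right psc.zero_left psc.zero_right

lemma psc_commute: "psc L0 x y = psc L0 y x"
  by (simp add: psc_def mult.commute)

text \<open>Frames are matrices whose rows are the frame vectors. Multiplying by a coefficient
  matrix from the left then forms linear combinations of vectors, and a matrix equation can be read
  row by row.\<close>

definition rows5 :: "'a \<Rightarrow> 'a \<Rightarrow> 'a \<Rightarrow> 'a \<Rightarrow> 'a \<Rightarrow> 'a^5" where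
  "rows5 a b c d e = (\<chi> i. if i = 1 then a else if i = 2 then b else if i = 3 then c else if i = 4 then d else e)"

lemma rows5_nth [simp]:
  "rows5 a b c d e $ 1 = a" "rows5 a b c d e $ 2 = b" "rows5 a b c d e $ 3 = c"
  "rows5 a b c d e $ 4 = d" "rows5 a b c d e $ 5 = e"
  by (simp_all add: rows5_def)

lemma eq_rows5_iff: "x = rows5 a b c d e \<longleftrightarrow> x$1 = a \<and> x$2 = b \<and> x$3 = c \<and> x$4 = d \<and> x$5 = e"
  by (simp add: vec_eq_iff forall_5)

lemma rows5_mult:
  "rows5 (rows5 a11 a12 a13 a14 a15) (rows5 a21 a22 a23 a24 a25) (rows5 a31 a32 a33 a34 a35)
     (rows5 a41 a42 a43 a44 a45) (rows5 a51 a52 a53 a54 a55) ** rows5 x1 x2 x3 x4 (x5 :: real^'n) =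
   rows5 (a11 *\<^sub>R x1 + a12 *\<^sub>R x2 + a13 *\<^sub>R x3 + a14 *\<^sub>R x4 + a15 *\<^sub>R x5)
     (a21 *\<^sub>R x1 + a22 *\<^sub>R x2 + a23 *\<^sub>R x3 + a24 *\<^sub>R x4 + a25 *\<^sub>R x5)
     (a31 *\<^sub>R x1 + a32 *\<^sub>R x2 + a33 *\<^sub>R x3 + a34 *\<^sub>R x4 + a35 *\<^sub>R x5)
     (a41 *\<^sub>R x1 + a42 *\<^sub>R x2 + a43 *\<^sub>R x3 + a44 *\<^sub>R x4 + a45 *\<^sub>R x5)
     (a51 *\<^sub>R x1 + a52 *\<^sub>R x2 + a53 *\<^sub>R x3 + a54 *\<^sub>R x4 + a55 *\<^sub>R x5)"
  by (simp add: eq_rows5_iff) (simp add: vec_eq_iff matrix_matrix_mult_def sum_5)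

lemma bounded_bilinear_matrix_mult: "bounded_bilinear ((**) :: real^'n^'m \<Rightarrow> real^'k^'n \<Rightarrow> real^'k^'m)"
  unfolding bilinear_conv_bounded_bilinear[symmetric] bilinear_def
  by (auto intro!: linearI simp: vec_eq_iff matrix_matrix_mult_def algebra_simps sum.distrib sum_distrib_left)

lemma bounded_linear_transpose: "bounded_linear (transpose :: real^'n^'m \<Rightarrow> real^'m^'n)"
  unfolding linear_conv_bounded_linear[symmetric] by (auto intro!: linearI simp: vec_eq_iff transpose_def)

text \<open>The sign of the fifth coordinate is \<open>sgn L0\<close>, except that the form is completed to a
  nondegenerate one if \<open>L0 = 0\<close>.\<close>

definition sg5 :: "real \<Rightarrow> real^5" where
  "sg5 L0 = rows5 1 1 (-1) (-1) (if L0 < 0 then -1 else 1)"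

definition eta :: "real \<Rightarrow> real^5^5" where
  "eta L0 = (\<chi> i j. if i = j then sg5 L0 $ i else 0)"

definition pse :: "real \<Rightarrow> real^5 \<Rightarrow> real^5 \<Rightarrow> real" where
  "pse L0 x y = (\<Sum>i\<in>UNIV. sg5 L0 $ i * (x $ i * y $ i))"

lemma sg5_square: "sg5 L0 $ i * sg5 L0 $ i = 1"
proof -
  have "\<forall>i. sg5 L0 $ i * sg5 L0 $ i = 1" unfolding forall_5 by (simp add: sg5_def)
  then show ?thesis ..
qed

lemma eta_mult_left: "(eta L0 ** M) $ i $ j = sg5 L0 $ i * M $ i $ j"
  by (simp add: eta_def matrix_matrix_mult_def if_distrib[of "\<lambda>x. x * _"] sum.delta cong: if_cong)

lemma eta_mult_right: "(M ** eta L0) $ i $ j = M $ i $ j * sg5 L0 $ j"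
  by (simp add: eta_def matrix_matrix_mult_def if_distrib[of "\<lambda>x. _ * x"] sum.delta' cong: if_cong)

lemma eta_eta [simp]: "eta L0 ** eta L0 = mat 1"
  by (simp add: vec_eq_iff eta_mult_left mat_def) (simp add: eta_def sg5_square)

lemma eta_eta_assoc [simp]: "eta L0 ** (eta L0 ** M) = M" "M ** eta L0 ** eta L0 = M"
  by (simp_all add: matrix_mul_assoc) (simp add: matrix_mul_assoc[symmetric])

lemma transpose_eta [simp]: "transpose (eta L0) = eta L0"
  by (simp add: vec_eq_iff transpose_def eta_def)

lemma gram_eta: "(F ** eta L0 ** transpose G) $ i $ j = pse L0 (F $ i) (G $ j)"
proof -
  have "(F ** eta L0 ** transpose G) $ i $ j = (\<Sum>k\<in>UNIV. (F ** eta L0) $ i $ k * transpose G $ k $ j)"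
    by (simp add: matrix_matrix_mult_def[of "F ** eta L0"])
  also have "\<dots> = pse L0 (F $ i) (G $ j)"
    by (simp add: eta_mult_right pse_def transpose_def mult_ac)
  finally show ?thesis .
qed

lemma pse_psc: "L0 \<noteq> 0 \<or> x$5 = 0 \<or> y$5 = 0 \<Longrightarrow> pse L0 x y = psc L0 x y"
  by (auto simp: pse_def psc_def sum_5 sg5_def sgn_if)

text \<open>Since \<open>eta\<close> is its own inverse, orthonormal rows exhibit
  \<open>eta F^T eta\<close> as a right inverse of \<open>F\<close>. For square matrices it is a
  left inverse too, which gives the relation for the columns.\<close>

lemma eta_orthogonal_inverse:
  assumes "F ** eta L0 ** transpose F = eta L0"
  shows "F ** (eta L0 ** transpose F ** eta L0) = mat 1"
    and "(eta L0 ** transpose F ** eta L0) ** F = mat 1"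
    and "transpose F ** eta L0 ** F = eta L0"
proof -
  show 1: "F ** (eta L0 ** transpose F ** eta L0) = mat 1"
    using assms by (simp add: matrix_mul_assoc)
  then show 2: "(eta L0 ** transpose F ** eta L0) ** F = mat 1"
    by (simp add: matrix_left_right_inverse)
  have "transpose F ** eta L0 ** F = eta L0 ** (eta L0 ** transpose F ** eta L0 ** F)"
    by (simp add: matrix_mul_assoc)
  also have "\<dots> = eta L0" using 2 by simp
  finally show "transpose F ** eta L0 ** F = eta L0" .
qed

lemma eta_orthogonal_transpose:
  assumes "transpose F ** eta L0 ** F = eta L0"
  shows "F ** eta L0 ** transpose F = eta L0"
  using eta_orthogonal_inverse(3)[of "transpose F" L0] assms by (simp add: transpose_transpose)

lemma eta_orthogonal_cancel:
  assumes "F ** eta L0 ** transpose F = eta L0" "M ** F = N ** F"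
  shows "M = N"
  by (metis assms(2) eta_orthogonal_inverse(1)[OF assms(1)] matrix_mul_assoc matrix_mul_rid)

lemma eta_orthogonal_zero:
  assumes "F ** eta L0 ** transpose F = eta L0" "\<And>i. pse L0 (F $ i) w = 0"
  shows "w = 0"
proof -
  \<comment> \<open>Repeating \<open>w\<close> in all rows states the five conditions as one matrix
    equation, from which \<open>F\<close> can be cancelled.\<close>
  let ?G = "rows5 w w w w w"
  have "F ** eta L0 ** transpose ?G = 0"
  proof -
    have "?G $ j = w" for j by (simp add: rows5_def)
    then have "(F ** eta L0 ** transpose ?G) $ i $ j = 0" for i j
      by (simp only: gram_eta assms(2))
    then show ?thesis by (simp add: vec_eq_iff)
  qed
  then have "(eta L0 ** transpose F ** eta L0) ** F ** eta L0 ** transpose ?G = 0"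
    by (metis matrix_mul_assoc times0_right)
  then have "eta L0 ** (eta L0 ** transpose ?G) = 0"
    using eta_orthogonal_inverse(2)[OF assms(1)] by (simp add: times0_right)
  then have G0: "transpose ?G = 0" by simp
  have "w $ j = 0" for j
  proof -
    have "transpose ?G $ j $ 1 = 0" unfolding G0 by simp
    then show ?thesis by (simp add: transpose_def)
  qed
  then show ?thesis by (simp add: vec_eq_iff)
qed

section \<open>Tangent vectors\<close>

lemma psc_position:
  assumes "x \<in> space_form L0" "w \<in> tangent_sp L0 x"
  shows "L0 * psc L0 x w = 0" "L0 * psc L0 w x = 0" "L0 \<noteq> 0 \<Longrightarrow> psc L0 x x = 1 / L0"
  using assms by (auto simp: space_form_def tangent_sp_def psc_commute split: if_splits)

lemma tangent_sp_linear:
  "v \<in> tangent_sp L0 x \<Longrightarrow> w \<in> tangent_sp L0 x \<Longrightarrow> v + w \<in> tangent_sp L0 x"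
  "v \<in> tangent_sp L0 x \<Longrightarrow> w \<in> tangent_sp L0 x \<Longrightarrow> v - w \<in> tangent_sp L0 x"
  "v \<in> tangent_sp L0 x \<Longrightarrow> c *\<^sub>R v \<in> tangent_sp L0 x"
  "v \<in> tangent_sp L0 x \<Longrightarrow> - v \<in> tangent_sp L0 x"
  by (auto simp: tangent_sp_def psc_linear split: if_splits)

lemma fd_vec_nth:
  fixes f :: "'a::real_normed_vector \<Rightarrow> real^'n"
  shows "f differentiable (at p) \<Longrightarrow>
    frechet_derivative (\<lambda>x. f x $ i) (at p) v = frechet_derivative f (at p) v $ i"
  by (rule fd_bounded_linear[OF bounded_linear_vec_nth])

lemma fd_psc:
  "f differentiable (at p) \<Longrightarrow> h differentiable (at p) \<Longrightarrow>
   frechet_derivative (\<lambda>x. psc L0 (f x) (h x)) (at p) v =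
     psc L0 (f p) (frechet_derivative h (at p) v) + psc L0 (frechet_derivative f (at p) v) (h p)"
  by (rule fd_bilinear[OF bounded_bilinear_psc])

lemma fd_const_on:
  assumes "open S" "p \<in> S" "\<And>x. x \<in> S \<Longrightarrow> f x = c"
  shows "frechet_derivative f (at p) v = 0"
  using fd_cong[OF _ assms(1,2), of "\<lambda>_. c" f v] assms(3) by simp

lemma tangent_derivative:
  assumes D: "open D" "p \<in> D" and X: "X differentiable (at p)" and sf: "\<And>q. q \<in> D \<Longrightarrow> X q \<in> space_form L0"
  shows "frechet_derivative X (at p) v \<in> tangent_sp L0 (X p)"
proof (cases "L0 = 0")
  case True
  then show ?thesis using fd_const_on[OF D, of "\<lambda>x. X x $ 5" 0 v] fd_vec_nth[OF X, of 5 v] sf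
    by (auto simp: space_form_def tangent_sp_def)
next
  case False
  have "frechet_derivative (\<lambda>x. psc L0 (X x) (X x)) (at p) v = 0"
    by (rule fd_const_on[OF D, where c="1 / L0"]) (use sf False in \<open>auto simp: space_form_def\<close>)
  then have "psc L0 (X p) (frechet_derivative X (at p) v) + psc L0 (frechet_derivative X (at p) v) (X p) = 0"
    by (simp add: fd_psc[OF X X])
  then show ?thesis using False psc_commute[of L0 "X p" "frechet_derivative X (at p) v"]
    by (simp add: tangent_sp_def)
qed

text \<open>Differentiating \<open>psc L0 Y X = 0\<close> trades the derivative of \<open>Y\<close>
  in the normal component for that of \<open>X\<close>. The correction is the second fundamental
  form of the space form in its ambient space, and it vanishes for \<open>L0 = 0\<close>.\<close>

lemma nabla_eq:
  assumes D: "open D" "p \<in> D" and X: "X differentiable (at p)" and Y: "Y differentiable (at p)"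
    and t: "\<And>q. q \<in> D \<Longrightarrow> Y q \<in> tangent_sp L0 (X q)"
  shows "frechet_derivative Y (at p) v = nabla L0 X v Y p - (L0 * psc L0 (Y p) (frechet_derivative X (at p) v)) *\<^sub>R X p"
proof -
  have "L0 * psc L0 (frechet_derivative Y (at p) v) (X p) = - (L0 * psc L0 (Y p) (frechet_derivative X (at p) v))"
  proof (cases "L0 = 0")
    case False
    have "frechet_derivative (\<lambda>x. psc L0 (Y x) (X x)) (at p) v = 0"
      by (rule fd_const_on[OF D, where c=0])
        (use t False psc_commute[of L0] in \<open>metis (mono_tags, lifting) mem_Collect_eq tangent_sp_def\<close>)
    then show ?thesis by (simp add: fd_psc[OF Y X] algebra_simps eq_neg_iff_add_eq_0 flip: distrib_left)
  qed simp
  then show ?thesis by (simp add: nabla_def Let_def)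
qed

lemma nabla_tangent:
  assumes D: "open D" "p \<in> D" and Y: "Y differentiable (at p)" and sf: "X p \<in> space_form L0"
    and t: "\<And>q. q \<in> D \<Longrightarrow> Y q \<in> tangent_sp L0 (X q)"
  shows "nabla L0 X v Y p \<in> tangent_sp L0 (X p)"
proof (cases "L0 = 0")
  case True
  then show ?thesis using fd_const_on[OF D, of "\<lambda>x. Y x $ 5" 0 v] fd_vec_nth[OF Y, of 5 v] t
    by (auto simp: tangent_sp_def nabla_def)
next
  case False
  then show ?thesis using sf psc_commute[of L0 "X p" "frechet_derivative Y (at p) v"]
    by (simp add: space_form_def tangent_sp_def nabla_def Let_def psc_linear)
qed

lemma psc_nabla:
  assumes "X p \<in> space_form L0" "w \<in> tangent_sp L0 (X p)"
  shows "psc L0 (nabla L0 X v Y p) w = psc L0 (frechet_derivative Y (at p) v) w"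
  using psc_position(1)[OF assms] by (auto simp: nabla_def Let_def psc_linear)

section \<open>Framed time-like surfaces\<close>

lemma smooth_on_psc:
  "open S \<Longrightarrow> smooth_on S f \<Longrightarrow> smooth_on S h \<Longrightarrow> smooth_on S (\<lambda>x. psc L0 (f x) (h x))"
  by (rule smooth_on_bilinear[OF bounded_bilinear_psc])

locale surface =
  fixes L0 :: real and D :: "plane set" and X :: "plane \<Rightarrow> real^5" and lam :: "plane \<Rightarrow> real"
  assumes open_D: "open D" and immersion: "immersion_on L0 D X" and conformal: "conformal_metric L0 D X lam"
begin

lemma smooth_X: "smooth_on D X"
  and in_space_form: "p \<in> D \<Longrightarrow> X p \<in> space_form L0"
  using immersion by (auto simp: immersion_on_def)

lemma smooth_T: "smooth_on D (D_u X)" "smooth_on D (D_v X)"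
  using smooth_on_D[OF smooth_X] by auto

lemma metric:
  assumes "p \<in> D"
  shows "psc L0 (D_u X p) (D_u X p) = exp (2 * lam p)" "psc L0 (D_u X p) (D_v X p) = 0"
    "psc L0 (D_v X p) (D_u X p) = 0" "psc L0 (D_v X p) (D_v X p) = - exp (2 * lam p)"
  using conformal assms by (auto simp: conformal_metric_def psc_commute)

text \<open>In \<open>conformal_metric\<close> the function \<open>lam\<close> carries no
  regularity; the metric expresses it as half the logarithm of a smooth positive function.\<close>

lemma smooth_lam: "smooth_on D lam"
proof (rule smooth_on_cong[OF _ open_D])
  show "smooth_on D (\<lambda>p. (1 / 2) * ln (psc L0 (D_u X p) (D_u X p)))"
    by (intro smooth_intros smooth_on_ln smooth_on_psc smooth_T open_D) (simp add: metric)
  show "1 / 2 * ln (psc L0 (D_u X p) (D_u X p)) = lam p" if "p \<in> D" for p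
    using that by (simp add: metric)
qed

lemma diff_at: "smooth_on D f \<Longrightarrow> p \<in> D \<Longrightarrow> f differentiable (at p)"
  by (rule smooth_on_differentiable)

lemma tangent_T:
  assumes "p \<in> D" shows "D_u X p \<in> tangent_sp L0 (X p)" "D_v X p \<in> tangent_sp L0 (X p)"
  unfolding D_u_def D_v_def
  using tangent_derivative[OF open_D assms diff_at[OF smooth_X assms] in_space_form] by auto

lemma D_psc:
  assumes "p \<in> D" "smooth_on D f" "smooth_on D h" "smooth_on D c"
    and "\<forall>q\<in>D. psc L0 (f q) (h q) = c q"
  shows "psc L0 (f p) (D_u h p) + psc L0 (D_u f p) (h p) = D_u c p"
    "psc L0 (f p) (D_v h p) + psc L0 (D_v f p) (h p) = D_v c p"
  unfolding D_u_def D_v_def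
    fd_psc[OF diff_at[OF assms(2,1)] diff_at[OF assms(3,1)], symmetric]
  by (rule fd_cong[OF diff_at[OF assms(4,1)] open_D assms(1)], simp add: assms(5))+

lemma X_uv: "p \<in> D \<Longrightarrow> D_v (D_u X) p = D_u (D_v X) p"
  using mixed_partials[OF open_D _ smooth_X] by simp

lemma D_exp_lam:
  assumes "p \<in> D"
  shows "D_u (\<lambda>p. c * exp (2 * lam p)) p = 2 * c * (D_u lam p * exp (2 * lam p))"
    "D_v (\<lambda>p. c * exp (2 * lam p)) p = 2 * c * (D_v lam p * exp (2 * lam p))"
proof -
  have d: "lam differentiable (at p)" "(\<lambda>p. 2 * lam p) differentiable (at p)"
    "(\<lambda>p. exp (2 * lam p)) differentiable (at p)"
    by (intro diff_at[OF _ assms] smooth_intros smooth_lam open_D)+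
  show "D_u (\<lambda>p. c * exp (2 * lam p)) p = 2 * c * (D_u lam p * exp (2 * lam p))"
    "D_v (\<lambda>p. c * exp (2 * lam p)) p = 2 * c * (D_v lam p * exp (2 * lam p))"
    unfolding D_u_def D_v_def by (subst fd_cmult[OF d(3)], subst fd_exp[OF d(2)], subst fd_cmult[OF d(1)], simp)+
qed

lemma smooth_exp_lam: "smooth_on D (\<lambda>p. c * exp (2 * lam p))"
  by (intro smooth_intros smooth_lam open_D)

text \<open>The Christoffel symbols of the metric \<open>e^(2 \<lambda>) (du^2 - dv^2)\<close>.
  Differentiating the three products of \<open>D_u X\<close> and \<open>D_v X\<close> in two
  directions yields six linear equations for the six unknowns, by symmetry of the second
  derivatives.\<close>

lemma X_second_tangential:
  assumes p: "p \<in> D"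
  shows "psc L0 (D_u (D_u X) p) (D_u X p) = D_u lam p * exp (2 * lam p)"
    "psc L0 (D_u (D_v X) p) (D_u X p) = D_v lam p * exp (2 * lam p)"
    "psc L0 (D_v (D_v X) p) (D_u X p) = D_u lam p * exp (2 * lam p)"
    "psc L0 (D_u (D_u X) p) (D_v X p) = - (D_v lam p * exp (2 * lam p))"
    "psc L0 (D_u (D_v X) p) (D_v X p) = - (D_u lam p * exp (2 * lam p))"
    "psc L0 (D_v (D_v X) p) (D_v X p) = - (D_v lam p * exp (2 * lam p))"
proof -
  have 3: "\<forall>q\<in>D. psc L0 (D_u X q) (D_v X q) = 0" using metric by simp
  have 1: "\<forall>q\<in>D. psc L0 (D_u X q) (D_u X q) = 1 * exp (2 * lam q)" using metric by simp
  have 2: "\<forall>q\<in>D. psc L0 (D_v X q) (D_v X q) = (-1) * exp (2 * lam q)" using metric by simp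
  note a = D_psc[OF p smooth_T(1) smooth_T(1) smooth_exp_lam 1, unfolded D_exp_lam[OF p]]
  note b = D_psc[OF p smooth_T(2) smooth_T(2) smooth_exp_lam 2, unfolded D_exp_lam[OF p]]
  note c = D_psc[OF p smooth_T(1) smooth_T(2) smooth_on_const 3]
  have z: "D_u (\<lambda>q. 0::real) p = 0" "D_v (\<lambda>q. 0::real) p = 0" by (simp_all add: D_u_def D_v_def)
  note cm = psc_commute[of L0 "D_u X p" "D_u (D_u X) p"] psc_commute[of L0 "D_v X p" "D_u (D_u X) p"]
    psc_commute[of L0 "D_u X p" "D_u (D_v X) p"] psc_commute[of L0 "D_v X p" "D_u (D_v X) p"]
    psc_commute[of L0 "D_u X p" "D_v (D_v X) p"] psc_commute[of L0 "D_v X p" "D_v (D_v X) p"]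
  show "psc L0 (D_u (D_u X) p) (D_u X p) = D_u lam p * exp (2 * lam p)"
    "psc L0 (D_u (D_v X) p) (D_u X p) = D_v lam p * exp (2 * lam p)"
    "psc L0 (D_v (D_v X) p) (D_u X p) = D_u lam p * exp (2 * lam p)"
    "psc L0 (D_u (D_u X) p) (D_v X p) = - (D_v lam p * exp (2 * lam p))"
    "psc L0 (D_u (D_v X) p) (D_v X p) = - (D_u lam p * exp (2 * lam p))"
    "psc L0 (D_v (D_v X) p) (D_v X p) = - (D_v lam p * exp (2 * lam p))"
    using a b c z cm unfolding X_uv[OF p] by linarith+
qed

lemma psc_normal_part:
  assumes "psc L0 n (D_u X p) = 0" "psc L0 n (D_v X p) = 0"
  shows "psc L0 (normal_part L0 X p w) n = psc L0 w n"
  using assms by (simp add: normal_part_def Let_def psc_linear psc_commute[of L0 _ n])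

text \<open>For \<open>du^2 - dv^2\<close> the trace is the difference of the two pure second
  derivatives, so a zero mean curvature vector equates their normal parts.\<close>

lemma zero_mean_normal:
  assumes p: "p \<in> D" and H: "mean_curvature_vector L0 X p = 0"
    and n: "n \<in> tangent_sp L0 (X p)" "psc L0 n (D_u X p) = 0" "psc L0 n (D_v X p) = 0"
  shows "psc L0 (D_v (D_v X) p) n = psc L0 (D_u (D_u X) p) n"
proof -
  let ?E = "exp (2 * lam p)"
  let ?s11 = "normal_part L0 X p (nabla L0 X (1, 0) (D_u X) p)"
  let ?s22 = "normal_part L0 X p (nabla L0 X (0, 1) (D_v X) p)"
  have "(1 / (2 * (- (?E * ?E)))) *\<^sub>R (- ?E *\<^sub>R ?s11 + ?E *\<^sub>R ?s22) = 0"
    using H unfolding mean_curvature_vector_def Let_def by (simp add: metric[OF p] algebra_simps)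
  then have "?E *\<^sub>R (?s22 - ?s11) = 0" by (simp add: algebra_simps)
  then have "?s22 = ?s11" by simp
  then have "psc L0 ?s22 n = psc L0 ?s11 n" by simp
  then show ?thesis
    unfolding psc_normal_part[OF n(2,3)] psc_nabla[where X=X and p=p, OF in_space_form[OF p] n(1)]
    by (simp add: D_u_def D_v_def)
qed

end

section \<open>Orthonormal frames and connection matrices\<close>

lemma positively_oriented_rows5:
  "positively_oriented L0 \<sigma> x a b c d \<longleftrightarrow>
    \<sigma> * det (rows5 a b c d (if L0 = 0 then axis 5 1 else x)) > 0"
proof -
  have "(\<chi> i. if i = 1 then a else if i = 2 then b else if i = 3 then c else if i = 4 then d
      else if L0 = 0 then axis 5 1 else x) = rows5 a b c d (if L0 = 0 then axis 5 1 else x)"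
    unfolding rows5_def ..
  then show ?thesis unfolding positively_oriented_def by simp
qed

text \<open>Division by \<open>e^\<lambda>\<close> makes the rows orthonormal for
  \<open>eta\<close>, whose signs 1, 1, -1, -1 follow the order \<open>T1\<close>,
  \<open>N1\<close>, \<open>T2\<close>, \<open>N2\<close>. The last row is the position vector
  scaled to unit length, or the unit normal of the hyperplane if \<open>L0 = 0\<close>.\<close>

definition frame_matrix ::
  "real \<Rightarrow> (plane \<Rightarrow> real^5) \<Rightarrow> (plane \<Rightarrow> real) \<Rightarrow> (plane \<Rightarrow> real^5) \<Rightarrow> (plane \<Rightarrow> real^5) \<Rightarrow> plane \<Rightarrow> real^5^5" where
  "frame_matrix L0 X lam N1 N2 p =
     rows5 (exp (- lam p) *\<^sub>R D_u X p) (exp (- lam p) *\<^sub>R N1 p) (exp (- lam p) *\<^sub>R D_v X p)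
       (exp (- lam p) *\<^sub>R N2 p) (if L0 = 0 then axis 5 1 else sqrt \<bar>L0\<bar> *\<^sub>R X p)"

text \<open>The coefficients of the structure equations for the normalized frame. The normalization
  removes the terms with \<open>\<lambda>_u\<close> on the diagonal, and what remains is skew for
  \<open>eta\<close>; the fifth row and column come from the position vector.\<close>

definition conn_u ::
  "real \<Rightarrow> (plane \<Rightarrow> real) \<Rightarrow> (plane \<Rightarrow> real) \<Rightarrow> (plane \<Rightarrow> real) \<Rightarrow> (plane \<Rightarrow> real) \<Rightarrow> (plane \<Rightarrow> real) \<Rightarrow>
   (plane \<Rightarrow> real) \<Rightarrow> plane \<Rightarrow> real^5^5" where
  "conn_u L0 lam al1 al2 be1 be2 mu1 p = rows5
     (rows5 0 (al1 p) (D_v lam p) (be1 p) (- sgn L0 * sqrt \<bar>L0\<bar> * exp (lam p)))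
     (rows5 (- al1 p) 0 (al2 p) (mu1 p) 0)
     (rows5 (D_v lam p) (al2 p) 0 (be2 p) 0)
     (rows5 (be1 p) (mu1 p) (- be2 p) 0 0)
     (rows5 (sqrt \<bar>L0\<bar> * exp (lam p)) 0 0 0 0)"

definition conn_v ::
  "real \<Rightarrow> (plane \<Rightarrow> real) \<Rightarrow> (plane \<Rightarrow> real) \<Rightarrow> (plane \<Rightarrow> real) \<Rightarrow> (plane \<Rightarrow> real) \<Rightarrow> (plane \<Rightarrow> real) \<Rightarrow>
   (plane \<Rightarrow> real) \<Rightarrow> plane \<Rightarrow> real^5^5" where
  "conn_v L0 lam al1 al2 be1 be2 mu2 p = rows5
     (rows5 0 (al2 p) (D_u lam p) (be2 p) 0)
     (rows5 (- al2 p) 0 (al1 p) (mu2 p) 0)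
     (rows5 (D_u lam p) (al1 p) 0 (be1 p) (sgn L0 * sqrt \<bar>L0\<bar> * exp (lam p)))
     (rows5 (be2 p) (mu2 p) (- be1 p) 0 0)
     (rows5 0 0 (sqrt \<bar>L0\<bar> * exp (lam p)) 0 0)"

lemma conn_skew:
  "transpose (conn_u L0 lam al1 al2 be1 be2 mu1 p) ** eta L0 + eta L0 ** conn_u L0 lam al1 al2 be1 be2 mu1 p = 0"
  "transpose (conn_v L0 lam al1 al2 be1 be2 mu2 p) ** eta L0 + eta L0 ** conn_v L0 lam al1 al2 be1 be2 mu2 p = 0"
  unfolding vec_eq_iff
  by (simp_all add: eta_mult_left eta_mult_right transpose_def forall_5 conn_u_def conn_v_def)
    (auto simp: sg5_def sgn_if)

locale framed_surface = surface +
  fixes \<sigma> :: real and N1 N2 :: "plane \<Rightarrow> real^5"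
  assumes frame: "normal_frame L0 \<sigma> D X lam N1 N2"
begin

lemma smooth_N: "smooth_on D N1" "smooth_on D N2"
  using frame by (auto simp: normal_frame_def)

lemma tangent_N: "p \<in> D \<Longrightarrow> N1 p \<in> tangent_sp L0 (X p)" "p \<in> D \<Longrightarrow> N2 p \<in> tangent_sp L0 (X p)"
  using frame by (auto simp: normal_frame_def)

lemma frame_products:
  assumes "p \<in> D"
  shows "psc L0 (N1 p) (D_u X p) = 0" "psc L0 (N1 p) (D_v X p) = 0"
    "psc L0 (N2 p) (D_u X p) = 0" "psc L0 (N2 p) (D_v X p) = 0"
    "psc L0 (D_u X p) (N1 p) = 0" "psc L0 (D_v X p) (N1 p) = 0"
    "psc L0 (D_u X p) (N2 p) = 0" "psc L0 (D_v X p) (N2 p) = 0"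
    "psc L0 (N1 p) (N1 p) = exp (2 * lam p)" "psc L0 (N2 p) (N2 p) = - exp (2 * lam p)"
    "psc L0 (N1 p) (N2 p) = 0" "psc L0 (N2 p) (N1 p) = 0"
  using frame assms by (auto simp: normal_frame_def psc_commute[of L0 "D_u X p"] psc_commute[of L0 "D_v X p"]
      psc_commute[of L0 "N2 p" "N1 p"])

lemma frame_tangential_pse:
  assumes "p \<in> D" "v \<in> tangent_sp L0 (X p)" "w \<in> tangent_sp L0 (X p)"
  shows "pse L0 v w = psc L0 v w"
    "pse L0 (if L0 = 0 then axis 5 1 else sqrt \<bar>L0\<bar> *\<^sub>R X p) w = 0"
    "pse L0 w (if L0 = 0 then axis 5 1 else sqrt \<bar>L0\<bar> *\<^sub>R X p) = 0"
proof -
  show "pse L0 v w = psc L0 v w" using assms by (intro pse_psc) (auto simp: tangent_sp_def split: if_splits)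
  have "pse L0 (if L0 = 0 then axis 5 1 else sqrt \<bar>L0\<bar> *\<^sub>R X p) w = 0 \<and>
    pse L0 w (if L0 = 0 then axis 5 1 else sqrt \<bar>L0\<bar> *\<^sub>R X p) = 0"
  proof (cases "L0 = 0")
    case True
    then have "w $ 5 = 0" using assms(3) by (simp add: tangent_sp_def)
    with True show ?thesis
      by (simp_all add: pse_def sum_5 axis_def)
  next
    case False
    then have "psc L0 (X p) w = 0" using assms(3) by (simp add: tangent_sp_def)
    moreover from this have "psc L0 w (X p) = 0" by (simp add: psc_commute[of L0 w])
    ultimately show ?thesis
      using False by (simp_all add: pse_psc psc_linear)
  qed
  then show "pse L0 (if L0 = 0 then axis 5 1 else sqrt \<bar>L0\<bar> *\<^sub>R X p) w = 0"
    "pse L0 w (if L0 = 0 then axis 5 1 else sqrt \<bar>L0\<bar> *\<^sub>R X p) = 0"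
    by auto
qed

lemma frame_orthonormal:
  assumes p: "p \<in> D"
  shows "frame_matrix L0 X lam N1 N2 p ** eta L0 ** transpose (frame_matrix L0 X lam N1 N2 p) = eta L0"
proof -
  let ?e5 = "if L0 = 0 then axis 5 1 else sqrt \<bar>L0\<bar> *\<^sub>R X p"
  have ee: "exp (- lam p) * (exp (- lam p) * exp (2 * lam p)) = 1" by (simp add: exp_add[symmetric])
  have 55: "pse L0 ?e5 ?e5 = sg5 L0 $ 5"
  proof (cases "L0 = 0")
    case True
    then show ?thesis by (simp add: pse_def sum_5 axis_def)
  next
    case False
    then have "pse L0 ?e5 ?e5 = \<bar>L0\<bar> * (1 / L0)"
      using psc_position(3)[OF in_space_form[OF p] tangent_T(1)[OF p]] by (simp add: pse_psc psc_linear)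
    also have "\<dots> = sg5 L0 $ 5" using False by (auto simp: sg5_def)
    finally show ?thesis .
  qed
  note t = tangent_T[OF p] tangent_N[OF p]
  note ts = tangent_sp_linear(3)[OF t(1), of "exp (- lam p)"] tangent_sp_linear(3)[OF t(2), of "exp (- lam p)"]
    tangent_sp_linear(3)[OF t(3), of "exp (- lam p)"] tangent_sp_linear(3)[OF t(4), of "exp (- lam p)"]
  note f = frame_tangential_pse[OF p]
  show ?thesis
    unfolding vec_eq_iff gram_eta unfolding frame_matrix_def forall_5
    by (simp add: f(2,3)[OF ts(1) ts(1)] f(2,3)[OF ts(1) ts(2)] f(2,3)[OF ts(1) ts(3)] f(2,3)[OF ts(1) ts(4)]
        f(1)[OF ts(1) ts(1)] f(1)[OF ts(1) ts(2)] f(1)[OF ts(1) ts(3)] f(1)[OF ts(1) ts(4)]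
        f(1)[OF ts(2) ts(1)] f(1)[OF ts(2) ts(2)] f(1)[OF ts(2) ts(3)] f(1)[OF ts(2) ts(4)]
        f(1)[OF ts(3) ts(1)] f(1)[OF ts(3) ts(2)] f(1)[OF ts(3) ts(3)] f(1)[OF ts(3) ts(4)]
        f(1)[OF ts(4) ts(1)] f(1)[OF ts(4) ts(2)] f(1)[OF ts(4) ts(3)] f(1)[OF ts(4) ts(4)]
        55 psc_linear metric[OF p] frame_products[OF p] ee eta_def sg5_def del: if_split_asm)
qed

text \<open>The difference is orthogonal to the four frame vectors, and to the fifth row because it
  is tangent to the space form; no nonzero vector is orthogonal to a full orthonormal frame.\<close>

lemma tangent_eqI:
  assumes p: "p \<in> D" and t: "v \<in> tangent_sp L0 (X p)" "w \<in> tangent_sp L0 (X p)"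
    and "psc L0 v (D_u X p) = psc L0 w (D_u X p)" "psc L0 v (N1 p) = psc L0 w (N1 p)"
      "psc L0 v (D_v X p) = psc L0 w (D_v X p)" "psc L0 v (N2 p) = psc L0 w (N2 p)"
  shows "v = w"
proof -
  have vw: "v - w \<in> tangent_sp L0 (X p)" using t by (rule tangent_sp_linear)
  note t = tangent_T[OF p] tangent_N[OF p]
  note ts = tangent_sp_linear(3)[OF t(1), of "exp (- lam p)"] tangent_sp_linear(3)[OF t(2), of "exp (- lam p)"]
    tangent_sp_linear(3)[OF t(3), of "exp (- lam p)"] tangent_sp_linear(3)[OF t(4), of "exp (- lam p)"]
  note f = frame_tangential_pse[OF p _ vw]
  have "\<forall>i. pse L0 (frame_matrix L0 X lam N1 N2 p $ i) (v - w) = 0"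
    unfolding forall_5 using assms(4-) f(2)[OF t(1)]
    by (simp add: frame_matrix_def f(1)[OF ts(1)] f(1)[OF ts(2)] f(1)[OF ts(3)] f(1)[OF ts(4)] psc_linear
        psc_commute[of L0 _ v] psc_commute[of L0 _ w])
  then have "v - w = 0" using eta_orthogonal_zero[OF frame_orthonormal[OF p]] by blast
  then show ?thesis by simp
qed

lemma N_first_tangential:
  assumes p: "p \<in> D"
  shows "psc L0 (D_u N1 p) (D_u X p) = - psc L0 (D_u (D_u X) p) (N1 p)"
    "psc L0 (D_u N1 p) (D_v X p) = - psc L0 (D_u (D_v X) p) (N1 p)"
    "psc L0 (D_v N1 p) (D_u X p) = - psc L0 (D_u (D_v X) p) (N1 p)"
    "psc L0 (D_v N1 p) (D_v X p) = - psc L0 (D_v (D_v X) p) (N1 p)"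
    "psc L0 (D_u N2 p) (D_u X p) = - psc L0 (D_u (D_u X) p) (N2 p)"
    "psc L0 (D_u N2 p) (D_v X p) = - psc L0 (D_u (D_v X) p) (N2 p)"
    "psc L0 (D_v N2 p) (D_u X p) = - psc L0 (D_u (D_v X) p) (N2 p)"
    "psc L0 (D_v N2 p) (D_v X p) = - psc L0 (D_v (D_v X) p) (N2 p)"
proof -
  have z: "D_u (\<lambda>q. 0::real) p = 0" "D_v (\<lambda>q. 0::real) p = 0" by (simp_all add: D_u_def D_v_def)
  have nt: "\<forall>q\<in>D. psc L0 (N1 q) (D_u X q) = 0" "\<forall>q\<in>D. psc L0 (N1 q) (D_v X q) = 0"
    "\<forall>q\<in>D. psc L0 (N2 q) (D_u X q) = 0" "\<forall>q\<in>D. psc L0 (N2 q) (D_v X q) = 0"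
    using frame_products by simp_all
  note a = D_psc[OF p smooth_N(1) smooth_T(1) smooth_on_const nt(1), unfolded z]
    D_psc[OF p smooth_N(1) smooth_T(2) smooth_on_const nt(2), unfolded z]
    D_psc[OF p smooth_N(2) smooth_T(1) smooth_on_const nt(3), unfolded z]
    D_psc[OF p smooth_N(2) smooth_T(2) smooth_on_const nt(4), unfolded z]
  note cm = psc_commute[of L0 "N1 p" "D_u (D_u X) p"] psc_commute[of L0 "N2 p" "D_u (D_u X) p"]
    psc_commute[of L0 "N1 p" "D_u (D_v X) p"] psc_commute[of L0 "N2 p" "D_u (D_v X) p"]
    psc_commute[of L0 "N1 p" "D_v (D_v X) p"] psc_commute[of L0 "N2 p" "D_v (D_v X) p"]
  show "psc L0 (D_u N1 p) (D_u X p) = - psc L0 (D_u (D_u X) p) (N1 p)"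
    "psc L0 (D_u N1 p) (D_v X p) = - psc L0 (D_u (D_v X) p) (N1 p)"
    "psc L0 (D_v N1 p) (D_u X p) = - psc L0 (D_u (D_v X) p) (N1 p)"
    "psc L0 (D_v N1 p) (D_v X p) = - psc L0 (D_v (D_v X) p) (N1 p)"
    "psc L0 (D_u N2 p) (D_u X p) = - psc L0 (D_u (D_u X) p) (N2 p)"
    "psc L0 (D_u N2 p) (D_v X p) = - psc L0 (D_u (D_v X) p) (N2 p)"
    "psc L0 (D_v N2 p) (D_u X p) = - psc L0 (D_u (D_v X) p) (N2 p)"
    "psc L0 (D_v N2 p) (D_v X p) = - psc L0 (D_v (D_v X) p) (N2 p)"
    using a cm unfolding X_uv[OF p] by linarith+
qed

lemma N_first_normal:
  assumes p: "p \<in> D"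
  shows "psc L0 (D_u N1 p) (N1 p) = D_u lam p * exp (2 * lam p)"
    "psc L0 (D_v N1 p) (N1 p) = D_v lam p * exp (2 * lam p)"
    "psc L0 (D_u N2 p) (N2 p) = - (D_u lam p * exp (2 * lam p))"
    "psc L0 (D_v N2 p) (N2 p) = - (D_v lam p * exp (2 * lam p))"
    "psc L0 (D_u N2 p) (N1 p) = - psc L0 (D_u N1 p) (N2 p)"
    "psc L0 (D_v N2 p) (N1 p) = - psc L0 (D_v N1 p) (N2 p)"
proof -
  have z: "D_u (\<lambda>q. 0::real) p = 0" "D_v (\<lambda>q. 0::real) p = 0" by (simp_all add: D_u_def D_v_def)
  have 3: "\<forall>q\<in>D. psc L0 (N1 q) (N2 q) = 0" using frame_products by simp
  have 1: "\<forall>q\<in>D. psc L0 (N1 q) (N1 q) = 1 * exp (2 * lam q)" using frame_products by simp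
  have 2: "\<forall>q\<in>D. psc L0 (N2 q) (N2 q) = (-1) * exp (2 * lam q)" using frame_products by simp
  note a = D_psc[OF p smooth_N(1) smooth_N(1) smooth_exp_lam 1, unfolded D_exp_lam[OF p]]
    D_psc[OF p smooth_N(2) smooth_N(2) smooth_exp_lam 2, unfolded D_exp_lam[OF p]]
    D_psc[OF p smooth_N(1) smooth_N(2) smooth_on_const 3, unfolded z]
  note cm = psc_commute[of L0 "N1 p" "D_u N1 p"] psc_commute[of L0 "N2 p" "D_u N2 p"]
    psc_commute[of L0 "N1 p" "D_v N1 p"] psc_commute[of L0 "N2 p" "D_v N2 p"]
    psc_commute[of L0 "N1 p" "D_u N2 p"] psc_commute[of L0 "N1 p" "D_v N2 p"]
  show "psc L0 (D_u N1 p) (N1 p) = D_u lam p * exp (2 * lam p)"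
    "psc L0 (D_v N1 p) (N1 p) = D_v lam p * exp (2 * lam p)"
    "psc L0 (D_u N2 p) (N2 p) = - (D_u lam p * exp (2 * lam p))"
    "psc L0 (D_v N2 p) (N2 p) = - (D_v lam p * exp (2 * lam p))"
    "psc L0 (D_u N2 p) (N1 p) = - psc L0 (D_u N1 p) (N2 p)"
    "psc L0 (D_v N2 p) (N1 p) = - psc L0 (D_v N1 p) (N2 p)"
    using a cm by linarith+
qed

text \<open>Explicit coefficients, obtained from products with the normal vectors; hence they are
  smooth. The minus signs come from \<open>h(N2, N2) = - e^(2 \<lambda>)\<close>.\<close>

definition "al1 p = psc L0 (D_u (D_u X) p) (N1 p) / exp (2 * lam p)"
definition "al2 p = psc L0 (D_u (D_v X) p) (N1 p) / exp (2 * lam p)"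
definition "be1 p = - psc L0 (D_u (D_u X) p) (N2 p) / exp (2 * lam p)"
definition "be2 p = - psc L0 (D_u (D_v X) p) (N2 p) / exp (2 * lam p)"
definition "mu1 p = - psc L0 (D_u N1 p) (N2 p) / exp (2 * lam p)"
definition "mu2 p = - psc L0 (D_v N1 p) (N2 p) / exp (2 * lam p)"

lemma smooth_coefficients:
  "smooth_on D al1" "smooth_on D al2" "smooth_on D be1" "smooth_on D be2" "smooth_on D mu1" "smooth_on D mu2"
  unfolding al1_def[abs_def] al2_def[abs_def] be1_def[abs_def] be2_def[abs_def] mu1_def[abs_def] mu2_def[abs_def]
  by (intro smooth_on_divide smooth_on_psc smooth_intros smooth_lam open_D smooth_on_D smooth_X smooth_N; simp)+

text \<open>Both sides of each equation are tangent to the space form, so products with the four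
  frame vectors decide. The hypothesis on the mean curvature enters through the normal components of
  \<open>D_v (D_v X)\<close>.\<close>

lemma associated_functions_exist:
  assumes H: "\<And>p. p \<in> D \<Longrightarrow> mean_curvature_vector L0 X p = 0"
  shows "associated_functions L0 D X N1 N2 lam al1 al2 be1 be2 mu1 mu2"
  unfolding associated_functions_def Let_def
proof (intro ballI conjI)
  fix p assume p: "p \<in> D"
  let ?E = "exp (2 * lam p)"
  have E: "?E \<noteq> 0" by simp
  have coef: "psc L0 (D_u (D_u X) p) (N1 p) = al1 p * ?E" "psc L0 (D_u (D_v X) p) (N1 p) = al2 p * ?E"
    "psc L0 (D_u (D_u X) p) (N2 p) = - (be1 p * ?E)" "psc L0 (D_u (D_v X) p) (N2 p) = - (be2 p * ?E)"
    "psc L0 (D_u N1 p) (N2 p) = - (mu1 p * ?E)" "psc L0 (D_v N1 p) (N2 p) = - (mu2 p * ?E)"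
    by (simp_all add: al1_def al2_def be1_def be2_def mu1_def mu2_def)
  have vv: "psc L0 (D_v (D_v X) p) (N1 p) = al1 p * ?E" "psc L0 (D_v (D_v X) p) (N2 p) = - (be1 p * ?E)"
    using zero_mean_normal[OF p H[OF p]] tangent_N[OF p] frame_products[OF p] coef by auto
  note t = tangent_T[OF p] tangent_N[OF p]
  have nabt: "nabla L0 X v Y p \<in> tangent_sp L0 (X p)"
    if "smooth_on D Y" "\<And>q. q \<in> D \<Longrightarrow> Y q \<in> tangent_sp L0 (X q)" for Y v
    using nabla_tangent[OF open_D p diff_at[OF that(1) p] in_space_form[OF p] that(2)] .
  have nab: "psc L0 (nabla L0 X (1, 0) Y p) w = psc L0 (D_u Y p) w" "psc L0 (nabla L0 X (0, 1) Y p) w = psc L0 (D_v Y p) w"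
    if "w \<in> tangent_sp L0 (X p)" for Y w
    using psc_nabla[where X=X and p=p, OF in_space_form[OF p] that] by (auto simp: D_u_def D_v_def)
  note n = nab nabt[OF smooth_T(1) tangent_T(1)] nabt[OF smooth_T(2) tangent_T(2)]
    nabt[OF smooth_N(1) tangent_N(1)] nabt[OF smooth_N(2) tangent_N(2)]
  note prods = psc_linear metric[OF p] frame_products[OF p] X_uv[OF p] X_second_tangential[OF p]
    N_first_tangential[OF p] N_first_normal[OF p] coef vv t
  show "nabla L0 X (1, 0) (D_u X) p = D_u lam p *\<^sub>R D_u X p + D_v lam p *\<^sub>R D_v X p + al1 p *\<^sub>R N1 p + be1 p *\<^sub>R N2 p"
    by (rule tangent_eqI[OF p]) (simp_all add: tangent_sp_linear n prods)
  show "nabla L0 X (1, 0) (D_v X) p = D_v lam p *\<^sub>R D_u X p + D_u lam p *\<^sub>R D_v X p + al2 p *\<^sub>R N1 p + be2 p *\<^sub>R N2 p"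
    by (rule tangent_eqI[OF p]) (simp_all add: tangent_sp_linear n prods)
  show "nabla L0 X (0, 1) (D_u X) p = D_v lam p *\<^sub>R D_u X p + D_u lam p *\<^sub>R D_v X p + al2 p *\<^sub>R N1 p + be2 p *\<^sub>R N2 p"
    by (rule tangent_eqI[OF p]) (simp_all add: tangent_sp_linear n prods)
  show "nabla L0 X (0, 1) (D_v X) p = D_u lam p *\<^sub>R D_u X p + D_v lam p *\<^sub>R D_v X p + al1 p *\<^sub>R N1 p + be1 p *\<^sub>R N2 p"
    by (rule tangent_eqI[OF p]) (simp_all add: tangent_sp_linear n prods)
  show "nabla L0 X (1, 0) N1 p = - al1 p *\<^sub>R D_u X p + al2 p *\<^sub>R D_v X p + D_u lam p *\<^sub>R N1 p + mu1 p *\<^sub>R N2 p"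
    by (rule tangent_eqI[OF p]) (simp_all add: tangent_sp_linear n prods)
  show "nabla L0 X (1, 0) N2 p = be1 p *\<^sub>R D_u X p - be2 p *\<^sub>R D_v X p + mu1 p *\<^sub>R N1 p + D_u lam p *\<^sub>R N2 p"
    by (rule tangent_eqI[OF p]) (simp_all add: tangent_sp_linear n prods)
  show "nabla L0 X (0, 1) N1 p = - al2 p *\<^sub>R D_u X p + al1 p *\<^sub>R D_v X p + D_v lam p *\<^sub>R N1 p + mu2 p *\<^sub>R N2 p"
    by (rule tangent_eqI[OF p]) (simp_all add: tangent_sp_linear n prods)
  show "nabla L0 X (0, 1) N2 p = be2 p *\<^sub>R D_u X p - be1 p *\<^sub>R D_v X p + mu2 p *\<^sub>R N1 p + D_v lam p *\<^sub>R N2 p"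
    by (rule tangent_eqI[OF p]) (simp_all add: tangent_sp_linear n prods)
qed

end

section \<open>The frame equations\<close>

lemma bounded_linear_axis: "bounded_linear (axis i :: 'b::euclidean_space \<Rightarrow> 'b^'n)"
  unfolding linear_conv_bounded_linear[symmetric] by (auto intro!: linearI simp: vec_eq_iff axis_def)

lemma rows5_axis:
  "rows5 a b c d (e :: 'b::euclidean_space) = axis 1 a + axis 2 b + axis 3 c + axis 4 d + axis 5 e"
  by (simp add: vec_eq_iff forall_5 axis_def)

lemma smooth_on_rows5:
  fixes a b c d e :: "plane \<Rightarrow> 'b::euclidean_space"
  assumes "open S" "smooth_on S a" "smooth_on S b" "smooth_on S c" "smooth_on S d" "smooth_on S e"
  shows "smooth_on S (\<lambda>p. rows5 (a p) (b p) (c p) (d p) (e p))"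
  unfolding rows5_axis
  by (intro smooth_on_add smooth_on_bounded_linear_compose[OF bounded_linear_axis] assms)

lemma fd_rows5:
  fixes a b c d e :: "plane \<Rightarrow> 'b::euclidean_space"
  assumes "open S" "p \<in> S" "smooth_on S a" "smooth_on S b" "smooth_on S c" "smooth_on S d" "smooth_on S e"
  shows "frechet_derivative (\<lambda>p. rows5 (a p) (b p) (c p) (d p) (e p)) (at p) v =
    rows5 (frechet_derivative a (at p) v) (frechet_derivative b (at p) v) (frechet_derivative c (at p) v)
      (frechet_derivative d (at p) v) (frechet_derivative e (at p) v)"
proof -
  have d: "(\<lambda>p. rows5 (a p) (b p) (c p) (d p) (e p)) differentiable (at p)"
    by (rule smooth_on_differentiable[OF smooth_on_rows5[OF assms(1,3-)] assms(2)])
  have L: "bounded_linear (\<lambda>x :: 'b^5. x $ i)" for i by (rule bounded_linear_vec_nth)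
  show ?thesis unfolding eq_rows5_iff
    using fd_bounded_linear[OF L[of 1] d, of v] fd_bounded_linear[OF L[of 2] d, of v]
      fd_bounded_linear[OF L[of 3] d, of v] fd_bounded_linear[OF L[of 4] d, of v]
      fd_bounded_linear[OF L[of 5] d, of v]
    by simp
qed

lemma sgn_sqrt_abs: "sgn L0 * sqrt \<bar>L0\<bar> * sqrt \<bar>L0\<bar> = L0"
  by (simp add: mult.assoc sgn_mult_abs)

lemma sgn_sqrt_scaleR:
  "(sgn L0 * sqrt \<bar>L0\<bar>) *\<^sub>R (if L0 = 0 then axis 5 1 else sqrt \<bar>L0\<bar> *\<^sub>R x) = L0 *\<^sub>R (x :: real^5)"
  by (simp add: sgn_sqrt_abs del: mult_sgn_abs)

context framed_surface
begin

abbreviation "fm \<equiv> frame_matrix L0 X lam N1 N2"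

lemma smooth_frame_matrix: "smooth_on D fm"
proof -
  have "smooth_on D (\<lambda>p. if L0 = 0 then axis 5 1 else sqrt \<bar>L0\<bar> *\<^sub>R X p)"
    by (intro smooth_on_if smooth_intros open_D smooth_X)
  then show ?thesis unfolding frame_matrix_def[abs_def]
    by (intro smooth_on_rows5 smooth_intros open_D smooth_lam smooth_T smooth_N)
qed

lemma fd_scaled:
  fixes Y :: "plane \<Rightarrow> real^5"
  assumes "p \<in> D" "smooth_on D Y"
  shows "frechet_derivative (\<lambda>p. exp (- lam p) *\<^sub>R Y p) (at p) v =
    exp (- lam p) *\<^sub>R (frechet_derivative Y (at p) v - frechet_derivative lam (at p) v *\<^sub>R Y p)"
proof -
  have d: "lam differentiable (at p)" "Y differentiable (at p)" "(\<lambda>p. - lam p) differentiable (at p)"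
    "(\<lambda>p. exp (- lam p)) differentiable (at p)"
    by (intro diff_at[OF _ assms(1)] smooth_intros smooth_lam open_D assms)+
  have "frechet_derivative (\<lambda>p. - lam p) (at p) v = - frechet_derivative lam (at p) v"
    by (rule fd_bounded_linear[OF bounded_linear_minus[OF bounded_linear_ident] d(1)])
  then show ?thesis by (subst fd_scaleR[OF d(4,2)]) (simp add: fd_exp[OF d(3)] algebra_simps)
qed

lemma fd_frame_matrix:
  assumes p: "p \<in> D"
  defines "l \<equiv> \<lambda>v. frechet_derivative lam (at p) v"
  defines "n \<equiv> \<lambda>v Y. exp (- lam p) *\<^sub>R (nabla L0 X v Y p
    - (L0 * psc L0 (Y p) (frechet_derivative X (at p) v)) *\<^sub>R X p - l v *\<^sub>R Y p)"
  shows "frechet_derivative fm (at p) v = rows5 (n v (D_u X)) (n v N1) (n v (D_v X)) (n v N2)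
    (sqrt \<bar>L0\<bar> *\<^sub>R frechet_derivative X (at p) v)"
proof -
  have s5: "smooth_on D (\<lambda>p. if L0 = 0 then axis 5 1 else sqrt \<bar>L0\<bar> *\<^sub>R X p)"
    by (intro smooth_on_if smooth_intros open_D smooth_X)
  have 5: "frechet_derivative (\<lambda>p. if L0 = 0 then axis 5 1 else sqrt \<bar>L0\<bar> *\<^sub>R X p) (at p) v =
      sqrt \<bar>L0\<bar> *\<^sub>R frechet_derivative X (at p) v"
    by (cases "L0 = 0") (simp_all add: fd_bounded_linear[OF bounded_linear_scaleR_right diff_at[OF smooth_X p]])
  have n: "frechet_derivative (\<lambda>p. exp (- lam p) *\<^sub>R Y p) (at p) v = n v Y"
    if "smooth_on D Y" "\<And>q. q \<in> D \<Longrightarrow> Y q \<in> tangent_sp L0 (X q)" for Y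
    using nabla_eq[where X=X and Y=Y, OF open_D p diff_at[OF smooth_X p] diff_at[OF that(1) p] that(2), of v]
    by (simp add: fd_scaled[OF p that(1)] n_def l_def)
  show ?thesis unfolding frame_matrix_def[abs_def]
    by (subst fd_rows5[OF open_D p])
      (auto intro!: smooth_intros open_D smooth_lam smooth_T smooth_N s5
        simp: 5 n[OF smooth_T(1) tangent_T(1)] n[OF smooth_T(2) tangent_T(2)]
          n[OF smooth_N(1) tangent_N(1)] n[OF smooth_N(2) tangent_N(2)])
qed

lemma frame_row_iff:
  fixes n x y z :: "real^5"
  shows "exp (- l) *\<^sub>R (n - c *\<^sub>R x - d *\<^sub>R y) = exp (- l) *\<^sub>R (z - c *\<^sub>R x) \<longleftrightarrow> n = d *\<^sub>R y + z"
  unfolding scaleR_cancel_left by (auto simp: algebra_simps)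

text \<open>Every row displays a multiple of \<open>X p\<close>, even when its coefficient is 0:
  \<open>frame_row_iff\<close> cancels this term against the one in
  \<open>fd_frame_matrix\<close>.\<close>

lemma conn_frame:
  assumes p: "p \<in> D"
  shows "conn_u L0 lam a1 a2 b1 b2 m1 p ** fm p = rows5
    (exp (- lam p) *\<^sub>R ((a1 p *\<^sub>R N1 p + D_v lam p *\<^sub>R D_v X p + b1 p *\<^sub>R N2 p) - (L0 * exp (2 * lam p)) *\<^sub>R X p))
    (exp (- lam p) *\<^sub>R ((- a1 p *\<^sub>R D_u X p + a2 p *\<^sub>R D_v X p + m1 p *\<^sub>R N2 p) - 0 *\<^sub>R X p))
    (exp (- lam p) *\<^sub>R ((D_v lam p *\<^sub>R D_u X p + a2 p *\<^sub>R N1 p + b2 p *\<^sub>R N2 p) - 0 *\<^sub>R X p))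
    (exp (- lam p) *\<^sub>R ((b1 p *\<^sub>R D_u X p + m1 p *\<^sub>R N1 p + - b2 p *\<^sub>R D_v X p) - 0 *\<^sub>R X p))
    (sqrt \<bar>L0\<bar> *\<^sub>R D_u X p)"
    (is "?A = rows5 ?a1 ?a2 ?a3 ?a4 ?a5")
  and "conn_v L0 lam a1 a2 b1 b2 m2 p ** fm p = rows5
    (exp (- lam p) *\<^sub>R ((a2 p *\<^sub>R N1 p + D_u lam p *\<^sub>R D_v X p + b2 p *\<^sub>R N2 p) - 0 *\<^sub>R X p))
    (exp (- lam p) *\<^sub>R ((- a2 p *\<^sub>R D_u X p + a1 p *\<^sub>R D_v X p + m2 p *\<^sub>R N2 p) - 0 *\<^sub>R X p))
    (exp (- lam p) *\<^sub>R ((D_u lam p *\<^sub>R D_u X p + a1 p *\<^sub>R N1 p + b1 p *\<^sub>R N2 p) - (- (L0 * exp (2 * lam p))) *\<^sub>R X p))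
    (exp (- lam p) *\<^sub>R ((b2 p *\<^sub>R D_u X p + m2 p *\<^sub>R N1 p + - b1 p *\<^sub>R D_v X p) - 0 *\<^sub>R X p))
    (sqrt \<bar>L0\<bar> *\<^sub>R D_v X p)"
    (is "?B = rows5 ?b1 ?b2 ?b3 ?b4 ?b5")
proof -
  have ee: "exp (- lam p) * (L0 * exp (2 * lam p)) = L0 * exp (lam p)"
    by (simp add: exp_add[symmetric] mult.commute[of L0] mult.assoc[symmetric])
  have e1: "exp (lam p) * exp (- lam p) = 1" by (simp add: exp_add[symmetric])
  have s: "(sgn L0 * sqrt \<bar>L0\<bar> * exp (lam p)) *\<^sub>R (if L0 = 0 then axis 5 1 else sqrt \<bar>L0\<bar> *\<^sub>R X p) =
      (L0 * exp (lam p)) *\<^sub>R X p"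
    using arg_cong[OF sgn_sqrt_scaleR[of L0 "X p"], of "\<lambda>x. exp (lam p) *\<^sub>R x"]
    by (simp add: mult_ac del: mult_sgn_abs)
  have s': "(- sgn L0 * sqrt \<bar>L0\<bar> * exp (lam p)) *\<^sub>R (if L0 = 0 then axis 5 1 else sqrt \<bar>L0\<bar> *\<^sub>R X p) =
      - ((L0 * exp (lam p)) *\<^sub>R X p)"
    using s by (metis minus_mult_left scaleR_minus_left)
  have r: "exp (- lam p) *\<^sub>R (z - (L0 * exp (2 * lam p)) *\<^sub>R X p) = exp (- lam p) *\<^sub>R z - (L0 * exp (lam p)) *\<^sub>R X p"
    "exp (- lam p) *\<^sub>R (z - (- (L0 * exp (2 * lam p))) *\<^sub>R X p) = exp (- lam p) *\<^sub>R z + (L0 * exp (lam p)) *\<^sub>R X p" for z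
    by (simp_all add: scaleR_diff_right scaleR_add_right ee)
  have t: "(sqrt \<bar>L0\<bar> * exp (lam p)) *\<^sub>R exp (- lam p) *\<^sub>R y = sqrt \<bar>L0\<bar> *\<^sub>R y" for y :: "real^5"
    using e1 by (simp add: mult.assoc)
  show "?A = rows5 ?a1 ?a2 ?a3 ?a4 ?a5"
    unfolding conn_u_def frame_matrix_def rows5_mult s s' r t by (simp add: eq_rows5_iff algebra_simps)
  show "?B = rows5 ?b1 ?b2 ?b3 ?b4 ?b5"
    unfolding conn_v_def frame_matrix_def rows5_mult s s' r t by (simp add: eq_rows5_iff algebra_simps)
qed

text \<open>Rows 1 to 4 of the two matrix equations are the eight structure equations, up to the
  factor \<open>e^(- \<lambda>)\<close> and the term in the direction of \<open>X p\<close>. The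
  fifth rows agree in any case, as both are multiples of the derivative of \<open>X\<close>.\<close>

lemma frame_equations_iff:
  "(\<forall>p\<in>D. D_u fm p = conn_u L0 lam a1 a2 b1 b2 m1 p ** fm p \<and> D_v fm p = conn_v L0 lam a1 a2 b1 b2 m2 p ** fm p)
    \<longleftrightarrow> associated_functions L0 D X N1 N2 lam a1 a2 b1 b2 m1 m2"
  unfolding associated_functions_def Let_def
proof (rule ball_cong[OF refl])
  fix p assume p: "p \<in> D"
  note m = metric[OF p] frame_products[OF p]
  have u: "D_u fm p = conn_u L0 lam a1 a2 b1 b2 m1 p ** fm p \<longleftrightarrow>
      nabla L0 X (1, 0) (D_u X) p = D_u lam p *\<^sub>R D_u X p + (a1 p *\<^sub>R N1 p + D_v lam p *\<^sub>R D_v X p + b1 p *\<^sub>R N2 p) \<and>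
      nabla L0 X (1, 0) N1 p = D_u lam p *\<^sub>R N1 p + (- a1 p *\<^sub>R D_u X p + a2 p *\<^sub>R D_v X p + m1 p *\<^sub>R N2 p) \<and>
      nabla L0 X (1, 0) (D_v X) p = D_u lam p *\<^sub>R D_v X p + (D_v lam p *\<^sub>R D_u X p + a2 p *\<^sub>R N1 p + b2 p *\<^sub>R N2 p) \<and>
      nabla L0 X (1, 0) N2 p = D_u lam p *\<^sub>R N2 p + (b1 p *\<^sub>R D_u X p + m1 p *\<^sub>R N1 p + - b2 p *\<^sub>R D_v X p)"
    unfolding conn_frame[OF p] D_u_def[of fm] fd_frame_matrix[OF p]
    unfolding D_u_def[symmetric] m mult_zero_right eq_rows5_iff
      rows5_nth frame_row_iff
    by simp
  have v: "D_v fm p = conn_v L0 lam a1 a2 b1 b2 m2 p ** fm p \<longleftrightarrow>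
      nabla L0 X (0, 1) (D_u X) p = D_v lam p *\<^sub>R D_u X p + (a2 p *\<^sub>R N1 p + D_u lam p *\<^sub>R D_v X p + b2 p *\<^sub>R N2 p) \<and>
      nabla L0 X (0, 1) N1 p = D_v lam p *\<^sub>R N1 p + (- a2 p *\<^sub>R D_u X p + a1 p *\<^sub>R D_v X p + m2 p *\<^sub>R N2 p) \<and>
      nabla L0 X (0, 1) (D_v X) p = D_v lam p *\<^sub>R D_v X p + (D_u lam p *\<^sub>R D_u X p + a1 p *\<^sub>R N1 p + b1 p *\<^sub>R N2 p) \<and>
      nabla L0 X (0, 1) N2 p = D_v lam p *\<^sub>R N2 p + (b2 p *\<^sub>R D_u X p + m2 p *\<^sub>R N1 p + - b1 p *\<^sub>R D_v X p)"
    unfolding conn_frame[OF p] D_v_def[of fm] fd_frame_matrix[OF p]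
    unfolding D_v_def[symmetric] m mult_zero_right mult_minus_right
      eq_rows5_iff rows5_nth frame_row_iff
    by simp
  show "(D_u fm p = conn_u L0 lam a1 a2 b1 b2 m1 p ** fm p \<and> D_v fm p = conn_v L0 lam a1 a2 b1 b2 m2 p ** fm p) \<longleftrightarrow>
       nabla L0 X (1, 0) (D_u X) p
         = D_u lam p *\<^sub>R D_u X p + D_v lam p *\<^sub>R D_v X p + a1 p *\<^sub>R N1 p + b1 p *\<^sub>R N2 p \<and>
       nabla L0 X (1, 0) (D_v X) p
         = D_v lam p *\<^sub>R D_u X p + D_u lam p *\<^sub>R D_v X p + a2 p *\<^sub>R N1 p + b2 p *\<^sub>R N2 p \<and>
       nabla L0 X (0, 1) (D_u X) p
         = D_v lam p *\<^sub>R D_u X p + D_u lam p *\<^sub>R D_v X p + a2 p *\<^sub>R N1 p + b2 p *\<^sub>R N2 p \<and>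
       nabla L0 X (0, 1) (D_v X) p
         = D_u lam p *\<^sub>R D_u X p + D_v lam p *\<^sub>R D_v X p + a1 p *\<^sub>R N1 p + b1 p *\<^sub>R N2 p \<and>
       nabla L0 X (1, 0) N1 p
         = - a1 p *\<^sub>R D_u X p + a2 p *\<^sub>R D_v X p + D_u lam p *\<^sub>R N1 p + m1 p *\<^sub>R N2 p \<and>
       nabla L0 X (1, 0) N2 p
         = b1 p *\<^sub>R D_u X p - b2 p *\<^sub>R D_v X p + m1 p *\<^sub>R N1 p + D_u lam p *\<^sub>R N2 p \<and>
       nabla L0 X (0, 1) N1 p
         = - a2 p *\<^sub>R D_u X p + a1 p *\<^sub>R D_v X p + D_v lam p *\<^sub>R N1 p + m2 p *\<^sub>R N2 p \<and>
       nabla L0 X (0, 1) N2 p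
         = b2 p *\<^sub>R D_u X p - b1 p *\<^sub>R D_v X p + m2 p *\<^sub>R N1 p + D_v lam p *\<^sub>R N2 p"
    unfolding u v by (simp only: ac_simps diff_conv_add_uminus scaleR_minus_left[symmetric])
qed

text \<open>Reduces statements about any associated functions to the explicit products with the
  normal vectors.\<close>

lemma associated_determined:
  assumes as: "associated_functions L0 D X N1 N2 lam a1 a2 b1 b2 m1 m2" and p: "p \<in> D"
  shows "a1 p = al1 p" "a2 p = al2 p" "b1 p = be1 p" "b2 p = be2 p"
proof -
  note t = tangent_N[OF p]
  have n: "psc L0 (nabla L0 X (1, 0) Y p) w = psc L0 (D_u Y p) w" if "w \<in> tangent_sp L0 (X p)" for Y w
    using psc_nabla[where X=X and p=p, OF in_space_form[OF p] that] by (auto simp: D_u_def)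
  have 1: "nabla L0 X (1, 0) (D_u X) p
         = D_u lam p *\<^sub>R D_u X p + D_v lam p *\<^sub>R D_v X p + a1 p *\<^sub>R N1 p + b1 p *\<^sub>R N2 p"
    and 2: "nabla L0 X (1, 0) (D_v X) p
         = D_v lam p *\<^sub>R D_u X p + D_u lam p *\<^sub>R D_v X p + a2 p *\<^sub>R N1 p + b2 p *\<^sub>R N2 p"
    using as p by (simp_all add: associated_functions_def Let_def)
  show "a1 p = al1 p" "b1 p = be1 p"
    using arg_cong[OF 1, of "\<lambda>w. psc L0 w (N1 p)"] arg_cong[OF 1, of "\<lambda>w. psc L0 w (N2 p)"]
    by (simp_all add: n t psc_linear metric[OF p] frame_products[OF p] al1_def be1_def)
  show "a2 p = al2 p" "b2 p = be2 p"
    using arg_cong[OF 2, of "\<lambda>w. psc L0 w (N1 p)"] arg_cong[OF 2, of "\<lambda>w. psc L0 w (N2 p)"]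
    by (simp_all add: n t psc_linear metric[OF p] frame_products[OF p] al2_def be2_def)
qed

end

section \<open>The equations of Gauss, Codazzi and Ricci\<close>

text \<open>The first equation is that of Gauss, the next four are those of Codazzi, and the last is
  that of Ricci.\<close>

definition gauss_codazzi_ricci ::
  "real \<Rightarrow> (plane \<Rightarrow> real) \<Rightarrow> (plane \<Rightarrow> real) \<Rightarrow> (plane \<Rightarrow> real) \<Rightarrow> (plane \<Rightarrow> real) \<Rightarrow> (plane \<Rightarrow> real) \<Rightarrow>
   (plane \<Rightarrow> real) \<Rightarrow> (plane \<Rightarrow> real) \<Rightarrow> plane \<Rightarrow> bool" where
  "gauss_codazzi_ricci L0 lam a1 a2 b1 b2 m1 m2 p \<longleftrightarrow>
     D_v (D_v lam) p - D_u (D_u lam) p + a1 p * a1 p - b1 p * b1 p - a2 p * a2 p + b2 p * b2 p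
       - L0 * exp (2 * lam p) = 0 \<and>
     D_v a1 p - D_u a2 p + D_v lam p * a1 p + b1 p * m2 p - D_u lam p * a2 p - b2 p * m1 p = 0 \<and>
     D_v b1 p - D_u b2 p + a1 p * m2 p + D_v lam p * b1 p - a2 p * m1 p - D_u lam p * b2 p = 0 \<and>
     D_v a2 p - D_u a1 p + D_v lam p * a2 p + b2 p * m2 p - D_u lam p * a1 p - b1 p * m1 p = 0 \<and>
     D_v b2 p - D_u b1 p + D_v lam p * b2 p + a2 p * m2 p - D_u lam p * b1 p - a1 p * m1 p = 0 \<and>
     D_v m1 p - D_u m2 p + 2 * (a2 p * b1 p - a1 p * b2 p) = 0"

lemma smooth_on_conn:
  assumes "open D" "smooth_on D lam" "smooth_on D a1" "smooth_on D a2" "smooth_on D b1" "smooth_on D b2"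
    "smooth_on D m1" "smooth_on D m2"
  shows "smooth_on D (conn_u L0 lam a1 a2 b1 b2 m1)" "smooth_on D (conn_v L0 lam a1 a2 b1 b2 m2)"
  unfolding conn_u_def[abs_def] conn_v_def[abs_def]
  by (intro smooth_on_rows5 smooth_intros smooth_on_D assms)+

text \<open>Pure algebra, with the derivatives as independent variables. \<open>c\<close> and
  \<open>d\<close> are the entries produced by the position vector, and their product
  \<open>E = L0 e^(2 \<lambda>)\<close> is the curvature term in the equation of Gauss.\<close>

lemma compatibility_scalar:
  fixes a1 a2 b1 b2 m1 m2 :: real
  assumes cd: "c * d = E"
  shows "rows5 (rows5 0 a1v lvv b1v (- (c * lv))) (rows5 (- a1v) 0 a2v m1v 0) (rows5 lvv a2v 0 b2v 0)
      (rows5 b1v m1v (- b2v) 0 0) (rows5 (d * lv) 0 0 0 0)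
    + rows5 (rows5 0 a1 lv b1 (- c)) (rows5 (- a1) 0 a2 m1 0) (rows5 lv a2 0 b2 0)
        (rows5 b1 m1 (- b2) 0 0) (rows5 d 0 0 0 0)
      ** rows5 (rows5 0 a2 lu b2 0) (rows5 (- a2) 0 a1 m2 0) (rows5 lu a1 0 b1 c)
        (rows5 b2 m2 (- b1) 0 0) (rows5 0 0 d 0 0)
    = rows5 (rows5 0 a2u luu b2u 0) (rows5 (- a2u) 0 a1u m2u 0) (rows5 luu a1u 0 b1u (c * lu))
      (rows5 b2u m2u (- b1u) 0 0) (rows5 0 0 (d * lu) 0 0)
    + rows5 (rows5 0 a2 lu b2 0) (rows5 (- a2) 0 a1 m2 0) (rows5 lu a1 0 b1 c)
        (rows5 b2 m2 (- b1) 0 0) (rows5 0 0 d 0 0)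
      ** rows5 (rows5 0 a1 lv b1 (- c)) (rows5 (- a1) 0 a2 m1 0) (rows5 lv a2 0 b2 0)
        (rows5 b1 m1 (- b2) 0 0) (rows5 d 0 0 0 0)
    \<longleftrightarrow>
     lvv - luu + a1 * a1 - b1 * b1 - a2 * a2 + b2 * b2 - E = 0 \<and>
     a1v - a2u + lv * a1 + b1 * m2 - lu * a2 - b2 * m1 = 0 \<and>
     b1v - b2u + a1 * m2 + lv * b1 - a2 * m1 - lu * b2 = 0 \<and>
     a2v - a1u + lv * a2 + b2 * m2 - lu * a1 - b1 * m1 = 0 \<and>
     b2v - b1u + lv * b2 + a2 * m2 - lu * b1 - a1 * m1 = 0 \<and>
     m1v - m2u + 2 * (a2 * b1 - a1 * b2) = 0"
  unfolding rows5_mult cd[symmetric] vec_eq_iff forall_5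
  by (simp add: algebra_simps) (intro iffI conjI; (elim conjE)?; linarith)

lemma compatibility_iff:
  fixes L0 :: real
  assumes D: "open D" "p \<in> D"
    and s: "smooth_on D lam" "smooth_on D a1" "smooth_on D a2" "smooth_on D b1" "smooth_on D b2"
      "smooth_on D m1" "smooth_on D m2"
  defines "A \<equiv> conn_u L0 lam a1 a2 b1 b2 m1" and "B \<equiv> conn_v L0 lam a1 a2 b1 b2 m2"
  shows "D_v A p + A p ** B p = D_u B p + B p ** A p \<longleftrightarrow> gauss_codazzi_ricci L0 lam a1 a2 b1 b2 m1 m2 p"
proof -
  note df = smooth_on_differentiable[OF _ D(2)]
  have fc: "frechet_derivative (\<lambda>p. c * exp (lam p)) (at p) v = c * exp (lam p) * frechet_derivative lam (at p) v" for c v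
    by (subst fd_cmult) (auto simp: fd_exp df[OF s(1)] intro!: df smooth_intros D s)
  have fm: "frechet_derivative (\<lambda>p. - f p) (at p) v = - frechet_derivative f (at p) v" if "smooth_on D f"
    for f :: "plane \<Rightarrow> real" and v
    by (rule fd_bounded_linear[OF bounded_linear_minus[OF bounded_linear_ident] df[OF that]])
  have sc: "smooth_on D (\<lambda>p. c * exp (lam p))" for c by (intro smooth_intros D s)
  have fcm: "D_u (\<lambda>p. c * exp (lam p)) p = c * exp (lam p) * D_u lam p"
    "D_v (\<lambda>p. c * exp (lam p)) p = c * exp (lam p) * D_v lam p" for c
    unfolding D_u_def D_v_def by (rule fc)+
  have fmm: "D_u (\<lambda>p. - f p) p = - D_u f p" "D_v (\<lambda>p. - f p) p = - D_v f p" if "smooth_on D f"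
    for f :: "plane \<Rightarrow> real"
    unfolding D_u_def D_v_def by (rule fm[OF that])+
  note r = fd_rows5[OF D]
  have A: "D_v A p = rows5 (rows5 0 (D_v a1 p) (D_v (D_v lam) p) (D_v b1 p) (- (sgn L0 * sqrt \<bar>L0\<bar> * exp (lam p) * D_v lam p)))
      (rows5 (- D_v a1 p) 0 (D_v a2 p) (D_v m1 p) 0) (rows5 (D_v (D_v lam) p) (D_v a2 p) 0 (D_v b2 p) 0)
      (rows5 (D_v b1 p) (D_v m1 p) (- D_v b2 p) 0 0) (rows5 (sqrt \<bar>L0\<bar> * exp (lam p) * D_v lam p) 0 0 0 0)"
    unfolding D_v_def[of A] unfolding A_def conn_u_def[abs_def]
    by (subst r; (intro smooth_on_rows5 smooth_intros smooth_on_D s D)?)+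
      (simp add: D_v_def[symmetric] fcm fmm s sc)
  have B: "D_u B p = rows5 (rows5 0 (D_u a2 p) (D_u (D_u lam) p) (D_u b2 p) 0)
      (rows5 (- D_u a2 p) 0 (D_u a1 p) (D_u m2 p) 0)
      (rows5 (D_u (D_u lam) p) (D_u a1 p) 0 (D_u b1 p) (sgn L0 * sqrt \<bar>L0\<bar> * exp (lam p) * D_u lam p))
      (rows5 (D_u b2 p) (D_u m2 p) (- D_u b1 p) 0 0) (rows5 0 0 (sqrt \<bar>L0\<bar> * exp (lam p) * D_u lam p) 0 0)"
    unfolding D_u_def[of B] unfolding B_def conn_v_def[abs_def]
    by (subst r; (intro smooth_on_rows5 smooth_intros smooth_on_D s D)?)+
      (simp add: D_u_def[symmetric] fcm fmm s sc)
  have cd: "(sgn L0 * sqrt \<bar>L0\<bar> * exp (lam p)) * (sqrt \<bar>L0\<bar> * exp (lam p)) = L0 * exp (2 * lam p)"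
    using sgn_sqrt_abs[of L0] by (simp add: mult_exp_exp mult.assoc mult.left_commute)
  show ?thesis
    unfolding A B gauss_codazzi_ricci_def
    unfolding A_def B_def conn_u_def conn_v_def mult_minus_left
    by (rule compatibility_scalar[OF cd])
qed

text \<open>Equality of the mixed derivatives of the frame gives the compatibility condition
  multiplied by the frame, and the frame is invertible.\<close>

lemma (in framed_surface) integrability:
  assumes as: "associated_functions L0 D X N1 N2 lam a1 a2 b1 b2 m1 m2" and p: "p \<in> D"
    and s: "smooth_on D a1" "smooth_on D a2" "smooth_on D b1" "smooth_on D b2" "smooth_on D m1" "smooth_on D m2"
  shows "gauss_codazzi_ricci L0 lam a1 a2 b1 b2 m1 m2 p"
proof -
  let ?A = "conn_u L0 lam a1 a2 b1 b2 m1" and ?B = "conn_v L0 lam a1 a2 b1 b2 m2"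
  have eq: "D_u fm q = ?A q ** fm q" "D_v fm q = ?B q ** fm q" if "q \<in> D" for q
    using as that unfolding frame_equations_iff[symmetric] by blast+
  note c = smooth_on_conn[OF open_D smooth_lam s]
  note df = diff_at[OF _ p]
  have 1: "D_v (D_u fm) p = ?A p ** D_v fm p + D_v ?A p ** fm p"
  proof -
    have "D_v (D_u fm) p = D_v (\<lambda>q. ?A q ** fm q) p"
      unfolding D_v_def
      by (rule fd_cong[OF _ open_D p])
        (auto simp: eq intro!: df smooth_on_bilinear[OF bounded_bilinear_matrix_mult] open_D c smooth_frame_matrix)
    then show ?thesis unfolding D_v_def
      by (simp add: fd_bilinear[OF bounded_bilinear_matrix_mult] df c smooth_frame_matrix)
  qed
  have 2: "D_u (D_v fm) p = ?B p ** D_u fm p + D_u ?B p ** fm p"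
  proof -
    have "D_u (D_v fm) p = D_u (\<lambda>q. ?B q ** fm q) p"
      unfolding D_u_def
      by (rule fd_cong[OF _ open_D p])
        (auto simp: eq intro!: df smooth_on_bilinear[OF bounded_bilinear_matrix_mult] open_D c smooth_frame_matrix)
    then show ?thesis unfolding D_u_def
      by (simp add: fd_bilinear[OF bounded_bilinear_matrix_mult] df c smooth_frame_matrix)
  qed
  have "(D_v ?A p + ?A p ** ?B p) ** fm p = (D_u ?B p + ?B p ** ?A p) ** fm p"
    using 1 2 mixed_partials[OF open_D p smooth_frame_matrix]
    by (simp add: eq[OF p] bounded_bilinear.add_left[OF bounded_bilinear_matrix_mult] matrix_mul_assoc add.commute)
  then have "D_v ?A p + ?A p ** ?B p = D_u ?B p + ?B p ** ?A p"
    by (rule eta_orthogonal_cancel[OF frame_orthonormal[OF p]])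
  then show ?thesis using compatibility_iff[OF open_D p smooth_lam s] by blast
qed

section \<open>Rigidity\<close>

lemma frame_form_derivative:
  fixes F F' :: "plane \<Rightarrow> real^5^5"
  assumes F: "(F has_derivative (\<lambda>z. fst z *\<^sub>R (A ** F p) + snd z *\<^sub>R (B ** F p))) (at p)"
    and F': "(F' has_derivative (\<lambda>z. fst z *\<^sub>R (A ** F' p) + snd z *\<^sub>R (B ** F' p))) (at p)"
    and sk: "transpose A ** eta L0 + eta L0 ** A = 0" "transpose B ** eta L0 + eta L0 ** B = 0"
  shows "((\<lambda>q. transpose (F q) ** eta L0 ** F' q) has_derivative (\<lambda>z. 0)) (at p)"
proof -
  interpret m: bounded_bilinear "(**) :: real^5^5 \<Rightarrow> real^5^5 \<Rightarrow> real^5^5" by (rule bounded_bilinear_matrix_mult)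
  interpret t: bounded_linear "transpose :: real^5^5 \<Rightarrow> real^5^5" by (rule bounded_linear_transpose)
  \<comment> \<open>The connection form evaluated on the direction \<open>z\<close>, so that both
    partial derivatives are treated at once.\<close>
  let ?C = "\<lambda>z::plane. fst z *\<^sub>R A + snd z *\<^sub>R B"
  have dC: "(F has_derivative (\<lambda>z. ?C z ** F p)) (at p)" "(F' has_derivative (\<lambda>z. ?C z ** F' p)) (at p)"
    using F F' by (simp_all add: m.add_left m.scaleR_left)
  have sC: "transpose (?C z) ** eta L0 + eta L0 ** ?C z = 0" for z
  proof -
    have "transpose (?C z) ** eta L0 + eta L0 ** ?C z =
        fst z *\<^sub>R (transpose A ** eta L0 + eta L0 ** A) + snd z *\<^sub>R (transpose B ** eta L0 + eta L0 ** B)"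
      by (simp add: t.add t.scaleR m.add_left m.add_right m.scaleR_left m.scaleR_right algebra_simps)
    then show ?thesis using sk by simp
  qed
  have "((\<lambda>q. transpose (F q) ** eta L0) has_derivative (\<lambda>z. transpose (?C z ** F p) ** eta L0)) (at p)"
    by (rule bounded_linear.has_derivative[OF m.bounded_linear_left t.has_derivative[OF dC(1)]])
  from m.FDERIV[OF this dC(2)]
  have "((\<lambda>q. transpose (F q) ** eta L0 ** F' q) has_derivative
      (\<lambda>z. transpose (F p) ** eta L0 ** (?C z ** F' p) + transpose (?C z ** F p) ** eta L0 ** F' p)) (at p)" .
  moreover have "transpose P ** eta L0 ** (C ** Q) + transpose (C ** P) ** eta L0 ** Q =
      transpose P ** (transpose C ** eta L0 + eta L0 ** C) ** Q" for P C Q :: "real^5^5"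
    by (simp only: matrix_transpose_mul m.add_left m.add_right matrix_mul_assoc add.commute)
  then have "transpose (F p) ** eta L0 ** (?C z ** F' p) + transpose (?C z ** F p) ** eta L0 ** F' p = 0" for z
    by (simp only: sC m.zero_left m.zero_right)
  ultimately show ?thesis by simp
qed

lemma eta_orthogonal_cancel_left:
  assumes F: "F ** eta L0 ** transpose F = eta L0" and eq: "F ** M = F ** N"
  shows "M = N"
proof -
  have "(eta L0 ** transpose F ** eta L0) ** F ** M = (eta L0 ** transpose F ** eta L0) ** F ** N"
    using eq by (simp only: matrix_mul_assoc[symmetric])
  then show ?thesis unfolding eta_orthogonal_inverse(2)[OF F] by simp
qed

lemma frames_congruent:
  fixes F F' :: "plane \<Rightarrow> real^5^5"
  assumes U: "open U" "connected U"
    and F: "\<And>p. p \<in> U \<Longrightarrow> (F has_derivative (\<lambda>z. fst z *\<^sub>R (A p ** F p) + snd z *\<^sub>R (B p ** F p))) (at p)"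
    and F': "\<And>p. p \<in> U \<Longrightarrow> (F' has_derivative (\<lambda>z. fst z *\<^sub>R (A p ** F' p) + snd z *\<^sub>R (B p ** F' p))) (at p)"
    and sk: "\<And>p. transpose (A p) ** eta L0 + eta L0 ** A p = 0" "\<And>p. transpose (B p) ** eta L0 + eta L0 ** B p = 0"
    and o: "\<And>p. p \<in> U \<Longrightarrow> F p ** eta L0 ** transpose (F p) = eta L0"
      "\<And>p. p \<in> U \<Longrightarrow> F' p ** eta L0 ** transpose (F' p) = eta L0"
    and ne: "p0 \<in> U"
  obtains G where "G ** eta L0 ** transpose G = eta L0" "\<And>p. p \<in> U \<Longrightarrow> F' p = F p ** G"
proof -
  define H where "H = (\<lambda>p. transpose (F p) ** eta L0 ** F' p)"
  have H: "H p = H p0" if "p \<in> U" for p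
    by (rule has_derivative_zero_unique_connected[OF U _ that ne])
      (use frame_form_derivative[OF F F' sk] in \<open>simp add: H_def\<close>)
  \<comment> \<open>As \<open>eta F^T eta\<close> inverts \<open>F\<close> and \<open>H\<close> is
    constant, this is the quotient of the two frames at every point of \<open>U\<close>.\<close>
  let ?G = "eta L0 ** H p0"
  have G: "F' p = F p ** ?G" if p: "p \<in> U" for p
  proof -
    have "F p ** ?G = (F p ** eta L0 ** transpose (F p)) ** eta L0 ** F' p"
      unfolding H[OF p, symmetric] unfolding H_def by (simp add: matrix_mul_assoc)
    then show ?thesis by (simp add: o(1)[OF p])
  qed
  have "F p0 ** (?G ** eta L0 ** transpose ?G) ** transpose (F p0) = eta L0"
    using o(2)[OF ne] unfolding G[OF ne] matrix_transpose_mul by (simp add: matrix_mul_assoc)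
  then have "(F p0 ** (?G ** eta L0 ** transpose ?G)) ** transpose (F p0) = (F p0 ** eta L0) ** transpose (F p0)"
    using o(1)[OF ne] by simp
  then have "F p0 ** (?G ** eta L0 ** transpose ?G) = F p0 ** eta L0"
    by (rule eta_orthogonal_cancel[of "transpose (F p0)" L0, rotated])
      (simp add: transpose_transpose eta_orthogonal_inverse(3)[OF o(1)[OF ne]])
  then have "?G ** eta L0 ** transpose ?G = eta L0"
    by (rule eta_orthogonal_cancel_left[OF o(1)[OF ne]])
  then show thesis using that G by blast
qed

section \<open>Isometries of the space form and congruence of surfaces\<close>

lemma pse_inner: "pse L0 x y = x \<bullet> (eta L0 *v y)"
proof -
  have "(eta L0 *v y) $ i = sg5 L0 $ i * y $ i" for i
    by (simp add: eta_def matrix_vector_mult_def if_distrib[of "\<lambda>x. x * _"] sum.delta cong: if_cong)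
  then show ?thesis by (simp add: pse_def inner_vec_def mult_ac)
qed

lemma pse_orthogonal:
  assumes "G ** eta L0 ** transpose G = eta L0"
  shows "pse L0 (transpose G *v x) (transpose G *v y) = pse L0 x y"
proof -
  have "(transpose G *v x) \<bullet> w = x \<bullet> (G *v w)" for w
    by (simp add: transpose_matrix_vector dot_lmul_matrix)
  then show ?thesis
    by (simp only: pse_inner matrix_vector_mul_assoc matrix_mul_assoc assms)
qed

text \<open>Frame vectors are rows, so a right factor \<open>G\<close> of the frame acts on vectors
  by its transpose. For \<open>L0 = 0\<close> the fifth coordinate is the product with the fixed
  vector \<open>axis 5 1\<close> and is therefore preserved.\<close>

lemma affine_preserves:
  assumes G: "G ** eta L0 ** transpose G = eta L0"
    and c: "if L0 = 0 then c $ 5 = 0 \<and> transpose G *v axis 5 1 = axis 5 1 else c = 0"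
  shows "x \<in> space_form L0 \<Longrightarrow> transpose G *v x + c \<in> space_form L0"
    and "v \<in> tangent_sp L0 x \<Longrightarrow> w \<in> tangent_sp L0 x \<Longrightarrow>
      psc L0 (transpose G *v v) (transpose G *v w) = psc L0 v w"
    and "L0 = 0 \<Longrightarrow> (transpose G *v x) $ 5 = x $ 5"
proof -
  have 5: "(transpose G *v x) $ 5 = x $ 5" if "L0 = 0" for x
  proof -
    have e: "pse L0 y (axis 5 1) = y $ 5" for y using that by (simp add: pse_def sum_5 axis_def sg5_def)
    have "pse L0 (transpose G *v x) (transpose G *v axis 5 1) = pse L0 x (axis 5 1)" by (rule pse_orthogonal[OF G])
    then show ?thesis using c that e by simp
  qed
  then show "L0 = 0 \<Longrightarrow> (transpose G *v x) $ 5 = x $ 5" .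
  show "transpose G *v x + c \<in> space_form L0" if "x \<in> space_form L0"
    using that c 5[of x] pse_orthogonal[OF G, of x x] by (auto simp: space_form_def pse_psc split: if_splits)
  show "psc L0 (transpose G *v v) (transpose G *v w) = psc L0 v w"
    if "v \<in> tangent_sp L0 x" "w \<in> tangent_sp L0 x"
  proof -
    have "pse L0 (transpose G *v v) (transpose G *v w) = psc L0 (transpose G *v v) (transpose G *v w)"
      "pse L0 v w = psc L0 v w"
      by (rule pse_psc; use that 5 in \<open>auto simp: tangent_sp_def split: if_splits\<close>)+
    then show ?thesis using pse_orthogonal[OF G, of v w] by simp
  qed
qed

text \<open>The affine map on the whole ambient space serves as the smooth extension, and its
  inverse is a map of the same kind, with \<open>H\<close> the inverse of \<open>G\<close>.\<close>

lemma space_form_isometry_affine: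
  assumes G: "G ** eta L0 ** transpose G = eta L0"
    and c: "if L0 = 0 then c $ 5 = 0 \<and> transpose G *v axis 5 1 = axis 5 1 else c = 0"
  shows "space_form_isometry L0 (\<lambda>x. transpose G *v x + c)"
proof -
  let ?\<Phi> = "\<lambda>x. transpose G *v x + c"
  define H where "H = eta L0 ** transpose G ** eta L0"
  let ?c' = "- (transpose H *v c)"
  let ?\<Psi> = "\<lambda>x. transpose H *v x + ?c'"
  note GH = eta_orthogonal_inverse[OF G, folded H_def]
  have H: "H ** eta L0 ** transpose H = eta L0"
    unfolding H_def matrix_transpose_mul transpose_transpose
    using GH(3) by (simp add: matrix_mul_assoc) (simp add: matrix_mul_assoc[symmetric])
  have HG: "transpose H *v (transpose G *v x) = x" "transpose G *v (transpose H *v x) = x" for x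
    by (simp_all only: matrix_vector_mul_assoc matrix_transpose_mul[symmetric] GH(1,2) transpose_mat
        matrix_vector_mul_lid)
  have c': "if L0 = 0 then ?c' $ 5 = 0 \<and> transpose H *v axis 5 1 = axis 5 1 else ?c' = 0"
  proof (cases "L0 = 0")
    case True
    then have e: "transpose H *v axis 5 1 = axis 5 1" using c HG(1)[of "axis 5 1"] by simp
    then have "(transpose H *v c) $ 5 = c $ 5" using affine_preserves(3)[OF H, of 0] True by simp
    then show ?thesis using True e c by simp
  next
    case False
    then show ?thesis using c by simp
  qed
  have inv: "?\<Psi> (?\<Phi> x) = x" "?\<Phi> (?\<Psi> x) = x" for x
    by (simp_all add: HG matrix_vector_right_distrib linear_neg[OF matrix_vector_mul_linear]
        linear_diff[OF matrix_vector_mul_linear]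
        del: transpose_matrix_vector)
  have bij: "bij_betw ?\<Phi> (space_form L0) (space_form L0)"
    by (rule bij_betw_byWitness[where f'="?\<Psi>"])
      (use inv affine_preserves(1)[OF G c] affine_preserves(1)[OF H c'] in auto)
  have sm: "smooth_on UNIV (\<lambda>x. M *v x + d)" for M :: "real^5^5" and d
    by (intro smooth_on_add smooth_on_const smooth_on_bounded_linear matrix_vector_mul_bounded_linear open_UNIV)
  have fd: "frechet_derivative ?\<Phi> (at x) v = transpose G *v v" for x v
  proof -
    have "(?\<Phi> has_derivative (\<lambda>v. transpose G *v v + 0)) (at x)"
      by (intro has_derivative_add has_derivative_const bounded_linear_imp_has_derivative matrix_vector_mul_bounded_linear)
    from frechet_derivativeI[OF this] show ?thesis by simp
  qed
  have "inv_into (space_form L0) ?\<Phi> x = ?\<Psi> x" if "x \<in> space_form L0" for x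
    using bij affine_preserves(1)[OF H c' that] inv by (intro inv_into_f_eq) (auto simp: bij_betw_def)
  then have inv': "\<exists>W \<Psi>. open W \<and> space_form L0 \<subseteq> W \<and> smooth_on W \<Psi> \<and>
        (\<forall>x\<in>space_form L0. \<Psi> x = inv_into (space_form L0) ?\<Phi> x)"
    by (intro exI[of _ UNIV] exI[of _ ?\<Psi>] conjI ballI open_UNIV subset_UNIV sm) (rule sym)
  have "\<exists>W \<Psi>. open W \<and> space_form L0 \<subseteq> W \<and> smooth_on W \<Psi> \<and>
        (\<forall>x\<in>space_form L0. \<Psi> x = ?\<Phi> x \<and>
           (\<forall>v\<in>tangent_sp L0 x. \<forall>w\<in>tangent_sp L0 x.
              psc L0 (frechet_derivative \<Psi> (at x) v) (frechet_derivative \<Psi> (at x) w) = psc L0 v w))"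
    by (intro exI[of _ UNIV] exI[of _ ?\<Phi>] conjI ballI open_UNIV subset_UNIV sm refl)
      (simp only: fd affine_preserves(2)[OF G c])
  then show ?thesis unfolding space_form_isometry_def using bij inv' by blast
qed

lemma matrix_mult_row: "(F ** G) $ i = transpose G *v (F $ i)"
  for F :: "real^'n^'m" and G :: "real^'k^'n"
  by (simp add: vec_eq_iff matrix_matrix_mult_def matrix_vector_mult_def transpose_def mult.commute)

lemma (in framed_surface) frame_derivative:
  assumes "associated_functions L0 D X N1 N2 lam a1 a2 b1 b2 m1 m2" "p \<in> D"
  shows "(fm has_derivative (\<lambda>z. fst z *\<^sub>R (conn_u L0 lam a1 a2 b1 b2 m1 p ** fm p)
    + snd z *\<^sub>R (conn_v L0 lam a1 a2 b1 b2 m2 p ** fm p))) (at p)"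
  using D_uv_has_derivative[OF diff_at[OF smooth_frame_matrix assms(2)]] assms
  unfolding frame_equations_iff[symmetric] by simp

text \<open>For \<open>L0 \<noteq> 0\<close> the last row of the frame is a multiple of the
  position, so congruent frames are congruent surfaces. For \<open>L0 = 0\<close> the frames control
  only the differentials, and the surfaces agree up to a translation within the hyperplane.\<close>

lemma surfaces_congruent:
  assumes s: "framed_surface L0 U X lam \<sigma> N1 N2" and as: "associated_functions L0 U X N1 N2 lam a1 a2 b1 b2 m1 m2"
    and s': "framed_surface L0 U X' lam \<sigma> N1' N2'" and as': "associated_functions L0 U X' N1' N2' lam a1 a2 b1 b2 m1 m2"
    and conn: "connected U"
  obtains \<Phi> where "space_form_isometry L0 \<Phi>" "\<And>q. q \<in> U \<Longrightarrow> X' q = \<Phi> (X q)"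
proof (cases "U = {}")
  case True
  have "space_form_isometry L0 (\<lambda>x. transpose (mat 1) *v x + 0)"
    by (rule space_form_isometry_affine) simp_all
  then show ?thesis using that True by blast
next
  case False
  then obtain p0 where p0: "p0 \<in> U" by blast
  interpret s: framed_surface L0 U X lam \<sigma> N1 N2 by (rule s)
  interpret s': framed_surface L0 U X' lam \<sigma> N1' N2' by (rule s')
  obtain G where G: "G ** eta L0 ** transpose G = eta L0" "\<And>p. p \<in> U \<Longrightarrow> s'.fm p = s.fm p ** G"
    using frames_congruent[OF s.open_D conn s.frame_derivative[OF as] s'.frame_derivative[OF as'] conn_skew
        s.frame_orthonormal s'.frame_orthonormal p0] by blast
  have row: "s'.fm p $ i = transpose G *v (s.fm p $ i)" if "p \<in> U" for p i
    by (simp add: G(2)[OF that] matrix_mult_row)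
  show thesis
  proof (cases "L0 = 0")
    case False
    have "space_form_isometry L0 (\<lambda>x. transpose G *v x + 0)"
      by (rule space_form_isometry_affine[OF G(1)]) (simp add: False)
    moreover have "X' q = transpose G *v X q + 0" if "q \<in> U" for q
      using row[OF that, of 5] False by (simp add: frame_matrix_def matrix_vector_mult_scaleR)
    ultimately show thesis using that by blast
  next
    case True
    have e5: "transpose G *v axis 5 1 = axis 5 1"
      using row[OF p0, of 5] True by (simp add: frame_matrix_def)
    have T: "D_u X' q = transpose G *v D_u X q" "D_v X' q = transpose G *v D_v X q" if "q \<in> U" for q
      using row[OF that, of 1] row[OF that, of 3] by (simp_all add: frame_matrix_def matrix_vector_mult_scaleR)
    define f where "f = (\<lambda>q. X' q - transpose G *v X q)"
    have "(f has_derivative (\<lambda>z. 0)) (at q)" if q: "q \<in> U" for q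
    proof -
      have "(f has_derivative (\<lambda>z. (fst z *\<^sub>R D_u X' q + snd z *\<^sub>R D_v X' q)
          - transpose G *v (fst z *\<^sub>R D_u X q + snd z *\<^sub>R D_v X q))) (at q)"
        unfolding f_def
        by (intro has_derivative_diff bounded_linear.has_derivative[OF matrix_vector_mul_bounded_linear]
            D_uv_has_derivative s.diff_at[OF s.smooth_X q] s'.diff_at[OF s'.smooth_X q])
      then show ?thesis by (simp add: T[OF q] matrix_vector_right_distrib matrix_vector_mult_scaleR)
    qed
    then have f: "f q = f p0" if "q \<in> U" for q
      by (rule has_derivative_zero_unique_connected[OF s.open_D conn _ that p0])
    have "f p0 $ 5 = 0"
      using s.in_space_form[OF p0] s'.in_space_form[OF p0] affine_preserves(3)[OF G(1), of 0] True e5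
      by (simp add: f_def space_form_def)
    then have "space_form_isometry L0 (\<lambda>x. transpose G *v x + f p0)"
      by (intro space_form_isometry_affine[OF G(1)]) (use True e5 in simp)
    moreover have "X' q = transpose G *v X q + f p0" if "q \<in> U" for q
      using f[OF that] by (simp add: f_def algebra_simps)
    ultimately show thesis using that by blast
  qed
qed

section \<open>Existence\<close>

lemma (in framed_surface) mean_curvature_zero:
  assumes "associated_functions L0 D X N1 N2 lam a1 a2 b1 b2 m1 m2" "p \<in> D"
  shows "mean_curvature_vector L0 X p = 0"
proof -
  have "nabla L0 X (1, 0) (D_u X) p = nabla L0 X (0, 1) (D_v X) p"
    using assms unfolding associated_functions_def Let_def by metis
  then show ?thesis unfolding mean_curvature_vector_def Let_def by (simp add: metric[OF assms(2)])
qed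

section \<open>Solutions of the frame equations and the surfaces that they define\<close>

lemma continuous_on_det:
  fixes f :: "'a::topological_space \<Rightarrow> real^'n^'n"
  assumes "continuous_on S f"
  shows "continuous_on S (\<lambda>x. det (f x))"
proof -
  have "continuous_on S (\<lambda>x. f x $ i $ j)" for i j
    by (intro bounded_linear.continuous_on[OF bounded_linear_vec_nth] assms)
  then show ?thesis unfolding det_def
    by (intro continuous_on_sum continuous_on_mult continuous_on_prod continuous_on_const)
qed

lemma prod_5: "prod f (UNIV::5 set) = f 1 * f 2 * f 3 * f 4 * f (5::5)"
  for f :: "5 \<Rightarrow> 'a::comm_monoid_mult"
  unfolding UNIV_5 by (simp add: ac_simps)

lemma det_rows5_scale:
  "det (rows5 (c1 *\<^sub>R x1) (c2 *\<^sub>R x2) (c3 *\<^sub>R x3) (c4 *\<^sub>R x4) (c5 *\<^sub>R (x5::real^5))) =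
    c1 * c2 * c3 * c4 * c5 * det (rows5 x1 x2 x3 x4 x5)"
proof -
  let ?c = "rows5 c1 c2 c3 c4 c5" and ?x = "rows5 x1 x2 x3 x4 x5"
  have "rows5 (c1 *\<^sub>R x1) (c2 *\<^sub>R x2) (c3 *\<^sub>R x3) (c4 *\<^sub>R x4) (c5 *\<^sub>R x5) = (\<chi> i. ?c $ i *s ?x $ i)"
    by (simp add: vec_eq_iff forall_5)
  then have "det (rows5 (c1 *\<^sub>R x1) (c2 *\<^sub>R x2) (c3 *\<^sub>R x3) (c4 *\<^sub>R x4) (c5 *\<^sub>R x5)) =
      prod (\<lambda>i. ?c $ i) UNIV * det (\<chi> i. ?x $ i)"
    by (simp only: det_rows_mul)
  then show ?thesis by (simp add: prod_5)
qed

lemma conn_rows: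
  fixes M :: "real^5^5"
  shows "(conn_u L0 lam a1 a2 b1 b2 m1 p ** M) $ 5 = (sqrt \<bar>L0\<bar> * exp (lam p)) *\<^sub>R M $ 1"
    "(conn_v L0 lam a1 a2 b1 b2 m2 p ** M) $ 5 = (sqrt \<bar>L0\<bar> * exp (lam p)) *\<^sub>R M $ 3"
    "(conn_v L0 lam a1 a2 b1 b2 m2 p ** M) $ 1 = a2 p *\<^sub>R M $ 2 + D_u lam p *\<^sub>R M $ 3 + b2 p *\<^sub>R M $ 4"
    "(conn_u L0 lam a1 a2 b1 b2 m1 p ** M) $ 3 = D_v lam p *\<^sub>R M $ 1 + a2 p *\<^sub>R M $ 2 + b2 p *\<^sub>R M $ 4"
  by (simp_all add: vec_eq_iff matrix_matrix_mult_def sum_5 conn_u_def conn_v_def)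

lemma fd_exp_scaleR:
  fixes Y :: "plane \<Rightarrow> 'b::real_normed_vector"
  assumes "lam differentiable (at p)" "Y differentiable (at p)"
  shows "frechet_derivative (\<lambda>p. exp (lam p) *\<^sub>R Y p) (at p) v =
    exp (lam p) *\<^sub>R (frechet_derivative Y (at p) v + frechet_derivative lam (at p) v *\<^sub>R Y p)"
proof -
  have "(\<lambda>p. exp (lam p)) differentiable (at p)"
    using has_derivative_exp[OF has_derivative_frechet[OF assms(1)]] by (auto simp: differentiable_def)
  then show ?thesis using assms by (simp add: fd_scaleR fd_exp algebra_simps)
qed

text \<open>At the corner the frame is chosen orthonormal, of the prescribed orientation, and with
  last row \<open>axis 5 1\<close>. The system carries orthonormality and orientation through the
  box, and for \<open>L0 = 0\<close> the last row as well.\<close>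

lemma frame_exists:
  fixes L0 \<sigma> :: real
  assumes D: "open D" "p0 \<in> D" and \<sigma>: "\<sigma> \<in> {1, -1}"
    and s: "smooth_on D lam" "smooth_on D a1" "smooth_on D a2" "smooth_on D b1" "smooth_on D b2"
      "smooth_on D m1" "smooth_on D m2"
    and gcr: "\<And>p. p \<in> D \<Longrightarrow> gauss_codazzi_ricci L0 lam a1 a2 b1 b2 m1 m2 p"
  defines "A \<equiv> conn_u L0 lam a1 a2 b1 b2 m1" and "B \<equiv> conn_v L0 lam a1 a2 b1 b2 m2"
  obtains a b F where "p0 \<in> box a b" "box a b \<subseteq> D" "smooth_on (box a b) F"
    "\<And>q. q \<in> box a b \<Longrightarrow> (F has_derivative (\<lambda>z. fst z *\<^sub>R (A q ** F q) + snd z *\<^sub>R (B q ** F q))) (at q)"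
    "\<And>q. q \<in> box a b \<Longrightarrow> F q ** eta L0 ** transpose (F q) = eta L0"
    "\<And>q. q \<in> box a b \<Longrightarrow> \<sigma> * det (F q) > 0"
    "\<And>q. q \<in> box a b \<Longrightarrow> L0 = 0 \<Longrightarrow> F q $ 5 = axis 5 1"
proof -
  note sAB = smooth_on_conn[OF D(1) s, of L0, folded A_def B_def]
  \<comment> \<open>The factor \<open>\<sigma>\<close> in one row fixes the orientation, since
    \<open>det F0 = \<sigma>\<close>; orthonormality survives because
    \<open>\<sigma> * \<sigma> = 1\<close>.\<close>
  define F0 :: "real^5^5" where "F0 = rows5 (axis 1 1) (\<sigma> *\<^sub>R axis 2 1) (axis 3 1) (axis 4 1) (axis 5 1)"
  have \<sigma>2: "\<sigma> * \<sigma> = 1" using \<sigma> by auto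
  have F0: "F0 ** eta L0 ** transpose F0 = eta L0"
    unfolding vec_eq_iff gram_eta forall_5 F0_def by (simp add: pse_def sum_5 axis_def eta_def sg5_def \<sigma>2)
  have "det F0 = prod (\<lambda>i. F0 $ i $ i) UNIV"
  proof (rule det_diagonal)
    have "\<forall>i j. i \<noteq> j \<longrightarrow> F0 $ i $ j = 0" unfolding forall_5 F0_def by (simp add: axis_def)
    then show "F0 $ i $ j = 0" if "i \<noteq> j" for i j using that by blast
  qed
  then have detF0: "det F0 = \<sigma>" by (simp add: prod_5 F0_def axis_def)
  have compat: "D_v A q ** e + A q ** (B q ** e) = D_u B q ** e + B q ** (A q ** e)" if "q \<in> D" for q and e :: "real^5^5"
  proof -
    have "(D_v A q + A q ** B q) ** e = (D_u B q + B q ** A q) ** e"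
      using gcr[OF that] compatibility_iff[OF D(1) that s, of L0] unfolding A_def B_def by simp
    then show ?thesis by (simp add: bounded_bilinear.add_left[OF bounded_bilinear_matrix_mult] matrix_mul_assoc)
  qed
  obtain a b F where ab: "p0 \<in> box a b" "cbox a b \<subseteq> D" and c: "continuous_on (cbox a b) F" and Fa: "F a = F0"
    and dF: "\<And>q. q \<in> box a b \<Longrightarrow> (F has_derivative (\<lambda>z. fst z *\<^sub>R (A q ** F q) + snd z *\<^sub>R (B q ** F q))) (at q)"
    by (rule frobenius_linear[OF bounded_bilinear_matrix_mult D sAB compat, where ?e0.0=F0]) blast+
  have ne: "box a b \<noteq> {}" using ab by blast
  have sub: "box a b \<subseteq> cbox a b" by (rule box_subset_cbox)
  have orth: "F q ** eta L0 ** transpose (F q) = eta L0" if "q \<in> cbox a b" for q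
  proof (rule eta_orthogonal_transpose)
    have "transpose (F q) ** eta L0 ** F q = transpose (F a) ** eta L0 ** F a"
    proof (rule constant_on_cbox[where f="\<lambda>q. transpose (F q) ** eta L0 ** F q", OF ne _ _ that])
      show "continuous_on (cbox a b) (\<lambda>q. transpose (F q) ** eta L0 ** F q)"
        by (intro bounded_bilinear.continuous_on[OF bounded_bilinear_matrix_mult] continuous_on_const c
            bounded_linear.continuous_on[OF bounded_linear_transpose])
      show "((\<lambda>q. transpose (F q) ** eta L0 ** F q) has_derivative (\<lambda>z. 0)) (at q)" if "q \<in> box a b" for q
        by (rule frame_form_derivative[OF dF[OF that] dF[OF that]]) (simp_all add: A_def B_def conn_skew)
    qed
    then show "transpose (F q) ** eta L0 ** F q = eta L0"
      using eta_orthogonal_inverse(3)[OF F0] Fa by simp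
  qed
  \<comment> \<open>The expression is 1 at the corner, and a change of sign would produce a zero by
    connectedness; but \<open>F eta F^T = eta\<close> excludes singular frames.\<close>
  have det: "\<sigma> * det (F q) > 0" if q: "q \<in> cbox a b" for q
  proof (rule ccontr)
    assume "\<not> \<sigma> * det (F q) > 0"
    then have le: "\<sigma> * det (F q) \<le> 0" by simp
    let ?g = "\<lambda>q. \<sigma> * det (F q)"
    have aC: "a \<in> cbox a b" using ne by (auto simp: mem_box box_ne_empty less_imp_le)
    have "connected (?g ` cbox a b)"
      by (rule connected_continuous_image) (intro continuous_intros continuous_on_det c, simp add: convex_connected)
    then have "{?g q..?g a} \<subseteq> ?g ` cbox a b"
      by (rule connected_contains_Icc) (use q aC in auto)
    moreover have "0 \<in> {?g q..?g a}" using le by (simp add: Fa detF0 \<sigma>2)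
    ultimately obtain r where r: "r \<in> cbox a b" "?g r = 0" by (metis (no_types, lifting) imageE subsetD)
    then have "det (F r) = 0" using \<sigma> by auto
    then have "det (eta L0) = 0" using arg_cong[OF orth[OF r(1)], of det] by (simp add: det_mul)
    moreover have "det (eta L0) * det (eta L0) = 1" by (metis det_mul det_I eta_eta)
    ultimately show False by simp
  qed
  \<comment> \<open>For \<open>L0 = 0\<close> the last rows of both connection matrices
    vanish.\<close>
  have row5: "F q $ 5 = axis 5 1" if "L0 = 0" "q \<in> cbox a b" for q
  proof -
    have "F q $ 5 = F a $ 5"
    proof (rule constant_on_cbox[where f="\<lambda>q. F q $ 5", OF ne _ _ that(2)])
      show "continuous_on (cbox a b) (\<lambda>q. F q $ 5)" by (intro continuous_intros c)
      show "((\<lambda>q. F q $ 5) has_derivative (\<lambda>z. 0)) (at q)" if "q \<in> box a b" for q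
        using bounded_linear.has_derivative[OF bounded_linear_vec_nth dF[OF that], of 5]
        by (simp add: A_def B_def conn_rows \<open>L0 = 0\<close>)
    qed
    then show ?thesis by (simp add: Fa F0_def)
  qed
  show thesis
  proof (rule that[of a b F])
    show "smooth_on (box a b) F"
      by (rule smooth_on_linear_system[OF bounded_bilinear_matrix_mult open_box _ _ dF])
        (use ab sub sAB in \<open>auto intro: smooth_on_subset\<close>)
  qed (use ab sub dF orth det row5 in auto)
qed

text \<open>If \<open>L0 \<noteq> 0\<close>, the last row of the frame divided by
  \<open>sqrt \<bar>L0\<bar>\<close> already is the surface. If \<open>L0 = 0\<close>, the surface
  is a primitive of the first and third row times \<open>e^\<lambda>\<close>; this pair is closed by
  the first row of the equation in \<open>v\<close> and the third row of that in
  \<open>u\<close>.\<close>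

lemma position_exists:
  fixes L0 \<sigma> :: real and F :: "plane \<Rightarrow> real^5^5"
  assumes p0: "p0 \<in> box a b" and lam: "smooth_on (box a b) lam" and sF: "smooth_on (box a b) F"
    and dF: "\<And>q. q \<in> box a b \<Longrightarrow> (F has_derivative (\<lambda>z. fst z *\<^sub>R (conn_u L0 lam a1 a2 b1 b2 m1 q ** F q)
      + snd z *\<^sub>R (conn_v L0 lam a1 a2 b1 b2 m2 q ** F q))) (at q)"
    and orth: "\<And>q. q \<in> box a b \<Longrightarrow> F q ** eta L0 ** transpose (F q) = eta L0"
    and e5: "\<And>q. q \<in> box a b \<Longrightarrow> L0 = 0 \<Longrightarrow> F q $ 5 = axis 5 1"
  obtains c d X where "p0 \<in> box c d" "box c d \<subseteq> box a b"
    "\<And>q. q \<in> box c d \<Longrightarrow> (X has_derivative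
      (\<lambda>z. fst z *\<^sub>R (exp (lam q) *\<^sub>R F q $ 1) + snd z *\<^sub>R (exp (lam q) *\<^sub>R F q $ 3))) (at q)"
    "\<And>q. q \<in> box c d \<Longrightarrow> X q \<in> space_form L0"
    "\<And>q. q \<in> box c d \<Longrightarrow> F q $ 5 = (if L0 = 0 then axis 5 1 else sqrt \<bar>L0\<bar> *\<^sub>R X q)"
proof (cases "L0 = 0")
  case False
  define k where "k = sqrt \<bar>L0\<bar>"
  have k: "k > 0" "k * k = \<bar>L0\<bar>" using False by (auto simp: k_def)
  let ?X = "\<lambda>q. (1 / k) *\<^sub>R F q $ 5"
  show thesis
  proof (rule that[of a b ?X])
    fix q assume q: "q \<in> box a b"
    have "((\<lambda>q. F q $ 5) has_derivative (\<lambda>z. fst z *\<^sub>R ((k * exp (lam q)) *\<^sub>R F q $ 1)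
        + snd z *\<^sub>R ((k * exp (lam q)) *\<^sub>R F q $ 3))) (at q)"
      using bounded_linear.has_derivative[OF bounded_linear_vec_nth dF[OF q], of 5]
      by (simp add: conn_rows k_def)
    from has_derivative_scaleR_right[OF this, of "1 / k"]
    show "(?X has_derivative (\<lambda>z. fst z *\<^sub>R (exp (lam q) *\<^sub>R F q $ 1) + snd z *\<^sub>R (exp (lam q) *\<^sub>R F q $ 3))) (at q)"
      using k by (simp add: algebra_simps)
    have "pse L0 (F q $ 5) (F q $ 5) = eta L0 $ 5 $ 5" using orth[OF q] gram_eta[of "F q" L0 "F q" 5 5] by simp
    then have "psc L0 (?X q) (?X q) = (1 / (k * k)) * eta L0 $ 5 $ 5" using False by (simp add: pse_psc psc_linear)
    also have "\<dots> = 1 / L0" using False k by (auto simp: eta_def sg5_def)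
    finally show "?X q \<in> space_form L0" using False by (simp add: space_form_def)
    show "F q $ 5 = (if L0 = 0 then axis 5 1 else sqrt \<bar>L0\<bar> *\<^sub>R ?X q)"
      using False k(1) by (simp add: k_def)
  qed (use p0 in auto)
next
  case True
  let ?g = "\<lambda>q. exp (lam q) *\<^sub>R F q $ 1" and ?h = "\<lambda>q. exp (lam q) *\<^sub>R F q $ 3"
  have sF': "smooth_on (box a b) (\<lambda>q. F q $ i)" for i
    by (rule smooth_on_bounded_linear_compose[OF bounded_linear_vec_nth open_box sF])
  have sg: "smooth_on (box a b) ?g" and sh: "smooth_on (box a b) ?h"
    by (intro smooth_intros open_box lam sF')+
  have cl: "D_v ?g q = D_u ?h q" if q: "q \<in> box a b" for q
  proof -
    have dFi: "((\<lambda>q. F q $ i) has_derivative (\<lambda>z. fst z *\<^sub>R (conn_u L0 lam a1 a2 b1 b2 m1 q ** F q) $ i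
      + snd z *\<^sub>R (conn_v L0 lam a1 a2 b1 b2 m2 q ** F q) $ i)) (at q)" for i
      using bounded_linear.has_derivative[OF bounded_linear_vec_nth dF[OF q], of i] by simp
    have d: "lam differentiable (at q)" "(\<lambda>q. F q $ i) differentiable (at q)" for i
      using smooth_on_differentiable[OF lam q] smooth_on_differentiable[OF sF' q] by auto
    have "D_v ?g q = exp (lam q) *\<^sub>R (D_v (\<lambda>q. F q $ 1) q + D_v lam q *\<^sub>R F q $ 1)"
      "D_u ?h q = exp (lam q) *\<^sub>R (D_u (\<lambda>q. F q $ 3) q + D_u lam q *\<^sub>R F q $ 3)"
      unfolding D_u_def D_v_def by (rule fd_exp_scaleR[OF d])+
    then show ?thesis unfolding D_uv_of_has_derivative[OF dFi] conn_rows by (simp add: algebra_simps)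
  qed
  obtain c d f where f: "p0 \<in> box c d" "box c d \<subseteq> box a b"
    "\<And>q. q \<in> box c d \<Longrightarrow> (f has_derivative (\<lambda>z. fst z *\<^sub>R ?g q + snd z *\<^sub>R ?h q)) (at q)"
    using poincare_plane[OF open_box p0 sg sh cl] by blast
  \<comment> \<open>The first and third row are orthogonal to \<open>axis 5 1\<close>, so the fifth
    coordinate of the primitive has derivative zero; subtracting it moves the surface into the
    hyperplane and leaves the differential unchanged.\<close>
  let ?X = "\<lambda>q. f q - (f q $ 5) *\<^sub>R axis 5 1"
  show thesis
  proof (rule that[of c d ?X])
    fix q assume q: "q \<in> box c d"
    then have q': "q \<in> box a b" using f by blast
    have e: "pse L0 (F q $ i) (axis 5 1) = F q $ i $ 5" for i using True by (simp add: pse_def sum_5 axis_def sg5_def)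
    have 0: "F q $ 1 $ 5 = 0" "F q $ 3 $ 5 = 0"
      using gram_eta[of "F q" L0 "F q" 1 5] gram_eta[of "F q" L0 "F q" 3 5] orth[OF q'] e5[OF q' True] e
      by (simp_all add: eta_def)
    have d5: "((\<lambda>q. f q $ 5) has_derivative (\<lambda>z. (fst z *\<^sub>R ?g q + snd z *\<^sub>R ?h q) $ 5)) (at q)"
      by (rule bounded_linear.has_derivative[OF bounded_linear_vec_nth f(3)[OF q]])
    have "(?X has_derivative (\<lambda>z. (fst z *\<^sub>R ?g q + snd z *\<^sub>R ?h q)
        - ((fst z *\<^sub>R ?g q + snd z *\<^sub>R ?h q) $ 5) *\<^sub>R axis 5 1)) (at q)"
      by (rule has_derivative_diff[OF f(3)[OF q] has_derivative_scaleR_left[OF d5]])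
    then show "(?X has_derivative (\<lambda>z. fst z *\<^sub>R ?g q + snd z *\<^sub>R ?h q)) (at q)" by (simp add: 0)
    show "?X q \<in> space_form L0" using True by (simp add: space_form_def axis_def)
    show "F q $ 5 = (if L0 = 0 then axis 5 1 else sqrt \<bar>L0\<bar> *\<^sub>R ?X q)" using True e5[OF q'] by simp
  qed (use f in auto)
qed

text \<open>The rows of the solution, multiplied by \<open>e^\<lambda>\<close>, are the coordinate
  vectors of the surface and its normal frame. Its frame matrix is then the solution itself, and the
  matrix equations become the structure equations.\<close>

lemma surface_exists:
  fixes L0 \<sigma> :: real
  assumes D: "open D" "p0 \<in> D" and \<sigma>: "\<sigma> \<in> {1, -1}"
    and s: "smooth_on D lam" "smooth_on D a1" "smooth_on D a2" "smooth_on D b1" "smooth_on D b2"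
      "smooth_on D m1" "smooth_on D m2"
    and gcr: "\<And>p. p \<in> D \<Longrightarrow> gauss_codazzi_ricci L0 lam a1 a2 b1 b2 m1 m2 p"
  obtains U X N1 N2 where "open U" "connected U" "p0 \<in> U" "U \<subseteq> D" "framed_surface L0 U X lam \<sigma> N1 N2"
    "associated_functions L0 U X N1 N2 lam a1 a2 b1 b2 m1 m2"
proof -
  obtain a b F where F: "p0 \<in> box a b" "box a b \<subseteq> D" "smooth_on (box a b) F"
    and dF: "\<And>q. q \<in> box a b \<Longrightarrow> (F has_derivative (\<lambda>z. fst z *\<^sub>R (conn_u L0 lam a1 a2 b1 b2 m1 q ** F q)
      + snd z *\<^sub>R (conn_v L0 lam a1 a2 b1 b2 m2 q ** F q))) (at q)"
    and orth: "\<And>q. q \<in> box a b \<Longrightarrow> F q ** eta L0 ** transpose (F q) = eta L0"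
    and det: "\<And>q. q \<in> box a b \<Longrightarrow> \<sigma> * det (F q) > 0"
    and e5: "\<And>q. q \<in> box a b \<Longrightarrow> L0 = 0 \<Longrightarrow> F q $ 5 = axis 5 1"
    by (rule frame_exists[OF D \<sigma> s gcr]) blast+
  obtain c d X where cd: "p0 \<in> box c d" "box c d \<subseteq> box a b"
    and dX: "\<And>q. q \<in> box c d \<Longrightarrow> (X has_derivative
      (\<lambda>z. fst z *\<^sub>R (exp (lam q) *\<^sub>R F q $ 1) + snd z *\<^sub>R (exp (lam q) *\<^sub>R F q $ 3))) (at q)"
    and sf: "\<And>q. q \<in> box c d \<Longrightarrow> X q \<in> space_form L0"
    and X5: "\<And>q. q \<in> box c d \<Longrightarrow> F q $ 5 = (if L0 = 0 then axis 5 1 else sqrt \<bar>L0\<bar> *\<^sub>R X q)"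
    by (rule position_exists[OF F(1) smooth_on_subset[OF s(1) F(2)] F(3) dF orth e5]) blast+
  let ?U = "box c d"
  have UD: "?U \<subseteq> D" using cd F by blast
  have open_U: "open ?U" by (rule open_box)
  define N1 where "N1 = (\<lambda>q. exp (lam q) *\<^sub>R F q $ 2)"
  define N2 where "N2 = (\<lambda>q. exp (lam q) *\<^sub>R F q $ 4)"
  have lam: "smooth_on ?U lam" by (rule smooth_on_subset[OF s(1) UD])
  have sF: "smooth_on ?U (\<lambda>q. F q $ i)" for i
    by (rule smooth_on_bounded_linear_compose[OF bounded_linear_vec_nth open_U smooth_on_subset[OF F(3) cd(2)]])
  have sE: "smooth_on ?U (\<lambda>q. exp (lam q) *\<^sub>R F q $ i)" for i
    by (intro smooth_intros open_U lam sF)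
  have sX: "smooth_on ?U X" by (rule smooth_on_planeI[OF open_U dX sE sE])
  have T: "D_u X q = exp (lam q) *\<^sub>R F q $ 1" "D_v X q = exp (lam q) *\<^sub>R F q $ 3" if "q \<in> ?U" for q
    using D_uv_of_has_derivative[OF dX[OF that]] by simp_all
  have gram: "pse L0 (F q $ i) (F q $ j) = (if i = j then sg5 L0 $ i else 0)" if "q \<in> ?U" for q i j
    using gram_eta[of "F q" L0 "F q" i j] orth[of q] that cd by (auto simp: eta_def)
  have tan: "F q $ i \<in> tangent_sp L0 (X q)" if q: "q \<in> ?U" and i: "i \<noteq> 5" for q i
  proof (cases "L0 = 0")
    case True
    then have "pse L0 (F q $ i) (axis 5 1) = 0" using gram[OF q, of i 5] X5[OF q] i by simp
    then show ?thesis using True by (simp add: tangent_sp_def pse_def sum_5 axis_def sg5_def)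
  next
    case False
    then have "sqrt \<bar>L0\<bar> * psc L0 (X q) (F q $ i) = 0"
      using gram[OF q, of 5 i] X5[OF q] i by (simp add: pse_psc psc_linear)
    then show ?thesis using False by (simp add: tangent_sp_def)
  qed
  have pr: "psc L0 (F q $ i) (F q $ j) = (if i = j then sg5 L0 $ i else 0)" if q: "q \<in> ?U" and "i \<noteq> 5" "j \<noteq> 5" for q i j
    using gram[OF q, of i j] pse_psc[of L0 "F q $ i" "F q $ j"] tan[OF q, of i] that
    by (auto simp: tangent_sp_def split: if_splits)
  have ee: "exp (lam q) * exp (lam q) = exp (2 * lam q)" for q by (simp add: mult_exp_exp)
  have conf: "conformal_metric L0 ?U X lam"
    unfolding conformal_metric_def by (simp add: T psc_linear pr sg5_def ee)
  have inj: "inj (frechet_derivative X (at q))" if q: "q \<in> ?U" for q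
  proof (rule linear_injective_0[THEN iffD2])
    have dq: "X differentiable (at q)" by (rule smooth_on_differentiable[OF sX q])
    show "linear (frechet_derivative X (at q))" by (rule linear_frechet_derivative[OF dq])
    show "\<forall>z. frechet_derivative X (at q) z = 0 \<longrightarrow> z = 0"
    proof (intro allI impI)
      fix z assume z: "frechet_derivative X (at q) z = 0"
      obtain x y where xy: "z = (x, y)" by (cases z)
      have 0: "x *\<^sub>R D_u X q + y *\<^sub>R D_v X q = 0" using z fd_plane[OF dq, of x y] xy by simp
      have "psc L0 (x *\<^sub>R D_u X q + y *\<^sub>R D_v X q) (F q $ 1) = 0" "psc L0 (x *\<^sub>R D_u X q + y *\<^sub>R D_v X q) (F q $ 3) = 0"
        unfolding 0 by (simp_all add: psc_linear)
      then show "z = 0" by (simp add: T[OF q] psc_linear pr[OF q] sg5_def xy zero_prod_def)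
    qed
  qed
  have surf: "surface L0 ?U X lam"
    by unfold_locales (use open_U conf sX sf inj in \<open>auto simp: immersion_on_def\<close>)
  have or: "positively_oriented L0 \<sigma> (X q) (D_u X q) (N1 q) (D_v X q) (N2 q)" if q: "q \<in> ?U" for q
  proof -
    \<comment> \<open>The factor between the last row of the frame and the transversal vector in
      \<open>positively_oriented\<close>; as it is positive, the sign of the determinant is
      kept.\<close>
    define k where "k = (if L0 = 0 then 1 else 1 / sqrt \<bar>L0\<bar>)"
    have k: "k > 0" by (simp add: k_def)
    have "(if L0 = 0 then axis 5 1 else X q) = k *\<^sub>R F q $ 5" using X5[OF q] by (simp add: k_def)
    then have "det (rows5 (D_u X q) (N1 q) (D_v X q) (N2 q) (if L0 = 0 then axis 5 1 else X q)) =
        exp (lam q) * exp (lam q) * exp (lam q) * exp (lam q) * k * det (rows5 (F q $ 1) (F q $ 2) (F q $ 3) (F q $ 4) (F q $ 5))"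
      by (simp only: T[OF q] N1_def N2_def det_rows5_scale)
    moreover have "rows5 (F q $ 1) (F q $ 2) (F q $ 3) (F q $ 4) (F q $ 5) = F q"
      by (rule sym) (simp add: eq_rows5_iff)
    ultimately have eq: "\<sigma> * det (rows5 (D_u X q) (N1 q) (D_v X q) (N2 q) (if L0 = 0 then axis 5 1 else X q)) =
        (exp (lam q) * exp (lam q) * exp (lam q) * exp (lam q) * k) * (\<sigma> * det (F q))"
      by (simp only: mult_ac)
    have "0 < \<sigma> * det (F q)" using det q cd by blast
    then show ?thesis unfolding positively_oriented_rows5 eq using k by simp
  qed
  have fr: "normal_frame L0 \<sigma> ?U X lam N1 N2"
    unfolding normal_frame_def using sE or
    by (auto simp: T N1_def N2_def psc_linear pr sg5_def ee tan tangent_sp_linear)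
  interpret f: framed_surface L0 ?U X lam \<sigma> N1 N2
    using surf fr by (simp add: framed_surface_def framed_surface_axioms_def)
  have fm: "f.fm q = F q" if q: "q \<in> ?U" for q
    by (rule sym) (simp add: frame_matrix_def eq_rows5_iff T[OF q] N1_def N2_def X5[OF q] mult_exp_exp)
  have "D_u f.fm q = conn_u L0 lam a1 a2 b1 b2 m1 q ** f.fm q \<and> D_v f.fm q = conn_v L0 lam a1 a2 b1 b2 m2 q ** f.fm q"
    if q: "q \<in> ?U" for q
  proof -
    have "(f.fm has_derivative (\<lambda>z. fst z *\<^sub>R (conn_u L0 lam a1 a2 b1 b2 m1 q ** F q)
      + snd z *\<^sub>R (conn_v L0 lam a1 a2 b1 b2 m2 q ** F q))) (at q)"
      by (rule has_derivative_transform_within_open[OF dF open_U q]) (use q cd fm in auto)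
    from D_uv_of_has_derivative[OF this] show ?thesis by (simp add: fm[OF q])
  qed
  then have "associated_functions L0 ?U X N1 N2 lam a1 a2 b1 b2 m1 m2"
    unfolding f.frame_equations_iff[symmetric] by blast
  then show thesis using that[of ?U X N1 N2] open_U cd UD f.framed_surface_axioms
    by (simp add: convex_connected)
qed

section \<open>The structure equations in terms of \<open>P\<close>, \<open>Q\<close>, \<open>R\<close>\<close>

text \<open>All relations between \<open>P\<close>, \<open>Q\<close>, \<open>R\<close>, their
  exponentials and the structure functions are combinations with constant coefficients valid on
  \<open>D\<close>; a coefficient 0 covers the shorter ones.\<close>

lemma linear_combination_3:
  fixes f g h F :: "plane \<Rightarrow> real"
  assumes D: "open D" and s: "smooth_on D f" "smooth_on D g" "smooth_on D h"
    and F: "\<forall>q\<in>D. F q = a * f q + b * g q + c * h q"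
  shows "smooth_on D F"
    and "q \<in> D \<Longrightarrow> D_u F q = a * D_u f q + b * D_u g q + c * D_u h q"
    and "q \<in> D \<Longrightarrow> D_v F q = a * D_v f q + b * D_v g q + c * D_v h q"
proof -
  let ?G = "\<lambda>q. a * f q + b * g q + c * h q"
  have sG: "smooth_on D ?G" by (intro smooth_intros D s)
  then show "smooth_on D F" using smooth_on_cong[OF sG D] F by simp
  have "frechet_derivative F (at q) v = a * frechet_derivative f (at q) v + b * frechet_derivative g (at q) v
      + c * frechet_derivative h (at q) v" if q: "q \<in> D" for q v
  proof -
    note d = smooth_on_differentiable[OF _ q]
    have "frechet_derivative F (at q) v = frechet_derivative ?G (at q) v"
      by (rule fd_cong[OF d[OF sG] D q]) (simp add: F)
    also have "\<dots> = a * frechet_derivative f (at q) v + b * frechet_derivative g (at q) v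
      + c * frechet_derivative h (at q) v"
      by (subst fd_add; (subst fd_add)?; (intro d smooth_intros D s)?)
        (simp add: fd_cmult d s)
    finally show ?thesis .
  qed
  then show "q \<in> D \<Longrightarrow> D_u F q = a * D_u f q + b * D_u g q + c * D_u h q"
    "q \<in> D \<Longrightarrow> D_v F q = a * D_v f q + b * D_v g q + c * D_v h q"
    unfolding D_u_def D_v_def by blast+
qed

lemma D_ts:
  fixes f :: "plane \<Rightarrow> real"
  assumes D: "open D" "p \<in> D" and s: "smooth_on D f"
  shows "D_t (D_s f) p = (1 / 2) * (D_u (D_u f) p - D_v (D_v f) p)"
proof -
  note d = smooth_on_differentiable
  have Ds: "\<forall>q\<in>D. D_s f q = (1 / sqrt 2) * D_u f q + (1 / sqrt 2) * D_v f q + 0 * f q"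
    using D_s_uv[OF d[OF s]] by (simp add: algebra_simps)
  note l = linear_combination_3[OF D(1) smooth_on_D(1)[OF s] smooth_on_D(2)[OF s] s Ds]
  have "D_t (D_s f) p = (1 / sqrt 2) * (D_u (D_s f) p - D_v (D_s f) p)"
    using D_t_uv[OF d[OF smooth_on_D(3)[OF s] D(2)]] by simp
  also have "\<dots> = (1 / sqrt 2) * ((1 / sqrt 2) * (D_u (D_u f) p - D_v (D_v f) p))"
    using l(2,3)[OF D(2)] mixed_partials[OF D s] by (simp add: algebra_simps)
  also have "\<dots> = (1 / 2) * (D_u (D_u f) p - D_v (D_v f) p)"
    by (simp add: mult.assoc[symmetric])
  finally show ?thesis .
qed

lemma D_ts_linear:
  fixes f g h F :: "plane \<Rightarrow> real"
  assumes D: "open D" "p \<in> D" and s: "smooth_on D f" "smooth_on D g" "smooth_on D h"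
    and F: "\<forall>q\<in>D. F q = a * f q + b * g q + c * h q"
  shows "D_t (D_s F) p = a * D_t (D_s f) p + b * D_t (D_s g) p + c * D_t (D_s h) p"
proof -
  note l = linear_combination_3[OF D(1) s F]
  have l': "\<forall>q\<in>D. D_u F q = a * D_u f q + b * D_u g q + c * D_u h q"
    "\<forall>q\<in>D. D_v F q = a * D_v f q + b * D_v g q + c * D_v h q" using l(2,3) by blast+
  note lu = linear_combination_3(2)[OF D(1) s[THEN smooth_on_D(1)] l'(1) D(2)]
  note lv = linear_combination_3(3)[OF D(1) s[THEN smooth_on_D(2)] l'(2) D(2)]
  show ?thesis unfolding D_ts[OF D l(1)] D_ts[OF D s(1)] D_ts[OF D s(2)] D_ts[OF D s(3)] lu lv
    by (simp add: field_simps)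
qed

lemma D_exp:
  fixes f :: "plane \<Rightarrow> real"
  assumes "smooth_on D f" "p \<in> D"
  shows "D_u (\<lambda>q. exp (f q)) p = exp (f p) * D_u f p" "D_v (\<lambda>q. exp (f q)) p = exp (f p) * D_v f p"
  unfolding D_u_def D_v_def by (simp_all add: fd_exp smooth_on_differentiable[OF assms])

text \<open>The relations of \<open>star\<close> that do not involve \<open>f1\<close> and
  \<open>f2\<close>. The constants \<open>x\<close>, \<open>y\<close>, \<open>z\<close> stand for
  \<open>e'\<close>, \<open>e' * e\<close>, \<open>e''\<close>, and \<open>x * exp P\<close>,
  \<open>y * exp Q\<close>, \<open>z * exp R\<close> are the nonzero null components.\<close>

definition star_data ::
  "plane set \<Rightarrow> real \<Rightarrow> real \<Rightarrow> real \<Rightarrow> (plane \<Rightarrow> real) \<Rightarrow> (plane \<Rightarrow> real) \<Rightarrow> (plane \<Rightarrow> real) \<Rightarrow>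
   (plane \<Rightarrow> real) \<Rightarrow> (plane \<Rightarrow> real) \<Rightarrow> (plane \<Rightarrow> real) \<Rightarrow> (plane \<Rightarrow> real) \<Rightarrow>
   (plane \<Rightarrow> real) \<Rightarrow> (plane \<Rightarrow> real) \<Rightarrow> (plane \<Rightarrow> real) \<Rightarrow> bool" where
  "star_data D x y z P Q R lam a1 a2 b1 b2 m1 m2 \<longleftrightarrow>
     smooth_on D P \<and> smooth_on D Q \<and> smooth_on D R \<and> (\<forall>p\<in>D.
       lam p = - (1 / 2) * (P p + R p) \<and>
       m1 p = - (1 / 2) * D_u P p + (1 / sqrt 2) * D_s Q p - (1 / 2) * D_v R p \<and>
       m2 p = - (1 / 2) * D_v P p + (1 / sqrt 2) * D_s Q p - (1 / 2) * D_u R p \<and>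
       a1 p = (x * exp (P p) + y * exp (Q p) + z * exp (R p)) / 4 \<and>
       a2 p = (x * exp (P p) - y * exp (Q p) + z * exp (R p)) / 4 \<and>
       b1 p = (x * exp (P p) - y * exp (Q p) - z * exp (R p)) / 4 \<and>
       b2 p = (x * exp (P p) + y * exp (Q p) - z * exp (R p)) / 4)"

text \<open>The equations of Codazzi leave no trace, as the choice of \<open>\<mu>\<^sub>1\<close> and \<open>\<mu>\<^sub>2\<close> makes them identities.\<close>

lemma star_data_equations:
  assumes D: "open D" and st: "star_data D x y z P Q R lam a1 a2 b1 b2 m1 m2"
  shows "smooth_on D lam" "smooth_on D a1" "smooth_on D a2" "smooth_on D b1" "smooth_on D b2"
      "smooth_on D m1" "smooth_on D m2"
    and "p \<in> D \<Longrightarrow> gauss_codazzi_ricci L0 lam a1 a2 b1 b2 m1 m2 p \<longleftrightarrow>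
      D_t (D_s (\<lambda>q. P q + R q)) p = L0 * exp (2 * lam p) - (x * y / 2) * exp (P p + Q p) \<and>
      D_t (D_s (\<lambda>q. Q q - R q)) p = - (x * y / 2) * exp (P p + Q p)"
proof -
  have s: "smooth_on D P" "smooth_on D Q" "smooth_on D R" using st by (auto simp: star_data_def)
  let ?E = "\<lambda>f q. exp (f q :: real)"
  have sE: "smooth_on D (?E P)" "smooth_on D (?E Q)" "smooth_on D (?E R)" by (intro smooth_intros D s)+
  have fl: "\<forall>q\<in>D. lam q = (-1/2) * P q + 0 * Q q + (-1/2) * R q"
    and fa: "\<forall>q\<in>D. a1 q = (x/4) * exp (P q) + (y/4) * exp (Q q) + (z/4) * exp (R q)"
      "\<forall>q\<in>D. a2 q = (x/4) * exp (P q) + (-y/4) * exp (Q q) + (z/4) * exp (R q)"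
      "\<forall>q\<in>D. b1 q = (x/4) * exp (P q) + (-y/4) * exp (Q q) + (-z/4) * exp (R q)"
      "\<forall>q\<in>D. b2 q = (x/4) * exp (P q) + (y/4) * exp (Q q) + (-z/4) * exp (R q)"
    using st by (auto simp: star_data_def field_simps)
  have sQ: "smooth_on D (\<lambda>q. D_u Q q + D_v Q q)" by (intro smooth_intros D smooth_on_D s)
  have DQ: "(1 / sqrt 2) * D_s Q q = (1 / 2) * (D_u Q q + D_v Q q)" if "q \<in> D" for q
    using D_s_uv[OF smooth_on_differentiable[OF s(2) that]] by (simp add: mult.assoc[symmetric])
  have fm: "\<forall>q\<in>D. m1 q = (-1/2) * D_u P q + (1/2) * (D_u Q q + D_v Q q) + (-1/2) * D_v R q"
    "\<forall>q\<in>D. m2 q = (-1/2) * D_v P q + (1/2) * (D_u Q q + D_v Q q) + (-1/2) * D_u R q"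
    using st DQ by (auto simp: star_data_def)
  note l = linear_combination_3[OF D s fl]
  note la1 = linear_combination_3[OF D sE fa(1)] and la2 = linear_combination_3[OF D sE fa(2)]
    and lb1 = linear_combination_3[OF D sE fa(3)] and lb2 = linear_combination_3[OF D sE fa(4)]
  note lm1 = linear_combination_3[OF D smooth_on_D(1)[OF s(1)] sQ smooth_on_D(2)[OF s(3)] fm(1)]
    and lm2 = linear_combination_3[OF D smooth_on_D(2)[OF s(1)] sQ smooth_on_D(1)[OF s(3)] fm(2)]
  show "smooth_on D lam" "smooth_on D a1" "smooth_on D a2" "smooth_on D b1" "smooth_on D b2"
      "smooth_on D m1" "smooth_on D m2"
    by (rule l la1 la2 lb1 lb2 lm1 lm2; assumption?)+
  assume p: "p \<in> D"
  have l': "\<forall>q\<in>D. D_u lam q = (-1/2) * D_u P q + 0 * D_u Q q + (-1/2) * D_u R q"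
    "\<forall>q\<in>D. D_v lam q = (-1/2) * D_v P q + 0 * D_v Q q + (-1/2) * D_v R q" using l(2,3) by blast+
  note luu = linear_combination_3(2)[OF D s[THEN smooth_on_D(1)] l'(1) p]
  note lvv = linear_combination_3(3)[OF D s[THEN smooth_on_D(2)] l'(2) p]
  have Quv: "D_u (\<lambda>q. D_u Q q + D_v Q q) p = D_u (D_u Q) p + D_u (D_v Q) p"
    "D_v (\<lambda>q. D_u Q q + D_v Q q) p = D_u (D_v Q) p + D_v (D_v Q) p"
    using mixed_partials[OF D p s(2)] unfolding D_u_def D_v_def
    by (simp_all add: fd_add smooth_on_differentiable[OF _ p] smooth_on_frechet s)
  note mx = mixed_partials[OF D p s(1), symmetric] mixed_partials[OF D p s(3), symmetric]
  have t1: "D_t (D_s (\<lambda>q. P q + R q)) p = (1/2) * (D_u (D_u P) p - D_v (D_v P) p) + (1/2) * (D_u (D_u R) p - D_v (D_v R) p)"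
    using D_ts_linear[OF D p s(1) s(3) s(2), of "\<lambda>q. P q + R q" 1 1 0] D_ts[OF D p s(1)] D_ts[OF D p s(3)] by simp
  have t2: "D_t (D_s (\<lambda>q. Q q - R q)) p = (1/2) * (D_u (D_u Q) p - D_v (D_v Q) p) - (1/2) * (D_u (D_u R) p - D_v (D_v R) p)"
    using D_ts_linear[OF D p s(2) s(3) s(1), of "\<lambda>q. Q q - R q" 1 "-1" 0] D_ts[OF D p s(2)] D_ts[OF D p s(3)]
    by (simp add: algebra_simps)
  \<comment> \<open>The first equation on the right is that of Gauss and the second that of Ricci.
    The quadratic terms are \<open>(x * y / 2) * exp (P + Q)\<close> in the former and its negative
    in the latter, as the terms with \<open>z\<close> cancel.\<close>
  show "gauss_codazzi_ricci L0 lam a1 a2 b1 b2 m1 m2 p \<longleftrightarrow>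
      D_t (D_s (\<lambda>q. P q + R q)) p = L0 * exp (2 * lam p) - (x * y / 2) * exp (P p + Q p) \<and>
      D_t (D_s (\<lambda>q. Q q - R q)) p = - (x * y / 2) * exp (P p + Q p)"
    unfolding gauss_codazzi_ricci_def luu lvv l(2)[OF p] l(3)[OF p] la1(2)[OF p] la1(3)[OF p] la2(2)[OF p] la2(3)[OF p]
      lb1(2)[OF p] lb1(3)[OF p] lb2(2)[OF p] lb2(3)[OF p] lm1(3)[OF p] lm2(2)[OF p] fa[THEN bspec, OF p] fm[THEN bspec, OF p] Quv mx t1 t2
      D_exp[OF s(1) p] D_exp[OF s(2) p] D_exp[OF s(3) p] exp_add
    by (simp add: algebra_simps) (auto simp: field_simps)
qed

lemma star_eq_star_data:
  "star L0 D lam a1 a2 b1 b2 m1 m2 \<longleftrightarrow>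
     (\<exists>e\<in>{1, -1}. \<exists>e'\<in>{1, -1}. \<exists>e''\<in>{1, -1}. \<exists>f1 f2 P Q R.
        smooth_on D f1 \<and> smooth_on D f2 \<and> star_data D e' (e' * e) e'' P Q R lam a1 a2 b1 b2 m1 m2 \<and>
        (\<forall>p\<in>D. D_t (D_s f1) p = L0 * exp (- f1 p - f2 p) \<and>
           D_t (D_s f2) p = - (e / 2) * exp (f1 p + 2 * f2 p) \<and>
           f1 p = P p - Q p + 2 * R p \<and> f2 p = Q p - R p))"
proof -
  have eq: "(1 / 2) * ((e' / 2) * (x + e * y) + (e'' / 2) * z) = (e' * x + e' * e * y + e'' * z) / 4"
    "(1 / 2) * ((e' / 2) * (x - e * y) + (e'' / 2) * z) = (e' * x - e' * e * y + e'' * z) / 4"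
    "(1 / 2) * ((e' / 2) * (x - e * y) - (e'' / 2) * z) = (e' * x - e' * e * y - e'' * z) / 4"
    "(1 / 2) * ((e' / 2) * (x + e * y) - (e'' / 2) * z) = (e' * x + e' * e * y - e'' * z) / 4"
    for e e' e'' x y z :: real by (simp_all add: algebra_simps add_divide_distrib diff_divide_distrib)
  show ?thesis unfolding star_def star_data_def Let_def eq by (intro bex_cong refl ex_cong1) blast
qed

text \<open>With \<open>f1 + f2 = P + R = - 2 \<lambda>\<close>, \<open>f2 = Q - R\<close> and
  \<open>f1 + 2 f2 = P + Q\<close>, the equation of Gauss is the sum of the two equations for
  \<open>f1\<close> and \<open>f2\<close>, and that of Ricci is the second one.\<close>

lemma star_equations:
  assumes D: "open D" and st: "star L0 D lam a1 a2 b1 b2 m1 m2"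
  shows "smooth_on D lam" "smooth_on D a1" "smooth_on D a2" "smooth_on D b1" "smooth_on D b2"
      "smooth_on D m1" "smooth_on D m2"
    and "p \<in> D \<Longrightarrow> gauss_codazzi_ricci L0 lam a1 a2 b1 b2 m1 m2 p"
    and "p \<in> D \<Longrightarrow> XY_condition a1 a2 b1 b2 p"
proof -
  obtain e e' e'' f1 f2 P Q R where e: "e \<in> {1, -1}" "e' \<in> {1, -1}" "e'' \<in> {1, -1}"
    and sd: "smooth_on D f1" "smooth_on D f2" "star_data D e' (e' * e) e'' P Q R lam a1 a2 b1 b2 m1 m2"
    and f: "\<And>p. p \<in> D \<Longrightarrow> D_t (D_s f1) p = L0 * exp (- f1 p - f2 p)"
      "\<And>p. p \<in> D \<Longrightarrow> D_t (D_s f2) p = - (e / 2) * exp (f1 p + 2 * f2 p)"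
      "\<And>p. p \<in> D \<Longrightarrow> f1 p = P p - Q p + 2 * R p" "\<And>p. p \<in> D \<Longrightarrow> f2 p = Q p - R p"
    using st unfolding star_eq_star_data by blast
  note sde = star_data_equations[OF D sd(3)]
  show "smooth_on D lam" "smooth_on D a1" "smooth_on D a2" "smooth_on D b1" "smooth_on D b2"
      "smooth_on D m1" "smooth_on D m2" by (rule sde)+
  {
    assume p: "p \<in> D"
    have ee: "e' * (e' * e) = e" using e by auto
    have "D_t (D_s (\<lambda>q. P q + R q)) p = 1 * D_t (D_s f1) p + 1 * D_t (D_s f2) p + 0 * D_t (D_s f2) p"
      by (rule D_ts_linear[OF D p sd(1,2) sd(2)]) (simp add: f(3,4))
    moreover have "D_t (D_s (\<lambda>q. Q q - R q)) p = 1 * D_t (D_s f2) p + 0 * D_t (D_s f2) p + 0 * D_t (D_s f2) p"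
      by (rule D_ts_linear[OF D p sd(2) sd(2) sd(2)]) (simp add: f(3,4))
    moreover have "lam p = - (1 / 2) * (P p + R p)" using sd(3) p unfolding star_data_def by blast
    then have "2 * lam p = - (P p + R p)" by argo
    then have "2 * lam p = - f1 p - f2 p" "f1 p + 2 * f2 p = P p + Q p"
      using f(3,4)[OF p] by linarith+
    ultimately show "gauss_codazzi_ricci L0 lam a1 a2 b1 b2 m1 m2 p"
      unfolding sde(8)[OF p] ee using f(1,2)[OF p] by simp
  }
  {
    assume p: "p \<in> D"
    have a: "a1 p = (e' * exp (P p) + e' * e * exp (Q p) + e'' * exp (R p)) / 4"
       "a2 p = (e' * exp (P p) - e' * e * exp (Q p) + e'' * exp (R p)) / 4"
       "b1 p = (e' * exp (P p) - e' * e * exp (Q p) - e'' * exp (R p)) / 4"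
       "b2 p = (e' * exp (P p) + e' * e * exp (Q p) - e'' * exp (R p)) / 4"
      using sd(3) p by (auto simp: star_data_def)
    have "(a1 p + b2 p)\<^sup>2 - (a2 p + b1 p)\<^sup>2 = e' * e' * e * (exp (P p) * exp (Q p))"
      unfolding a by (simp add: field_simps power2_eq_square)
    also have "\<dots> \<noteq> 0" using e by auto
    finally have "(a1 p + b2 p)\<^sup>2 \<noteq> (a2 p + b1 p)\<^sup>2" by simp
    moreover have "a1 p - b2 p = e'' * exp (R p) / 2" "a2 p - b1 p = e'' * exp (R p) / 2"
      unfolding a by (simp_all add: field_simps)
    ultimately show "XY_condition a1 a2 b1 b2 p" using e by (auto simp: XY_condition_def Let_def)
  }
qed

section \<open>From the structure equations to the normal form\<close>

lemma constant_sign: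
  fixes f :: "plane \<Rightarrow> real"
  assumes D: "connected D" and f: "continuous_on D f" "\<And>p. p \<in> D \<Longrightarrow> f p \<noteq> 0"
  obtains e where "e \<in> {1, -1}" "\<And>p. p \<in> D \<Longrightarrow> f p = e * \<bar>f p\<bar>"
proof -
  have "(\<forall>p\<in>D. f p > 0) \<or> (\<forall>p\<in>D. f p < 0)"
  proof (rule ccontr)
    assume "\<not> ?thesis"
    then obtain p q where pq: "p \<in> D" "q \<in> D" "f p \<le> 0" "f q \<ge> 0" by (meson not_less)
    have "{f p..f q} \<subseteq> f ` D"
      by (rule connected_contains_Icc[OF connected_continuous_image[OF f(1) D]]) (use pq in auto)
    then have "0 \<in> f ` D" using pq by auto
    then show False using f(2) by force
  qed
  then show thesis
  proof
    assume "\<forall>p\<in>D. f p > 0"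
    then have "f p = 1 * \<bar>f p\<bar>" if "p \<in> D" for p using that by force
    then show thesis using that[of 1] by blast
  next
    assume "\<forall>p\<in>D. f p < 0"
    then have "f p = -1 * \<bar>f p\<bar>" if "p \<in> D" for p using that by force
    then show thesis using that[of "-1"] by blast
  qed
qed

text \<open>On a connected domain the sign of \<open>f\<close> is one constant \<open>e\<close>, so
  \<open>ln \<bar>f\<bar> = ln (e f)\<close> is smooth. The signs in \<open>star\<close> are
  likewise chosen once for the whole domain.\<close>

lemma smooth_log_abs:
  fixes f :: "plane \<Rightarrow> real"
  assumes D: "open D" "connected D" and f: "smooth_on D f" "\<And>p. p \<in> D \<Longrightarrow> f p \<noteq> 0"
  obtains e P where "e \<in> {1, -1}" "smooth_on D P" "\<And>p. p \<in> D \<Longrightarrow> f p = e * exp (P p)"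
    "\<And>p. p \<in> D \<Longrightarrow> P p = ln \<bar>f p\<bar>"
proof -
  obtain e where e: "e \<in> {1, -1}" "\<And>p. p \<in> D \<Longrightarrow> f p = e * \<bar>f p\<bar>"
    using constant_sign[OF D(2) smooth_on_continuous[OF f(1)] f(2)] by blast
  have abs: "\<bar>f p\<bar> = e * f p" if "p \<in> D" for p
  proof -
    have "e * f p = e * (e * \<bar>f p\<bar>)" using e(2)[OF that] by metis
    also have "\<dots> = \<bar>f p\<bar>" using e(1) by auto
    finally show ?thesis by simp
  qed
  have "smooth_on D (\<lambda>p. ln (e * f p))"
    by (intro smooth_on_ln smooth_intros D f) (use abs f(2) in \<open>metis zero_less_abs_iff\<close>)
  then have "smooth_on D (\<lambda>p. ln \<bar>f p\<bar>)" by (rule smooth_on_cong[OF _ D(1)]) (simp add: abs)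
  then show thesis using that[of e "\<lambda>p. ln \<bar>f p\<bar>"] e f(2) by simp
qed

text \<open>The hypothesis \<open>nrm\<close> is \<open>2 \<lambda> + P + R = 0\<close> in
  exponential form. Codazzi's equations, divided by the null components, are linear in the
  derivatives of the logarithms and can be solved for \<open>m1\<close> and
  \<open>m2\<close>.\<close>

lemma star_of_equations:
  assumes D: "open D" "connected D"
    and s: "smooth_on D lam" "smooth_on D a1" "smooth_on D a2" "smooth_on D b1" "smooth_on D b2"
      "smooth_on D m1" "smooth_on D m2"
    and gcr: "\<And>p. p \<in> D \<Longrightarrow> gauss_codazzi_ricci L0 lam a1 a2 b1 b2 m1 m2 p"
    and XY: "\<And>p. p \<in> D \<Longrightarrow> XY_condition a1 a2 b1 b2 p"
    and nrm: "\<And>p. p \<in> D \<Longrightarrow> \<bar>(a1 p + a2 p + b1 p + b2 p) * (a1 p + a2 p - b1 p - b2 p)\<bar> * exp (2 * lam p) = 1"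
  shows "star L0 D lam a1 a2 b1 b2 m1 m2"
proof -
  \<comment> \<open>The three nonzero null components \<open>X_+ + Y_+\<close>,
    \<open>X_+ - Y_+\<close>, \<open>X_- + Y_-\<close>; the fourth, \<open>X_- - Y_-\<close>,
    vanishes by hypothesis.\<close>
  define x y z where "x = (\<lambda>p. a1 p + a2 p + b1 p + b2 p)" and "y = (\<lambda>p. a1 p - a2 p - b1 p + b2 p)"
    and "z = (\<lambda>p. a1 p + a2 p - b1 p - b2 p)"
  have sm: "smooth_on D x" "smooth_on D y" "smooth_on D z"
    unfolding x_def y_def z_def by (intro smooth_intros D s)+
  have nz: "x p \<noteq> 0" "y p \<noteq> 0" "z p \<noteq> 0" and xm: "a1 p - b2 p = a2 p - b1 p" if "p \<in> D" for p
  proof -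
    have X: "(a1 p + b2 p)\<^sup>2 \<noteq> (a2 p + b1 p)\<^sup>2" "a1 p - b2 p = a2 p - b1 p" "a2 p - b1 p \<noteq> 0"
      using XY[OF that] by (auto simp: XY_condition_def Let_def)
    have "x p * y p = (a1 p + b2 p)\<^sup>2 - (a2 p + b1 p)\<^sup>2"
      by (simp add: x_def y_def power2_eq_square algebra_simps)
    then show "x p \<noteq> 0" "y p \<noteq> 0" using X(1) by auto
    show "z p \<noteq> 0" using X(2,3) by (simp add: z_def)
    show "a1 p - b2 p = a2 p - b1 p" by (rule X)
  qed
  obtain e' P where P: "e' \<in> {1, -1}" "smooth_on D P" "\<And>p. p \<in> D \<Longrightarrow> x p = e' * exp (P p)" "\<And>p. p \<in> D \<Longrightarrow> P p = ln \<bar>x p\<bar>"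
    using smooth_log_abs[OF D sm(1) nz(1)] by blast
  obtain ey Q where Q: "ey \<in> {1, -1}" "smooth_on D Q" "\<And>p. p \<in> D \<Longrightarrow> y p = ey * exp (Q p)"
    using smooth_log_abs[OF D sm(2) nz(2)] by metis
  obtain e'' R where R: "e'' \<in> {1, -1}" "smooth_on D R" "\<And>p. p \<in> D \<Longrightarrow> z p = e'' * exp (R p)" "\<And>p. p \<in> D \<Longrightarrow> R p = ln \<bar>z p\<bar>"
    using smooth_log_abs[OF D sm(3) nz(3)] by blast
  \<comment> \<open>The normal form puts \<open>e'\<close> in front of both exponentials, so
    \<open>e\<close> is the sign of \<open>y\<close> relative to that of \<open>x\<close>.\<close>
  define e where "e = e' * ey"
  have e: "e \<in> {1, -1}" "ey = e' * e" "e' * ey = e" using P(1) Q(1) by (auto simp: e_def)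
  have lam: "lam p = - (1 / 2) * (P p + R p)" if p: "p \<in> D" for p
  proof -
    have "ln (\<bar>x p * z p\<bar> * exp (2 * lam p)) = 0" using nrm[OF p] by (simp add: x_def z_def)
    moreover have "ln (\<bar>x p * z p\<bar> * exp (2 * lam p)) = P p + R p + 2 * lam p"
      using nz[OF p] by (simp add: abs_mult ln_mult P(4)[OF p] R(4)[OF p])
    ultimately show ?thesis by argo
  qed
  have a: "a1 p = (x p + y p + z p) / 4" "a2 p = (x p - y p + z p) / 4"
    "b1 p = (x p - y p - z p) / 4" "b2 p = (x p + y p - z p) / 4" if "p \<in> D" for p
    using xm[OF that] by (simp_all add: x_def y_def z_def)
  have mu: "m1 p = - (1 / 2) * D_u P p + (1 / sqrt 2) * D_s Q p - (1 / 2) * D_v R p"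
    "m2 p = - (1 / 2) * D_v P p + (1 / sqrt 2) * D_s Q p - (1 / 2) * D_u R p" if p: "p \<in> D" for p
  proof -
    have sE: "smooth_on D (\<lambda>p. exp (P p))" "smooth_on D (\<lambda>p. exp (Q p))" "smooth_on D (\<lambda>p. exp (R p))"
      by (intro smooth_intros D P Q R)+
    have dx: "D_u x p = x p * D_u P p" "D_v x p = x p * D_v P p"
      "D_u y p = y p * D_u Q p" "D_v y p = y p * D_v Q p"
      "D_u z p = z p * D_u R p" "D_v z p = z p * D_v R p"
      using linear_combination_3(2,3)[OF D(1) sE, of x e' 0 0 p] linear_combination_3(2,3)[OF D(1) sE, of y 0 ey 0 p]
        linear_combination_3(2,3)[OF D(1) sE, of z 0 0 e'' p] P(3) Q(3) R(3) p
      by (simp_all add: D_exp[OF P(2) p] D_exp[OF Q(2) p] D_exp[OF R(2) p])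
    have fa: "\<forall>q\<in>D. a1 q = (1/4) * x q + (1/4) * y q + (1/4) * z q"
      "\<forall>q\<in>D. a2 q = (1/4) * x q + (-1/4) * y q + (1/4) * z q"
      "\<forall>q\<in>D. b1 q = (1/4) * x q + (-1/4) * y q + (-1/4) * z q"
      "\<forall>q\<in>D. b2 q = (1/4) * x q + (1/4) * y q + (-1/4) * z q"
      using a by (simp_all add: add_divide_distrib diff_divide_distrib)
    note d = linear_combination_3(2,3)[OF D(1) sm fa(1) p] linear_combination_3(2,3)[OF D(1) sm fa(2) p]
      linear_combination_3(2,3)[OF D(1) sm fa(3) p] linear_combination_3(2,3)[OF D(1) sm fa(4) p]
    have cod: "D_v a1 p - D_u a2 p + D_v lam p * a1 p + b1 p * m2 p - D_u lam p * a2 p - b2 p * m1 p = 0"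
      "D_v b1 p - D_u b2 p + a1 p * m2 p + D_v lam p * b1 p - a2 p * m1 p - D_u lam p * b2 p = 0"
      "D_v a2 p - D_u a1 p + D_v lam p * a2 p + b2 p * m2 p - D_u lam p * a1 p - b1 p * m1 p = 0"
      "D_v b2 p - D_u b1 p + D_v lam p * b2 p + a2 p * m2 p - D_u lam p * b1 p - a1 p * m1 p = 0"
      using gcr[OF p] unfolding gauss_codazzi_ricci_def by auto
    note cod = cod[unfolded d dx fa[THEN bspec, OF p]]
    \<comment> \<open>The sum of the first two equations contains \<open>x\<close> alone, because
      \<open>a1 + b1 = a2 + b2 = x / 2\<close>. Combinations of the four equations isolate
      \<open>y\<close> and \<open>z\<close> below.\<close>
    have "x p * (D_v P p - D_u P p + D_v lam p - D_u lam p + m2 p - m1 p) = 0"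
      using cod(1,2) by (simp add: algebra_simps)
    then have c1: "D_v P p - D_u P p + D_v lam p - D_u lam p + m2 p - m1 p = 0" using nz[OF p] by simp
    have "y p * (D_v Q p + D_u Q p + D_v lam p + D_u lam p - m1 p - m2 p) = 0"
      using cod by (simp add: algebra_simps)
    then have c2: "D_v Q p + D_u Q p + D_v lam p + D_u lam p - m1 p - m2 p = 0" using nz[OF p] by simp
    have "z p * (D_v R p - D_u R p + D_v lam p - D_u lam p - m2 p + m1 p) = 0"
      using cod by (simp add: algebra_simps)
    then have c3: "D_v R p - D_u R p + D_v lam p - D_u lam p - m2 p + m1 p = 0" using nz[OF p] by simp
    have fl: "\<forall>q\<in>D. lam q = (-1/2) * P q + 0 * Q q + (-1/2) * R q"
      using lam by (simp add: add_divide_distrib)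
    note dl = linear_combination_3(2,3)[OF D(1) P(2) Q(2) R(2) fl p]
    have DQ: "(1 / sqrt 2) * D_s Q p = (1 / 2) * (D_u Q p + D_v Q p)"
      using D_s_uv[OF smooth_on_differentiable[OF Q(2) p]] by (simp add: mult.assoc[symmetric])
    have dl: "2 * D_u lam p = - D_u P p - D_u R p" "2 * D_v lam p = - D_v P p - D_v R p" using dl by auto
    show "m1 p = - (1 / 2) * D_u P p + (1 / sqrt 2) * D_s Q p - (1 / 2) * D_v R p"
      unfolding DQ using c1 c2 c3 dl by argo
    show "m2 p = - (1 / 2) * D_v P p + (1 / sqrt 2) * D_s Q p - (1 / 2) * D_u R p"
      unfolding DQ using c1 c2 c3 dl by argo
  qed
  have sd: "star_data D e' (e' * e) e'' P Q R lam a1 a2 b1 b2 m1 m2"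
    unfolding star_data_def e(2)[symmetric]
  proof (intro conjI ballI P Q R lam mu)
    fix p assume p: "p \<in> D"
    show "a1 p = (e' * exp (P p) + ey * exp (Q p) + e'' * exp (R p)) / 4"
      "a2 p = (e' * exp (P p) - ey * exp (Q p) + e'' * exp (R p)) / 4"
      "b1 p = (e' * exp (P p) - ey * exp (Q p) - e'' * exp (R p)) / 4"
      "b2 p = (e' * exp (P p) + ey * exp (Q p) - e'' * exp (R p)) / 4"
      using a[OF p] P(3)[OF p] Q(3)[OF p] R(3)[OF p] by simp_all
  qed
  let ?f1 = "\<lambda>p. P p - Q p + 2 * R p" and ?f2 = "\<lambda>p. Q p - R p"
  have sf: "smooth_on D ?f1" "smooth_on D ?f2" by (intro smooth_intros D P Q R)+
  have "D_t (D_s ?f1) p = L0 * exp (- ?f1 p - ?f2 p) \<and> D_t (D_s ?f2) p = - (e / 2) * exp (?f1 p + 2 * ?f2 p)"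
    if p: "p \<in> D" for p
  proof -
    have ee: "e' * (e' * e) = e" using e by simp
    have g: "D_t (D_s (\<lambda>q. P q + R q)) p = L0 * exp (2 * lam p) - (e / 2) * exp (P p + Q p)"
      "D_t (D_s ?f2) p = - (e / 2) * exp (P p + Q p)"
      using gcr[OF p] unfolding star_data_equations(8)[OF D(1) sd p] ee by auto
    have sPR: "smooth_on D (\<lambda>q. P q + R q)" by (intro smooth_intros D P R)
    have "D_t (D_s ?f1) p = 1 * D_t (D_s (\<lambda>q. P q + R q)) p + (-1) * D_t (D_s ?f2) p + 0 * D_t (D_s ?f2) p"
      by (rule D_ts_linear[OF D(1) p sPR sf(2) sf(2)]) simp
    then show ?thesis using g lam[OF p] by (simp add: algebra_simps)
  qed
  then show ?thesis unfolding star_eq_star_data using e(1) P(1) R(1) sd sf by blast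
qed

section \<open>Change of the paracomplex coordinate\<close>

definition paracomplex_derivative :: "(plane \<Rightarrow> plane) \<Rightarrow> plane \<Rightarrow> real \<Rightarrow> real \<Rightarrow> bool" where
  "paracomplex_derivative \<tau> p a b \<longleftrightarrow> (\<tau> has_derivative (\<lambda>(x, y). (a * x + b * y, b * x + a * y))) (at p)"

definition paracomplex_map :: "plane set \<Rightarrow> (plane \<Rightarrow> plane) \<Rightarrow> bool" where
  "paracomplex_map W \<tau> \<longleftrightarrow>
     smooth_on W \<tau> \<and> (\<forall>p\<in>W. \<exists>a b. a\<^sup>2 - b\<^sup>2 > 0 \<and> paracomplex_derivative \<tau> p a b)"

lemma paracomplex_change_iff:
  "paracomplex_change (U, \<phi>) (U', \<phi>') \<longleftrightarrow> paracomplex_map (\<phi> ` (U \<inter> U')) (\<phi>' \<circ> inv_into U \<phi>)"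
  by (simp add: paracomplex_change_def paracomplex_map_def paracomplex_derivative_def)

text \<open>The differentials multiply as paracomplex numbers, and \<open>a^2 - b^2\<close> is
  multiplicative, being the norm of \<open>a + jb\<close>.\<close>

lemma paracomplex_map_compose:
  assumes \<tau>: "paracomplex_map W \<tau>" and \<tau>': "paracomplex_map W' \<tau>'" and W: "open W" and sub: "\<tau> ` W \<subseteq> W'"
  shows "paracomplex_map W (\<lambda>q. \<tau>' (\<tau> q))"
  unfolding paracomplex_map_def
proof (intro conjI ballI)
  show "smooth_on W (\<lambda>q. \<tau>' (\<tau> q))"
    using \<tau> \<tau>' W sub by (auto simp: paracomplex_map_def intro: smooth_on_compose)
  fix p assume p: "p \<in> W"
  obtain a b where ab: "a\<^sup>2 - b\<^sup>2 > 0" "paracomplex_derivative \<tau> p a b"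
    using \<tau> p by (auto simp: paracomplex_map_def)
  obtain a' b' where ab': "a'\<^sup>2 - b'\<^sup>2 > 0" "paracomplex_derivative \<tau>' (\<tau> p) a' b'"
  proof -
    have "\<tau> p \<in> W'" using p sub by blast
    then show thesis using \<tau>' that unfolding paracomplex_map_def by blast
  qed
  have "((\<lambda>q. \<tau>' (\<tau> q)) has_derivative (\<lambda>z. (\<lambda>(x, y). (a' * x + b' * y, b' * x + a' * y))
      ((\<lambda>(x, y). (a * x + b * y, b * x + a * y)) z))) (at p)"
    using has_derivative_compose[OF ab(2)[unfolded paracomplex_derivative_def] ab'(2)[unfolded paracomplex_derivative_def]] .
  moreover have "(\<lambda>z. (\<lambda>(x, y). (a' * x + b' * y, b' * x + a' * y)) ((\<lambda>(x, y). (a * x + b * y, b * x + a * y)) z))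
      = (\<lambda>(x, y). ((a' * a + b' * b) * x + (a' * b + b' * a) * y, (a' * b + b' * a) * x + (a' * a + b' * b) * y))"
    by (auto simp: fun_eq_iff algebra_simps)
  ultimately have "paracomplex_derivative (\<lambda>q. \<tau>' (\<tau> q)) p (a' * a + b' * b) (a' * b + b' * a)"
    by (simp add: paracomplex_derivative_def)
  moreover have "(a' * a + b' * b)\<^sup>2 - (a' * b + b' * a)\<^sup>2 = (a\<^sup>2 - b\<^sup>2) * (a'\<^sup>2 - b'\<^sup>2)"
    by (simp add: power2_eq_square algebra_simps)
  ultimately show "\<exists>a b. a\<^sup>2 - b\<^sup>2 > 0 \<and> paracomplex_derivative (\<lambda>q. \<tau>' (\<tau> q)) p a b"
    using ab(1) ab'(1) by (metis mult_pos_pos)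
qed

lemma paracomplex_map_cong:
  assumes "paracomplex_map W \<tau>" "open W" "\<And>q. q \<in> W \<Longrightarrow> \<tau> q = \<tau>' q"
  shows "paracomplex_map W \<tau>'"
proof -
  have "paracomplex_derivative \<tau>' p a b" if "p \<in> W" "paracomplex_derivative \<tau> p a b" for p a b
    using that(2) unfolding paracomplex_derivative_def
    by (rule has_derivative_transform_within_open[OF _ assms(2) that(1)]) (rule assms(3))
  moreover have "smooth_on W \<tau>'"
    using assms(1) by (intro smooth_on_cong[OF _ assms(2,3)]) (simp add: paracomplex_map_def)
  ultimately show ?thesis using assms(1) unfolding paracomplex_map_def by blast
qed

lemma paracomplex_map_subset: "paracomplex_map W \<tau> \<Longrightarrow> V \<subseteq> W \<Longrightarrow> paracomplex_map V \<tau>"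
  unfolding paracomplex_map_def by (blast intro: smooth_on_subset)

lemma D_compose_paracomplex:
  fixes f :: "plane \<Rightarrow> 'b::real_normed_vector"
  assumes "f differentiable (at (\<tau> p))" "paracomplex_derivative \<tau> p a b"
  shows "D_u (\<lambda>q. f (\<tau> q)) p = a *\<^sub>R D_u f (\<tau> p) + b *\<^sub>R D_v f (\<tau> p)"
    "D_v (\<lambda>q. f (\<tau> q)) p = b *\<^sub>R D_u f (\<tau> p) + a *\<^sub>R D_v f (\<tau> p)"
  using frechet_derivativeI[OF has_derivative_compose[OF assms(2)[unfolded paracomplex_derivative_def]
        has_derivative_frechet[OF assms(1)]]] fd_plane[OF assms(1)]
  unfolding D_u_def[of "\<lambda>q. f (\<tau> q)"] D_v_def[of "\<lambda>q. f (\<tau> q)"] by simp_all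

lemma paracomplex_derivative_D_u:
  assumes "paracomplex_derivative \<tau> p a b"
  shows "D_u \<tau> p = (a, b)"
  unfolding D_u_def frechet_derivativeI[OF assms[unfolded paracomplex_derivative_def]] by simp

section \<open>Behaviour under changes of coordinate and normal frame\<close>

lemma det_rows5_add:
  fixes a b c d e x :: "real^5"
  shows "det (rows5 (a + x) b c d e) = det (rows5 a b c d e) + det (rows5 x b c d e)"
    "det (rows5 a (b + x) c d e) = det (rows5 a b c d e) + det (rows5 a x c d e)"
    "det (rows5 a b (c + x) d e) = det (rows5 a b c d e) + det (rows5 a b x d e)"
    "det (rows5 a b c (d + x) e) = det (rows5 a b c d e) + det (rows5 a b c x e)"
proof -
  let ?r = "rows5 a b c d e"
  have r: "rows5 y b c d e = (\<chi> i. if i = 1 then y else ?r $ i)" "rows5 a y c d e = (\<chi> i. if i = 2 then y else ?r $ i)"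
    "rows5 a b y d e = (\<chi> i. if i = 3 then y else ?r $ i)" "rows5 a b c y e = (\<chi> i. if i = 4 then y else ?r $ i)" for y
    by (simp_all add: rows5_def vec_eq_iff)
  show "det (rows5 (a + x) b c d e) = det (rows5 a b c d e) + det (rows5 x b c d e)"
    using det_row_add[where k=1 and a="\<lambda>_. a" and b="\<lambda>_. x" and c="\<lambda>i. ?r $ i"]
    unfolding r(1)[symmetric] .
  show "det (rows5 a (b + x) c d e) = det (rows5 a b c d e) + det (rows5 a x c d e)"
    using det_row_add[where k=2 and a="\<lambda>_. b" and b="\<lambda>_. x" and c="\<lambda>i. ?r $ i"]
    unfolding r(2)[symmetric] .
  show "det (rows5 a b (c + x) d e) = det (rows5 a b c d e) + det (rows5 a b x d e)"
    using det_row_add[where k=3 and a="\<lambda>_. c" and b="\<lambda>_. x" and c="\<lambda>i. ?r $ i"]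
    unfolding r(3)[symmetric] .
  show "det (rows5 a b c (d + x) e) = det (rows5 a b c d e) + det (rows5 a b c x e)"
    using det_row_add[where k=4 and a="\<lambda>_. d" and b="\<lambda>_. x" and c="\<lambda>i. ?r $ i"]
    unfolding r(4)[symmetric] .
qed

lemma det_rows5_equal:
  fixes a b c d e :: "real^5"
  shows "det (rows5 a b a d e) = 0" "det (rows5 a b c b e) = 0"
  by (rule det_identical_rows[of 1 3]; simp add: row_def) (rule det_identical_rows[of 2 4]; simp add: row_def)

text \<open>Compares orientations: the tangent vectors and the normal vectors are transformed
  separately, so the determinants of the two blocks multiply.\<close>

lemma det_rows5_blocks:
  fixes t1 n1 t2 n2 e :: "real^5"
  shows "det (rows5 (a *\<^sub>R t1 + b *\<^sub>R t2) (p *\<^sub>R n1 + q *\<^sub>R n2) (b *\<^sub>R t1 + a *\<^sub>R t2) (r *\<^sub>R n1 + s *\<^sub>R n2) e) =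
    (a\<^sup>2 - b\<^sup>2) * (p * s - q * r) * det (rows5 t1 n1 t2 n2 e)"
proof -
  have sc: "det (rows5 (k *\<^sub>R w) x y z e) = k * det (rows5 w x y z e)" "det (rows5 w (k *\<^sub>R x) y z e) = k * det (rows5 w x y z e)"
    "det (rows5 w x (k *\<^sub>R y) z e) = k * det (rows5 w x y z e)" "det (rows5 w x y (k *\<^sub>R z) e) = k * det (rows5 w x y z e)"
    for k and w x y z :: "real^5"
    using det_rows5_scale[of k w 1 x 1 y 1 z 1 e] det_rows5_scale[of 1 w k x 1 y 1 z 1 e]
      det_rows5_scale[of 1 w 1 x k y 1 z 1 e] det_rows5_scale[of 1 w 1 x 1 y k z 1 e] by simp_all
  have "det (rows5 t2 x t1 z e) + det (rows5 t1 x t2 z e) = 0" "det (rows5 w n2 y n1 e) + det (rows5 w n1 y n2 e) = 0"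
    for w x y z :: "real^5"
    using det_rows5_equal(1)[of "t1 + t2" x z e, unfolded det_rows5_add]
      det_rows5_equal(2)[of w "n1 + n2" y e, unfolded det_rows5_add]
    by (simp_all add: det_rows5_equal)
  then have sw: "det (rows5 t2 x t1 z e) = - det (rows5 t1 x t2 z e)" "det (rows5 w n2 y n1 e) = - det (rows5 w n1 y n2 e)"
    for w x y z :: "real^5"
    by (simp_all only: eq_neg_iff_add_eq_0)
  show ?thesis
    by (simp add: det_rows5_add sc det_rows5_equal sw power2_eq_square) (simp add: algebra_simps)
qed

text \<open>A change of frame in a Lorentz plane that rescales the metric by \<open>m\<close> and
  keeps the orientation is a boost times a factor, with matrix symmetric and of equal diagonal
  entries. The identity below forces the determinant to be \<open>m\<close>; Cramer's rule does the
  rest.\<close>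

lemma hyperbolic_rotation:
  fixes p q r s m :: real
  assumes "p\<^sup>2 - q\<^sup>2 = m" "r\<^sup>2 - s\<^sup>2 = - m" "p * r - q * s = 0" "p * s - q * r > 0" "m > 0"
  shows "p = s" "q = r"
proof -
  have "(p * s - q * r)\<^sup>2 = (p\<^sup>2 - q\<^sup>2) * (s\<^sup>2 - r\<^sup>2) + (p * r - q * s)\<^sup>2"
    by (simp add: power2_eq_square algebra_simps)
  also have "\<dots> = m\<^sup>2" using assms by (simp add: power2_eq_square)
  finally have d: "p * s - q * r = m" using assms(4,5) by (simp add: power2_eq_iff)
  have "p * m = p * p * s - q * (p * r)" by (simp add: d[symmetric] algebra_simps)
  also have "\<dots> = (p\<^sup>2 - q\<^sup>2) * s" using assms(3) by (simp add: power2_eq_square algebra_simps)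
  finally show "p = s" using assms(1,5) by simp
  have "q * m = p * (q * s) - q * q * r" by (simp add: d[symmetric] algebra_simps)
  also have "\<dots> = (p\<^sup>2 - q\<^sup>2) * r" using assms(3) by (simp add: power2_eq_square algebra_simps)
  finally show "q = r" using assms(1,5) by simp
qed

lemma XY_condition_iff:
  "XY_condition a1 a2 b1 b2 p \<longleftrightarrow> a1 p + a2 p + b1 p + b2 p \<noteq> 0 \<and> a1 p - a2 p - b1 p + b2 p \<noteq> 0 \<and>
     a1 p + a2 p - b1 p - b2 p \<noteq> 0 \<and> a1 p - a2 p + b1 p - b2 p = 0"
proof -
  have "(a1 p + b2 p)\<^sup>2 - (a2 p + b1 p)\<^sup>2 = (a1 p + a2 p + b1 p + b2 p) * (a1 p - a2 p - b1 p + b2 p)"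
    by (simp add: power2_eq_square algebra_simps)
  then have "(a1 p + b2 p)\<^sup>2 \<noteq> (a2 p + b1 p)\<^sup>2 \<longleftrightarrow> a1 p + a2 p + b1 p + b2 p \<noteq> 0 \<and> a1 p - a2 p - b1 p + b2 p \<noteq> 0"
    by (metis eq_iff_diff_eq_0 mult_eq_0_iff)
  then show ?thesis by (auto simp: XY_condition_def Let_def)
qed

context framed_surface
begin

text \<open>Up to the factor \<open>e\<^bsup>2\<lambda>\<^esup>\<close>, the components of the second fundamental form in the null
  directions of the tangent plane and of the normal plane.\<close>

lemma null_components:
  assumes as: "associated_functions L0 D X N1 N2 lam a1 a2 b1 b2 m1 m2" and p: "p \<in> D"
  shows "(a1 p + a2 p + b1 p + b2 p) * exp (2 * lam p) = psc L0 (D_u (D_u X) p + D_u (D_v X) p) (N1 p - N2 p)"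
    "(a1 p - a2 p - b1 p + b2 p) * exp (2 * lam p) = psc L0 (D_u (D_u X) p - D_u (D_v X) p) (N1 p + N2 p)"
    "(a1 p + a2 p - b1 p - b2 p) * exp (2 * lam p) = psc L0 (D_u (D_u X) p + D_u (D_v X) p) (N1 p + N2 p)"
    "(a1 p - a2 p + b1 p - b2 p) * exp (2 * lam p) = psc L0 (D_u (D_u X) p - D_u (D_v X) p) (N1 p - N2 p)"
  unfolding associated_determined[OF as p] al1_def al2_def be1_def be2_def
  by (simp_all add: psc_linear field_simps)

end

lemma D_u_add:
  "f differentiable (at p) \<Longrightarrow> g differentiable (at p) \<Longrightarrow> D_u (\<lambda>x. f x + g x) p = D_u f p + D_u g p"
  by (simp add: D_u_def fd_add)

lemma D_u_scaleR:
  "f differentiable (at p) \<Longrightarrow> g differentiable (at p) \<Longrightarrow>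
    D_u (\<lambda>x. f x *\<^sub>R g x) p = f p *\<^sub>R D_u g p + D_u f p *\<^sub>R g p"
  by (simp add: D_u_def fd_scaleR)

lemma D_u_cong:
  "f differentiable (at p) \<Longrightarrow> open S \<Longrightarrow> p \<in> S \<Longrightarrow> (\<And>x. x \<in> S \<Longrightarrow> f x = g x) \<Longrightarrow> D_u g p = D_u f p"
  unfolding D_u_def by (rule fd_cong)

text \<open>The chain rule differentiates the multipliers \<open>a\<close>, \<open>b\<close> too,
  but these terms are tangential and vanish against the normal vector \<open>n\<close>. As the pure
  second derivatives agree against \<open>n\<close>, the null directions
  \<open>\<partial>_u + \<partial>_v\<close> and \<open>\<partial>_u - \<partial>_v\<close> decouple
  and scale by \<open>a + b\<close> and \<open>a - b\<close>.\<close>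

lemma second_derivative_transfer:
  assumes W: "open W" "p \<in> W" and \<tau>: "paracomplex_map W \<tau>" "\<tau> ` W \<subseteq> D'"
    and X': "smooth_on D' X'" "open D'" and X: "\<forall>q\<in>W. X q = X' (\<tau> q)"
    and d: "paracomplex_derivative \<tau> p a b"
    and n: "psc L0 (D_u X' (\<tau> p)) n = 0" "psc L0 (D_v X' (\<tau> p)) n = 0"
      "psc L0 (D_v (D_v X') (\<tau> p)) n = psc L0 (D_u (D_u X') (\<tau> p)) n"
  shows "D_u X p = a *\<^sub>R D_u X' (\<tau> p) + b *\<^sub>R D_v X' (\<tau> p)" "D_v X p = b *\<^sub>R D_u X' (\<tau> p) + a *\<^sub>R D_v X' (\<tau> p)"
    "psc L0 (D_u (D_u X) p + D_u (D_v X) p) n = (a + b)\<^sup>2 * psc L0 (D_u (D_u X') (\<tau> p) + D_u (D_v X') (\<tau> p)) n"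
    "psc L0 (D_u (D_u X) p - D_u (D_v X) p) n = (a - b)\<^sup>2 * psc L0 (D_u (D_u X') (\<tau> p) - D_u (D_v X') (\<tau> p)) n"
proof -
  have st: "smooth_on W \<tau>" using \<tau> by (simp add: paracomplex_map_def)
  \<comment> \<open>The multiplier is known at each point only by existence;
    \<open>D_u \<tau> = (A, B)\<close> recovers it as a smooth function, so that it can be
    differentiated.\<close>
  define A B where "A = (\<lambda>q. fst (D_u \<tau> q))" and "B = (\<lambda>q. snd (D_u \<tau> q))"
  have sAB: "smooth_on W A" "smooth_on W B"
    unfolding A_def B_def
    by (intro smooth_on_bounded_linear_compose[OF bounded_linear_fst W(1)]
        smooth_on_bounded_linear_compose[OF bounded_linear_snd W(1)] smooth_on_D(1)[OF st])+
  have AB: "paracomplex_derivative \<tau> q (A q) (B q)" if "q \<in> W" for q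
    using \<tau>(1) that paracomplex_derivative_D_u[of \<tau> q] by (force simp: paracomplex_map_def A_def B_def)
  have ABp: "A p = a" "B p = b" using paracomplex_derivative_D_u[OF d] by (simp_all add: A_def B_def)
  have in': "\<tau> q \<in> D'" if "q \<in> W" for q using \<tau>(2) that by blast
  note df' = smooth_on_differentiable[OF _ in'] and df = smooth_on_differentiable[OF _ W(2)]
  have first: "D_u X q = A q *\<^sub>R D_u X' (\<tau> q) + B q *\<^sub>R D_v X' (\<tau> q)"
    "D_v X q = B q *\<^sub>R D_u X' (\<tau> q) + A q *\<^sub>R D_v X' (\<tau> q)" if q: "q \<in> W" for q
  proof -
    have dc: "(\<lambda>q. X' (\<tau> q)) differentiable (at q)"
      by (rule smooth_on_differentiable[OF smooth_on_compose[OF X'(1) W(1) st \<tau>(2)] q])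
    have "D_u X q = D_u (\<lambda>q. X' (\<tau> q)) q" "D_v X q = D_v (\<lambda>q. X' (\<tau> q)) q"
      unfolding D_u_def D_v_def by (rule fd_cong[OF dc W(1) q]; simp add: X)+
    then show "D_u X q = A q *\<^sub>R D_u X' (\<tau> q) + B q *\<^sub>R D_v X' (\<tau> q)"
      "D_v X q = B q *\<^sub>R D_u X' (\<tau> q) + A q *\<^sub>R D_v X' (\<tau> q)"
      using D_compose_paracomplex[OF df'[OF X'(1) q] AB[OF q]] by simp_all
  qed
  show "D_u X p = a *\<^sub>R D_u X' (\<tau> p) + b *\<^sub>R D_v X' (\<tau> p)" "D_v X p = b *\<^sub>R D_u X' (\<tau> p) + a *\<^sub>R D_v X' (\<tau> p)"
    using first[OF W(2)] ABp by simp_all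
  have sT: "smooth_on W (\<lambda>q. D_u X' (\<tau> q))" "smooth_on W (\<lambda>q. D_v X' (\<tau> q))"
    using smooth_on_compose[OF smooth_on_D(1)[OF X'(1)] W(1) st \<tau>(2)]
      smooth_on_compose[OF smooth_on_D(2)[OF X'(1)] W(1) st \<tau>(2)] by simp_all
  have comb: "D_u (\<lambda>q. C q *\<^sub>R D_u X' (\<tau> q) + E q *\<^sub>R D_v X' (\<tau> q)) p =
      C p *\<^sub>R (a *\<^sub>R D_u (D_u X') (\<tau> p) + b *\<^sub>R D_u (D_v X') (\<tau> p)) + D_u C p *\<^sub>R D_u X' (\<tau> p)
      + E p *\<^sub>R (a *\<^sub>R D_u (D_v X') (\<tau> p) + b *\<^sub>R D_v (D_v X') (\<tau> p)) + D_u E p *\<^sub>R D_v X' (\<tau> p)"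
    if s: "smooth_on W C" "smooth_on W E" for C E
  proof -
    have s2: "smooth_on W (\<lambda>q. C q *\<^sub>R D_u X' (\<tau> q))" "smooth_on W (\<lambda>q. E q *\<^sub>R D_v X' (\<tau> q))"
      by (intro smooth_intros W(1) s sT)+
    have t: "D_u (\<lambda>q. D_u X' (\<tau> q)) p = a *\<^sub>R D_u (D_u X') (\<tau> p) + b *\<^sub>R D_u (D_v X') (\<tau> p)"
      "D_u (\<lambda>q. D_v X' (\<tau> q)) p = a *\<^sub>R D_u (D_v X') (\<tau> p) + b *\<^sub>R D_v (D_v X') (\<tau> p)"
      using D_compose_paracomplex(1)[OF df'[OF smooth_on_D(1)[OF X'(1)] W(2)] d]
        D_compose_paracomplex(1)[OF df'[OF smooth_on_D(2)[OF X'(1)] W(2)] d]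
        mixed_partials[OF X'(2) in'[OF W(2)] X'(1)] by simp_all
    have "D_u (\<lambda>q. C q *\<^sub>R D_u X' (\<tau> q) + E q *\<^sub>R D_v X' (\<tau> q)) p =
       (C p *\<^sub>R D_u (\<lambda>q. D_u X' (\<tau> q)) p + D_u C p *\<^sub>R D_u X' (\<tau> p))
      + (E p *\<^sub>R D_u (\<lambda>q. D_v X' (\<tau> q)) p + D_u E p *\<^sub>R D_v X' (\<tau> p))"
      by (simp only: D_u_add[OF df[OF s2(1)] df[OF s2(2)]] D_u_scaleR[OF df[OF s(1)] df[OF sT(1)]]
          D_u_scaleR[OF df[OF s(2)] df[OF sT(2)]])
    then show ?thesis unfolding t by (simp add: add.assoc)
  qed
  have sc: "smooth_on W (\<lambda>q. A q *\<^sub>R D_u X' (\<tau> q) + B q *\<^sub>R D_v X' (\<tau> q))"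
    "smooth_on W (\<lambda>q. B q *\<^sub>R D_u X' (\<tau> q) + A q *\<^sub>R D_v X' (\<tau> q))"
    by (intro smooth_intros W(1) sAB sT)+
  have uu: "D_u (D_u X) p = D_u (\<lambda>q. A q *\<^sub>R D_u X' (\<tau> q) + B q *\<^sub>R D_v X' (\<tau> q)) p"
    by (rule D_u_cong[OF df[OF sc(1)] W]) (simp add: first)
  have uv: "D_u (D_v X) p = D_u (\<lambda>q. B q *\<^sub>R D_u X' (\<tau> q) + A q *\<^sub>R D_v X' (\<tau> q)) p"
    by (rule D_u_cong[OF df[OF sc(2)] W]) (simp add: first)
  have "psc L0 (D_u (D_u X) p) n = (a * a + b * b) * psc L0 (D_u (D_u X') (\<tau> p)) n + 2 * a * b * psc L0 (D_u (D_v X') (\<tau> p)) n"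
    "psc L0 (D_u (D_v X) p) n = 2 * a * b * psc L0 (D_u (D_u X') (\<tau> p)) n + (a * a + b * b) * psc L0 (D_u (D_v X') (\<tau> p)) n"
    unfolding uu uv comb[OF sAB] comb[OF sAB(2,1)] ABp by (simp_all only: psc_linear n) (simp_all add: algebra_simps)
  then show "psc L0 (D_u (D_u X) p + D_u (D_v X) p) n = (a + b)\<^sup>2 * psc L0 (D_u (D_u X') (\<tau> p) + D_u (D_v X') (\<tau> p)) n"
    "psc L0 (D_u (D_u X) p - D_u (D_v X) p) n = (a - b)\<^sup>2 * psc L0 (D_u (D_u X') (\<tau> p) - D_u (D_v X') (\<tau> p)) n"
    by (simp_all add: psc_linear power2_eq_square algebra_simps)
qed

text \<open>The normal frames at corresponding points differ by a boost times a factor, so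
  \<open>N1 - N2\<close> and \<open>N1 + N2\<close> are multiplied by
  \<open>\<alpha> - \<beta>\<close> and \<open>\<alpha> + \<beta>\<close>. Each null component gets
  a nonzero factor, which preserves (a). In the product of two of them,
  \<open>(\<alpha> - \<beta>) (\<alpha> + \<beta>)\<close> is the ratio of the metrics and is
  absorbed by \<open>e^(2 \<lambda>)\<close>.\<close>

lemma coordinate_change:
  assumes S: "framed_surface L0 D X lam \<sigma> N1 N2" and as: "associated_functions L0 D X N1 N2 lam a1 a2 b1 b2 m1 m2"
    and S': "framed_surface L0 D' X' lam' \<sigma> N1' N2'"
    and as': "associated_functions L0 D' X' N1' N2' lam' a1' a2' b1' b2' m1' m2'"
    and W: "open W" "p \<in> W" "W \<subseteq> D" and \<tau>: "paracomplex_map W \<tau>" "\<tau> ` W \<subseteq> D'"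
    and X: "\<forall>q\<in>W. X q = X' (\<tau> q)"
    and d: "paracomplex_derivative \<tau> p a b" and ab: "a\<^sup>2 - b\<^sup>2 > 0" and \<sigma>: "\<sigma> \<noteq> 0"
  shows "XY_condition a1 a2 b1 b2 p \<longleftrightarrow> XY_condition a1' a2' b1' b2' (\<tau> p)"
    and "(a1 p + a2 p + b1 p + b2 p) * (a1 p + a2 p - b1 p - b2 p) * exp (2 * lam p) =
      (a + b) ^ 4 * ((a1' (\<tau> p) + a2' (\<tau> p) + b1' (\<tau> p) + b2' (\<tau> p)) *
        (a1' (\<tau> p) + a2' (\<tau> p) - b1' (\<tau> p) - b2' (\<tau> p)) * exp (2 * lam' (\<tau> p)))"
proof -
  interpret s: framed_surface L0 D X lam \<sigma> N1 N2 by (rule S)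
  interpret s': framed_surface L0 D' X' lam' \<sigma> N1' N2' by (rule S')
  let ?r = "\<tau> p"
  have p: "p \<in> D" and r: "?r \<in> D'" using W \<tau> by auto
  define E E' where "E = exp (2 * lam p)" and "E' = exp (2 * lam' ?r)"
  have E: "E > 0" "E' > 0" by (simp_all add: E_def E'_def)
  have Xp: "X p = X' ?r" using X W(2) by blast
  note pr = s.frame_products[OF p, folded E_def] and pr' = s'.frame_products[OF r, folded E'_def]
  note m' = s'.metric[OF r, folded E'_def]
  note t' = s'.tangent_T[OF r] s'.tangent_N[OF r]
  have tr: "D_u X p = a *\<^sub>R D_u X' ?r + b *\<^sub>R D_v X' ?r" "D_v X p = b *\<^sub>R D_u X' ?r + a *\<^sub>R D_v X' ?r"
    "psc L0 (D_u (D_u X) p + D_u (D_v X) p) n = (a + b)\<^sup>2 * psc L0 (D_u (D_u X') ?r + D_u (D_v X') ?r) n"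
    "psc L0 (D_u (D_u X) p - D_u (D_v X) p) n = (a - b)\<^sup>2 * psc L0 (D_u (D_u X') ?r - D_u (D_v X') ?r) n"
    if "n \<in> tangent_sp L0 (X' ?r)" "psc L0 n (D_u X' ?r) = 0" "psc L0 n (D_v X' ?r) = 0" for n
    using second_derivative_transfer[OF W(1,2) \<tau> s'.smooth_X s'.open_D X d, of L0 n]
      s'.zero_mean_normal[OF r s'.mean_curvature_zero[OF as' r] that]
      that psc_commute[of L0 n] by auto
  have 0: "(0::real^5) \<in> tangent_sp L0 (X' ?r)" by (simp add: tangent_sp_def psc_linear)
  have tr0: "D_u X p = a *\<^sub>R D_u X' ?r + b *\<^sub>R D_v X' ?r" "D_v X p = b *\<^sub>R D_u X' ?r + a *\<^sub>R D_v X' ?r"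
    by (rule tr(1,2)[OF 0]; simp add: psc_linear)+
  have orth: "psc L0 n (D_u X' ?r) = 0 \<and> psc L0 n (D_v X' ?r) = 0"
    if "psc L0 n (D_u X p) = 0" "psc L0 n (D_v X p) = 0" for n
  proof -
    let ?x = "psc L0 n (D_u X' ?r)" and ?y = "psc L0 n (D_v X' ?r)"
    have e: "a * ?x + b * ?y = 0" "b * ?x + a * ?y = 0" using that unfolding tr0 by (simp_all add: psc_linear)
    have "(a\<^sup>2 - b\<^sup>2) * ?x = a * (a * ?x + b * ?y) - b * (b * ?x + a * ?y)"
      "(a\<^sup>2 - b\<^sup>2) * ?y = a * (b * ?x + a * ?y) - b * (a * ?x + b * ?y)"
      by (simp_all add: power2_eq_square algebra_simps)
    then show ?thesis unfolding e using ab by simp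
  qed
  have No: "psc L0 (N1 p) (D_u X' ?r) = 0" "psc L0 (N1 p) (D_v X' ?r) = 0"
    "psc L0 (N2 p) (D_u X' ?r) = 0" "psc L0 (N2 p) (D_v X' ?r) = 0"
    using orth[of "N1 p"] orth[of "N2 p"] pr by auto
  have Nt: "N1 p \<in> tangent_sp L0 (X' ?r)" "N2 p \<in> tangent_sp L0 (X' ?r)" using s.tangent_N[OF p] Xp by simp_all
  \<comment> \<open>Coordinates of \<open>N1 p\<close> and \<open>N2 p\<close> in the frame
    \<open>N1'\<close>, \<open>N2'\<close>; the minus signs account for the negative square of
    \<open>N2'\<close>.\<close>
  define \<alpha> \<beta> \<gamma> \<delta> where "\<alpha> = psc L0 (N1 p) (N1' ?r) / E'" and "\<beta> = - psc L0 (N1 p) (N2' ?r) / E'"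
    and "\<gamma> = psc L0 (N2 p) (N1' ?r) / E'" and "\<delta> = - psc L0 (N2 p) (N2' ?r) / E'"
  have N1: "N1 p = \<alpha> *\<^sub>R N1' ?r + \<beta> *\<^sub>R N2' ?r" and N2: "N2 p = \<gamma> *\<^sub>R N1' ?r + \<delta> *\<^sub>R N2' ?r"
    by (rule s'.tangent_eqI[OF r]; use E in \<open>simp add: Nt t' tangent_sp_linear psc_linear pr' No \<alpha>_def \<beta>_def \<gamma>_def \<delta>_def\<close>)+
  have "\<alpha>\<^sup>2 - \<beta>\<^sup>2 = E / E'" "\<gamma>\<^sup>2 - \<delta>\<^sup>2 = - (E / E')" "\<alpha> * \<gamma> - \<beta> * \<delta> = 0"
  proof -
    have *: "(\<alpha>\<^sup>2 - \<beta>\<^sup>2) * E' = E" "(\<gamma>\<^sup>2 - \<delta>\<^sup>2) * E' = - E" "(\<alpha> * \<gamma> - \<beta> * \<delta>) * E' = 0"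
      using pr(9,10,11) unfolding N1 N2 by (simp_all add: psc_linear pr' power2_eq_square algebra_simps)
    have "\<gamma>\<^sup>2 - \<delta>\<^sup>2 = (\<gamma>\<^sup>2 - \<delta>\<^sup>2) * E' / E'" using E by simp
    then show "\<gamma>\<^sup>2 - \<delta>\<^sup>2 = - (E / E')" unfolding *(2) by simp
    show "\<alpha>\<^sup>2 - \<beta>\<^sup>2 = E / E'" "\<alpha> * \<gamma> - \<beta> * \<delta> = 0"
      using * E by (simp_all add: eq_divide_eq)
  qed
  \<comment> \<open>Opposite orientations would exchange the two null directions of the normal
    plane, and with them the null components. This is where the orientation of the space form
    enters.\<close>
  moreover have "\<alpha> * \<delta> - \<beta> * \<gamma> > 0"
  proof -
    let ?e = "if L0 = 0 then axis 5 1 else X' ?r"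
    have "\<sigma> * det (rows5 (D_u X p) (N1 p) (D_v X p) (N2 p) ?e) > 0"
      using s.frame p unfolding normal_frame_def positively_oriented_rows5 Xp[symmetric] by auto
    moreover have "\<sigma> * det (rows5 (D_u X' ?r) (N1' ?r) (D_v X' ?r) (N2' ?r) ?e) > 0"
      using s'.frame r unfolding normal_frame_def positively_oriented_rows5 by auto
    moreover have "\<sigma> * det (rows5 (D_u X p) (N1 p) (D_v X p) (N2 p) ?e) =
        (a\<^sup>2 - b\<^sup>2) * (\<alpha> * \<delta> - \<beta> * \<gamma>) * (\<sigma> * det (rows5 (D_u X' ?r) (N1' ?r) (D_v X' ?r) (N2' ?r) ?e))"
      unfolding tr0 N1 N2 det_rows5_blocks by simp
    ultimately show ?thesis using ab by (simp add: zero_less_mult_iff)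
  qed
  ultimately have rot: "\<alpha> = \<delta>" "\<beta> = \<gamma>" and m: "\<alpha>\<^sup>2 - \<beta>\<^sup>2 = E / E'"
    using hyperbolic_rotation[of \<alpha> \<beta> "E / E'" \<gamma> \<delta>] E by auto
  have Npm: "N1 p - N2 p = (\<alpha> - \<beta>) *\<^sub>R (N1' ?r - N2' ?r)" "N1 p + N2 p = (\<alpha> + \<beta>) *\<^sub>R (N1' ?r + N2' ?r)"
    unfolding N1 N2 rot by (simp_all add: algebra_simps)
  have nn: "n \<in> tangent_sp L0 (X' ?r) \<and> psc L0 n (D_u X' ?r) = 0 \<and> psc L0 n (D_v X' ?r) = 0"
    if "n = N1 p - N2 p \<or> n = N1 p + N2 p" for n
    using that Nt No by (auto simp: tangent_sp_linear psc_linear)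
  note c = s.null_components[OF as p, folded E_def] and c' = s'.null_components[OF as' r, folded E'_def]
  let ?x = "a1 p + a2 p + b1 p + b2 p" and ?y = "a1 p - a2 p - b1 p + b2 p"
    and ?z = "a1 p + a2 p - b1 p - b2 p" and ?m = "a1 p - a2 p + b1 p - b2 p"
  let ?x' = "a1' ?r + a2' ?r + b1' ?r + b2' ?r" and ?y' = "a1' ?r - a2' ?r - b1' ?r + b2' ?r"
    and ?z' = "a1' ?r + a2' ?r - b1' ?r - b2' ?r" and ?m' = "a1' ?r - a2' ?r + b1' ?r - b2' ?r"
  have x: "?x * E = (a + b)\<^sup>2 * (\<alpha> - \<beta>) * (?x' * E')" and m: "?m * E = (a - b)\<^sup>2 * (\<alpha> - \<beta>) * (?m' * E')"
    and y: "?y * E = (a - b)\<^sup>2 * (\<alpha> + \<beta>) * (?y' * E')" and z: "?z * E = (a + b)\<^sup>2 * (\<alpha> + \<beta>) * (?z' * E')"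
    unfolding c c' using tr(3,4)[of "N1 p - N2 p"] tr(3,4)[of "N1 p + N2 p"] nn
    by (simp_all add: Npm psc.scaleR_right)
  have ab0: "a + b \<noteq> 0" "a - b \<noteq> 0"
  proof -
    have "(a + b) * (a - b) \<noteq> 0" using ab by (simp add: power2_eq_square algebra_simps)
    then show "a + b \<noteq> 0" "a - b \<noteq> 0" by auto
  qed
  have al0: "\<alpha> - \<beta> \<noteq> 0" "\<alpha> + \<beta> \<noteq> 0"
  proof -
    have "(\<alpha> - \<beta>) * (\<alpha> + \<beta>) = E / E'" using \<open>\<alpha>\<^sup>2 - \<beta>\<^sup>2 = E / E'\<close> by (simp add: power2_eq_square algebra_simps)
    then show "\<alpha> - \<beta> \<noteq> 0" "\<alpha> + \<beta> \<noteq> 0" using E by auto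
  qed
  have iff: "v = 0 \<longleftrightarrow> w = 0" if "v * E = k * l * (w * E')" "k \<noteq> 0" "l \<noteq> 0" for v w k l :: real
    using that E by (metis less_irrefl mult_eq_0_iff)
  show "XY_condition a1 a2 b1 b2 p \<longleftrightarrow> XY_condition a1' a2' b1' b2' ?r"
    unfolding XY_condition_iff using iff[OF x] iff[OF y] iff[OF z] iff[OF m] ab0 al0 by simp
  have "(?x * ?z * E) * E = (?x * E) * (?z * E)" by simp
  also have "\<dots> = (a + b) ^ 4 * ((\<alpha>\<^sup>2 - \<beta>\<^sup>2) * E' * (?x' * ?z' * E'))"
  proof -
    have "(a + b) ^ 4 = (a + b)\<^sup>2 * (a + b)\<^sup>2" "\<alpha>\<^sup>2 - \<beta>\<^sup>2 = (\<alpha> - \<beta>) * (\<alpha> + \<beta>)"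
      by (simp add: power_add[symmetric]) (simp add: power2_eq_square algebra_simps)
    then show ?thesis unfolding x z by (simp only: mult_ac)
  qed
  also have "\<dots> = ((a + b) ^ 4 * (?x' * ?z' * E')) * E"
    unfolding \<open>\<alpha>\<^sup>2 - \<beta>\<^sup>2 = E / E'\<close> using E by simp
  finally show "?x * ?z * exp (2 * lam p) = (a + b) ^ 4 * (?x' * ?z' * exp (2 * lam' ?r))"
    using E unfolding E_def E'_def by simp
qed

section \<open>Normalization of the coordinate\<close>

text \<open>\<open>h\<close> is a primitive of the positive function \<open>g\<close>, hence
  strictly increasing, and \<open>\<psi>\<close> is its inverse. Both are kept on intervals where
  they are mutually inverse, so that they can serve as coordinate changes.\<close>

lemma inverse_function_smooth:
  fixes g :: "real \<Rightarrow> real"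
  assumes g: "smooth_on {l0<..<r0} g" "\<And>x. x \<in> {l0<..<r0} \<Longrightarrow> g x > 0" and x0: "x0 \<in> {l0<..<r0}"
  obtains l r h \<psi> J where "x0 \<in> {l<..<r}" "{l<..<r} \<subseteq> {l0<..<r0}" "open J" "convex J"
    "smooth_on {l<..<r} h" "smooth_on J \<psi>" "h ` {l<..<r} \<subseteq> J" "\<psi> ` J \<subseteq> {l<..<r}"
    "\<And>x. x \<in> {l<..<r} \<Longrightarrow> \<psi> (h x) = x" "\<And>y. y \<in> J \<Longrightarrow> h (\<psi> y) = y"
    "\<And>x. x \<in> {l<..<r} \<Longrightarrow> (h has_real_derivative g x) (at x)"
    "\<And>y. y \<in> J \<Longrightarrow> (\<psi> has_real_derivative inverse (g (\<psi> y))) (at y)"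
proof -
  \<comment> \<open>A slightly smaller interval, on whose closure \<open>g\<close> is continuous, so
    that the primitive can start at \<open>l\<close>.\<close>
  define l r where "l = (l0 + x0) / 2" and "r = (x0 + r0) / 2"
  have lr: "l0 < l" "l < x0" "x0 < r" "r < r0" using x0 by (auto simp: l_def r_def)
  let ?I = "{l<..<r}"
  have sub: "{l..r} \<subseteq> {l0<..<r0}" using lr by auto
  have gI: "smooth_on ?I g" by (rule smooth_on_subset[OF g(1)]) (use lr in auto)
  have cg: "continuous_on {l..r} g" by (rule continuous_on_subset[OF smooth_on_continuous[OF g(1)] sub])
  define h where "h = (\<lambda>x. integral {l..x} g)"
  have dh: "(h has_real_derivative g x) (at x)" if "x \<in> ?I" for x
  proof -
    have "(h has_real_derivative g x) (at x within {l..r})"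
      unfolding h_def by (rule integral_has_real_derivative[OF cg]) (use that in auto)
    moreover have "at x within {l..r} = at x" by (rule at_within_interior) (use that in simp)
    ultimately show ?thesis by simp
  qed
  have ch: "continuous_on {l..r} h"
    unfolding h_def by (rule indefinite_integral_continuous_1[OF integrable_continuous_real[OF cg]])
  have mono: "h x < h y" if "l \<le> x" "x < y" "y \<le> r" for x y
  proof (rule DERIV_pos_imp_increasing_open[OF that(2)])
    show "continuous_on {x..y} h" by (rule continuous_on_subset[OF ch]) (use that in auto)
    show "\<exists>d. (h has_real_derivative d) (at z) \<and> 0 < d" if "x < z" "z < y" for z
      using dh[of z] g(2)[of z] that \<open>l \<le> x\<close> \<open>y \<le> r\<close> lr by auto
  qed
  have inj: "inj_on h ?I"
  proof (rule linorder_inj_onI)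
    show "h x \<noteq> h y" if "x < y" "x \<in> ?I" "y \<in> ?I" for x y using mono[of x y] that by simp
  qed auto
  define J where "J = {h l<..<h r}"
  have J: "h ` ?I = J"
  proof
    show "h ` ?I \<subseteq> J" using mono by (auto simp: J_def)
    show "J \<subseteq> h ` ?I"
    proof
      fix y assume y: "y \<in> J"
      then obtain x where "l \<le> x" "x \<le> r" "h x = y"
        using IVT'[of h l y r] ch lr by (auto simp: J_def)
      then show "y \<in> h ` ?I" using y by (cases "x = l \<or> x = r") (auto simp: J_def)
    qed
  qed
  define \<psi> where "\<psi> = inv_into ?I h"
  have \<psi>h: "\<psi> (h x) = x" if "x \<in> ?I" for x unfolding \<psi>_def using inj that by (rule inv_into_f_f)
  have h\<psi>: "h (\<psi> y) = y" and \<psi>I: "\<psi> y \<in> ?I" if "y \<in> J" for y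
  proof -
    have "y \<in> h ` ?I" using that J by simp
    then show "h (\<psi> y) = y" "\<psi> y \<in> ?I" unfolding \<psi>_def by (rule f_inv_into_f, rule inv_into_into)
  qed
  have gp: "g (\<psi> y) > 0" if "y \<in> J" for y using \<psi>I[OF that] lr by (intro g(2)) auto
  have d\<psi>: "(\<psi> has_real_derivative inverse (g (\<psi> y))) (at y)" if y: "y \<in> J" for y
  proof (rule DERIV_inverse_function[where a="h l" and b="h r"])
    let ?x = "\<psi> y"
    show "(h has_real_derivative g ?x) (at ?x)" by (rule dh[OF \<psi>I[OF y]])
    show "g ?x \<noteq> 0" using gp[OF y] by simp
    show "h l < y" "y < h r" using y by (auto simp: J_def)
    show "h (\<psi> z) = z" if "h l < z" "z < h r" for z using h\<psi>[of z] that by (simp add: J_def)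
    define d where "d = min (?x - l) (r - ?x) / 2"
    have d: "0 < d" using \<psi>I[OF y] by (simp add: d_def)
    have inI: "z \<in> ?I" if "\<bar>z - ?x\<bar> \<le> d" for z
    proof -
      have "2 * d \<le> ?x - l" "2 * d \<le> r - ?x" unfolding d_def by auto
      moreover have "z - ?x \<le> d" "?x - z \<le> d" using that by auto
      ultimately show ?thesis using d by simp
    qed
    have "isCont \<psi> (h ?x)"
      by (rule isCont_inverse_function[OF d]) (use inI \<psi>h dh in \<open>auto intro: DERIV_isCont\<close>)
    then show "isCont \<psi> y" by (simp add: h\<psi>[OF y])
  qed
  have oJ: "open J" by (simp add: J_def)
  have sh: "smooth_on ?I h"
    by (rule smooth_onI[where f'="\<lambda>x v. g x * v"])
      (use dh gI in \<open>auto intro!: smooth_intros simp: has_field_derivative_def\<close>)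
  \<comment> \<open>In \<open>\<psi>' = 1 / g(\<psi>)\<close> the right-hand side contains only
    \<open>\<psi>\<close> itself, so every order of smoothness gives the next.\<close>
  have "Ck_on k J \<psi>" for k
  proof (induction k)
    case 0
    show ?case using d\<psi> by (auto intro!: continuous_at_imp_continuous_on DERIV_isCont)
  next
    case (Suc k)
    have g0: "g (\<psi> y) \<noteq> 0" if "y \<in> J" for y using gp[OF that] by simp
    have "Ck_on k J (\<lambda>y. g (\<psi> y))"
      by (rule Ck_on_compose[OF oJ, of \<psi> ?I]) (use \<psi>I gI Suc in \<open>auto simp: smooth_on_def\<close>)
    then have "Ck_on k J (\<lambda>y. inverse (g (\<psi> y)) * v)" for v
      by (intro Ck_on_bilinear[OF bounded_bilinear_mult oJ] Ck_on_inverse[OF oJ] Ck_on_const g0)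
    then show ?case
      by (intro Ck_on_SucI[OF oJ, where f'="\<lambda>y v. inverse (g (\<psi> y)) * v"])
        (use d\<psi> in \<open>auto simp: has_field_derivative_def\<close>)
  qed
  then have s\<psi>: "smooth_on J \<psi>" by (simp add: smooth_on_def)
  show thesis
    by (rule that[of l r J h \<psi>]) (use lr J \<psi>h h\<psi> \<psi>I dh d\<psi> oJ sh s\<psi> in \<open>auto simp: J_def\<close>)
qed

section \<open>Reparametrizations of one null coordinate\<close>

lemma smooth_on_Pair:
  fixes f g :: "plane \<Rightarrow> real"
  assumes "open S" "smooth_on S f" "smooth_on S g"
  shows "smooth_on S (\<lambda>x. (f x, g x))"
proof -
  have "bounded_linear (\<lambda>t::real. (t, 0::real))" "bounded_linear (\<lambda>t::real. (0::real, t))"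
    by (intro bounded_linear_Pair bounded_linear_ident bounded_linear_zero)+
  from smooth_on_add[OF assms(1) smooth_on_bounded_linear_compose[OF this(1) assms(1,2)]
      smooth_on_bounded_linear_compose[OF this(2) assms(1,3)]]
  show ?thesis by simp
qed

text \<open>The coordinate change \<open>(s, t) \<mapsto> (h(s), t)\<close>, up to the factor \<open>sqrt 2\<close>.\<close>

definition null_change :: "(real \<Rightarrow> real) \<Rightarrow> plane \<Rightarrow> plane" where
  "null_change h q = ((h (fst q + snd q) + (fst q - snd q)) / 2, (h (fst q + snd q) - (fst q - snd q)) / 2)"

lemma null_change_coordinates:
  "fst (null_change h q) + snd (null_change h q) = h (fst q + snd q)"
  "fst (null_change h q) - snd (null_change h q) = fst q - snd q"
  by (simp_all add: null_change_def field_simps)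

lemma null_change_compose:
  assumes "\<psi> (h (fst q + snd q)) = fst q + snd q"
  shows "null_change \<psi> (null_change h q) = q"
  unfolding null_change_def[of \<psi>] null_change_coordinates assms by (simp add: prod_eq_iff)

text \<open>The multiplier \<open>a + jb\<close> acts on the null directions by \<open>a + b\<close>
  and \<open>a - b\<close>, which here have to be \<open>d\<close> and 1.\<close>

lemma null_change_derivative:
  assumes "(h has_real_derivative d) (at (fst q + snd q))"
  shows "paracomplex_derivative (null_change h) q ((d + 1) / 2) ((d - 1) / 2)"
proof -
  have "((\<lambda>q::plane. fst q + snd q) has_derivative (\<lambda>z. fst z + snd z)) (at q)"
    by (intro has_derivative_add has_derivative_fst has_derivative_snd has_derivative_ident)
  from has_derivative_compose[OF this assms[unfolded has_field_derivative_def]]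
  have "((\<lambda>q. h (fst q + snd q)) has_derivative (\<lambda>z. d * (fst z + snd z))) (at q)" .
  then have "(null_change h has_derivative (\<lambda>z. ((d * (fst z + snd z) + (fst z - snd z)) / 2,
      (d * (fst z + snd z) - (fst z - snd z)) / 2))) (at q)"
    unfolding null_change_def[abs_def] divide_inverse
    by (intro has_derivative_Pair has_derivative_mult_left has_derivative_add has_derivative_diff
        has_derivative_fst has_derivative_snd has_derivative_ident)
  moreover have "(\<lambda>z. ((d * (fst z + snd z) + (fst z - snd z)) / 2, (d * (fst z + snd z) - (fst z - snd z)) / 2)) =
      (\<lambda>(x, y). ((d + 1) / 2 * x + (d - 1) / 2 * y, (d - 1) / 2 * x + (d + 1) / 2 * y))"
    by (auto simp: fun_eq_iff field_simps)
  ultimately show ?thesis by (simp add: paracomplex_derivative_def)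
qed

lemma null_change_paracomplex:
  assumes W: "open W" "\<And>q. q \<in> W \<Longrightarrow> fst q + snd q \<in> I" and h: "smooth_on I h"
    and d: "\<And>x. x \<in> I \<Longrightarrow> (h has_real_derivative h' x) (at x)" "\<And>x. x \<in> I \<Longrightarrow> h' x > 0"
  shows "paracomplex_map W (null_change h)"
  unfolding paracomplex_map_def
proof (intro conjI ballI)
  have l: "smooth_on W (\<lambda>q::plane. fst q + snd q)" "smooth_on W (\<lambda>q::plane. fst q - snd q)"
    by (intro smooth_on_bounded_linear bounded_linear_add bounded_linear_sub bounded_linear_fst bounded_linear_snd)+
  have "smooth_on W (\<lambda>q. h (fst q + snd q))"
    by (rule smooth_on_compose[OF h W(1) l(1)]) (use W(2) in auto)
  then show "smooth_on W (null_change h)"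
    unfolding null_change_def[abs_def] divide_inverse by (intro smooth_on_Pair smooth_intros W(1) l)
  fix q assume "q \<in> W"
  then have q: "fst q + snd q \<in> I" using W by blast
  have "((h' (fst q + snd q) + 1) / 2)\<^sup>2 - ((h' (fst q + snd q) - 1) / 2)\<^sup>2 = h' (fst q + snd q)"
    by (simp add: power2_eq_square field_simps)
  then show "\<exists>a b. a\<^sup>2 - b\<^sup>2 > 0 \<and> paracomplex_derivative (null_change h) q a b"
    using null_change_derivative[OF d(1)[OF q]] d(2)[OF q] by metis
qed

text \<open>A function \<open>T\<close> with \<open>T\<^sub>t = 0\<close> depends on \<open>s\<close> only; the new coordinate is an integral of
  \<open>\<bar>T\<bar>\<^sup>1\<^sup>/\<^sup>4 ds\<close>.\<close>

lemma null_reparametrization: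
  fixes T :: "plane \<Rightarrow> real"
  assumes D: "open D" "p0 \<in> D" and T: "smooth_on D T" "\<And>q. q \<in> D \<Longrightarrow> T q \<noteq> 0"
    and Tt: "\<And>q. q \<in> D \<Longrightarrow> D_u T q = D_v T q"
  obtains V V' \<kappa> \<theta> where "open V" "p0 \<in> V" "V \<subseteq> D" "open V'" "connected V'"
    "paracomplex_map V \<kappa>" "paracomplex_map V' \<theta>" "\<kappa> ` V \<subseteq> V'" "\<theta> ` V' \<subseteq> V"
    "\<And>q. q \<in> V \<Longrightarrow> \<theta> (\<kappa> q) = q" "\<And>q. q \<in> V' \<Longrightarrow> \<kappa> (\<theta> q) = q"
    "\<And>q. q \<in> V' \<Longrightarrow> \<exists>a b. a\<^sup>2 - b\<^sup>2 > 0 \<and> paracomplex_derivative \<theta> q a b \<and> (a + b) ^ 4 * \<bar>T (\<theta> q)\<bar> = 1"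
proof -
  obtain e where e: "e > 0" "ball p0 e \<subseteq> D" using D by (meson openE)
  \<comment> \<open>The distance to \<open>p0\<close> is at most the sum of the two deviations in
    the null coordinates, hence less than \<open>2 * \<delta> = e\<close>.\<close>
  define \<delta> where "\<delta> = e / 2"
  have \<delta>: "\<delta> > 0" using e by (simp add: \<delta>_def)
  define s0 t0 where "s0 = fst p0 + snd p0" and "t0 = fst p0 - snd p0"
  \<comment> \<open>The point with null coordinates \<open>u + v = s\<close> and
    \<open>u - v = t\<close>; the factor \<open>1 / sqrt 2\<close> of the original coordinates is
    omitted.\<close>
  define pt where "pt = (\<lambda>s t::real. ((s + t) / 2, (s - t) / 2))"
  let ?S = "{s0 - \<delta><..<s0 + \<delta>}" and ?Z = "{t0 - \<delta><..<t0 + \<delta>}"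
  have pt_D: "pt s t \<in> D" if "s \<in> ?S" "t \<in> ?Z" for s t
  proof -
    have f: "fst p0 = (s0 + t0) / 2" "snd p0 = (s0 - t0) / 2" by (simp_all add: s0_def t0_def)
    have st: "\<bar>s0 - s\<bar> < \<delta>" "\<bar>t0 - t\<bar> < \<delta>" using that by (auto simp: abs_less_iff)
    have 1: "dist p0 (pt s t) \<le> \<bar>fst p0 - (s + t) / 2\<bar> + \<bar>snd p0 - (s - t) / 2\<bar>"
      using sqrt_sum_squares_le_sum_abs[of "fst p0 - (s + t) / 2" "snd p0 - (s - t) / 2"]
      by (cases p0) (simp add: pt_def dist_Pair_Pair dist_real_def)
    have 2: "\<bar>fst p0 - (s + t) / 2\<bar> \<le> (\<bar>s0 - s\<bar> + \<bar>t0 - t\<bar>) / 2" unfolding f by argo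
    have 3: "\<bar>snd p0 - (s - t) / 2\<bar> \<le> (\<bar>s0 - s\<bar> + \<bar>t0 - t\<bar>) / 2" unfolding f by argo
    have "dist p0 (pt s t) < e" using 1 2 3 st unfolding \<delta>_def by argo
    then show ?thesis using e by auto
  qed
  have pt_q: "pt (fst q + snd q) (fst q - snd q) = q" for q by (simp add: pt_def prod_eq_iff)
  have const: "T (pt s t) = T (pt s t0)" if s: "s \<in> ?S" and t: "t \<in> ?Z" for s t
  proof -
    have d: "((\<lambda>t. T (pt s t)) has_derivative (\<lambda>v. 0)) (at t within ?Z)" if t: "t \<in> ?Z" for t
    proof -
      have "(pt s has_derivative (\<lambda>v. ((0 + v) / 2, (0 - v) / 2))) (at t)"
        unfolding pt_def divide_inverse
        by (intro has_derivative_Pair has_derivative_mult_left has_derivative_add has_derivative_diff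
            has_derivative_const has_derivative_ident)
      from has_derivative_compose[OF this D_uv_has_derivative[OF smooth_on_differentiable[OF T(1) pt_D[OF s t]]]]
      have "((\<lambda>t. T (pt s t)) has_derivative (\<lambda>v. 0)) (at t)"
        by (simp add: Tt[OF pt_D[OF s t]])
      then show ?thesis by (rule has_derivative_at_withinI)
    qed
    have "convex ?Z" by simp
    from has_derivative_zero_constant[OF this d] obtain c where "\<forall>t\<in>?Z. T (pt s t) = c" by blast
    then show ?thesis using t \<delta> by simp
  qed
  \<comment> \<open>This is the fourth root of \<open>\<bar>T\<bar>\<close> along the line
    \<open>t = t0\<close>. The logarithm of the square avoids the absolute value, so that smoothness
    is immediate.\<close>
  define g where "g = (\<lambda>s. exp ((1 / 8) * ln (T (pt s t0) * T (pt s t0))))"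
  have t0Z: "t0 \<in> ?Z" using \<delta> by simp
  have spt: "smooth_on ?S (\<lambda>s. pt s t0)"
  proof (rule smooth_onI[where f'="\<lambda>s v. (v / 2, v / 2)"])
    show "((\<lambda>s. pt s t0) has_derivative (\<lambda>v. (v / 2, v / 2))) (at s)" for s
      unfolding pt_def divide_inverse by (auto intro!: derivative_eq_intros)
  qed (auto intro: smooth_on_const)
  have sTpt: "smooth_on ?S (\<lambda>s. T (pt s t0))"
    by (rule smooth_on_compose[OF T(1) _ spt]) (use pt_D t0Z in auto)
  have sg: "smooth_on ?S g" unfolding g_def
    by (intro smooth_intros smooth_on_ln sTpt open_greaterThanLessThan)
      (use T(2) pt_D t0Z in \<open>metis not_real_square_gt_zero\<close>)
  have g0: "g s > 0" for s by (simp add: g_def)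
  have g4: "g s ^ 4 = \<bar>T (pt s t0)\<bar>" if "s \<in> ?S" for s
  proof -
    have nz: "T (pt s t0) \<noteq> 0" using T(2) pt_D[OF that t0Z] by blast
    have "g s ^ 4 = exp (4 * ((1 / 8) * ln (T (pt s t0) * T (pt s t0))))"
      unfolding g_def by (simp only: exp_of_nat_mult[symmetric] of_nat_numeral)
    also have "T (pt s t0) * T (pt s t0) = \<bar>T (pt s t0)\<bar> ^ 2" by (simp add: power2_eq_square)
    also have "ln (\<bar>T (pt s t0)\<bar> ^ 2) = 2 * ln \<bar>T (pt s t0)\<bar>" using nz by (subst ln_realpow) simp_all
    finally show ?thesis using nz by simp
  qed
  have s0S: "s0 \<in> ?S" using \<delta> by simp
  obtain l r h \<psi> J where lr: "s0 \<in> {l<..<r}" "{l<..<r} \<subseteq> ?S" and J: "open J" "convex J"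
    and sm: "smooth_on {l<..<r} h" "smooth_on J \<psi>" and im: "h ` {l<..<r} \<subseteq> J" "\<psi> ` J \<subseteq> {l<..<r}"
    and inv: "\<And>x. x \<in> {l<..<r} \<Longrightarrow> \<psi> (h x) = x" "\<And>y. y \<in> J \<Longrightarrow> h (\<psi> y) = y"
    and d: "\<And>x. x \<in> {l<..<r} \<Longrightarrow> (h has_real_derivative g x) (at x)"
      "\<And>y. y \<in> J \<Longrightarrow> (\<psi> has_real_derivative inverse (g (\<psi> y))) (at y)"
    using inverse_function_smooth[OF sg g0 s0S] by metis
  have lins: "linear (\<lambda>q::plane. fst q + snd q)" "linear (\<lambda>q::plane. fst q - snd q)"
    by (auto intro!: linearI simp: algebra_simps)
  let ?s = "\<lambda>q::plane. fst q + snd q" and ?t = "\<lambda>q::plane. fst q - snd q"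
  have cont: "continuous_on UNIV ?s" "continuous_on UNIV ?t" by (intro continuous_intros)+
  \<comment> \<open>Rectangles in the null coordinates. The convexity of \<open>J\<close> makes
    \<open>V'\<close> convex, hence connected, as the choice of constant signs on the new chart
    demands.\<close>
  define V V' where "V = ?s -` {l<..<r} \<inter> ?t -` ?Z" and "V' = ?s -` J \<inter> ?t -` ?Z"
  have oV: "open V" "open V'"
    unfolding V_def V'_def by (intro open_Int open_vimage cont J open_greaterThanLessThan)+
  have "convex V'" unfolding V'_def
    by (intro convex_Int convex_linear_vimage lins J convex_real_interval)
  then have cV: "connected V'" by (rule convex_connected)
  have p0V: "p0 \<in> V" using lr(1) \<delta> by (simp add: V_def s0_def t0_def)
  have VD: "V \<subseteq> D"
  proof
    fix q assume "q \<in> V"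
    then have "pt (?s q) (?t q) \<in> D" using lr(2) by (intro pt_D) (auto simp: V_def)
    then show "q \<in> D" unfolding pt_q .
  qed
  have \<kappa>: "paracomplex_map V (null_change h)"
    by (rule null_change_paracomplex[OF oV(1) _ sm(1) d(1) g0]) (simp add: V_def)
  have \<theta>: "paracomplex_map V' (null_change \<psi>)"
    by (rule null_change_paracomplex[OF oV(2) _ sm(2) d(2)]) (auto simp: V'_def g0)
  show thesis
  proof (rule that[OF oV(1) p0V VD oV(2) cV \<kappa> \<theta>])
    show "null_change h ` V \<subseteq> V'" "null_change \<psi> ` V' \<subseteq> V"
      using im by (auto simp: V_def V'_def null_change_coordinates simp del: greaterThanLessThan_iff)
    show "null_change \<psi> (null_change h q) = q" if "q \<in> V" for q
      by (rule null_change_compose) (use inv that in \<open>simp add: V_def\<close>)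
    show "null_change h (null_change \<psi> q) = q" if "q \<in> V'" for q
      by (rule null_change_compose) (use inv that in \<open>simp add: V'_def\<close>)
    fix q assume q: "q \<in> V'"
    let ?y = "fst q + snd q"
    have y: "?y \<in> J" "fst q - snd q \<in> ?Z" using q by (auto simp: V'_def)
    have \<psi>y: "\<psi> ?y \<in> ?S" using im(2) y(1) lr(2) by blast
    let ?d = "inverse (g (\<psi> ?y))"
    have dp: "?d > 0" using g0 by simp
    have "((d + 1) / 2)\<^sup>2 - ((d - 1) / 2)\<^sup>2 = d" "(d + 1) / 2 + (d - 1) / 2 = d" for d :: real
      by (simp_all add: power2_eq_square field_simps)
    note this[of ?d]
    moreover have "?d ^ 4 * \<bar>T (null_change \<psi> q)\<bar> = 1"
    proof -
      have "null_change \<psi> q = pt (\<psi> ?y) (fst q - snd q)" by (simp add: null_change_def pt_def)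
      then have "\<bar>T (null_change \<psi> q)\<bar> = g (\<psi> ?y) ^ 4" using const[OF \<psi>y y(2)] g4[OF \<psi>y] by simp
      then show ?thesis using g0[of "\<psi> ?y"] by (simp add: power_inverse)
    qed
    ultimately show "\<exists>a b. a\<^sup>2 - b\<^sup>2 > 0 \<and> paracomplex_derivative (null_change \<psi>) q a b \<and>
        (a + b) ^ 4 * \<bar>T (null_change \<psi> q)\<bar> = 1"
      using null_change_derivative[OF d(2)[OF y(1)]] dp by metis
  qed
qed

text \<open>\<open>T\<close> is the coefficient of the quartic differential \<open>h(II(\<partial>\<^sub>s, \<partial>\<^sub>s), II(\<partial>\<^sub>s, \<partial>\<^sub>s)) ds\<^sup>4\<close>, where
  \<open>II\<close> is the second fundamental form.\<close>

lemma null_quartic: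
  assumes D: "open D" "p \<in> D"
    and s: "smooth_on D lam" "smooth_on D a1" "smooth_on D a2" "smooth_on D b1" "smooth_on D b2"
    and gcr: "gauss_codazzi_ricci L0 lam a1 a2 b1 b2 m1 m2 p"
  defines "T \<equiv> \<lambda>p. (a1 p + a2 p + b1 p + b2 p) * (a1 p + a2 p - b1 p - b2 p) * exp (2 * lam p)"
  shows "D_u T p = D_v T p"
proof -
  let ?x = "\<lambda>p. a1 p + a2 p + b1 p + b2 p" and ?z = "\<lambda>p. a1 p + a2 p - b1 p - b2 p"
  note d = smooth_on_differentiable[OF _ D(2)]
  note ds = s[THEN d]
  have sx: "smooth_on D ?x" "smooth_on D ?z" "smooth_on D (\<lambda>p. 2 * lam p)" "smooth_on D (\<lambda>p. exp (2 * lam p))"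
      "smooth_on D (\<lambda>p. ?x p * ?z p)"
    by (intro smooth_intros D(1) s)+
  have fd: "frechet_derivative T (at p) v = exp (2 * lam p) *
      (?x p * frechet_derivative ?z (at p) v + frechet_derivative ?x (at p) v * ?z p
        + 2 * ?x p * ?z p * frechet_derivative lam (at p) v)" for v
    unfolding T_def
    by (subst fd_mult[OF d[OF sx(5)] d[OF sx(4)]], subst fd_mult[OF d[OF sx(1)] d[OF sx(2)]],
        subst fd_exp[OF d[OF sx(3)]], subst fd_cmult[OF ds(1)]) (simp add: algebra_simps)
  have fx: "frechet_derivative ?x (at p) v = frechet_derivative a1 (at p) v + frechet_derivative a2 (at p) v
      + frechet_derivative b1 (at p) v + frechet_derivative b2 (at p) v"
    "frechet_derivative ?z (at p) v = frechet_derivative a1 (at p) v + frechet_derivative a2 (at p) v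
      - frechet_derivative b1 (at p) v - frechet_derivative b2 (at p) v" for v
    using ds by (simp_all add: fd_add fd_diff)
  have c: "D_v a1 p - D_u a2 p + D_v lam p * a1 p + b1 p * m2 p - D_u lam p * a2 p - b2 p * m1 p = 0"
      "D_v b1 p - D_u b2 p + a1 p * m2 p + D_v lam p * b1 p - a2 p * m1 p - D_u lam p * b2 p = 0"
      "D_v a2 p - D_u a1 p + D_v lam p * a2 p + b2 p * m2 p - D_u lam p * a1 p - b1 p * m1 p = 0"
      "D_v b2 p - D_u b1 p + D_v lam p * b2 p + a2 p * m2 p - D_u lam p * b1 p - a1 p * m1 p = 0"
    using gcr unfolding gauss_codazzi_ricci_def by auto
  \<comment> \<open>Codazzi's equations give the derivatives along t of the two null components in
    \<open>T\<close>. The normal connection enters with opposite signs, so it cancels in the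
    product, and the factor \<open>e^(2 \<lambda>)\<close> compensates the derivatives of
    \<open>lam\<close>.\<close>
  have x: "D_v a1 p + D_v a2 p + D_v b1 p + D_v b2 p - (D_u a1 p + D_u a2 p + D_u b1 p + D_u b2 p) =
      - (D_v lam p - D_u lam p + m2 p - m1 p) * ?x p"
    using c by (simp add: algebra_simps)
  have z: "D_v a1 p + D_v a2 p - D_v b1 p - D_v b2 p - (D_u a1 p + D_u a2 p - D_u b1 p - D_u b2 p) =
      - (D_v lam p - D_u lam p - m2 p + m1 p) * ?z p"
    using c by (simp add: algebra_simps)
  have "D_v T p - D_u T p = exp (2 * lam p) * (
      ?x p * (D_v a1 p + D_v a2 p - D_v b1 p - D_v b2 p - (D_u a1 p + D_u a2 p - D_u b1 p - D_u b2 p))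
      + (D_v a1 p + D_v a2 p + D_v b1 p + D_v b2 p - (D_u a1 p + D_u a2 p + D_u b1 p + D_u b2 p)) * ?z p
      + 2 * ?x p * ?z p * (D_v lam p - D_u lam p))"
    unfolding D_u_def D_v_def fd fx by (simp add: algebra_simps)
  also have "\<dots> = 0" unfolding x z by (simp add: algebra_simps)
  finally show ?thesis by simp
qed

section \<open>Charts\<close>

lemma local_chartD:
  assumes "local_chart (U, \<phi>)"
  shows "open U" "open (\<phi> ` U)" "continuous_on U \<phi>" "continuous_on (\<phi> ` U) (inv_into U \<phi>)"
    "inj_on \<phi> U" "\<And>x. x \<in> U \<Longrightarrow> inv_into U \<phi> (\<phi> x) = x" "\<And>V. open V \<Longrightarrow> V \<subseteq> U \<Longrightarrow> open (\<phi> ` V)"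
proof -
  have h: "open U" "open (\<phi> ` U)" "homeomorphism U (\<phi> ` U) \<phi> (inv_into U \<phi>)"
    using assms by (auto simp: local_chart_def)
  then show "open U" "open (\<phi> ` U)" "continuous_on U \<phi>" "continuous_on (\<phi> ` U) (inv_into U \<phi>)"
    by (auto simp: homeomorphism_def)
  show inv: "inv_into U \<phi> (\<phi> x) = x" if "x \<in> U" for x using h(3) that by (auto simp: homeomorphism_def)
  show "inj_on \<phi> U" by (rule inj_on_inverseI) (rule inv)
  show "open (\<phi> ` V)" if "open V" "V \<subseteq> U" for V
  proof -
    have "openin (top_of_set U) V" using that h(1) by (simp add: openin_open_eq)
    from homeomorphism_imp_open_map[OF h(3) this] show ?thesis using h(2) by (simp add: openin_open_eq)
  qed
qed

lemma inv_into_inter: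
  assumes "local_chart (U, \<phi>)" "S \<subseteq> U" "q \<in> \<phi> ` S"
  shows "inv_into U \<phi> q \<in> S" "\<phi> (inv_into U \<phi> q) = q"
  using assms local_chartD(6)[OF assms(1)] by auto

text \<open>Coordinates of the maximal atlas are compatible with the members of \<open>A\<close> by
  definition, but not directly with each other. Near \<open>y\<close> the transition factors through
  a chart of \<open>A\<close> around \<open>y\<close>, which is why the conclusion is local.\<close>

lemma chart_transition:
  assumes L: "lorentz_surface M A" and c: "paracomplex_coordinate M A (U, \<phi>)"
    and c': "paracomplex_coordinate M A (U', \<phi>')" and y: "y \<in> U" "y \<in> U'"
  obtains W where "open W" "\<phi> y \<in> W" "W \<subseteq> \<phi> ` (U \<inter> U')" "paracomplex_map W (\<lambda>q. \<phi>' (inv_into U \<phi> q))"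
proof -
  have "y \<in> M" using c y by (auto simp: paracomplex_coordinate_def)
  then obtain U'' \<phi>'' where c'': "(U'', \<phi>'') \<in> A" "y \<in> U''"
    using L by (force simp: lorentz_surface_def)
  have lc: "local_chart (U, \<phi>)" "local_chart (U', \<phi>')" "local_chart (U'', \<phi>'')"
    using c c' c'' L by (auto simp: paracomplex_coordinate_def lorentz_surface_def)
  define S where "S = U \<inter> U' \<inter> U''"
  define W where "W = \<phi> ` S"
  have oS: "open S" using lc[THEN local_chartD(1)] by (auto simp: S_def)
  have oW: "open W" unfolding W_def by (rule local_chartD(7)[OF lc(1) oS]) (auto simp: S_def)
  have p1: "paracomplex_map W (\<phi>'' \<circ> inv_into U \<phi>)"
    by (rule paracomplex_map_subset[of "\<phi> ` (U \<inter> U'')"])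
      (use c c'' in \<open>auto simp: W_def S_def paracomplex_coordinate_def paracomplex_change_iff[symmetric]\<close>)
  have p2: "paracomplex_map (\<phi>'' ` (U'' \<inter> U')) (\<phi>' \<circ> inv_into U'' \<phi>'')"
    using c' c'' by (auto simp: paracomplex_coordinate_def paracomplex_change_iff[symmetric])
  have sub: "(\<phi>'' \<circ> inv_into U \<phi>) ` W \<subseteq> \<phi>'' ` (U'' \<inter> U')"
  proof
    fix z assume "z \<in> (\<phi>'' \<circ> inv_into U \<phi>) ` W"
    then obtain q where q: "q \<in> W" "z = \<phi>'' (inv_into U \<phi> q)" by auto
    have "inv_into U \<phi> q \<in> S" using inv_into_inter(1)[OF lc(1), of S q] q by (auto simp: W_def S_def)
    then show "z \<in> \<phi>'' ` (U'' \<inter> U')" using q by (auto simp: S_def)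
  qed
  have "paracomplex_map W (\<lambda>q. (\<phi>' \<circ> inv_into U'' \<phi>'') ((\<phi>'' \<circ> inv_into U \<phi>) q))"
    by (rule paracomplex_map_compose[OF p1 p2 oW sub])
  then have "paracomplex_map W (\<lambda>q. \<phi>' (inv_into U \<phi> q))"
  proof (rule paracomplex_map_cong[OF _ oW])
    fix q assume "q \<in> W"
    then have "inv_into U \<phi> q \<in> U''" using inv_into_inter(1)[OF lc(1), of S q] by (auto simp: W_def S_def)
    then show "(\<phi>' \<circ> inv_into U'' \<phi>'') ((\<phi>'' \<circ> inv_into U \<phi>) q) = \<phi>' (inv_into U \<phi> q)"
      using local_chartD(6)[OF lc(3)] by simp
  qed
  moreover have "\<phi> y \<in> W" "W \<subseteq> \<phi> ` (U \<inter> U')" using y c'' by (auto simp: W_def S_def)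
  ultimately show thesis using that oW by blast
qed

text \<open>The transitions between the new chart and the atlas are those of the old chart composed
  with \<open>\<theta>\<close> or \<open>\<kappa>\<close>, and paracomplex maps are closed under
  composition.\<close>

lemma new_chart:
  fixes U :: "'m::{t2_space, second_countable_topology} set"
  assumes c: "paracomplex_coordinate M A (U, \<phi>)" and A: "\<forall>c\<in>A. local_chart c"
    and V: "open V" "V \<subseteq> \<phi> ` U" and V': "open V'"
    and \<kappa>: "paracomplex_map V \<kappa>" "\<kappa> ` V \<subseteq> V'" and \<theta>: "paracomplex_map V' \<theta>" "\<theta> ` V' \<subseteq> V"
    and inv: "\<forall>q\<in>V. \<theta> (\<kappa> q) = q" "\<forall>q\<in>V'. \<kappa> (\<theta> q) = q"
  defines "U1 \<equiv> inv_into U \<phi> ` V" and "\<phi>1 \<equiv> \<lambda>x. \<kappa> (\<phi> x)"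
  shows "paracomplex_coordinate M A (U1, \<phi>1)" "\<phi>1 ` U1 = V'"
    "\<And>q. q \<in> V' \<Longrightarrow> inv_into U1 \<phi>1 q = inv_into U \<phi> (\<theta> q)"
proof -
  have lc: "local_chart (U, \<phi>)" and UM: "U \<subseteq> M" using c by (auto simp: paracomplex_coordinate_def)
  note l = local_chartD[OF lc] and inv = inv[rule_format]
  have \<phi>i: "\<phi> (inv_into U \<phi> q) = q" "inv_into U \<phi> q \<in> U" if "q \<in> V" for q
    using inv_into_inter[OF lc order_refl, of q] V(2) that by auto
  have U1: "U1 = {x \<in> U. \<phi> x \<in> V}"
    unfolding U1_def using \<phi>i l(6) by (auto intro!: image_eqI)
  have "U1 = \<phi> -` V \<inter> U" by (auto simp: U1)
  then have oU1: "open U1" using continuous_on_open_vimage[OF l(1)] l(3) V(1) by metis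
  show im: "\<phi>1 ` U1 = V'"
  proof
    show "\<phi>1 ` U1 \<subseteq> V'" using \<kappa>(2) by (auto simp: U1 \<phi>1_def)
    show "V' \<subseteq> \<phi>1 ` U1"
    proof
      fix q assume q: "q \<in> V'"
      then have "\<theta> q \<in> V" using \<theta>(2) by blast
      then have "q = \<phi>1 (inv_into U \<phi> (\<theta> q))" "inv_into U \<phi> (\<theta> q) \<in> U1"
        using \<phi>i(1) inv(2)[OF q] by (auto simp: U1_def \<phi>1_def)
      then show "q \<in> \<phi>1 ` U1" by (rule image_eqI)
    qed
  qed
  have inj: "inj_on \<phi>1 U1"
  proof (rule inj_onI)
    fix x y assume xy: "x \<in> U1" "y \<in> U1" "\<phi>1 x = \<phi>1 y"
    then have "\<phi> x \<in> V" "\<phi> y \<in> V" "\<kappa> (\<phi> x) = \<kappa> (\<phi> y)" by (auto simp: \<phi>1_def U1)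
    then have "\<phi> x = \<phi> y" using inv(1) by metis
    then show "x = y" by (rule inj_onD[OF l(5)]) (use xy in \<open>auto simp: U1\<close>)
  qed
  show iv: "inv_into U1 \<phi>1 q = inv_into U \<phi> (\<theta> q)" if q: "q \<in> V'" for q
  proof (rule inv_into_f_eq[OF inj])
    have "\<theta> q \<in> V" using q \<theta>(2) by blast
    then show "inv_into U \<phi> (\<theta> q) \<in> U1" "\<phi>1 (inv_into U \<phi> (\<theta> q)) = q"
      using \<phi>i inv(2)[OF q] by (auto simp: U1_def \<phi>1_def)
  qed
  have \<kappa>c: "continuous_on V \<kappa>" and \<theta>c: "continuous_on V' \<theta>"
    using \<kappa>(1) \<theta>(1) by (auto simp: paracomplex_map_def smooth_on_continuous)
  have lc1: "local_chart (U1, \<phi>1)"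
  proof -
    have "continuous_on U1 \<phi>1" unfolding \<phi>1_def
      by (rule continuous_on_compose2[OF \<kappa>c continuous_on_subset[OF l(3)]]) (auto simp: U1)
    moreover have "continuous_on V' (\<lambda>q. inv_into U \<phi> (\<theta> q))"
      by (rule continuous_on_compose2[OF l(4) \<theta>c]) (use \<theta>(2) V(2) in blast)
    then have "continuous_on V' (inv_into U1 \<phi>1)" by (rule continuous_on_eq) (simp add: iv)
    moreover have "inv_into U1 \<phi>1 ` V' = U1" unfolding im[symmetric] by (rule inv_into_image_cancel[OF inj order_refl])
    ultimately have "homeomorphism U1 (\<phi>1 ` U1) \<phi>1 (inv_into U1 \<phi>1)"
      unfolding homeomorphism_def im using inj im by (auto simp: inv_into_f_f f_inv_into_f)
    then show ?thesis using oU1 V' im by (simp add: local_chart_def)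
  qed
  have "paracomplex_change (U1, \<phi>1) (U', \<phi>')" "paracomplex_change (U', \<phi>') (U1, \<phi>1)" if cA: "(U', \<phi>') \<in> A" for U' \<phi>'
  proof -
    have lc': "local_chart (U', \<phi>')" using A cA by blast
    have pc: "paracomplex_map (\<phi> ` (U \<inter> U')) (\<phi>' \<circ> inv_into U \<phi>)" "paracomplex_map (\<phi>' ` (U' \<inter> U)) (\<phi> \<circ> inv_into U' \<phi>')"
      using c cA by (auto simp: paracomplex_coordinate_def paracomplex_change_iff[symmetric])
    have sub1: "\<phi>1 ` (U1 \<inter> U') \<subseteq> V'" using im by blast
    have o1: "open (\<phi>1 ` (U1 \<inter> U'))"
      by (rule local_chartD(7)[OF lc1]) (use oU1 local_chartD(1)[OF lc'] in auto)
    have \<theta>\<phi>1: "\<theta> (\<phi>1 x) = \<phi> x" if "x \<in> U1" for x using that inv(1) by (simp add: U1 \<phi>1_def)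
    have "paracomplex_map (\<phi>1 ` (U1 \<inter> U')) (\<lambda>q. (\<phi>' \<circ> inv_into U \<phi>) (\<theta> q))"
      by (rule paracomplex_map_compose[OF paracomplex_map_subset[OF \<theta>(1) sub1] pc(1) o1])
        (use \<theta>\<phi>1 in \<open>auto simp: U1\<close>)
    then show "paracomplex_change (U1, \<phi>1) (U', \<phi>')"
      unfolding paracomplex_change_iff
    proof (rule paracomplex_map_cong[OF _ o1])
      fix q assume "q \<in> \<phi>1 ` (U1 \<inter> U')"
      then have "q \<in> V'" using sub1 by blast
      then show "(\<phi>' \<circ> inv_into U \<phi>) (\<theta> q) = (\<phi>' \<circ> inv_into U1 \<phi>1) q" by (simp add: iv)
    qed
    have o2: "open (\<phi>' ` (U' \<inter> U1))"
      by (rule local_chartD(7)[OF lc']) (use oU1 local_chartD(1)[OF lc'] in auto)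
    have sub2: "\<phi>' ` (U' \<inter> U1) \<subseteq> \<phi>' ` (U' \<inter> U)" by (auto simp: U1)
    have "paracomplex_map (\<phi>' ` (U' \<inter> U1)) (\<lambda>q. \<kappa> ((\<phi> \<circ> inv_into U' \<phi>') q))"
      by (rule paracomplex_map_compose[OF paracomplex_map_subset[OF pc(2) sub2] \<kappa>(1) o2])
        (use local_chartD(6)[OF lc'] in \<open>auto simp: U1\<close>)
    then show "paracomplex_change (U', \<phi>') (U1, \<phi>1)"
      unfolding paracomplex_change_iff by (rule paracomplex_map_cong[OF _ o2]) (simp add: \<phi>1_def)
  qed
  then show "paracomplex_coordinate M A (U1, \<phi>1)"
    unfolding paracomplex_coordinate_def using lc1 UM by (auto simp: U1)
qed

section \<open>Normalized charts\<close>

lemma framed_surfaceI: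
  "open D \<Longrightarrow> immersion_on L0 D X \<Longrightarrow> conformal_metric L0 D X lam \<Longrightarrow> normal_frame L0 \<sigma> D X lam N1 N2 \<Longrightarrow>
    framed_surface L0 D X lam \<sigma> N1 N2"
  by (simp add: framed_surface_def surface_def framed_surface_axioms_def)

text \<open>The hypothesis provides, for each point, a chart and frame of its own. The invariance in
  \<open>coordinate_change\<close> carries the condition over to one given chart and frame, where it
  then holds at all points.\<close>

lemma satisfies_XY_everywhere:
  fixes F :: "'m::{t2_space, second_countable_topology} \<Rightarrow> real^5"
  assumes L: "lorentz_surface M A" and imm: "timelike_conformal_immersion L0 M A F" and XY: "satisfies_XY L0 \<sigma> M A F"
    and \<sigma>: "\<sigma> \<noteq> 0"
    and c: "paracomplex_coordinate M A (U, \<phi>)"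
    and S: "framed_surface L0 (\<phi> ` U) (local_rep (U, \<phi>) F) lam \<sigma> N1 N2"
    and as: "associated_functions L0 (\<phi> ` U) (local_rep (U, \<phi>) F) N1 N2 lam a1 a2 b1 b2 m1 m2"
    and q: "q \<in> \<phi> ` U"
  shows "XY_condition a1 a2 b1 b2 q"
proof -
  obtain y where y: "y \<in> U" "q = \<phi> y" using q by blast
  have "y \<in> M" using y c by (auto simp: paracomplex_coordinate_def)
  then obtain c' lam' N1' N2' a1' a2' b1' b2' m1' m2' where
    c': "paracomplex_coordinate M A c'" "y \<in> fst c'"
    and d: "conformal_metric L0 (chart_image c') (local_rep c' F) lam'"
      "normal_frame L0 \<sigma> (chart_image c') (local_rep c' F) lam' N1' N2'"
      "associated_functions L0 (chart_image c') (local_rep c' F) N1' N2' lam' a1' a2' b1' b2' m1' m2'"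
      "XY_condition a1' a2' b1' b2' (snd c' y)"
    using XY unfolding satisfies_XY_def by meson
  obtain U' \<phi>' where c'_eq: "c' = (U', \<phi>')" by (cases c')
  have lc: "local_chart (U, \<phi>)" "local_chart (U', \<phi>')"
    using c c' by (auto simp: paracomplex_coordinate_def c'_eq)
  have S': "framed_surface L0 (\<phi>' ` U') (local_rep (U', \<phi>') F) lam' \<sigma> N1' N2'"
    by (rule framed_surfaceI)
      (use imm c' d local_chartD(2)[OF lc(2)] in \<open>auto simp: c'_eq timelike_conformal_immersion_def\<close>)
  obtain W where W: "open W" "q \<in> W" "W \<subseteq> \<phi> ` (U \<inter> U')" "paracomplex_map W (\<lambda>q. \<phi>' (inv_into U \<phi> q))"
    using chart_transition[OF L c c'(1)[unfolded c'_eq] y(1)] c'(2) y(2) c'_eq by auto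
  have iU: "inv_into U \<phi> z \<in> U'" if "z \<in> W" for z
    using inv_into_inter(1)[OF lc(1), of "U \<inter> U'" z] W(3) that by auto
  obtain a b where ab: "a\<^sup>2 - b\<^sup>2 > 0" "paracomplex_derivative (\<lambda>q. \<phi>' (inv_into U \<phi> q)) q a b"
    using W(2,4) by (auto simp: paracomplex_map_def)
  have "XY_condition a1 a2 b1 b2 q \<longleftrightarrow> XY_condition a1' a2' b1' b2' (\<phi>' (inv_into U \<phi> q))"
  proof (rule coordinate_change(1)[OF S as S' _ W(1,2) _ W(4) _ _ ab(2,1) \<sigma>])
    show "associated_functions L0 (\<phi>' ` U') (local_rep (U', \<phi>') F) N1' N2' lam' a1' a2' b1' b2' m1' m2'"
      using d(3) by (simp add: c'_eq)
    show "W \<subseteq> \<phi> ` U" using W(3) by blast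
    show "(\<lambda>q. \<phi>' (inv_into U \<phi> q)) ` W \<subseteq> \<phi>' ` U'" using iU by blast
    show "\<forall>z\<in>W. local_rep (U, \<phi>) F z = local_rep (U', \<phi>') F (\<phi>' (inv_into U \<phi> z))"
      using local_chartD(6)[OF lc(2) iU] by (simp add: local_rep_def)
  qed
  then show ?thesis using d(4) y local_chartD(6)[OF lc(1)] by (simp add: c'_eq)
qed

text \<open>The normal plane at a point does not depend on the coordinate, so the old normal vectors
  need only be rescaled to the length prescribed by the new metric; the orientation is kept because
  \<open>a^2 - b^2 > 0\<close>.\<close>

lemma normal_frame_transport:
  assumes S: "framed_surface L0 D X lam \<sigma> N1 N2" and S': "surface L0 D' X' lam'"
    and \<theta>: "paracomplex_map D' \<theta>" "\<theta> ` D' \<subseteq> D" and X': "\<forall>q\<in>D'. X' q = X (\<theta> q)"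
  defines "k \<equiv> \<lambda>q. exp (lam' q - lam (\<theta> q))"
  shows "normal_frame L0 \<sigma> D' X' lam' (\<lambda>q. k q *\<^sub>R N1 (\<theta> q)) (\<lambda>q. k q *\<^sub>R N2 (\<theta> q))"
proof -
  interpret s: framed_surface L0 D X lam \<sigma> N1 N2 by (rule S)
  interpret s': surface L0 D' X' lam' by (rule S')
  have st: "smooth_on D' \<theta>" using \<theta>(1) by (simp add: paracomplex_map_def)
  have sk: "smooth_on D' k" unfolding k_def
    by (intro smooth_intros s'.open_D s'.smooth_lam smooth_on_compose[OF s.smooth_lam s'.open_D st \<theta>(2)])
  have sN: "smooth_on D' (\<lambda>q. k q *\<^sub>R N1 (\<theta> q))" "smooth_on D' (\<lambda>q. k q *\<^sub>R N2 (\<theta> q))"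
    using smooth_on_scaleR[OF s'.open_D sk smooth_on_compose[OF s.smooth_N(1) s'.open_D st \<theta>(2)]]
      smooth_on_scaleR[OF s'.open_D sk smooth_on_compose[OF s.smooth_N(2) s'.open_D st \<theta>(2)]] by simp_all
  have T: "\<exists>a b. a\<^sup>2 - b\<^sup>2 > 0 \<and> D_u X' q = a *\<^sub>R D_u X (\<theta> q) + b *\<^sub>R D_v X (\<theta> q) \<and>
      D_v X' q = b *\<^sub>R D_u X (\<theta> q) + a *\<^sub>R D_v X (\<theta> q)" if q: "q \<in> D'" for q
  proof -
    obtain a b where ab: "a\<^sup>2 - b\<^sup>2 > 0" "paracomplex_derivative \<theta> q a b" using \<theta>(1) q by (auto simp: paracomplex_map_def)
    have \<theta>q: "\<theta> q \<in> D" using \<theta>(2) q by blast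
    have dc: "(\<lambda>q. X (\<theta> q)) differentiable (at q)"
      by (rule smooth_on_differentiable[OF smooth_on_compose[OF s.smooth_X s'.open_D st \<theta>(2)] q])
    have "D_u X' q = D_u (\<lambda>q. X (\<theta> q)) q" "D_v X' q = D_v (\<lambda>q. X (\<theta> q)) q"
      unfolding D_u_def D_v_def by (rule fd_cong[OF dc s'.open_D q]; simp add: X')+
    then show ?thesis using D_compose_paracomplex[OF s.diff_at[OF s.smooth_X \<theta>q] ab(2)] ab(1) by auto
  qed
  have kk: "k q * (k q * exp (2 * lam (\<theta> q))) = exp (2 * lam' q)" for q
    by (simp add: k_def mult_exp_exp algebra_simps)
  have "k q *\<^sub>R N1 (\<theta> q) \<in> tangent_sp L0 (X' q) \<and> k q *\<^sub>R N2 (\<theta> q) \<in> tangent_sp L0 (X' q) \<and>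
        psc L0 (k q *\<^sub>R N1 (\<theta> q)) (D_u X' q) = 0 \<and> psc L0 (k q *\<^sub>R N1 (\<theta> q)) (D_v X' q) = 0 \<and>
        psc L0 (k q *\<^sub>R N2 (\<theta> q)) (D_u X' q) = 0 \<and> psc L0 (k q *\<^sub>R N2 (\<theta> q)) (D_v X' q) = 0 \<and>
        psc L0 (k q *\<^sub>R N1 (\<theta> q)) (k q *\<^sub>R N1 (\<theta> q)) = exp (2 * lam' q) \<and>
        psc L0 (k q *\<^sub>R N2 (\<theta> q)) (k q *\<^sub>R N2 (\<theta> q)) = - exp (2 * lam' q) \<and>
        psc L0 (k q *\<^sub>R N1 (\<theta> q)) (k q *\<^sub>R N2 (\<theta> q)) = 0 \<and>
        positively_oriented L0 \<sigma> (X' q) (D_u X' q) (k q *\<^sub>R N1 (\<theta> q)) (D_v X' q) (k q *\<^sub>R N2 (\<theta> q))"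
    if q: "q \<in> D'" for q
  proof -
    have \<theta>q: "\<theta> q \<in> D" using \<theta>(2) q by blast
    obtain a b where ab: "a\<^sup>2 - b\<^sup>2 > 0" and Tq: "D_u X' q = a *\<^sub>R D_u X (\<theta> q) + b *\<^sub>R D_v X (\<theta> q)"
      "D_v X' q = b *\<^sub>R D_u X (\<theta> q) + a *\<^sub>R D_v X (\<theta> q)" using T[OF q] by blast
    have k: "k q > 0" by (simp add: k_def)
    have "\<sigma> * det (rows5 (D_u X (\<theta> q)) (N1 (\<theta> q)) (D_v X (\<theta> q)) (N2 (\<theta> q)) (if L0 = 0 then axis 5 1 else X' q)) > 0"
      using s.frame \<theta>q unfolding normal_frame_def positively_oriented_rows5 X'[rule_format, OF q] by blast
    then have "(a\<^sup>2 - b\<^sup>2) * (k q * k q) *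
        (\<sigma> * det (rows5 (D_u X (\<theta> q)) (N1 (\<theta> q)) (D_v X (\<theta> q)) (N2 (\<theta> q)) (if L0 = 0 then axis 5 1 else X' q))) > 0"
      using ab by (intro mult_pos_pos[OF mult_pos_pos[OF _ mult_pos_pos[OF k k]]])
    then have "positively_oriented L0 \<sigma> (X' q) (D_u X' q) (k q *\<^sub>R N1 (\<theta> q)) (D_v X' q) (k q *\<^sub>R N2 (\<theta> q))"
      unfolding positively_oriented_rows5 Tq
      using det_rows5_blocks[of a "D_u X (\<theta> q)" b "D_v X (\<theta> q)" "k q" "N1 (\<theta> q)" 0 "N2 (\<theta> q)" 0 "k q"]
      by (simp add: mult_ac)
    then show ?thesis
      using s.tangent_N[OF \<theta>q] s.frame_products[OF \<theta>q] kk[of q]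
      by (simp add: X'[rule_format, OF q] tangent_sp_linear psc_linear Tq)
  qed
  then show ?thesis unfolding normal_frame_def using sN by blast
qed

text \<open>In a preliminary chart around \<open>x\<close> the coefficient \<open>T\<close> of the
  quartic differential has no zeros and depends on s alone. In the coordinate that normalizes
  \<open>\<bar>T\<bar>\<close> to 1, the surface has the form required by
  \<open>star_of_equations\<close>.\<close>

lemma star_chart_exists:
  fixes F :: "'m::{t2_space, second_countable_topology} \<Rightarrow> real^5"
  assumes L: "lorentz_surface M A" and imm: "timelike_conformal_immersion L0 M A F"
    and H: "zero_mean_curvature L0 M A F" and XY: "satisfies_XY L0 \<sigma> M A F" and \<sigma>: "\<sigma> \<noteq> 0" and x: "x \<in> M"
  shows "\<exists>c lam N1 N2 al1 al2 be1 be2 mu1 mu2.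
     paracomplex_coordinate M A c \<and> x \<in> fst c \<and>
     conformal_metric L0 (chart_image c) (local_rep c F) lam \<and>
     normal_frame L0 \<sigma> (chart_image c) (local_rep c F) lam N1 N2 \<and>
     associated_functions L0 (chart_image c) (local_rep c F) N1 N2 lam al1 al2 be1 be2 mu1 mu2 \<and>
     star L0 (chart_image c) lam al1 al2 be1 be2 mu1 mu2"
proof -
  obtain c lam N1 N2 where c: "paracomplex_coordinate M A c" "x \<in> fst c"
    and d: "conformal_metric L0 (chart_image c) (local_rep c F) lam"
      "normal_frame L0 \<sigma> (chart_image c) (local_rep c F) lam N1 N2"
    using XY x unfolding satisfies_XY_def by meson
  obtain U \<phi> where c_eq: "c = (U, \<phi>)" by (cases c)
  note c = c[unfolded c_eq fst_conv] and d = d[unfolded c_eq fst_conv snd_conv]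
  have lc: "local_chart (U, \<phi>)" using c by (auto simp: paracomplex_coordinate_def)
  let ?D = "\<phi> ` U" and ?X = "local_rep (U, \<phi>) F"
  have S: "framed_surface L0 ?D ?X lam \<sigma> N1 N2"
    by (rule framed_surfaceI) (use imm c d local_chartD(2)[OF lc] in \<open>auto simp: timelike_conformal_immersion_def\<close>)
  interpret s: framed_surface L0 ?D ?X lam \<sigma> N1 N2 by (rule S)
  \<comment> \<open>The explicit coefficients take the place of the associated functions provided by
    the hypothesis, because they are known to be smooth.\<close>
  have as: "associated_functions L0 ?D ?X N1 N2 lam s.al1 s.al2 s.be1 s.be2 s.mu1 s.mu2"
    by (rule s.associated_functions_exist) (use H c in \<open>auto simp: zero_mean_curvature_def\<close>)
  define T where "T = (\<lambda>p. (s.al1 p + s.al2 p + s.be1 p + s.be2 p) * (s.al1 p + s.al2 p - s.be1 p - s.be2 p) * exp (2 * lam p))"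
  have sT: "smooth_on ?D T"
    unfolding T_def by (intro smooth_intros s.open_D s.smooth_lam s.smooth_coefficients)
  have T0: "T q \<noteq> 0" if "q \<in> ?D" for q
    using satisfies_XY_everywhere[OF L imm XY \<sigma> c(1) S as that] by (simp add: T_def XY_condition_iff)
  have Tt: "D_u T q = D_v T q" if "q \<in> ?D" for q
    unfolding T_def
    by (rule null_quartic[OF s.open_D that s.smooth_lam s.smooth_coefficients(1-4)
          s.integrability[OF as that s.smooth_coefficients]])
  have x\<phi>: "\<phi> x \<in> ?D" using c by blast
  obtain V V' \<kappa> \<theta> where V: "open V" "\<phi> x \<in> V" "V \<subseteq> ?D" and V': "open V'" "connected V'"
    and \<kappa>: "paracomplex_map V \<kappa>" "\<kappa> ` V \<subseteq> V'" and \<theta>: "paracomplex_map V' \<theta>" "\<theta> ` V' \<subseteq> V"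
    and inv: "\<And>q. q \<in> V \<Longrightarrow> \<theta> (\<kappa> q) = q" "\<And>q. q \<in> V' \<Longrightarrow> \<kappa> (\<theta> q) = q"
    and norm: "\<And>q. q \<in> V' \<Longrightarrow> \<exists>a b. a\<^sup>2 - b\<^sup>2 > 0 \<and> paracomplex_derivative \<theta> q a b \<and> (a + b) ^ 4 * \<bar>T (\<theta> q)\<bar> = 1"
    by (rule null_reparametrization[OF s.open_D x\<phi> sT T0 Tt]) blast+
  define U1 \<phi>1 where "U1 = inv_into U \<phi> ` V" and "\<phi>1 = (\<lambda>x. \<kappa> (\<phi> x))"
  have lcA: "\<forall>c\<in>A. local_chart c" using L by (simp add: lorentz_surface_def)
  have inv': "\<forall>q\<in>V. \<theta> (\<kappa> q) = q" "\<forall>q\<in>V'. \<kappa> (\<theta> q) = q" using inv by blast+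
  note nc = new_chart[OF c(1) lcA V(1,3) V'(1) \<kappa> \<theta> inv', folded U1_def \<phi>1_def]
  let ?c1 = "(U1, \<phi>1)"
  let ?Y = "local_rep ?c1 F"
  have Y: "\<forall>q\<in>V'. ?Y q = ?X (\<theta> q)" using nc(3) by (simp add: local_rep_def)
  obtain lam1 where lam1: "conformal_metric L0 V' ?Y lam1" and imm1: "immersion_on L0 V' ?Y"
    using imm nc(1,2) unfolding timelike_conformal_immersion_def by (metis fst_conv snd_conv)
  have surf1: "surface L0 V' ?Y lam1" using V' lam1 imm1 by (simp add: surface_def)
  have \<theta>D: "\<theta> ` V' \<subseteq> ?D" using \<theta>(2) V(3) by blast
  define k where "k = (\<lambda>q. exp (lam1 q - lam (\<theta> q)))"
  define N1' N2' where "N1' = (\<lambda>q. k q *\<^sub>R N1 (\<theta> q))" and "N2' = (\<lambda>q. k q *\<^sub>R N2 (\<theta> q))"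
  have fr1: "normal_frame L0 \<sigma> V' ?Y lam1 N1' N2'"
    unfolding N1'_def N2'_def k_def by (rule normal_frame_transport[OF S surf1 \<theta>(1) \<theta>D Y])
  have S1: "framed_surface L0 V' ?Y lam1 \<sigma> N1' N2'"
    by (rule framed_surfaceI[OF V'(1) imm1 lam1 fr1])
  interpret s1: framed_surface L0 V' ?Y lam1 \<sigma> N1' N2' by (rule S1)
  have as1: "associated_functions L0 V' ?Y N1' N2' lam1 s1.al1 s1.al2 s1.be1 s1.be2 s1.mu1 s1.mu2"
    by (rule s1.associated_functions_exist) (use H nc(1,2) in \<open>auto simp: zero_mean_curvature_def\<close>)
  have chg: "XY_condition s1.al1 s1.al2 s1.be1 s1.be2 q \<and>
      \<bar>(s1.al1 q + s1.al2 q + s1.be1 q + s1.be2 q) * (s1.al1 q + s1.al2 q - s1.be1 q - s1.be2 q)\<bar> * exp (2 * lam1 q) = 1"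
    if q: "q \<in> V'" for q
  proof -
    obtain a b where ab: "a\<^sup>2 - b\<^sup>2 > 0" "paracomplex_derivative \<theta> q a b" "(a + b) ^ 4 * \<bar>T (\<theta> q)\<bar> = 1"
      using norm[OF q] by blast
    note cc = coordinate_change[OF S1 as1 S as V'(1) q order_refl \<theta>(1) \<theta>D Y ab(2,1) \<sigma>]
    have "\<theta> q \<in> ?D" using q \<theta>D by blast
    then have "XY_condition s1.al1 s1.al2 s1.be1 s1.be2 q"
      using cc(1) satisfies_XY_everywhere[OF L imm XY \<sigma> c(1) S as] by blast
    moreover have "\<bar>(s1.al1 q + s1.al2 q + s1.be1 q + s1.be2 q) * (s1.al1 q + s1.al2 q - s1.be1 q - s1.be2 q) * exp (2 * lam1 q)\<bar> = 1"
    proof -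
      have "\<bar>(a + b) ^ 4 * T (\<theta> q)\<bar> = 1" using ab(3) by (simp add: abs_mult power_even_abs)
      then show ?thesis unfolding cc(2) T_def .
    qed
    then have "\<bar>(s1.al1 q + s1.al2 q + s1.be1 q + s1.be2 q) * (s1.al1 q + s1.al2 q - s1.be1 q - s1.be2 q)\<bar> * exp (2 * lam1 q) = 1"
      by (simp add: abs_mult)
    ultimately show ?thesis by blast
  qed
  have "star L0 V' lam1 s1.al1 s1.al2 s1.be1 s1.be2 s1.mu1 s1.mu2"
    by (rule star_of_equations[OF V' s1.smooth_lam s1.smooth_coefficients s1.integrability[OF as1 _ s1.smooth_coefficients]])
      (use chg in blast)+
  moreover have "x \<in> U1"
    unfolding U1_def using V(2) local_chartD(6)[OF lc c(2)] by (auto intro!: image_eqI[of _ _ "\<phi> x"])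
  ultimately have "paracomplex_coordinate M A ?c1 \<and> x \<in> fst ?c1 \<and>
     conformal_metric L0 (chart_image ?c1) ?Y lam1 \<and> normal_frame L0 \<sigma> (chart_image ?c1) ?Y lam1 N1' N2' \<and>
     associated_functions L0 (chart_image ?c1) ?Y N1' N2' lam1 s1.al1 s1.al2 s1.be1 s1.be2 s1.mu1 s1.mu2 \<and>
     star L0 (chart_image ?c1) lam1 s1.al1 s1.al2 s1.be1 s1.be2 s1.mu1 s1.mu2"
    by (simp only: fst_conv snd_conv nc(1,2) lam1 fr1 as1 simp_thms)
  then show ?thesis by blast
qed

theorem theorem6p1:
  fixes L0 \<sigma> :: real
    and M :: "'m::{t2_space, second_countable_topology} set"
    and A :: "'m chart set"
    and F :: "'m \<Rightarrow> real^5"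
  assumes "\<sigma> \<in> {1, -1}"
  shows
    "(lorentz_surface M A \<and> timelike_conformal_immersion L0 M A F \<and> zero_mean_curvature L0 M A F \<longrightarrow>
        (satisfies_XY L0 \<sigma> M A F \<longleftrightarrow> star_representable L0 \<sigma> M A F))
     \<and>
     (\<forall>D lam al1 al2 be1 be2 mu1 mu2.
        open D \<and> star L0 D lam al1 al2 be1 be2 mu1 mu2 \<longrightarrow>
          (\<forall>p\<in>D. XY_condition al1 al2 be1 be2 p) \<and>
          (\<forall>p\<in>D. \<exists>U X. open U \<and> connected U \<and> p \<in> U \<and> U \<subseteq> D \<and>
             realizes L0 \<sigma> U X lam al1 al2 be1 be2 mu1 mu2) \<and>
          (\<forall>U X X'. open U \<and> connected U \<and> U \<subseteq> D \<and>
             realizes L0 \<sigma> U X lam al1 al2 be1 be2 mu1 mu2 \<and>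
             realizes L0 \<sigma> U X' lam al1 al2 be1 be2 mu1 mu2 \<longrightarrow>
             (\<exists>\<Phi>. space_form_isometry L0 \<Phi> \<and> (\<forall>q\<in>U. X' q = \<Phi> (X q)))))"
proof (intro conjI impI allI ballI)
  have \<sigma>0: "\<sigma> \<noteq> 0" using assms by auto
  assume *: "lorentz_surface M A \<and> timelike_conformal_immersion L0 M A F \<and> zero_mean_curvature L0 M A F"
  show "satisfies_XY L0 \<sigma> M A F \<longleftrightarrow> star_representable L0 \<sigma> M A F"
  proof
    assume "satisfies_XY L0 \<sigma> M A F"
    then show "star_representable L0 \<sigma> M A F"
      unfolding star_representable_def using * star_chart_exists[OF _ _ _ _ \<sigma>0] by blast
  next
    assume st: "star_representable L0 \<sigma> M A F"
    show "satisfies_XY L0 \<sigma> M A F" unfolding satisfies_XY_def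
    proof
      fix x assume "x \<in> M"
      then obtain c lam N1 N2 a1 a2 b1 b2 m1 m2 where c: "paracomplex_coordinate M A c" "x \<in> fst c"
        and d: "conformal_metric L0 (chart_image c) (local_rep c F) lam"
          "normal_frame L0 \<sigma> (chart_image c) (local_rep c F) lam N1 N2"
          "associated_functions L0 (chart_image c) (local_rep c F) N1 N2 lam a1 a2 b1 b2 m1 m2"
          "star L0 (chart_image c) lam a1 a2 b1 b2 m1 m2"
        using st unfolding star_representable_def by meson
      have "open (chart_image c)" using c local_chartD(2)[of "fst c" "snd c"]
        by (simp add: paracomplex_coordinate_def)
      \<comment> \<open>In this direction the chart and the frame stay the same: the exponentials in
        the normal form have no zeros, and \<open>X_- = Y_-\<close> is built into it.\<close>
      then have "XY_condition a1 a2 b1 b2 (snd c x)" using star_equations(9)[OF _ d(4)] c(2) by blast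
      then show "\<exists>c lam N1 N2 al1 al2 be1 be2 mu1 mu2.
         paracomplex_coordinate M A c \<and> x \<in> fst c \<and>
         conformal_metric L0 (chart_image c) (local_rep c F) lam \<and>
         normal_frame L0 \<sigma> (chart_image c) (local_rep c F) lam N1 N2 \<and>
         associated_functions L0 (chart_image c) (local_rep c F) N1 N2 lam al1 al2 be1 be2 mu1 mu2 \<and>
         XY_condition al1 al2 be1 be2 (snd c x)"
        using c d by blast
    qed
  qed
next
  fix D lam al1 al2 be1 be2 mu1 mu2 p
  assume "open D \<and> star L0 D lam al1 al2 be1 be2 mu1 mu2" and p: "p \<in> D"
  then have D: "open D" and st: "star L0 D lam al1 al2 be1 be2 mu1 mu2" by auto
  note se = star_equations[OF D st]
  show "XY_condition al1 al2 be1 be2 p" by (rule se(9)[OF p])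
  obtain U X N1 N2 where U: "open U" "connected U" "p \<in> U" "U \<subseteq> D" and S: "framed_surface L0 U X lam \<sigma> N1 N2"
    and as: "associated_functions L0 U X N1 N2 lam al1 al2 be1 be2 mu1 mu2"
    using surface_exists[OF D p assms se(1-8)] by metis
  interpret s: framed_surface L0 U X lam \<sigma> N1 N2 by (rule S)
  have "realizes L0 \<sigma> U X lam al1 al2 be1 be2 mu1 mu2"
    unfolding realizes_def using s.immersion s.conformal s.frame as s.mean_curvature_zero[OF as] by blast
  then show "\<exists>U X. open U \<and> connected U \<and> p \<in> U \<and> U \<subseteq> D \<and>
      realizes L0 \<sigma> U X lam al1 al2 be1 be2 mu1 mu2"
    using U by blast
next
  fix D lam al1 al2 be1 be2 mu1 mu2 U X X'
  assume "open U \<and> connected U \<and> U \<subseteq> D \<and> realizes L0 \<sigma> U X lam al1 al2 be1 be2 mu1 mu2 \<and>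
    realizes L0 \<sigma> U X' lam al1 al2 be1 be2 mu1 mu2"
  then have U: "open U" "connected U"
    and r: "realizes L0 \<sigma> U X lam al1 al2 be1 be2 mu1 mu2" "realizes L0 \<sigma> U X' lam al1 al2 be1 be2 mu1 mu2"
    by auto
  \<comment> \<open>The two immersions may come with different normal frames. Each frame realizes
    the same functions, hence the same linear system, and the congruence maps one frame to the
    other.\<close>
  obtain N1 N2 where S: "framed_surface L0 U X lam \<sigma> N1 N2"
    and as: "associated_functions L0 U X N1 N2 lam al1 al2 be1 be2 mu1 mu2"
    using r(1) framed_surfaceI[OF U(1)] unfolding realizes_def by blast
  obtain N1' N2' where S': "framed_surface L0 U X' lam \<sigma> N1' N2'"
    and as': "associated_functions L0 U X' N1' N2' lam al1 al2 be1 be2 mu1 mu2"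
    using r(2) framed_surfaceI[OF U(1)] unfolding realizes_def by blast
  show "\<exists>\<Phi>. space_form_isometry L0 \<Phi> \<and> (\<forall>q\<in>U. X' q = \<Phi> (X q))"
    using surfaces_congruent[OF S as S' as' U(2)] by metis
qed

end
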